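(* Let $u$ be a non-negative measurable function on $\Omega\times\mathbb{C}^n$ and $v$ a non-negative measurable function on $\mathbb{H}^n$. Let $U=u^*$ be the decreasing rearrangement of $u$ with respect to the measure $d\nu_2(a)\,dw$ on $\Omega\times\mathbb{C}^n$, and define $V$ by $\frac1V=\left(\frac1v\right)^*$, the decreasing rearrangement of $1/v$ with respect to the measure $dz\,dt$ on $\mathbb{H}^n$. Let $1\le p\le q\le\infty$. If $p<\infty$ and $$\sup_{s>0}\left(\int_0^{1/s}U(t)^q\,dt\right)^{1/q}\left(\int_0^{s}V(t)^{-p'}\,dt\right)^{1/p'}<\infty,$$ then there exists a constant $C$ such that for all $f\in\mathcal{S}(\mathbb{H}^n)$, $$\left(\int_{\Omega\times\mathbb{C}^n}|\tilde f(a,w)|^q\,u(a,w)^q\,dw\,d\nu_2(a)\right)^{1/q}\le C\left(\int_{\mathbb{H}^n}|f(z,t)|^p\,v(z,t)^p\,dz\,dt\right)^{1/p}.$$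
   Context: The Heisenberg group $\mathbb{H}^n=\mathbb{C}^n\times\mathbb{R}$ ($n\ge1$) has group law $(z,t)(w,s)=(z+w,\,t+s+\frac12\operatorname{Im}(z\cdot\bar w))$, with Lebesgue (Haar) measure $dz\,dt$; $\mathcal{S}(\mathbb{H}^n)$ is the Schwartz space on $\mathbb{C}^n\times\mathbb{R}$. For $\delta>-1$, $k\in\{0,1,2,\dots\}$, the Laguerre polynomial is $L_k^\delta(t)=\frac{t^{-\delta}e^t}{k!}\left(\frac{d}{dt}\right)^k(e^{-t}t^{k+\delta})$. For $\lambda\in\mathbb{R}^*=\mathbb{R}\setminus\{0\}$ put $\varphi^{n-1}_{k,\lambda}(z)=L^{n-1}_k(\frac12|\lambda||z|^2)e^{-\frac14|\lambda||z|^2}$ and $e^{n-1}_{k,\lambda}(z,t)=e^{i\lambda t}\varphi^{n-1}_{k,\lambda}(z)$. The Heisenberg fan $\Omega$ is the union of the rays $R_k=\{(\lambda,(2k+n)|\lambda|):\lambda\in\mathbb{R}^*\}$, $k=0,1,2,\dots$, and $R_\infty=\{(0,\tau):\tau\ge0\}$. The Strichartz Fourier transform of $f$ is the function on $\Omega\times\mathbb{C}^n$ given by $\widehat f(a,w)=\int_{\mathbb{H}^n}f(z,t)\,e_a((z,t)^{-1}(w,0))\,dz\,dt$ for $a=(\lambda,(2k+n)|\lambda|)\in R_k$, where $e_a=e^{n-1}_{k,\lambda}$, and $\widehat f(0,\tau,w)=(n-1)!\,2^{n-1}\int_{\mathbb{H}^n}f(z,t)\frac{J_{n-1}(\sqrt\tau|w-z|)}{(\sqrt\tau|w-z|)^{n-1}}\,dz\,dt$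 on $R_\infty$ ($J_{n-1}$ the Bessel function). The normalized transform is $\tilde f(a,w)=\frac{k!(n-1)!}{(k+n-1)!}\widehat f(a,w)$ for $a\in R_k$ and $\tilde f(0,\tau,w)=\widehat f(0,\tau,w)$. The measure $\nu_2$ on $\Omega$ is defined by $$\int_\Omega\phi(a)\,d\nu_2(a)=(2\pi)^{-2n-1}\int_{-\infty}^\infty\left(\sum_{k=0}^\infty\left(\frac{(k+n-1)!}{k!(n-1)!}\right)^2\phi(\lambda,(2k+n)|\lambda|)\right)|\lambda|^{2n}\,d\lambda.$$ For a measurable function $g$ on a measure space $(X,\mu)$: $d_g(M)=\mu\{x:|g(x)|>M\}$ and $g^*(t)=\inf\{s>0:d_g(s)\le t\}$ for $t\ge0$. $p'$ is the Hölder conjugate of $p$. When an exponent is $\infty$ the corresponding expression is the usual (essential) supremum norm. *)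

theory Defs
  imports "HOL-Analysis.Analysis" "HOL-Probability.Essential_Supremum"
    "HOL-Computational_Algebra.Polynomial"
begin

section \<open>The Heisenberg group\<close>

text \<open>The dimension \<open>n \<ge> 1\<close> is \<open>CARD('n)\<close>. The norm of \<^typ>\<open>complex ^ 'n\<close> is the Euclidean
  one and \<^term>\<open>lborel\<close> on the product is Haar measure \<open>dz dt\<close>.\<close>

type_synonym 'n heis = "(complex ^ 'n) \<times> real"

definition herm :: "complex ^ 'n \<Rightarrow> complex ^ 'n \<Rightarrow> complex" where
  "herm z w = (\<Sum>j\<in>UNIV. z $ j * cnj (w $ j))"

definition hmult :: "'n::finite heis \<Rightarrow> 'n heis \<Rightarrow> 'n heis" where
  "hmult = (\<lambda>(z, t) (w, s). (z + w, t + s + Im (herm z w) / 2))"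

definition hinv :: "'n::finite heis \<Rightarrow> 'n heis" where
  "hinv = (\<lambda>(z, t). (- z, - t))"

lemma herm_self: "Im (herm z z) = 0"
  by (simp add: herm_def)

lemma herm_minus: "herm (- z) w = - herm z w" "herm z (- w) = - herm z w"
  by (simp_all add: herm_def sum_negf)

lemma hmult_hinv: "hmult g (hinv g) = (0, 0)" "hmult (hinv g) g = (0, 0)"
  by (simp_all add: hmult_def hinv_def herm_minus herm_self split: prod.splits)


section \<open>Schwartz functions\<close>

definition dir_deriv :: "'a \<Rightarrow> ('a::euclidean_space \<Rightarrow> complex) \<Rightarrow> 'a \<Rightarrow> complex" where
  "dir_deriv h f = (\<lambda>x. frechet_derivative f (at x) h)"

text \<open>\<open>foldr dir_deriv hs f\<close> is the iterated partial derivative of \<open>f\<close> along the list \<open>hs\<close> of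
  coordinate directions, so \<open>hs\<close> plays the role of a multi-index.\<close>

definition schwartz :: "('a::euclidean_space \<Rightarrow> complex) set" where
  "schwartz = {f. \<forall>hs \<in> lists Basis.
      (\<forall>x. (foldr dir_deriv hs f) differentiable (at x)) \<and>
      (\<forall>N::nat. bounded (range (\<lambda>x. norm x ^ N *\<^sub>R foldr dir_deriv hs f x)))}"


section \<open>Laguerre polynomials and Bessel functions\<close>

text \<open>Rodrigues' formula, which makes sense for \<open>t > 0\<close>. Since \<open>0 powr (- \<delta>) = 0\<close> in HOL, it would
  give a wrong value at \<open>0\<close>; the Laguerre polynomial is therefore the polynomial that agrees with
  it on \<open>t > 0\<close>.\<close>

definition rodrigues :: "nat \<Rightarrow> real \<Rightarrow> real \<Rightarrow> real" where
  "rodrigues k \<delta> t = t powr (- \<delta>) * exp t / fact k *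
     (deriv ^^ k) (\<lambda>s. exp (- s) * s powr (real k + \<delta>)) t"

definition laguerre :: "nat \<Rightarrow> real \<Rightarrow> real poly" where
  "laguerre k \<delta> = (THE p. \<forall>t>0. poly p t = rodrigues k \<delta> t)"

lemma iterated_deriv_exp_powr:
  "\<exists>p. \<forall>t>0. (deriv ^^ m) (\<lambda>s. exp (- s) * s powr a) t = exp (- t) * t powr (a - real m) * poly p t"
proof (induction m)
  case 0
  show ?case by (rule exI[of _ 1]) simp
next
  case (Suc m)
  then obtain p where
    p: "\<And>t. t > 0 \<Longrightarrow> (deriv ^^ m) (\<lambda>s. exp (- s) * s powr a) t = exp (- t) * t powr (a - real m) * poly p t"
    by blast
  let ?q = "smult (a - real m) p + [:0, 1:] * pderiv p - [:0, 1:] * p"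
  have "(deriv ^^ Suc m) (\<lambda>s. exp (- s) * s powr a) t = exp (- t) * t powr (a - real (Suc m)) * poly ?q t"
    if t: "t > 0" for t
  proof -
    have powr_eq: "t powr (a - real m) = t powr (a - real (Suc m)) * t"
      using t powr_add[of t "a - real (Suc m)" 1] by simp
    have DERIV_powr': "((\<lambda>t. t powr (a - real m)) has_real_derivative
        (a - real m) * t powr (a - real m - 1)) (at t)"
      using has_real_derivative_powr[OF t] .
    have "((\<lambda>t. exp (- t) * t powr (a - real m) * poly p t) has_real_derivative
        (- exp (- t) * t powr (a - real m) + exp (- t) * ((a - real m) * t powr (a - real m - 1))) * poly p t
        + exp (- t) * t powr (a - real m) * poly (pderiv p) t) (at t)"
      by (rule derivative_eq_intros DERIV_powr' refl)+ simp
    moreover have "eventually (\<lambda>s. (deriv ^^ m) (\<lambda>s. exp (- s) * s powr a) s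
        = exp (- s) * s powr (a - real m) * poly p s) (nhds t)"
      using p t eventually_nhds_in_open[of "{0<..}" t] by (auto elim: eventually_mono)
    ultimately have "((deriv ^^ m) (\<lambda>s. exp (- s) * s powr a) has_real_derivative
        (- exp (- t) * t powr (a - real m) + exp (- t) * ((a - real m) * t powr (a - real m - 1))) * poly p t
        + exp (- t) * t powr (a - real m) * poly (pderiv p) t) (at t)"
      by (subst DERIV_cong_ev[OF refl _ refl])
    then have "(deriv ^^ Suc m) (\<lambda>s. exp (- s) * s powr a) t =
        (- exp (- t) * t powr (a - real m) + exp (- t) * ((a - real m) * t powr (a - real m - 1))) * poly p t
        + exp (- t) * t powr (a - real m) * poly (pderiv p) t"
      by (simp add: DERIV_imp_deriv)
    also have "a - real m - 1 = a - real (Suc m)" by simp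
    finally show ?thesis
      unfolding powr_eq by (simp add: algebra_simps)
  qed
  then show ?case by blast
qed

lemma poly_laguerre:
  assumes "t > 0"
  shows "poly (laguerre k \<delta>) t = rodrigues k \<delta> t"
proof -
  obtain p where p: "\<And>t. t > 0 \<Longrightarrow> (deriv ^^ k) (\<lambda>s. exp (- s) * s powr (real k + \<delta>)) t
      = exp (- t) * t powr (real k + \<delta> - real k) * poly p t"
    using iterated_deriv_exp_powr by blast
  let ?P = "\<lambda>q. \<forall>t>0. poly q t = rodrigues k \<delta> t"
  have ex: "?P (smult (1 / fact k) p)"
  proof (intro allI impI)
    fix t :: real assume t: "t > 0"
    have "rodrigues k \<delta> t = (t powr (- \<delta>) * t powr \<delta>) * (exp t * exp (- t)) * (poly p t / fact k)"
      using p[OF t] by (simp add: rodrigues_def)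
    also have "t powr (- \<delta>) * t powr \<delta> = 1"
      using t by (simp add: powr_add[symmetric])
    also have "exp t * exp (- t) = 1"
      by (simp add: exp_minus)
    finally show "poly (smult (1 / fact k) p) t = rodrigues k \<delta> t"
      by simp
  qed
  have uniq: "q = r" if "?P q" "?P r" for q r
  proof (rule ccontr)
    assume "q \<noteq> r"
    then have "finite {x. poly (q - r) x = 0}" by (intro poly_roots_finite) simp
    moreover have "{0<..} \<subseteq> {x. poly (q - r) x = 0}" using that by auto
    ultimately have "finite {0::real<..}" using finite_subset by blast
    then show False using infinite_Ioi by blast
  qed
  have "?P (laguerre k \<delta>)"
    unfolding laguerre_def by (rule theI2[of ?P, OF ex]) (use uniq ex in auto)
  then show ?thesis using assms by blast
qed

definition bessel_J :: "nat \<Rightarrow> real \<Rightarrow> real" where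
  "bessel_J m x = (\<Sum>j. (- 1) ^ j / (fact j * fact (j + m)) * (x / 2) ^ (2 * j + m))"

text \<open>\<open>J_m(x) / x^m\<close>, with its limit \<open>1 / (2^m m!)\<close> as value at the removable singularity \<open>0\<close>.\<close>

definition bessel_quot :: "nat \<Rightarrow> real \<Rightarrow> real" where
  "bessel_quot m x = (if x = 0 then 1 / (2 ^ m * fact m) else bessel_J m x / x ^ m)"


section \<open>The Heisenberg fan\<close>

definition ray :: "nat \<Rightarrow> nat \<Rightarrow> (real \<times> real) set" where
  "ray n k = {(l, (2 * real k + real n) * \<bar>l\<bar>) | l. l \<noteq> 0}"

definition ray_inf :: "(real \<times> real) set" where
  "ray_inf = {(0, \<tau>) | \<tau>. 0 \<le> \<tau>}"

definition fan :: "nat \<Rightarrow> (real \<times> real) set" where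
  "fan n = (\<Union>k. ray n k) \<union> ray_inf"

text \<open>For \<open>a\<close> in the fan off \<open>ray_inf\<close>: the unique \<open>k\<close> with \<open>a \<in> ray n k\<close>.\<close>

definition fan_index :: "nat \<Rightarrow> real \<times> real \<Rightarrow> nat" where
  "fan_index n a = (THE k. a \<in> ray n k)"

lemma fan_index_eq:
  assumes "l \<noteq> 0"
  shows "fan_index n (l, (2 * real k + real n) * \<bar>l\<bar>) = k"
  unfolding fan_index_def using assms by (intro the_equality) (auto simp: ray_def)

definition ray_weight :: "nat \<Rightarrow> nat \<Rightarrow> real" where
  "ray_weight n k = fact (k + n - 1) / (fact k * fact (n - 1))"

text \<open>\<open>nu2 n\<close> is carried by the rays \<open>ray n k\<close>, as the image of a weighted measure in the parameters
  \<open>(\<lambda>, k)\<close>; lemma \<open>nn_integral_nu2\<close> is the usual description. The parameter value \<open>\<lambda> = 0\<close> is null.\<close>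

definition nu2 :: "nat \<Rightarrow> (real \<times> real) measure" where
  "nu2 n = distr
     (density (lborel \<Otimes>\<^sub>M count_space UNIV)
       (\<lambda>(l, k). ennreal ((ray_weight n k)\<^sup>2 * \<bar>l\<bar> ^ (2 * n) / (2 * pi) ^ (2 * n + 1))))
     (restrict_space borel (fan n))
     (\<lambda>(l, k). (l, (2 * real k + real n) * \<bar>l\<bar>))"

lemma space_nu2: "space (nu2 n) = fan n"
  by (simp add: nu2_def space_restrict_space)

lemma fan_param_measurable:
  "(\<lambda>(l, k). (l, (2 * real k + real n) * \<bar>l\<bar>))
     \<in> measurable (lborel \<Otimes>\<^sub>M count_space UNIV) (restrict_space borel (fan n))"
proof (rule measurable_restrict_space2)
  show "(\<lambda>(l, k). (l, (2 * real k + real n) * \<bar>l\<bar>)) \<in> space (lborel \<Otimes>\<^sub>M count_space UNIV) \<rightarrow> fan n"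
    by (auto simp: fan_def ray_def ray_inf_def)
  show "(\<lambda>(l, k). (l, (2 * real k + real n) * \<bar>l\<bar>))
     \<in> measurable (lborel \<Otimes>\<^sub>M count_space UNIV) borel"
    unfolding borel_prod[symmetric] by measurable
qed

lemma nn_integral_nu2:
  assumes [measurable]: "\<phi> \<in> borel_measurable (restrict_space borel (fan n))"
  shows "(\<integral>\<^sup>+ a. \<phi> a \<partial>nu2 n) = ennreal (1 / (2 * pi) ^ (2 * n + 1)) *
    (\<integral>\<^sup>+ l. (\<Sum>k. ennreal ((ray_weight n k)\<^sup>2) * \<phi> (l, (2 * real k + real n) * \<bar>l\<bar>)) *
       ennreal (\<bar>l\<bar> ^ (2 * n)) \<partial>lborel)"
proof -
  note fan_param_measurable[of n, measurable]
  let ?M = "lborel \<Otimes>\<^sub>M (count_space UNIV :: nat measure)"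
  let ?T = "\<lambda>(l, k). (l, (2 * real k + real n) * \<bar>l\<bar>)"
  let ?c = "1 / (2 * pi) ^ (2 * n + 1)"
  interpret C: sigma_finite_measure "count_space UNIV :: nat measure"
    by (rule sigma_finite_measure_count_space)
  have phi [measurable]: "(\<lambda>x. \<phi> (?T x)) \<in> borel_measurable ?M"
    by (rule measurable_compose[OF fan_param_measurable assms])
  have w [measurable]: "(\<lambda>(l, k). ennreal ((ray_weight n k)\<^sup>2 * \<bar>l\<bar> ^ (2 * n) / (2 * pi) ^ (2 * n + 1)))
      \<in> borel_measurable ?M" by measurable
  have phik [measurable]: "(\<lambda>l. \<phi> (l, (2 * real k + real n) * \<bar>l\<bar>)) \<in> borel_measurable lborel" for k
    using measurable_compose[OF _ phi, of "\<lambda>l. (l, k)" lborel] by simp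
  have "(\<integral>\<^sup>+ a. \<phi> a \<partial>nu2 n) =
      (\<integral>\<^sup>+ (l, k). ennreal ((ray_weight n k)\<^sup>2 * \<bar>l\<bar> ^ (2 * n) / (2 * pi) ^ (2 * n + 1)) *
        \<phi> (l, (2 * real k + real n) * \<bar>l\<bar>) \<partial>?M)"
    unfolding nu2_def using phi w
    by (subst nn_integral_distr) (auto simp: nn_integral_density split_beta')
  also have "\<dots> = (\<integral>\<^sup>+ l. (\<integral>\<^sup>+ k. ennreal ((ray_weight n k)\<^sup>2 * \<bar>l\<bar> ^ (2 * n) / (2 * pi) ^ (2 * n + 1)) *
        \<phi> (l, (2 * real k + real n) * \<bar>l\<bar>) \<partial>count_space UNIV) \<partial>lborel)"
    using phi w by (subst C.nn_integral_fst[symmetric]) (auto simp: split_beta')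
  also have "\<dots> = (\<integral>\<^sup>+ l. ennreal ?c * ((\<Sum>k. ennreal ((ray_weight n k)\<^sup>2) *
      \<phi> (l, (2 * real k + real n) * \<bar>l\<bar>)) * ennreal (\<bar>l\<bar> ^ (2 * n))) \<partial>lborel)"
  proof (rule nn_integral_cong)
    fix l :: real
    let ?f = "\<lambda>k. \<phi> (l, (2 * real k + real n) * \<bar>l\<bar>)"
    have eq: "ennreal ((ray_weight n k)\<^sup>2 * \<bar>l\<bar> ^ (2 * n) / (2 * pi) ^ (2 * n + 1)) * x =
        (ennreal ?c * ennreal (\<bar>l\<bar> ^ (2 * n))) * (ennreal ((ray_weight n k)\<^sup>2) * x)" for k x
    proof -
      have "(ray_weight n k)\<^sup>2 * \<bar>l\<bar> ^ (2 * n) / (2 * pi) ^ (2 * n + 1) =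
          ?c * \<bar>l\<bar> ^ (2 * n) * (ray_weight n k)\<^sup>2" by simp
      then have "ennreal ((ray_weight n k)\<^sup>2 * \<bar>l\<bar> ^ (2 * n) / (2 * pi) ^ (2 * n + 1)) =
          ennreal ?c * ennreal (\<bar>l\<bar> ^ (2 * n)) * ennreal ((ray_weight n k)\<^sup>2)"
        by (simp only: ennreal_mult zero_le_power2 zero_le_power abs_ge_zero
            mult_nonneg_nonneg divide_nonneg_nonneg zero_le_one pi_ge_zero zero_le_numeral)
      then show ?thesis by (simp only: mult.assoc)
    qed
    have "(\<Sum>k. (ennreal ?c * ennreal (\<bar>l\<bar> ^ (2 * n))) * (ennreal ((ray_weight n k)\<^sup>2) * ?f k)) =
        (ennreal ?c * ennreal (\<bar>l\<bar> ^ (2 * n))) * (\<Sum>k. ennreal ((ray_weight n k)\<^sup>2) * ?f k)"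
      by (rule ennreal_suminf_cmult)
    then show "(\<integral>\<^sup>+ k. ennreal ((ray_weight n k)\<^sup>2 * \<bar>l\<bar> ^ (2 * n) / (2 * pi) ^ (2 * n + 1)) *
        ?f k \<partial>count_space UNIV) =
        ennreal ?c * ((\<Sum>k. ennreal ((ray_weight n k)\<^sup>2) * ?f k) * ennreal (\<bar>l\<bar> ^ (2 * n)))"
      unfolding nn_integral_count_space_nat eq by (simp only: mult_ac)
  qed
  also have "\<dots> = ennreal ?c * (\<integral>\<^sup>+ l. ((\<Sum>k. ennreal ((ray_weight n k)\<^sup>2) *
      \<phi> (l, (2 * real k + real n) * \<bar>l\<bar>)) * ennreal (\<bar>l\<bar> ^ (2 * n))) \<partial>lborel)"
    by (rule nn_integral_cmult) measurable
  finally show ?thesis .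
qed


section \<open>The Strichartz Fourier transform\<close>

definition phi_fun :: "nat \<Rightarrow> real \<Rightarrow> complex ^ 'n::finite \<Rightarrow> real" where
  "phi_fun k l z = poly (laguerre k (real (CARD('n) - 1))) (\<bar>l\<bar> * (norm z)\<^sup>2 / 2) *
     exp (- (\<bar>l\<bar> * (norm z)\<^sup>2 / 4))"

definition e_fun :: "nat \<Rightarrow> real \<Rightarrow> 'n::finite heis \<Rightarrow> complex" where
  "e_fun k l = (\<lambda>(z, t). cis (l * t) * complex_of_real (phi_fun k l z))"

definition strichartz :: "('n::finite heis \<Rightarrow> complex) \<Rightarrow> (real \<times> real) \<times> (complex ^ 'n) \<Rightarrow> complex" where
  "strichartz f = (\<lambda>(a, w).
     if fst a \<noteq> 0
     then (LINT g|lborel. f g * e_fun (fan_index CARD('n) a) (fst a) (hmult (hinv g) (w, 0)))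
     else fact (CARD('n) - 1) * 2 ^ (CARD('n) - 1) *
       (LINT g|lborel. f g *
         complex_of_real (bessel_quot (CARD('n) - 1) (sqrt (snd a) * norm (w - fst g)))))"

definition norm_strichartz :: "('n::finite heis \<Rightarrow> complex) \<Rightarrow> (real \<times> real) \<times> (complex ^ 'n) \<Rightarrow> complex" where
  "norm_strichartz f = (\<lambda>(a, w).
     if fst a \<noteq> 0
     then complex_of_real (inverse (ray_weight CARD('n) (fan_index CARD('n) a))) * strichartz f (a, w)
     else strichartz f (a, w))"

text \<open>\<open>d\<nu>\<^sub>2(a) dw\<close> on the fan times \<open>\<complex>\<^sup>n\<close>. Here, as for \<^term>\<open>lebesgue\<close> on the group, the measure is
  completed, so that weights need only be Lebesgue (not Borel) measurable.\<close>

definition fan_measure :: "((real \<times> real) \<times> (complex ^ 'n::finite)) measure" where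
  "fan_measure = completion (nu2 CARD('n) \<Otimes>\<^sub>M lborel)"


section \<open>Rearrangements and Lebesgue norms of \<open>[0, \<infinity>]\<close>-valued functions\<close>

definition distr_fun :: "'a measure \<Rightarrow> ('a \<Rightarrow> ennreal) \<Rightarrow> ennreal \<Rightarrow> ennreal" where
  "distr_fun M g s = emeasure M {x \<in> space M. s < g x}"

definition rearr :: "'a measure \<Rightarrow> ('a \<Rightarrow> ennreal) \<Rightarrow> real \<Rightarrow> ennreal" where
  "rearr M g t = Inf {s. 0 < s \<and> distr_fun M g s \<le> ennreal t}"

definition epowr :: "ennreal \<Rightarrow> real \<Rightarrow> ennreal" where  \<comment> \<open>only for \<open>r > 0\<close>\<close>
  "epowr x r = (if x = \<infinity> then \<infinity> else ennreal (enn2real x powr r))"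

definition Lnorm :: "'a measure \<Rightarrow> ennreal \<Rightarrow> ('a \<Rightarrow> ennreal) \<Rightarrow> ennreal" where
  "Lnorm M p g =
     (if p = \<infinity> then esssup M g
      else epowr (\<integral>\<^sup>+ x. epowr (g x) (enn2real p) \<partial>M) (1 / enn2real p))"

end

theory Submission
  imports Defs "HOL-Probability.Characteristic_Functions" "HOL-Probability.Sinc_Integral"
    "HOL-Real_Asymp.Real_Asymp"
begin

text \<open>The normalized transform is an integral operator \<open>T\<close> whose kernel is bounded by 1, because
  \<open>\<bar>L\<^sub>k\<^sup>d(x)\<bar> e\<^bsup>-x/2\<^esup> \<le> (k + d choose k)\<close>, and which is bounded on \<open>L\<^sup>2\<close>: on each \<open>\<lambda>\<close>-fibre, the squared
  norms over all \<open>k\<close> are summed by Bessel's inequality on circles \<open>\<bar>w\<bar> = r < 1\<close>, where the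
  generating function of the Laguerre functions is a complex Gaussian, and twisted convolution with
  a Gaussian is controlled by Schur's test for \<open>S\<^sup>* S\<close>.

  For every operator with these two bounds, the Jurkat-Sampson inequality estimates the
  rearrangement of \<open>T f\<close> in \<open>L\<^sup>q\<close> (\<open>q \<ge> 2\<close>) by \<open>\<Phi>(t) = \<integral>\<^bsub>0\<^esub>\<^bsup>1/t\<^esup> f\<^sup>*\<close>, which reduces the weighted inequality
  to a weighted Hardy inequality; the case \<open>q < 2\<close> follows by duality, and \<open>p = 1\<close> or \<open>q = \<infinity>\<close> from
  Hoelder's inequality alone.\<close>

section \<open>Powers and rearrangements\<close>

text \<open>Constants may be crude, but they must not depend on \<open>k\<close> or on the fibre.
  Two uniformities give this. As \<open>w\<close> approaches the unit circle, the L1 norm of the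
  Gaussian kernel blows up, so Schur's test for the operator itself yields no uniform bound. The
  kernel of S* S keeps the cancellation of the phases, and its L1 norm is at most (8 pi^2 / l^2)^n
  for every \<open>w\<close> in the disc. The resulting factor |l|^(-2n) is cancelled exactly by the
  density |l|^(2n) of \<open>nu2\<close>, so the fibres can be integrated by a Plancherel inequality
  in \<open>t\<close>.

  The real-variable half is stated for an abstract kernel between two sigma-finite spaces, because
  the case q < 2 applies the case q >= 2 to the transposed kernel, with the spaces and the weights
  exchanged. Weights with values in [0, infinity] bring in the convention 0 * infinity = 0. The
  supremum condition therefore yields finiteness of either factor only after both weights are known
  not to vanish almost everywhere.\<close>

lemma epowr_ennreal: "0 \<le> x \<Longrightarrow> epowr (ennreal x) r = ennreal (x powr r)"
  by (simp add: epowr_def)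

lemma epowr_top [simp]: "epowr top r = top"
  by (simp add: epowr_def)

lemma epowr_0 [simp]: "epowr 0 r = 0"
  by (simp add: epowr_def)

lemma epowr_1 [simp]: "epowr x 1 = x"
  by (cases x) (simp_all add: epowr_def)

lemma epowr_eq_0_iff [simp]: "epowr x r = 0 \<longleftrightarrow> x = 0"
  by (cases x) (auto simp: epowr_def ennreal_eq_0_iff)

lemma epowr_eq_top_iff [simp]: "epowr x r = top \<longleftrightarrow> x = top"
  by (cases x) (auto simp: epowr_def)

lemma epowr_mono: "x \<le> y \<Longrightarrow> 0 \<le> r \<Longrightarrow> epowr x r \<le> epowr y r"
  by (cases x; cases y) (auto simp: epowr_def top_unique intro!: ennreal_leI powr_mono2)

lemma epowr_epowr: "epowr (epowr x r) s = epowr x (r * s)"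
  by (cases x) (auto simp: epowr_def powr_powr)

lemma epowr_mult: "epowr (x * y) r = epowr x r * epowr y r"
  by (cases x; cases y)
     (auto simp: epowr_ennreal ennreal_mult[symmetric] ennreal_mult_top ennreal_top_mult powr_mult ennreal_eq_0_iff)

lemma epowr_inverse: "0 < r \<Longrightarrow> epowr (epowr x r) (1 / r) = x" "0 < r \<Longrightarrow> epowr (epowr x (1 / r)) r = x"
  by (simp_all add: epowr_epowr)

lemma epowr_add: "x \<noteq> 0 \<Longrightarrow> x \<noteq> top \<Longrightarrow> epowr x (r + s) = epowr x r * epowr x s"
  by (cases x) (auto simp: epowr_ennreal powr_add ennreal_mult)

lemma epowr_2: "epowr x 2 = x\<^sup>2"
  by (cases x) (auto simp: epowr_ennreal ennreal_power)

lemma epowr_measurable [measurable]: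
  assumes [measurable]: "f \<in> borel_measurable M"
  shows "(\<lambda>x. epowr (f x) r) \<in> borel_measurable M"
  unfolding epowr_def by measurable

text \<open>Distribution functions, rearrangements and \<open>PhiF\<close> all get their
  measurability from monotonicity alone.\<close>

lemma borel_measurable_ennreal_mono:
  fixes f :: "real \<Rightarrow> ennreal"
  assumes "mono f"
  shows "f \<in> borel_measurable borel"
proof (rule borel_measurableI_greater)
  fix y
  have "is_interval {x. y < f x}"
    using assms unfolding is_interval_1 mono_def by (auto intro: less_le_trans)
  then show "{x \<in> space borel. y < f x} \<in> sets borel"
    using real_interval_borel_measurable by simp
qed

lemma borel_measurable_ennreal_antimono:
  fixes f :: "real \<Rightarrow> ennreal"
  assumes "antimono f"
  shows "f \<in> borel_measurable borel"
proof -
  have "mono (\<lambda>x. f (- x))" using assms by (auto simp: mono_def antimono_def)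
  from measurable_compose[OF _ borel_measurable_ennreal_mono[OF this], of uminus borel]
  show ?thesis by simp
qed

lemma rearr_antimono: "antimono (rearr M g)"
  unfolding rearr_def antimono_def
  by (auto intro!: Inf_superset_mono intro: order_trans simp: ennreal_leI)

lemma rearr_measurable [measurable]: "rearr M g \<in> borel_measurable borel"
  by (rule borel_measurable_ennreal_antimono[OF rearr_antimono])

text \<open>A level whose superlevel set has measure at most \<open>t\<close> cannot lie below
  \<open>s\<close>, where that measure is already larger. This is the direction that bounds
  quantities of \<open>w\<close> from above by its rearrangement.\<close>

lemma le_rearr:
  assumes "w \<in> borel_measurable M" "ennreal t < emeasure M {x \<in> space M. s < w x}"
  shows "s \<le> rearr M w t"
  unfolding rearr_def distr_fun_def
proof (rule Inf_greatest, clarsimp)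
  fix r assume r: "0 < r" "emeasure M {x \<in> space M. r < w x} \<le> ennreal t"
  show "s \<le> r"
  proof (rule ccontr)
    assume "\<not> s \<le> r"
    then have "{x \<in> space M. s < w x} \<subseteq> {x \<in> space M. r < w x}" by auto
    moreover have "{x \<in> space M. r < w x} \<in> sets M" using assms(1) by measurable
    ultimately have "emeasure M {x \<in> space M. s < w x} \<le> emeasure M {x \<in> space M. r < w x}"
      by (rule emeasure_mono)
    with r assms(2) show False by auto
  qed
qed

section \<open>Layer-cake formulas and rearrangement inequalities\<close>

lemma nn_integral_powr:
  assumes a: "0 < a" and c: "0 \<le> c"
  shows "(\<integral>\<^sup>+ s. ennreal (a * s powr (a - 1)) * indicator {0<..<c} s \<partial>lborel) = ennreal (c powr a)"
proof (cases "c = 0")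
  case False
  with c have c: "0 < c" by simp
  have D: "((\<lambda>s. s powr a) has_real_derivative a * s powr (a - 1)) (at s)" if "0 < s" for s :: real
    using has_real_derivative_powr[OF that, of a] .
  have cont: "isCont (\<lambda>s. a * s powr (a - 1)) s" if "0 < s" for s :: real
    using that by (auto intro!: continuous_intros)
  have A: "(((\<lambda>s. s powr a) \<circ> real_of_ereal) \<longlongrightarrow> 0) (at_right (ereal 0))"
  proof -
    have "((\<lambda>s. s powr a) \<longlongrightarrow> 0 powr a) (at_right (0::real))"
      using a by (intro tendsto_powr' tendsto_intros) (auto intro: eventually_at_right_less[THEN eventually_mono])
    then show ?thesis
      unfolding ereal_tendsto_simps1 ereal_tendsto_simps using a by simp
  qed
  have B: "(((\<lambda>s. s powr a) \<circ> real_of_ereal) \<longlongrightarrow> c powr a) (at_left (ereal c))"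
    unfolding ereal_tendsto_simps1 ereal_tendsto_simps
    using c by (auto intro!: tendsto_eq_intros)
  \<comment> \<open>For \<open>a < 1\<close> the integrand is unbounded at 0, so the fundamental
    theorem is used in its improper form, with one-sided limits of the antiderivative.\<close>
  have I: "set_integrable lborel (einterval (ereal 0) (ereal c)) (\<lambda>s. a * s powr (a - 1))"
    "(LBINT x=ereal 0..ereal c. a * x powr (a - 1)) = c powr a - 0"
    by (rule interval_integral_FTC_nonneg[OF _ D cont _ A B]; use a c in simp)+
  have e: "einterval (ereal 0) (ereal c) = {0<..<c}" by auto
  have "(\<integral>\<^sup>+ s. ennreal (a * s powr (a - 1)) * indicator {0<..<c} s \<partial>lborel)
     = (\<integral>\<^sup>+ s. ennreal (indicator {0<..<c} s * (a * s powr (a - 1))) \<partial>lborel)"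
    by (intro nn_integral_cong) (auto simp: indicator_def)
  also have "\<dots> = ennreal (LINT s|lborel. indicator {0<..<c} s * (a * s powr (a - 1)))"
    using I(1) a by (intro nn_integral_eq_integral) (auto simp: set_integrable_def e indicator_def)
  also have "(LINT s|lborel. indicator {0<..<c} s * (a * s powr (a - 1))) = c powr a"
    using I(2) c by (simp add: interval_lebesgue_integral_def set_lebesgue_integral_def e mult.left_commute[of _ a])
  finally show ?thesis .
qed (use a in simp)

lemma layer_less:
  assumes a: "0 < a"
  shows "(\<integral>\<^sup>+ s. ennreal (a * s powr (a - 1)) * indicator {s. 0 < s \<and> ennreal s < x} s \<partial>lborel) = epowr x a"
    (is "?I x = _")
proof (cases x)
  case (real c)
  then have "{s. 0 < s \<and> ennreal s < x} = {0<..<c}" by (auto simp: ennreal_less_iff)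
  then show ?thesis using nn_integral_powr[OF a real(1)] real by (simp add: epowr_ennreal)
next
  case top
  have "ennreal r \<le> ?I top" if "0 \<le> r" for r
  proof -
    have "ennreal r = ennreal ((r powr (1 / a)) powr a)" using that a by (simp add: powr_powr)
    also have "\<dots> = (\<integral>\<^sup>+ s. ennreal (a * s powr (a - 1)) * indicator {0<..<r powr (1 / a)} s \<partial>lborel)"
      by (rule nn_integral_powr[symmetric]) (use a in auto)
    also have "\<dots> \<le> ?I top"
      by (intro nn_integral_mono mult_left_mono) (auto simp: indicator_def)
    finally show ?thesis .
  qed
  note * = this
  have "?I top = top"
  proof (rule ccontr)
    assume "?I top \<noteq> top"
    then obtain r where r: "0 \<le> r" "?I top = ennreal r" by (cases "?I top") auto
    have "ennreal (r + 1) \<le> ennreal r" using *[of "r + 1"] r by simp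
    then show False using r(1) by (simp add: ennreal_le_iff)
  qed
  then show ?thesis using top by simp
qed

text \<open>The weak inequality is the one that fits the conclusion of \<open>le_rearr\<close>; the
  two integrands differ at a single point.\<close>

lemma layer_le:
  assumes a: "0 < a"
  shows "(\<integral>\<^sup>+ s. ennreal (a * s powr (a - 1)) * indicator {s. 0 < s \<and> ennreal s \<le> x} s \<partial>lborel) = epowr x a"
proof -
  have "AE s in lborel. s \<noteq> enn2real x"
    by (rule AE_lborel_singleton)
  then have "(\<integral>\<^sup>+ s. ennreal (a * s powr (a - 1)) * indicator {s. 0 < s \<and> ennreal s \<le> x} s \<partial>lborel)
    = (\<integral>\<^sup>+ s. ennreal (a * s powr (a - 1)) * indicator {s. 0 < s \<and> ennreal s < x} s \<partial>lborel)"
    by (intro nn_integral_cong_AE) (auto simp: indicator_def le_less elim!: eventually_mono)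
  then show ?thesis using layer_less[OF a] by simp
qed

lemma nn_integral_layer:
  assumes "sigma_finite_measure M" and [measurable]: "h \<in> borel_measurable M" "w \<in> borel_measurable M" and a: "0 < a"
  shows "(\<integral>\<^sup>+ x. h x * epowr (w x) a \<partial>M) =
    (\<integral>\<^sup>+ s. ennreal (a * s powr (a - 1)) * indicator {0<..} s *
        (\<integral>\<^sup>+ x. h x * indicator {x \<in> space M. ennreal s < w x} x \<partial>M) \<partial>lborel)"
proof -
  interpret sigma_finite_measure M by fact
  interpret pair_sigma_finite M "lborel :: real measure" ..
  have "(\<integral>\<^sup>+ x. h x * epowr (w x) a \<partial>M) = (\<integral>\<^sup>+ x. \<integral>\<^sup>+ s. h x *
     (ennreal (a * s powr (a - 1)) * indicator {s. 0 < s \<and> ennreal s < w x} s) \<partial>lborel \<partial>M)"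
    by (intro nn_integral_cong) (simp add: layer_less[OF a, symmetric] nn_integral_cmult)
  also have "\<dots> = (\<integral>\<^sup>+ s. \<integral>\<^sup>+ x. h x *
     (ennreal (a * s powr (a - 1)) * indicator {s. 0 < s \<and> ennreal s < w x} s) \<partial>M \<partial>lborel)"
    by (rule Fubini'[symmetric]) measurable
  also have "\<dots> = (\<integral>\<^sup>+ s. \<integral>\<^sup>+ x. (ennreal (a * s powr (a - 1)) * indicator {0<..} s) *
      (h x * indicator {x \<in> space M. ennreal s < w x} x) \<partial>M \<partial>lborel)"
    by (intro nn_integral_cong) (auto simp: indicator_def mult_ac)
  also have "\<dots> = (\<integral>\<^sup>+ s. ennreal (a * s powr (a - 1)) * indicator {0<..} s *
        (\<integral>\<^sup>+ x. h x * indicator {x \<in> space M. ennreal s < w x} x \<partial>M) \<partial>lborel)"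
    by (intro nn_integral_cong nn_integral_cmult) measurable
  finally show ?thesis .
qed

text \<open>A form of the Hardy-Littlewood inequality. By hypothesis \<open>h\<close> has on every
  set at most the mass that \<open>H\<close> has on an interval of the same measure. This is applied
  to the superlevel sets of \<open>w\<close>; after Fubini's theorem \<open>le_rearr\<close> inverts
  their measures \<open>?d s\<close>. It serves for unit weights, for norms of rearrangements, and
  with |T f|^q in the place of \<open>h\<close>.\<close>

lemma rearr_bound:
  assumes sf: "sigma_finite_measure M" and [measurable]: "h \<in> borel_measurable M" "w \<in> borel_measurable M"
    "H \<in> borel_measurable borel" and a: "0 < a"
    and E: "\<And>E. E \<in> sets M \<Longrightarrow> (\<integral>\<^sup>+ x. h x * indicator E x \<partial>M) \<le>
      (\<integral>\<^sup>+ t. H t * indicator {t. 0 < t \<and> ennreal t < emeasure M E} t \<partial>lborel)"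
  shows "(\<integral>\<^sup>+ x. h x * epowr (w x) a \<partial>M) \<le>
    (\<integral>\<^sup>+ t. H t * indicator {0<..} t * epowr (rearr M w t) a \<partial>lborel)"
proof -
  interpret sigma_finite_measure M by fact
  interpret P: pair_sigma_finite M "lborel :: real measure" ..
  let ?c = "\<lambda>s. ennreal (a * s powr (a - 1)) * indicator {0<..} s"
  let ?d = "\<lambda>s. emeasure M {x \<in> space M. ennreal s < w x}"
  have d [measurable]: "?d \<in> borel_measurable borel"
  proof (rule borel_measurable_ennreal_antimono, rule antimonoI)
    fix s s' :: real assume "s \<le> s'"
    then show "?d s' \<le> ?d s"
      by (intro emeasure_mono) (auto dest: order.strict_trans1[OF ennreal_leI])
  qed
  have "(\<integral>\<^sup>+ x. h x * epowr (w x) a \<partial>M) =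
    (\<integral>\<^sup>+ s. ?c s * (\<integral>\<^sup>+ x. h x * indicator {x \<in> space M. ennreal s < w x} x \<partial>M) \<partial>lborel)"
    by (rule nn_integral_layer[OF sf]) (use a in auto)
  also have "\<dots> \<le> (\<integral>\<^sup>+ s. ?c s * (\<integral>\<^sup>+ t. H t * indicator {t. 0 < t \<and> ennreal t < ?d s} t \<partial>lborel) \<partial>lborel)"
    by (intro nn_integral_mono mult_left_mono E) auto
  also have "\<dots> = (\<integral>\<^sup>+ s. \<integral>\<^sup>+ t. ?c s * (H t * indicator {t. 0 < t \<and> ennreal t < ?d s} t) \<partial>lborel \<partial>lborel)"
    by (intro nn_integral_cong nn_integral_cmult[symmetric]) measurable
  also have "\<dots> = (\<integral>\<^sup>+ t. \<integral>\<^sup>+ s. ?c s * (H t * indicator {t. 0 < t \<and> ennreal t < ?d s} t) \<partial>lborel \<partial>lborel)"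
    by (rule lborel_pair.Fubini'[symmetric]) measurable
  also have "\<dots> \<le> (\<integral>\<^sup>+ t. \<integral>\<^sup>+ s. H t * indicator {0<..} t *
      (ennreal (a * s powr (a - 1)) * indicator {s. 0 < s \<and> ennreal s \<le> rearr M w t} s) \<partial>lborel \<partial>lborel)"
    by (intro nn_integral_mono) (auto simp: indicator_def mult_ac intro!: le_rearr)
  also have "\<dots> = (\<integral>\<^sup>+ t. H t * indicator {0<..} t * epowr (rearr M w t) a \<partial>lborel)"
    by (intro nn_integral_cong) (simp add: layer_le[OF a, symmetric] nn_integral_cmult)
  finally show ?thesis .
qed

text \<open>The condition \<open>ennreal t < y\<close> replaces an interval, so that sets of
  infinite measure need no separate case later.\<close>

lemma emeasure_ennreal_interval: "emeasure lborel {t::real. 0 < t \<and> ennreal t < y} = y"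
proof (cases y)
  case (real r)
  then have "{t::real. 0 < t \<and> ennreal t < y} = {0<..<r}" by (auto simp: ennreal_less_iff)
  then show ?thesis using real by simp
next
  case top
  have "{t::real. 0 < t \<and> ennreal t < y} = {0<..}" using top by (auto simp: less_top)
  moreover have "emeasure lborel {0::real<..} = top"
  proof (rule ccontr)
    assume "emeasure lborel {0::real<..} \<noteq> top"
    then obtain r where r: "0 \<le> r" "emeasure lborel {0::real<..} = ennreal r"
      by (cases "emeasure lborel {0::real<..}") auto
    have "emeasure lborel {0<..<r + 1} \<le> emeasure lborel {0::real<..}" by (rule emeasure_mono) auto
    then show False using r by (simp add: ennreal_le_iff)
  qed
  ultimately show ?thesis using top by simp
qed

lemma ennreal_mult3:
  "0 \<le> a \<Longrightarrow> 0 \<le> b \<Longrightarrow> 0 \<le> c \<Longrightarrow> ennreal a * (ennreal b * (x * ennreal c)) = ennreal (a * b * c) * x"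
  by (simp add: ennreal_mult mult_ac)

lemma Hoelder_nn_integral:
  assumes [measurable]: "f \<in> borel_measurable M" "g \<in> borel_measurable M"
    and p: "1 < p" and q: "1 < q" and pq: "1 / p + 1 / q = 1"
  shows "(\<integral>\<^sup>+ x. f x * g x \<partial>M) \<le> epowr (\<integral>\<^sup>+ x. epowr (f x) p \<partial>M) (1 / p) * epowr (\<integral>\<^sup>+ x. epowr (g x) q \<partial>M) (1 / q)"
proof -
  let ?A = "\<integral>\<^sup>+ x. epowr (f x) p \<partial>M" and ?B = "\<integral>\<^sup>+ x. epowr (g x) q \<partial>M"
  have zero: "(\<integral>\<^sup>+ x. f x * g x \<partial>M) = 0" if "?A = 0 \<or> ?B = 0"
  proof -
    have "AE x in M. f x * g x = 0"
      using that by (elim disjE) (auto simp: nn_integral_0_iff_AE elim!: eventually_mono)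
    then show ?thesis by (simp add: nn_integral_0_iff_AE)
  qed
  consider "?A = 0 \<or> ?B = 0" | "?A \<noteq> 0" "?B \<noteq> 0" "?A = top \<or> ?B = top" | "?A \<noteq> 0" "?B \<noteq> 0" "?A < top" "?B < top"
    using top.not_eq_extremum by metis
  then show ?thesis
  proof cases
    case 1
    then show ?thesis using zero by simp
  next
    case 2
    then show ?thesis by (auto simp: ennreal_mult_eq_top_iff top_unique)
  next
    case 3
    obtain a where a: "?A = ennreal a" "0 < a" using 3 by (cases ?A) (auto simp: less_le)
    obtain b where b: "?B = ennreal b" "0 < b" using 3 by (cases ?B) (auto simp: less_le)
    let ?c = "ennreal (a powr (1 / p))" and ?d = "ennreal (b powr (1 / q))"
    \<comment> \<open>Young's inequality for the two functions divided by their norms, with the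
      norms moved to the right-hand side so that infinite values of \<open>f\<close> and
      \<open>g\<close> are covered as well.\<close>
    have young: "f x * g x \<le> ?c * ?d * (ennreal (1 / (a * p)) * epowr (f x) p + ennreal (1 / (b * q)) * epowr (g x) q)" for x
    proof (cases "f x = top \<or> g x = top")
      case True
      then show ?thesis using a b p q by (elim disjE) (simp_all add: ennreal_mult_top ennreal_top_mult)
    next
      case False
      then obtain s t where s: "f x = ennreal s" "0 \<le> s" and t: "g x = ennreal t" "0 \<le> t"
        by (cases "f x"; cases "g x") auto
      have "(s / a powr (1 / p)) * (t / b powr (1 / q)) \<le>
         (s / a powr (1 / p)) powr p / p + (t / b powr (1 / q)) powr q / q"
        using s t by (intro Youngs_inequality p q pq) auto
      also have "(s / a powr (1 / p)) powr p = s powr p / a"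
        using s a p by (simp add: powr_divide powr_powr)
      also have "(t / b powr (1 / q)) powr q = t powr q / b"
        using t b q by (simp add: powr_divide powr_powr)
      finally have "s * t \<le> a powr (1 / p) * b powr (1 / q) * (1 / (a * p) * s powr p + 1 / (b * q) * t powr q)"
        using a b by (simp add: field_simps)
      then show ?thesis using s t a b p q
        by (simp add: epowr_ennreal ennreal_mult[symmetric] ennreal_plus[symmetric] del: ennreal_plus)
    qed
    have "(\<integral>\<^sup>+ x. f x * g x \<partial>M) \<le> (\<integral>\<^sup>+ x. ?c * ?d * (ennreal (1 / (a * p)) * epowr (f x) p + ennreal (1 / (b * q)) * epowr (g x) q) \<partial>M)"
      by (rule nn_integral_mono) (rule young)
    also have "\<dots> = ?c * ?d * (ennreal (1 / (a * p)) * ?A + ennreal (1 / (b * q)) * ?B)"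
      by (simp add: nn_integral_cmult nn_integral_add)
    also have "ennreal (1 / (a * p)) * ?A + ennreal (1 / (b * q)) * ?B = 1"
      using a b p q pq by (simp add: ennreal_mult[symmetric] ennreal_plus[symmetric] del: ennreal_plus)
    also have "?c * ?d * 1 = epowr ?A (1 / p) * epowr ?B (1 / q)"
      using a b by (simp add: epowr_ennreal)
    finally show ?thesis .
  qed
qed

section \<open>A weighted Hardy inequality\<close>

definition unit_weights :: "'a measure \<Rightarrow> ennreal \<Rightarrow> ('a \<Rightarrow> ennreal) set" where
  "unit_weights M x = {h \<in> borel_measurable M. (\<forall>a. h a \<le> 1) \<and> (\<integral>\<^sup>+ a. h a \<partial>M) \<le> x}"

text \<open>The integral of the decreasing rearrangement of \<open>f\<close> over \<open>(0, x)\<close>. Weights \<open>h\<close> instead of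
  sets of measure at most \<open>x\<close> make atoms harmless.\<close>

definition Fsup :: "'a measure \<Rightarrow> ('a \<Rightarrow> ennreal) \<Rightarrow> ennreal \<Rightarrow> ennreal" where
  "Fsup M f x = (SUP h\<in>unit_weights M x. \<integral>\<^sup>+ a. f a * h a \<partial>M)"

lemma Fsup_mono: "x \<le> y \<Longrightarrow> Fsup M f x \<le> Fsup M f y"
  unfolding Fsup_def unit_weights_def by (rule SUP_subset_mono) auto

lemma le_Fsup: "h \<in> unit_weights M x \<Longrightarrow> (\<integral>\<^sup>+ a. f a * h a \<partial>M) \<le> Fsup M f x"
  unfolding Fsup_def by (rule SUP_upper)

text \<open>In the usual notation, the integral of the decreasing rearrangement over (0, 1/t). The
  value \<open>top\<close> for \<open>t \<le> 0\<close> makes the function antitone on the whole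
  line and hence Borel measurable.\<close>

definition PhiF :: "'a measure \<Rightarrow> ('a \<Rightarrow> ennreal) \<Rightarrow> real \<Rightarrow> ennreal" where
  "PhiF M f t = (if t \<le> 0 then top else Fsup M f (ennreal (1 / t)))"

lemma PhiF_measurable [measurable]: "PhiF M f \<in> borel_measurable borel"
proof (rule borel_measurable_ennreal_antimono, rule antimonoI)
  fix s t :: real assume "s \<le> t"
  then show "PhiF M f t \<le> PhiF M f s"
    by (auto simp: PhiF_def intro!: Fsup_mono ennreal_leI divide_left_mono)
qed

text \<open>The bathtub principle: on a set \<open>E\<close> the weight has mass at most
  \<open>min x (emeasure M E)\<close>, which is the mass of an interval cut off at \<open>x\<close>,
  so \<open>rearr_bound\<close> applies with an indicator as \<open>H\<close>.\<close>

lemma unit_weight_integral_le: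
  assumes sf: "sigma_finite_measure M" and h: "h \<in> unit_weights M x"
    and [measurable]: "\<sigma> \<in> borel_measurable M" and a: "0 < a"
  shows "(\<integral>\<^sup>+ y. h y * epowr (\<sigma> y) a \<partial>M) \<le>
    (\<integral>\<^sup>+ t. epowr (rearr M \<sigma> t) a * indicator {t. 0 < t \<and> ennreal t < x} t \<partial>lborel)"
proof -
  have [measurable]: "h \<in> borel_measurable M" and h1: "\<And>y. h y \<le> 1" and hx: "(\<integral>\<^sup>+ y. h y \<partial>M) \<le> x"
    using h by (auto simp: unit_weights_def)
  have "(\<integral>\<^sup>+ y. h y * epowr (\<sigma> y) a \<partial>M) \<le>
    (\<integral>\<^sup>+ t. indicator {t. ennreal t < x} t * indicator {0<..} t * epowr (rearr M \<sigma> t) a \<partial>lborel)"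
  proof (rule rearr_bound[OF sf _ _ _ a])
    fix E assume [measurable]: "E \<in> sets M"
    have "(\<integral>\<^sup>+ y. h y * indicator E y \<partial>M) \<le> (\<integral>\<^sup>+ y. indicator E y \<partial>M)"
      using h1 by (intro nn_integral_mono) (auto simp: indicator_def)
    moreover have "(\<integral>\<^sup>+ y. h y * indicator E y \<partial>M) \<le> x"
      by (rule order_trans[OF nn_integral_mono hx]) (auto simp: indicator_def)
    ultimately have "(\<integral>\<^sup>+ y. h y * indicator E y \<partial>M) \<le> min x (emeasure M E)"
      by simp
    also have "\<dots> = emeasure lborel {t::real. 0 < t \<and> ennreal t < min x (emeasure M E)}"
      by (rule emeasure_ennreal_interval[symmetric])
    also have "\<dots> = (\<integral>\<^sup>+ t. indicator {t::real. 0 < t \<and> ennreal t < min x (emeasure M E)} t \<partial>lborel)"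
      by simp
    also have "\<dots> = (\<integral>\<^sup>+ t. indicator {t. ennreal t < x} t * indicator {t. 0 < t \<and> ennreal t < emeasure M E} t \<partial>lborel)"
      by (intro nn_integral_cong) (auto simp: indicator_def)
    finally show "(\<integral>\<^sup>+ y. h y * indicator E y \<partial>M) \<le>
       (\<integral>\<^sup>+ t. indicator {t. ennreal t < x} t * indicator {t. 0 < t \<and> ennreal t < emeasure M E} t \<partial>lborel)" .
  qed auto
  also have "\<dots> = (\<integral>\<^sup>+ t. epowr (rearr M \<sigma> t) a * indicator {t. 0 < t \<and> ennreal t < x} t \<partial>lborel)"
    by (intro nn_integral_cong) (auto simp: indicator_def)
  finally show ?thesis .
qed

text \<open>An initial segment of the half-line is exhausted, up to its supremum, by intervals that
  end inside it. A bound known only for intervals ending in \<open>S\<close> thus passes to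
  \<open>S\<close> by monotone convergence.\<close>

lemma nn_integral_initial_segment_le:
  fixes D :: "real \<Rightarrow> ennreal"
  assumes [measurable]: "D \<in> borel_measurable borel" "S \<in> sets borel"
    and S: "S \<subseteq> {0<..}" and down: "\<And>r t. t \<in> S \<Longrightarrow> 0 < r \<Longrightarrow> r \<le> t \<Longrightarrow> r \<in> S"
    and c: "\<And>t. t \<in> S \<Longrightarrow> (\<integral>\<^sup>+ r. D r * indicator {0<..<t} r \<partial>lborel) \<le> c"
  shows "(\<integral>\<^sup>+ r. D r * indicator S r \<partial>lborel) \<le> c"
proof -
  have "\<exists>t::nat \<Rightarrow> real. incseq t \<and> (\<forall>n. t n \<le> 0 \<or> t n \<in> S) \<and> (\<exists>m. S \<subseteq> insert m (\<Union>n. {0<..<t n}))"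
  proof (cases "bdd_above S")
    case False
    have "real n \<in> S" if "n > 0" for n
    proof -
      obtain t where "t \<in> S" "real n < t" using False by (auto simp: bdd_above_def not_le)
      then show ?thesis using down[of t "real n"] that by simp
    qed
    moreover have "S \<subseteq> insert 0 (\<Union>n. {0<..<real n})"
      using S reals_Archimedean2 by fastforce
    ultimately show ?thesis by (intro exI[of _ real] conjI allI exI[of _ 0]) (auto simp: incseq_def)
  next
    case True
    show ?thesis
    proof (cases "S = {}")
      case True
      then show ?thesis by (intro exI[of _ "\<lambda>_. 0"]) (simp add: incseq_def)
    next
      case ne: False
    let ?t = "\<lambda>n. Sup S - inverse (real (Suc n))"
    have "?t n \<le> 0 \<or> ?t n \<in> S" for n
    proof (cases "?t n \<le> 0")
      case False
      have "?t n < Sup S" by simp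
      then obtain s where "s \<in> S" "?t n < s"
        using less_cSup_iff[OF ne True, of "?t n"] by blast
      then have "?t n \<in> S" using down[of s "?t n"] False by simp
      then show ?thesis ..
    qed simp
    moreover have "incseq ?t" by (auto simp: incseq_def field_simps)
    moreover have "S \<subseteq> insert (Sup S) (\<Union>n. {0<..<?t n})"
    proof
      fix s assume s: "s \<in> S"
      then have "s \<le> Sup S" using True by (rule cSup_upper)
      show "s \<in> insert (Sup S) (\<Union>n. {0<..<?t n})"
      proof (cases "s = Sup S")
        case False
        then have "0 < Sup S - s" using \<open>s \<le> Sup S\<close> by simp
        then obtain n where "inverse (real (Suc n)) < Sup S - s" using reals_Archimedean by blast
        then show ?thesis using s S by (auto intro!: exI[of _ n])
      qed simp
    qed
    ultimately show ?thesis by blast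
    qed
  qed
  then obtain t :: "nat \<Rightarrow> real" and m where t: "incseq t" "\<And>n. t n \<le> 0 \<or> t n \<in> S"
    and m: "S \<subseteq> insert m (\<Union>n. {0<..<t n})" by auto
  have "(\<integral>\<^sup>+ r. D r * indicator S r \<partial>lborel) \<le> (\<integral>\<^sup>+ r. (SUP n. D r * indicator {0<..<t n} r) \<partial>lborel)"
  proof (intro nn_integral_mono_AE eventually_mono[OF AE_lborel_singleton[of m]])
    fix r assume "r \<noteq> m"
    show "D r * indicator S r \<le> (SUP n. D r * indicator {0<..<t n} r)"
    proof (cases "r \<in> S")
      case True
      then obtain n where "r \<in> {0<..<t n}" using m \<open>r \<noteq> m\<close> True by blast
      then show ?thesis by (intro SUP_upper2[of n]) (auto simp: indicator_def)
    qed simp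
  qed
  also have "\<dots> = (SUP n. \<integral>\<^sup>+ r. D r * indicator {0<..<t n} r \<partial>lborel)"
    using t(1) by (intro nn_integral_monotone_convergence_SUP)
      (auto simp: incseq_def le_fun_def indicator_def intro: less_le_trans)
  also have "\<dots> \<le> c"
  proof (rule SUP_least)
    fix n show "(\<integral>\<^sup>+ r. D r * indicator {0<..<t n} r \<partial>lborel) \<le> c"
      using t(2)[of n] c[of "t n"] by (cases "t n \<le> 0") auto
  qed
  finally show ?thesis .
qed

text \<open>Marcinkiewicz interpolation for \<open>\<phi> \<mapsto> PhiF (\<phi> \<sigma>) / w\<close>, which is of weak type \<open>(1, 1)\<close> and bounded
  on \<open>L\<^sup>\<infinity>\<close> as a map from functions of \<open>\<phi> \<sigma>\<^bsup>1 - p'\<^esup>\<close> with the measure \<open>\<sigma>\<^bsup>p'\<^esup>\<close>. The extra power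
  \<open>PhiF\<^bsup>q - p\<^esup>\<close> is absorbed by Hoelder's inequality.\<close>

lemma weighted_Hardy:
  fixes \<phi> \<sigma> :: "'a \<Rightarrow> real" and D :: "real \<Rightarrow> ennreal" and M :: "'a measure" and p q p' B :: real
  defines "W \<equiv> \<lambda>x. \<integral>\<^sup>+ t. epowr (rearr M (\<lambda>x. ennreal (\<sigma> x)) t) p' * indicator {0<..<x} t \<partial>lborel"
  defines "N \<equiv> \<integral>\<^sup>+ x. epowr (ennreal (\<phi> x)) p \<partial>M"
  assumes sf: "sigma_finite_measure M" and [measurable]: "\<phi> \<in> borel_measurable M" "\<sigma> \<in> borel_measurable M"
    and \<phi>: "\<And>x. 0 \<le> \<phi> x" and \<sigma>: "\<And>x. 0 \<le> \<sigma> x"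
    and p: "1 < p" "p \<le> q" and p': "1 < p'" and pp': "1 / p + 1 / p' = 1"
    and D [measurable]: "D \<in> borel_measurable borel"
    and W: "\<And>x. 0 < x \<Longrightarrow> W x \<noteq> 0" "\<And>x. 0 < x \<Longrightarrow> W x \<noteq> top"
    and B: "0 < B" "\<And>t. 0 < t \<Longrightarrow> (\<integral>\<^sup>+ r. D r * indicator {0<..<t} r \<partial>lborel) * epowr (W (1 / t)) (q / p') \<le> ennreal B"
  shows "(\<integral>\<^sup>+ t. epowr (PhiF M (\<lambda>x. ennreal (\<phi> x * \<sigma> x)) t) q * D t * indicator {0<..} t \<partial>lborel)
    \<le> ennreal ((q / p' + 1) * B * 2 * p / (p - 1) * 2 powr (p - 1)) * epowr N (q / p)"
proof (cases "N = top")
  case True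
  have "0 < (q / p' + 1) * B * 2 * p / (p - 1) * 2 powr (p - 1)"
    using p p' B by (intro mult_pos_pos divide_pos_pos add_nonneg_pos) auto
  then have "ennreal ((q / p' + 1) * B * 2 * p / (p - 1) * 2 powr (p - 1)) \<noteq> 0"
    by (simp only: ennreal_eq_0_iff not_le not_False_eq_True)
  then show ?thesis by (simp only: True epowr_top ennreal_mult_top if_False top_greatest)
next
  case False
  define \<theta> where "\<theta> = q / p'"
  have \<theta>: "0 < \<theta>" using p p' by (simp add: \<theta>_def)
  define w where "w t = (if t \<le> 0 then top else W (1 / t))" for t :: real
  have w0: "w t \<noteq> 0" "w t \<noteq> top" if "0 < t" for t using W[of "1 / t"] that by (auto simp: w_def)
  have W_mono: "W x \<le> W y" if "x \<le> y" for x y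
    unfolding W_def using that by (intro nn_integral_mono mult_left_mono) (auto simp: indicator_def)
  have w_anti: "antimono w"
    unfolding w_def antimono_def by (auto intro!: W_mono divide_left_mono)
  then have [measurable]: "w \<in> borel_measurable borel" by (rule borel_measurable_ennreal_antimono)
  define \<Phi> where "\<Phi> = PhiF M (\<lambda>x. ennreal (\<phi> x * \<sigma> x))"
  have [measurable]: "\<Phi> \<in> borel_measurable borel" unfolding \<Phi>_def by measurable
  have unit: "(\<integral>\<^sup>+ y. h y * ennreal (\<sigma> y powr p') \<partial>M) \<le> w t" if h: "h \<in> unit_weights M (ennreal (1 / t))" and t: "0 < t" for h t
  proof -
    have "{s. 0 < s \<and> ennreal s < ennreal (1 / t)} = {0<..<1 / t}"
      using t by (auto simp: ennreal_less_iff)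
    with unit_weight_integral_le[OF sf h, of "\<lambda>x. ennreal (\<sigma> x)" p'] p' \<sigma> t
    show ?thesis by (simp add: epowr_ennreal w_def W_def)
  qed
  \<comment> \<open>This pointwise bound yields the finiteness of \<open>\<Phi>\<close>, and it
    later pays for the surplus power \<open>q - p\<close>.\<close>
  have holder: "\<Phi> t \<le> epowr N (1 / p) * epowr (w t) (1 / p')" if t: "0 < t" for t
  proof -
    have "(\<integral>\<^sup>+ x. ennreal (\<phi> x * \<sigma> x) * h x \<partial>M) \<le> epowr N (1 / p) * epowr (w t) (1 / p')"
      if h: "h \<in> unit_weights M (ennreal (1 / t))" for h
    proof -
      have [measurable]: "h \<in> borel_measurable M" and h1: "\<And>y. h y \<le> 1" using h by (auto simp: unit_weights_def)
      have "(\<integral>\<^sup>+ x. ennreal (\<phi> x * \<sigma> x) * h x \<partial>M) = (\<integral>\<^sup>+ x. ennreal (\<phi> x) * (ennreal (\<sigma> x) * h x) \<partial>M)"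
        using \<phi> \<sigma> by (simp add: ennreal_mult mult.assoc)
      also have "\<dots> \<le> epowr N (1 / p) * epowr (\<integral>\<^sup>+ x. epowr (ennreal (\<sigma> x) * h x) p' \<partial>M) (1 / p')"
        unfolding N_def by (rule Hoelder_nn_integral) (use p p' pp' in auto)
      also have "\<dots> \<le> epowr N (1 / p) * epowr (w t) (1 / p')"
      proof (intro mult_left_mono epowr_mono)
        have "epowr (h x) p' \<le> h x" for x
        proof -
          obtain r where r: "h x = ennreal r" "0 \<le> r" "r \<le> 1"
            using h1[of x] by (cases "h x") (auto simp: top_unique)
          have "r powr p' \<le> r powr 1" using r p' by (intro powr_mono') auto
          then show ?thesis using r by (simp add: epowr_ennreal ennreal_leI)
        qed
        then have "(\<integral>\<^sup>+ x. epowr (ennreal (\<sigma> x) * h x) p' \<partial>M) \<le> (\<integral>\<^sup>+ x. h x * ennreal (\<sigma> x powr p') \<partial>M)"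
          using \<sigma> by (intro nn_integral_mono) (simp add: epowr_mult epowr_ennreal mult.commute mult_right_mono)
        also have "\<dots> \<le> w t" by (rule unit[OF h t])
        finally show "(\<integral>\<^sup>+ x. epowr (ennreal (\<sigma> x) * h x) p' \<partial>M) \<le> w t" .
      qed (use p' in auto)
      finally show ?thesis .
    qed
    then show ?thesis using t unfolding \<Phi>_def PhiF_def Fsup_def by (auto intro: SUP_least)
  qed
  \<comment> \<open>Since \<open>\<phi> * \<sigma>\<close> equals \<open>v / 2\<close> times the
    power \<open>p'\<close> of \<open>\<sigma>\<close>, that product is small where
    \<open>v \<le> l\<close>. The factor 2 leaves half of \<open>l * w t\<close> to spare, so that
    \<open>\<Phi> t > l * w t\<close> forces \<open>w t < I l * (2 / l)\<close>.\<close>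
  define v where "v x = 2 * \<phi> x / \<sigma> x powr (p' - 1)" for x
  have [measurable]: "v \<in> borel_measurable M" unfolding v_def by measurable
  have v0: "0 \<le> v x" for x using \<phi> \<sigma> by (simp add: v_def)
  define I where "I l = (\<integral>\<^sup>+ x. ennreal (\<phi> x * \<sigma> x) * indicator {x \<in> space M. ennreal l < ennreal (v x)} x \<partial>M)" for l
  have level: "\<Phi> t \<le> I l + ennreal (l / 2) * w t" if t: "0 < t" and l: "0 < l" for t l
  proof -
    have "(\<integral>\<^sup>+ x. ennreal (\<phi> x * \<sigma> x) * h x \<partial>M) \<le> I l + ennreal (l / 2) * w t"
      if h: "h \<in> unit_weights M (ennreal (1 / t))" for h
    proof -
      have [measurable]: "h \<in> borel_measurable M" and h1: "\<And>y. h y \<le> 1" using h by (auto simp: unit_weights_def)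
      have pt: "ennreal (\<phi> x * \<sigma> x) * h x \<le> ennreal (\<phi> x * \<sigma> x) * indicator {x \<in> space M. ennreal l < ennreal (v x)} x
        + ennreal (l / 2) * (h x * ennreal (\<sigma> x powr p'))" if x: "x \<in> space M" for x
      proof (cases "l < v x")
        case True
        then have "ennreal l < ennreal (v x)" using l by (simp add: ennreal_less_iff)
        then show ?thesis using x h1[of x] mult_left_mono[OF h1[of x], of "ennreal (\<phi> x * \<sigma> x)"]
          by (simp add: add_increasing2)
      next
        case False
        have "\<phi> x * \<sigma> x \<le> l / 2 * \<sigma> x powr p'"
        proof (cases "\<sigma> x = 0")
          case False
          then have s: "0 < \<sigma> x" using \<sigma>[of x] by simp
          then have "2 * \<phi> x \<le> l * \<sigma> x powr (p' - 1)" using \<open>\<not> l < v x\<close> by (simp add: v_def not_less field_simps)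
          then have "\<phi> x * \<sigma> x \<le> (l / 2) * \<sigma> x powr (p' - 1) * \<sigma> x" using s by simp
          also have "\<dots> = l / 2 * \<sigma> x powr p'" using s by (simp add: powr_diff)
          finally show ?thesis .
        qed simp
        then have "ennreal (\<phi> x * \<sigma> x) * h x \<le> ennreal (l / 2 * \<sigma> x powr p') * h x"
          by (intro mult_right_mono ennreal_leI) auto
        also have "\<dots> = ennreal (l / 2) * (h x * ennreal (\<sigma> x powr p'))"
          using l by (subst ennreal_mult) (auto simp: mult_ac)
        finally show ?thesis by (simp add: add_increasing)
      qed
      have "(\<integral>\<^sup>+ x. ennreal (\<phi> x * \<sigma> x) * h x \<partial>M) \<le> (\<integral>\<^sup>+ x. ennreal (\<phi> x * \<sigma> x) * indicator {x \<in> space M. ennreal l < ennreal (v x)} x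
        + ennreal (l / 2) * (h x * ennreal (\<sigma> x powr p')) \<partial>M)"
        by (rule nn_integral_mono) (rule pt)
      also have "\<dots> = I l + ennreal (l / 2) * (\<integral>\<^sup>+ x. h x * ennreal (\<sigma> x powr p') \<partial>M)"
        unfolding I_def by (subst nn_integral_add) (auto simp: nn_integral_cmult)
      also have "\<dots> \<le> I l + ennreal (l / 2) * w t"
        by (intro add_left_mono mult_left_mono unit[OF h t]) auto
      finally show ?thesis .
    qed
    then show ?thesis using t unfolding \<Phi>_def PhiF_def Fsup_def by (auto intro: SUP_least)
  qed
  \<comment> \<open>As \<open>w\<close> is antitone, the set where it exceeds \<open>s\<close> is an
    initial segment. On the intervals that end inside it, the hypothesis on \<open>B\<close> can be
    used with \<open>s\<close> in the place of \<open>w t\<close>.\<close>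
  have tail: "(\<integral>\<^sup>+ t. D t * indicator {t. 0 < t \<and> ennreal s < w t} t \<partial>lborel) \<le> ennreal (B * s powr (- \<theta>))" if s: "0 < s" for s
  proof (rule nn_integral_initial_segment_le)
    fix t assume t: "t \<in> {t. 0 < t \<and> ennreal s < w t}"
    let ?J = "\<integral>\<^sup>+ r. D r * indicator {0<..<t} r \<partial>lborel"
    have "?J * epowr (ennreal s) \<theta> \<le> ?J * epowr (w t) \<theta>"
      using t \<theta> by (intro mult_left_mono epowr_mono) auto
    also have "\<dots> \<le> ennreal B" using B(2)[of t] t by (simp add: w_def \<theta>_def)
    finally have J: "?J * ennreal (s powr \<theta>) \<le> ennreal B" using s by (simp add: epowr_ennreal)
    have "?J = (?J * ennreal (s powr \<theta>)) * ennreal (s powr (- \<theta>))"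
      using s by (simp add: mult.assoc ennreal_mult[symmetric] powr_add[symmetric])
    also have "\<dots> \<le> ennreal B * ennreal (s powr (- \<theta>))" using J by (rule mult_right_mono) simp
    also have "\<dots> = ennreal (B * s powr (- \<theta>))" using B by (simp add: ennreal_mult)
    finally show "?J \<le> ennreal (B * s powr (- \<theta>))" .
  next
    fix r t assume "t \<in> {t. 0 < t \<and> ennreal s < w t}" "0 < r" "r \<le> t"
    then show "r \<in> {t. 0 < t \<and> ennreal s < w t}" using antimonoD[OF w_anti, of r t] by auto
  qed auto
  \<comment> \<open>The exponent \<open>\<theta> + 1\<close> is the one for which the factor s^theta
    of the layer cake cancels the decay s^(-theta) from \<open>tail\<close>; the mass of
    \<open>{w < R}\<close> then grows linearly in \<open>R\<close>, which is the weak type (1,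
    1).\<close>
  define h where "h t = epowr (w t) (\<theta> + 1) * D t * indicator {0<..} t" for t
  have [measurable]: "h \<in> borel_measurable borel" unfolding h_def by measurable
  have weak: "(\<integral>\<^sup>+ t. h t * indicator {t. w t < R} t \<partial>lborel) \<le> ennreal ((\<theta> + 1) * B) * R" for R
  proof -
    have "(\<integral>\<^sup>+ t. h t * indicator {t. w t < R} t \<partial>lborel) =
       (\<integral>\<^sup>+ t. (D t * indicator {t. 0 < t \<and> w t < R} t) * epowr (w t) (\<theta> + 1) \<partial>lborel)"
      by (intro nn_integral_cong) (auto simp: h_def indicator_def mult_ac)
    also have "\<dots> = (\<integral>\<^sup>+ s. ennreal ((\<theta> + 1) * s powr (\<theta> + 1 - 1)) * indicator {0<..} s *
        (\<integral>\<^sup>+ t. (D t * indicator {t. 0 < t \<and> w t < R} t) * indicator {t \<in> space lborel. ennreal s < w t} t \<partial>lborel) \<partial>lborel)"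
      by (rule nn_integral_layer) (use \<theta> sigma_finite_lborel in auto)
    also have "\<dots> \<le> (\<integral>\<^sup>+ s. ennreal ((\<theta> + 1) * B) * indicator {s. 0 < s \<and> ennreal s < R} s \<partial>lborel)"
    proof (rule nn_integral_mono)
      fix s :: real
      let ?K = "\<integral>\<^sup>+ t. (D t * indicator {t. 0 < t \<and> w t < R} t) * indicator {t \<in> space lborel. ennreal s < w t} t \<partial>lborel"
      show "ennreal ((\<theta> + 1) * s powr (\<theta> + 1 - 1)) * indicator {0<..} s * ?K \<le> ennreal ((\<theta> + 1) * B) * indicator {s. 0 < s \<and> ennreal s < R} s"
      proof (cases "0 < s \<and> ennreal s < R")
        case True
        have "?K \<le> (\<integral>\<^sup>+ t. D t * indicator {t. 0 < t \<and> ennreal s < w t} t \<partial>lborel)"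
          by (intro nn_integral_mono) (auto simp: indicator_def)
        also have "\<dots> \<le> ennreal (B * s powr (- \<theta>))" using tail True by simp
        finally have "ennreal ((\<theta> + 1) * s powr \<theta>) * ?K \<le> ennreal ((\<theta> + 1) * s powr \<theta>) * ennreal (B * s powr (- \<theta>))"
          by (rule mult_left_mono) simp
        also have "\<dots> = ennreal ((\<theta> + 1) * B)"
          using True \<theta> B by (simp add: ennreal_mult[symmetric] powr_minus)
        finally show ?thesis using True by simp
      next
        case False
        then have "0 < s \<Longrightarrow> ?K = 0"
          by (intro nn_integral_0_iff_AE[THEN iffD2] AE_I2) (auto simp: indicator_def)
        then show ?thesis using False by (auto simp: indicator_def)
      qed
    qed
    also have "\<dots> = ennreal ((\<theta> + 1) * B) * R"
      by (simp add: nn_integral_cmult emeasure_ennreal_interval)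
    finally show ?thesis .
  qed
  \<comment> \<open>The left-hand side is the total power of \<open>w\<close> that remains when
    Phi^(q - p) is estimated by \<open>holder\<close> and Phi^p is written as w^p (Phi / w)^p. The
    identity rests on \<open>p / p' = p - 1\<close>.\<close>
  have exps: "(q - p) / p' + p = \<theta> + 1"
    using pp' p p' by (simp add: \<theta>_def field_simps)
  have "epowr (\<Phi> t) q * D t * indicator {0<..} t \<le> epowr N ((q - p) / p) * (h t * epowr (\<Phi> t / w t) p)" for t
  proof (cases "0 < t")
    case t: True
    obtain c where c: "w t = ennreal c" "0 < c" using w0[OF t] by (cases "w t") (auto simp: less_le)
    have "\<Phi> t \<noteq> top" using holder[OF t] False w0[OF t] by (auto simp: top_unique ennreal_mult_eq_top_iff)
    then obtain b where b: "\<Phi> t = ennreal b" "0 \<le> b" by (cases "\<Phi> t") auto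
    have "epowr (\<Phi> t) q = epowr (\<Phi> t) (q - p) * epowr (\<Phi> t) p"
      using b by (cases "b = 0") (auto simp: epowr_ennreal ennreal_mult[symmetric] powr_add[symmetric])
    also have "\<dots> \<le> epowr (epowr N (1 / p) * epowr (w t) (1 / p')) (q - p) * epowr (\<Phi> t) p"
      using p by (intro mult_right_mono epowr_mono holder t) auto
    also have "epowr (epowr N (1 / p) * epowr (w t) (1 / p')) (q - p) = epowr N ((q - p) / p) * epowr (w t) ((q - p) / p')"
      by (simp add: epowr_mult epowr_epowr)
    also have "epowr N ((q - p) / p) * epowr (w t) ((q - p) / p') * epowr (\<Phi> t) p = epowr N ((q - p) / p) * (epowr (w t) (\<theta> + 1) * epowr (\<Phi> t / w t) p)"
    proof -
      have "epowr (w t) ((q - p) / p') * epowr (\<Phi> t) p = ennreal (c powr ((q - p) / p') * b powr p)"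
        using b c by (simp add: epowr_ennreal ennreal_mult)
      also have "c powr ((q - p) / p') * b powr p = c powr ((q - p) / p' + p) * (b / c) powr p"
        using b c by (simp add: powr_divide powr_add)
      also have "ennreal \<dots> = epowr (w t) (\<theta> + 1) * epowr (\<Phi> t / w t) p"
        using b c by (simp add: exps epowr_ennreal ennreal_mult divide_ennreal)
      finally show ?thesis by (simp add: mult.assoc)
    qed
    finally have "epowr (\<Phi> t) q * D t \<le> epowr N ((q - p) / p) * (epowr (w t) (\<theta> + 1) * epowr (\<Phi> t / w t) p) * D t"
      by (rule mult_right_mono) simp
    then show ?thesis using t by (simp add: h_def mult_ac)
  qed simp
  then have "(\<integral>\<^sup>+ t. epowr (\<Phi> t) q * D t * indicator {0<..} t \<partial>lborel) \<le>
      (\<integral>\<^sup>+ t. epowr N ((q - p) / p) * (h t * epowr (\<Phi> t / w t) p) \<partial>lborel)"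
    by (intro nn_integral_mono)
  also have "\<dots> = epowr N ((q - p) / p) * (\<integral>\<^sup>+ t. h t * epowr (\<Phi> t / w t) p \<partial>lborel)"
    by (rule nn_integral_cmult) measurable
  also have "(\<integral>\<^sup>+ t. h t * epowr (\<Phi> t / w t) p \<partial>lborel) = (\<integral>\<^sup>+ l. ennreal (p * l powr (p - 1)) * indicator {0<..} l *
      (\<integral>\<^sup>+ t. h t * indicator {t \<in> space lborel. ennreal l < \<Phi> t / w t} t \<partial>lborel) \<partial>lborel)"
    by (rule nn_integral_layer) (use p sigma_finite_lborel in auto)
  \<comment> \<open>By \<open>level\<close> and \<open>weak\<close> the level set of
    \<open>\<Phi> / w\<close> costs a multiple of \<open>I l / l\<close>, which lowers the power of
    \<open>l\<close> by one. What remains is a layer cake on \<open>M\<close> with the exponent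
    \<open>p - 1\<close>, which is undone next.\<close>
  also have "\<dots> \<le> (\<integral>\<^sup>+ l. ennreal ((\<theta> + 1) * B * 2 * p / (p - 1)) * (ennreal ((p - 1) * l powr (p - 1 - 1)) * indicator {0<..} l * I l) \<partial>lborel)"
  proof (rule nn_integral_mono)
    fix l :: real
    let ?K = "\<integral>\<^sup>+ t. h t * indicator {t \<in> space lborel. ennreal l < \<Phi> t / w t} t \<partial>lborel"
    show "ennreal (p * l powr (p - 1)) * indicator {0<..} l * ?K \<le> ennreal ((\<theta> + 1) * B * 2 * p / (p - 1)) * (ennreal ((p - 1) * l powr (p - 1 - 1)) * indicator {0<..} l * I l)"
    proof (cases "0 < l")
      case l: True
      have "w t < I l * ennreal (2 / l)" if t: "0 < t" and lt: "ennreal l < \<Phi> t / w t" for t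
      proof -
        obtain c where c: "w t = ennreal c" "0 < c" using w0[OF t] by (cases "w t") (auto simp: less_le)
        have "\<Phi> t \<noteq> top" using holder[OF t] False w0[OF t] by (auto simp: top_unique ennreal_mult_eq_top_iff)
        then obtain b where b: "\<Phi> t = ennreal b" "0 \<le> b" by (cases "\<Phi> t") auto
        have lb: "l * c < b" using lt b c l by (simp add: divide_ennreal ennreal_less_iff pos_less_divide_eq)
        show ?thesis
        proof (cases "I l")
          case (real i)
          have "b \<le> i + l / 2 * c" using level[OF t l] b c real l by (simp add: ennreal_mult[symmetric] ennreal_plus[symmetric] del: ennreal_plus)
          then have "c < i * (2 / l)" using lb l by (simp add: field_simps)
          then show ?thesis using c real l by (simp add: ennreal_mult[symmetric] ennreal_less_iff)
        next
          case top
          then show ?thesis using c l by (simp add: ennreal_top_mult)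
        qed
      qed
      then have "?K \<le> (\<integral>\<^sup>+ t. h t * indicator {t. w t < I l * ennreal (2 / l)} t \<partial>lborel)"
        by (intro nn_integral_mono) (auto simp: indicator_def h_def)
      also have "\<dots> \<le> ennreal ((\<theta> + 1) * B) * (I l * ennreal (2 / l))" by (rule weak)
      finally have "ennreal (p * l powr (p - 1)) * ?K \<le> ennreal (p * l powr (p - 1)) * (ennreal ((\<theta> + 1) * B) * (I l * ennreal (2 / l)))"
        by (rule mult_left_mono) simp
      also have "\<dots> = ennreal ((p * l powr (p - 1)) * ((\<theta> + 1) * B) * (2 / l)) * I l"
        by (rule ennreal_mult3) (use p \<theta> B l in auto)
      also have "(p * l powr (p - 1)) * ((\<theta> + 1) * B) * (2 / l) = ((\<theta> + 1) * B * 2 * p / (p - 1)) * ((p - 1) * l powr (p - 1 - 1))"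
      proof -
        have "l powr (p - 1) = l powr (p - 1 - 1) * l" using l powr_add[of l "p - 1 - 1" 1] by simp
        then show ?thesis using p l by (simp only:) simp
      qed
      also have "ennreal \<dots> * I l = ennreal ((\<theta> + 1) * B * 2 * p / (p - 1)) * (ennreal ((p - 1) * l powr (p - 1 - 1)) * I l)"
        using p \<theta> B l by (subst ennreal_mult) (auto simp: mult.assoc)
      finally show ?thesis using l by simp
    qed simp
  qed
  also have "\<dots> = ennreal ((\<theta> + 1) * B * 2 * p / (p - 1)) *
      (\<integral>\<^sup>+ l. ennreal ((p - 1) * l powr (p - 1 - 1)) * indicator {0<..} l * I l \<partial>lborel)"
  proof (rule nn_integral_cmult)
    have "antimono (\<lambda>l. if l \<le> 0 then top else I l)"
      unfolding I_def antimono_def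
      by (auto intro!: nn_integral_mono simp: indicator_def ennreal_less_iff)
    then have [measurable]: "(\<lambda>l. if l \<le> 0 then top else I l) \<in> borel_measurable borel" by (rule borel_measurable_ennreal_antimono)
    have "(\<lambda>l. ennreal ((p - 1) * l powr (p - 1 - 1)) * indicator {0<..} l * (if l \<le> 0 then top else I l)) \<in> borel_measurable lborel"
      by measurable
    moreover have "(\<lambda>l. ennreal ((p - 1) * l powr (p - 1 - 1)) * indicator {0<..} l * (if l \<le> 0 then top else I l)) =
       (\<lambda>l. ennreal ((p - 1) * l powr (p - 1 - 1)) * indicator {0<..} l * I l)"
      by (auto simp: indicator_def)
    ultimately show "(\<lambda>l. ennreal ((p - 1) * l powr (p - 1 - 1)) * indicator {0<..} l * I l) \<in> borel_measurable lborel"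
      by (simp only:)
  qed
  also have "(\<integral>\<^sup>+ l. ennreal ((p - 1) * l powr (p - 1 - 1)) * indicator {0<..} l * I l \<partial>lborel)
     = (\<integral>\<^sup>+ x. ennreal (\<phi> x * \<sigma> x) * epowr (ennreal (v x)) (p - 1) \<partial>M)"
    unfolding I_def by (rule nn_integral_layer[OF sf, symmetric]) (use p in auto)
  also have "\<dots> \<le> (\<integral>\<^sup>+ x. ennreal (2 powr (p - 1)) * epowr (ennreal (\<phi> x)) p \<partial>M)"
  proof (rule nn_integral_mono)
    fix x
    show "ennreal (\<phi> x * \<sigma> x) * epowr (ennreal (v x)) (p - 1) \<le> ennreal (2 powr (p - 1)) * epowr (ennreal (\<phi> x)) p"
    proof (cases "\<sigma> x = 0 \<or> \<phi> x = 0")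
      case False
      then have s: "0 < \<sigma> x" "0 < \<phi> x" using \<sigma>[of x] \<phi>[of x] by auto
      have "(p' - 1) * (p - 1) = 1" using pp' p p' by (simp add: field_simps)
      then have "v x powr (p - 1) = 2 powr (p - 1) * \<phi> x powr (p - 1) / \<sigma> x"
        using s by (simp add: v_def powr_divide powr_mult powr_powr)
      then have "\<phi> x * \<sigma> x * v x powr (p - 1) = 2 powr (p - 1) * \<phi> x powr p"
        using s by (simp add: powr_diff)
      then show ?thesis using s v0[of x] by (simp add: epowr_ennreal ennreal_mult[symmetric])
    qed auto
  qed
  also have "\<dots> = ennreal (2 powr (p - 1)) * N"
    unfolding N_def by (rule nn_integral_cmult) measurable
  finally have "(\<integral>\<^sup>+ t. epowr (\<Phi> t) q * D t * indicator {0<..} t \<partial>lborel) \<le>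
    epowr N ((q - p) / p) * (ennreal ((\<theta> + 1) * B * 2 * p / (p - 1)) * (ennreal (2 powr (p - 1)) * N))"
    by (simp add: mult_left_mono)
  also have "\<dots> = ennreal ((\<theta> + 1) * B * 2 * p / (p - 1)) * ennreal (2 powr (p - 1)) * (epowr N ((q - p) / p) * N)"
    by (simp add: mult_ac)
  also have "epowr N ((q - p) / p) * N = epowr N (q / p)"
  proof (cases "N = 0")
    case False
    have "q / p = (q - p) / p + 1" using p by (simp add: field_simps)
    then show ?thesis using epowr_add[of N "(q - p) / p" 1] False \<open>N \<noteq> top\<close> by simp
  qed simp
  also have "ennreal ((\<theta> + 1) * B * 2 * p / (p - 1)) * ennreal (2 powr (p - 1)) = ennreal ((q / p' + 1) * B * 2 * p / (p - 1) * 2 powr (p - 1))"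
    using p \<theta> B by (simp add: ennreal_mult[symmetric] \<theta>_def)
  finally show ?thesis unfolding \<Phi>_def .
qed

section \<open>Operators of type \<open>(1, \<infinity>)\<close> and \<open>(2, 2)\<close>\<close>

lemma ennreal_inverse_antimono:
  fixes x y :: ennreal
  assumes "x \<le> y"
  shows "inverse y \<le> inverse x"
proof (cases "x = 0 \<or> y = top")
  case False
  then obtain a b where "x = ennreal a" "0 < a" "y = ennreal b" "0 \<le> b"
    using assms by (cases x; cases y) (auto simp: less_le top_unique)
  then show ?thesis using assms
    by (auto simp: inverse_ennreal intro!: ennreal_leI le_imp_inverse_le)
qed auto

text \<open>The level set need not contain a subset of measure exactly \<open>y\<close>. Its
  indicator scaled by \<open>y / ?d\<close> is a unit weight of mass \<open>y\<close>, and
  \<open>g\<close> exceeds \<open>s\<close> on its support.\<close>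

lemma level_le_Fsup:
  fixes g :: "'a \<Rightarrow> real"
  assumes [measurable]: "g \<in> borel_measurable X" and s: "0 \<le> s"
    and y: "y \<le> emeasure X {x \<in> space X. s < g x}" and fin: "emeasure X {x \<in> space X. s < g x} \<noteq> top"
  shows "ennreal s * y \<le> Fsup X (\<lambda>x. ennreal (g x)) y"
proof (cases "y = 0")
  case False
  let ?A = "{x \<in> space X. s < g x}"
  let ?d = "emeasure X ?A"
  have d0: "?d \<noteq> 0" using y False by auto
  let ?h = "\<lambda>x. (y / ?d) * indicator ?A x"
  have 1: "y / ?d \<le> 1" using y d0 fin by (simp add: divide_le_posI_ennreal zero_less_iff_neq_zero)
  have 2: "y / ?d * ?d = y" using d0 fin by (simp add: ennreal_divide_times divide_mult_eq less_top)
  have "(\<integral>\<^sup>+ x. ?h x \<partial>X) = y" using 2 by (subst nn_integral_cmult_indicator) auto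
  moreover have "?h a \<le> 1" for a using 1 by (auto simp: indicator_def)
  ultimately have "?h \<in> unit_weights X y" by (auto simp: unit_weights_def)
  from le_Fsup[OF this, of "\<lambda>x. ennreal (g x)"]
  have "(\<integral>\<^sup>+ x. ennreal (g x) * ?h x \<partial>X) \<le> Fsup X (\<lambda>x. ennreal (g x)) y" .
  moreover have "(\<integral>\<^sup>+ x. ennreal s * ?h x \<partial>X) \<le> (\<integral>\<^sup>+ x. ennreal (g x) * ?h x \<partial>X)"
    using s by (intro nn_integral_mono) (auto simp: indicator_def intro!: mult_right_mono ennreal_leI)
  moreover have "(\<integral>\<^sup>+ x. ennreal s * ?h x \<partial>X) = ennreal s * y"
  proof -
    have "(\<integral>\<^sup>+ x. ennreal s * ?h x \<partial>X) = ennreal s * (\<integral>\<^sup>+ x. ?h x \<partial>X)" by (rule nn_integral_cmult) measurable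
    also have "(\<integral>\<^sup>+ x. ?h x \<partial>X) = y" using 2 by (subst nn_integral_cmult_indicator) auto
    finally show ?thesis .
  qed
  ultimately show ?thesis by simp
qed simp

text \<open>The substitution r = 1/t turns the integral into the length of the interval from
  \<open>x\<close> to \<open>d\<close>. In the application \<open>z\<close> is the measure of a set;
  the value \<open>top\<close> is allowed and corresponds to \<open>x = 0\<close>.\<close>

lemma nn_integral_inverse_square:
  assumes x: "0 \<le> x" "x < d" and z: "inverse z = ennreal x"
  shows "(\<integral>\<^sup>+ t. ennreal (1 / t\<^sup>2) * indicator {t. 1 / d \<le> t \<and> ennreal t < z} t \<partial>lborel) = ennreal (d - x)"
proof (cases z)
  case (real z0)
  have z0: "0 < z0"
  proof (rule ccontr)
    assume "\<not> 0 < z0"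
    then show False using real z by simp
  qed
  have xz: "x = 1 / z0" using z real z0 x by (simp add: inverse_ennreal divide_inverse)
  have d0: "0 < d" using x by simp
  have "1 / z0 < d" using x xz by simp
  then have d: "0 < d" "1 / d \<le> z0" using d0 z0 by (simp_all add: field_simps)
  have d1: "0 < 1 / d" using d0 by simp
  have "(1 / d \<le> t \<and> ennreal t < z) \<longleftrightarrow> (1 / d \<le> t \<and> t \<le> z0)" if "t \<noteq> z0" for t
  proof (cases "1 / d \<le> t")
    case True
    then have "0 \<le> t" using d1 by linarith
    then show ?thesis using that by (auto simp: real ennreal_less_iff)
  qed simp
  then have eq: "indicator {t. 1 / d \<le> t \<and> ennreal t < z} t = (indicator {1 / d .. z0} t :: ennreal)" if "t \<noteq> z0" for t
    using that by (simp add: indicator_def)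
  have "(\<integral>\<^sup>+ t. ennreal (1 / t\<^sup>2) * indicator {t. 1 / d \<le> t \<and> ennreal t < z} t \<partial>lborel)
     = (\<integral>\<^sup>+ t. ennreal (1 / t\<^sup>2) * indicator {1 / d .. z0} t \<partial>lborel)"
    using eq by (intro nn_integral_cong_AE eventually_mono[OF AE_lborel_singleton[of z0]]) simp
  also have "\<dots> = ennreal (- (1 / z0) - (- (1 / (1 / d))))"
  proof (rule nn_integral_FTC_Icc)
    fix t assume "t \<in> {1 / d..z0}"
    then have "1 / d \<le> t" "t \<le> z0" by auto
    then have "0 < t" using d1 by linarith
    then show "((\<lambda>t. - (1 / t)) has_real_derivative 1 / t\<^sup>2) (at t)"
      by (auto intro!: derivative_eq_intros simp: power2_eq_square)
    show "0 \<le> 1 / t\<^sup>2" by simp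
  qed (use d in auto)
  finally show ?thesis using xz by simp
next
  case top
  then have x0: "x = 0" using z x by (simp add: ennreal_eq_0_iff)
  have d: "0 < d" using x by simp
  then have d1: "0 < 1 / d" by simp
  have "(\<integral>\<^sup>+ t. ennreal (1 / t\<^sup>2) * indicator {t. 1 / d \<le> t \<and> ennreal t < z} t \<partial>lborel)
     = (\<integral>\<^sup>+ t. ennreal (1 / t\<^sup>2) * indicator {1 / d ..} t \<partial>lborel)"
    by (intro nn_integral_cong) (auto simp: indicator_def top)
  also have "\<dots> = ennreal (0 - (- (1 / (1 / d))))"
  proof (rule nn_integral_FTC_atLeast)
    fix t assume "1 / d \<le> t"
    then have "0 < t" using d1 by linarith
    then show "((\<lambda>t. - (1 / t)) has_real_derivative 1 / t\<^sup>2) (at t)"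
      by (auto intro!: derivative_eq_intros simp: power2_eq_square)
  next
    show "((\<lambda>t::real. - (1 / t)) \<longlongrightarrow> 0) at_top" by real_asymp
  qed auto
  finally show ?thesis using x0 by simp
qed

text \<open>\<open>c\<close> is the infimum of the levels whose superlevel sets have measure at most
  \<open>y\<close>. Boundedness of \<open>f\<close> provides such a level, and right-continuity of
  the distribution function makes \<open>c\<close> one of them.\<close>

lemma generalized_inverse_distribution:
  fixes f :: "'a \<Rightarrow> real"
  assumes [measurable]: "f \<in> borel_measurable X" and b: "\<And>x. f x \<le> b"
  obtains c where "0 \<le> c" "emeasure X {x \<in> space X. c < f x} \<le> y"
    "\<And>r. 0 \<le> r \<Longrightarrow> r < c \<Longrightarrow> y < emeasure X {x \<in> space X. r < f x}"
proof
  let ?d = "\<lambda>r. emeasure X {x \<in> space X. r < f x}"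
  let ?S = "{r. 0 \<le> r \<and> ?d r \<le> y}"
  have "{x \<in> space X. max 0 b < f x} = {}" using b by (auto simp: not_less le_max_iff_disj)
  then have "?d (max 0 b) = 0" by (simp only: emeasure_empty)
  then have ne: "max 0 b \<in> ?S" by simp
  have bdd: "bdd_below ?S" by (auto simp: bdd_below_def)
  define c where "c = Inf ?S"
  have "?S \<noteq> {}" using ne by blast
  then show "0 \<le> c" unfolding c_def by (rule cInf_greatest) blast
  show "y < ?d r" if "0 \<le> r" "r < c" for r
    using that cInf_lower[OF _ bdd, of r] unfolding c_def by (force simp: not_le[symmetric])
  have "?d c = emeasure X (\<Union>n. {x \<in> space X. c + inverse (real (Suc n)) < f x})"
  proof (rule arg_cong[where f = "emeasure X"], safe)
    fix x assume x: "x \<in> space X" "c < f x"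
    then obtain n where "inverse (real (Suc n)) < f x - c" using reals_Archimedean[of "f x - c"] by auto
    then show "x \<in> (\<Union>n. {x \<in> space X. c + inverse (real (Suc n)) < f x})" using x by (auto intro!: exI[of _ n])
  next
    fix x n assume "c + inverse (real (Suc n)) < f x"
    moreover have "0 < inverse (real (Suc n))" by simp
    ultimately show "c < f x" by linarith
  qed
  also have "\<dots> = (SUP n. ?d (c + inverse (real (Suc n))))"
    by (rule SUP_emeasure_incseq[symmetric])
       (auto simp: incseq_def intro: order.strict_trans1[rotated] le_imp_inverse_le)
  also have "\<dots> \<le> y"
  proof (rule SUP_least)
    fix n
    have "Inf ?S < c + inverse (real (Suc n))" by (simp add: c_def)
    then obtain r where r: "r \<in> ?S" "r < c + inverse (real (Suc n))"
      using cInf_less_iff[OF _ bdd, of "c + inverse (real (Suc n))"] ne by blast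
    have "?d (c + inverse (real (Suc n))) \<le> ?d r"
      using r by (intro emeasure_mono) auto
    then show "?d (c + inverse (real (Suc n))) \<le> y" using r by auto
  qed
  finally show "?d c \<le> y" .
qed

text \<open>The kernel is paired without conjugation, so that its transpose is again of this kind,
  as \<open>dual\<close> shows. Integrability of \<open>f\<close> makes the operator defined
  pointwise; \<open>L2\<close> compares integrals in [0, infinity] and bounds the left-hand side
  when \<open>f\<close> is also square-integrable.\<close>

locale kernel_op = X: sigma_finite_measure X + Y: sigma_finite_measure Y
  for X :: "'a measure" and Y :: "'b measure" +
  fixes k :: "'a \<Rightarrow> 'b \<Rightarrow> complex" and K :: real
  assumes k_meas: "(\<lambda>(x, y). k x y) \<in> borel_measurable (X \<Otimes>\<^sub>M Y)"
    and k_le: "cmod (k x y) \<le> 1"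
    and K_pos: "0 < K"
    and L2: "integrable X f \<Longrightarrow>
      (\<integral>\<^sup>+ y. (ennreal (cmod (LINT x|X. k x y * f x)))\<^sup>2 \<partial>Y) \<le> ennreal K * (\<integral>\<^sup>+ x. (ennreal (cmod (f x)))\<^sup>2 \<partial>X)"
begin

definition T :: "('a \<Rightarrow> complex) \<Rightarrow> 'b \<Rightarrow> complex" where
  "T f y = (LINT x|X. k x y * f x)"

lemma k_meas_pair [measurable (raw)]:
  assumes "f \<in> measurable M X" "g \<in> measurable M Y"
  shows "(\<lambda>x. k (f x) (g x)) \<in> borel_measurable M"
  using measurable_compose[OF measurable_Pair[OF assms] k_meas] by simp

lemma T_measurable [measurable]:
  assumes [measurable]: "f \<in> borel_measurable X"
  shows "T f \<in> borel_measurable Y"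
  unfolding T_def by (rule X.borel_measurable_lebesgue_integral) measurable

lemma T_integrable:
  assumes f: "integrable X f" and y: "y \<in> space Y"
  shows "integrable X (\<lambda>x. k x y * f x)"
proof (rule Bochner_Integration.integrable_bound[OF f])
  have [measurable]: "f \<in> borel_measurable X" using f by simp
  show "(\<lambda>x. k x y * f x) \<in> borel_measurable X" using y by measurable
  show "AE x in X. norm (k x y * f x) \<le> norm (f x)"
    using k_le by (intro AE_I2) (auto simp: norm_mult mult_left_le_one_le)
qed

lemma T_bound:
  assumes f: "integrable X f" and y: "y \<in> space Y"
  shows "ennreal (cmod (T f y)) \<le> (\<integral>\<^sup>+ x. ennreal (cmod (f x)) \<partial>X)"
proof -
  have "ennreal (cmod (T f y)) \<le> (\<integral>\<^sup>+ x. ennreal (cmod (k x y * f x)) \<partial>X)"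
    unfolding T_def using integral_norm_bound_ennreal[OF T_integrable[OF f y]] by simp
  also have "\<dots> \<le> (\<integral>\<^sup>+ x. ennreal (cmod (f x)) \<partial>X)"
    using k_le by (intro nn_integral_mono ennreal_leI) (auto simp: norm_mult mult_left_le_one_le)
  finally show ?thesis .
qed

lemma T_add:
  assumes "integrable X f" "integrable X g" and y: "y \<in> space Y"
  shows "T (\<lambda>x. f x + g x) y = T f y + T g y"
  unfolding T_def using T_integrable[OF assms(1) y] T_integrable[OF assms(2) y] by (simp add: distrib_left)

text \<open>\<open>f\<close> is split at the height where its distribution function crosses \<open>1 / \<bar>E\<bar>\<close>: the part above is
  estimated by the bound of type \<open>(1, \<infinity>)\<close>, the part below by that of type \<open>(2, 2)\<close>.\<close>

lemma Jurkat_Sampson_2: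
  assumes f: "integrable X f" and b: "\<And>x. cmod (f x) \<le> b" and E [measurable]: "E \<in> sets Y"
  shows "(\<integral>\<^sup>+ y. (ennreal (cmod (T f y)))\<^sup>2 * indicator E y \<partial>Y) \<le> ennreal (2 + 4 * K) *
    (\<integral>\<^sup>+ t. (PhiF X (\<lambda>x. ennreal (cmod (f x))) t)\<^sup>2 * indicator {t. 0 < t \<and> ennreal t < emeasure Y E} t \<partial>lborel)"
proof (cases "emeasure Y E = 0")
  case True
  then have "AE y in Y. y \<notin> E" using E by (intro AE_not_in) (auto simp: null_sets_def)
  then have "(\<integral>\<^sup>+ y. (ennreal (cmod (T f y)))\<^sup>2 * indicator E y \<partial>Y) = (\<integral>\<^sup>+ y. 0 \<partial>Y)"
    by (intro nn_integral_cong_AE) (auto simp: indicator_def elim!: eventually_mono)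
  then show ?thesis by simp
next
  case False
  have [measurable]: "f \<in> borel_measurable X" using f by simp
  define z where "z = emeasure Y E"
  \<comment> \<open>The reciprocal of the measure of \<open>E\<close>, which is 0 if
    \<open>E\<close> has infinite measure.\<close>
  define x where "x = enn2real (inverse z)"
  have "inverse z \<noteq> top" using False by (simp add: z_def ennreal_inverse_eq_top_iff)
  then have x: "inverse z = ennreal x" "0 \<le> x"
    by (cases "inverse z"; simp add: x_def)+
  have zx: "z * ennreal x = 1" if "x \<noteq> 0"
  proof -
    have "z \<noteq> top" using that x by auto
    moreover have "z \<noteq> 0" using False by (simp add: z_def)
    ultimately show ?thesis using ennreal_divide_self[of z] x(1) by (simp add: divide_ennreal_def top.not_eq_extremum zero_less_iff_neq_zero)
  qed
  define F where "F = Fsup X (\<lambda>x. ennreal (cmod (f x)))"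
  define \<Phi> where "\<Phi> = PhiF X (\<lambda>x. ennreal (cmod (f x)))"
  have \<Phi>: "\<Phi> t = F (ennreal (1 / t))" if "0 < t" for t using that by (simp add: \<Phi>_def PhiF_def F_def)
  have [measurable]: "\<Phi> \<in> borel_measurable borel" by (simp add: \<Phi>_def)
  define J where "J = (\<integral>\<^sup>+ t. (\<Phi> t)\<^sup>2 * indicator {t. 0 < t \<and> ennreal t < z} t \<partial>lborel)"
  let ?d = "\<lambda>r. emeasure X {a \<in> space X. r < cmod (f a)}"
  obtain c where c: "0 \<le> c" "?d c \<le> ennreal x" "\<And>r. 0 \<le> r \<Longrightarrow> r < c \<Longrightarrow> ennreal x < ?d r"
    using generalized_inverse_distribution[of "\<lambda>x. cmod (f x)" X b "ennreal x"] b by auto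
  have dfin: "?d r \<noteq> top" if "0 < r" for r
  proof -
    have "ennreal r * ?d r = (\<integral>\<^sup>+ a. ennreal r * indicator {a \<in> space X. r < cmod (f a)} a \<partial>X)"
      by (rule nn_integral_cmult_indicator[symmetric]) measurable
    also have "\<dots> \<le> (\<integral>\<^sup>+ a. ennreal (cmod (f a)) \<partial>X)"
      by (intro nn_integral_mono) (auto simp: indicator_def intro!: ennreal_leI)
    also have "\<dots> < top" using f by (simp add: integrable_iff_bounded less_top)
    finally show ?thesis using that by (auto simp: ennreal_mult_top)
  qed
  define A where "A = {a \<in> space X. c < cmod (f a)}"
  have [measurable]: "A \<in> sets X" by (simp add: A_def)
  define f1 f2 where "f1 = (\<lambda>a. indicator A a *\<^sub>R f a)" and "f2 = (\<lambda>a. indicator (space X - A) a *\<^sub>R f a)"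
  have f12: "integrable X f1" "integrable X f2"
    unfolding f1_def f2_def by (auto intro!: integrable_mult_indicator f)
  have Tf: "T f y = T f1 y + T f2 y" if y: "y \<in> space Y" for y
  proof -
    have "T f y = T (\<lambda>a. f1 a + f2 a) y"
      unfolding T_def by (intro Bochner_Integration.integral_cong) (auto simp: f1_def f2_def indicator_def)
    then show ?thesis using T_add[OF f12 y] by simp
  qed
  have F1: "ennreal (cmod (T f1 y)) \<le> F (ennreal x)" if y: "y \<in> space Y" for y
  proof -
    have "(indicator A :: _ \<Rightarrow> ennreal) \<in> unit_weights X (ennreal x)"
      using c by (auto simp: unit_weights_def indicator_def A_def[symmetric])
    from le_Fsup[OF this, of "\<lambda>a. ennreal (cmod (f a))"]
    have "(\<integral>\<^sup>+ a. ennreal (cmod (f a)) * indicator A a \<partial>X) \<le> F (ennreal x)" by (simp add: F_def)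
    moreover have "(\<integral>\<^sup>+ a. ennreal (cmod (f a)) * indicator A a \<partial>X) = (\<integral>\<^sup>+ a. ennreal (cmod (f1 a)) \<partial>X)"
      by (intro nn_integral_cong) (auto simp: f1_def indicator_def)
    ultimately show ?thesis using T_bound[OF f12(1) y] by simp
  qed
  \<comment> \<open>\<open>F\<close> is monotone and \<open>1 / t\<close> is at least
    \<open>x\<close> for \<open>t < z\<close>, so the integrand of \<open>J\<close> is at least the
    square of \<open>F x\<close> on an interval of length \<open>z\<close>.\<close>
  have zF: "z * (F (ennreal x))\<^sup>2 \<le> J"
  proof -
    have "z * (F (ennreal x))\<^sup>2 = (\<integral>\<^sup>+ t. (F (ennreal x))\<^sup>2 * indicator {t. 0 < t \<and> ennreal t < z} t \<partial>lborel)"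
      by (simp add: nn_integral_cmult emeasure_ennreal_interval mult.commute)
    also have "\<dots> \<le> J"
      unfolding J_def
    proof (intro nn_integral_mono)
      fix t :: real
      show "(F (ennreal x))\<^sup>2 * indicator {t. 0 < t \<and> ennreal t < z} t \<le> (\<Phi> t)\<^sup>2 * indicator {t. 0 < t \<and> ennreal t < z} t"
      proof (cases "0 < t \<and> ennreal t < z")
        case True
        then have "inverse z \<le> inverse (ennreal t)" by (simp add: ennreal_inverse_antimono less_imp_le)
        then have "ennreal x \<le> ennreal (1 / t)" using True x by (simp add: inverse_ennreal divide_inverse)
        then show ?thesis using True unfolding \<Phi>[OF conjunct1[OF True]] F_def
          by (intro mult_right_mono power_mono Fsup_mono) auto
      qed simp
    qed
    finally show ?thesis .
  qed
  \<comment> \<open>At a level \<open>s < c\<close> the distribution \<open>d\<close> of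
    \<open>f\<close> exceeds \<open>x\<close>. It is split as \<open>x + (d - x)\<close>, and
    \<open>d - x\<close> is the integral of 1/t^2 over the \<open>t \<ge> 1 / d\<close> below
    \<open>z\<close>, where \<open>level_le_Fsup\<close> gives \<open>s \<le> t * \<Phi> t\<close>.
    Integrating over \<open>s\<close> first turns this part into \<open>J\<close> and the part with
    \<open>x\<close> into at most the left-hand side of \<open>zF\<close>.\<close>
  have f2: "(\<integral>\<^sup>+ a. (ennreal (cmod (f2 a)))\<^sup>2 \<partial>X) \<le> J + J"
  proof -
    have "(\<integral>\<^sup>+ a. (ennreal (cmod (f2 a)))\<^sup>2 \<partial>X) = (\<integral>\<^sup>+ a. 1 * epowr (ennreal (cmod (f2 a))) 2 \<partial>X)"
      by (simp add: epowr_2)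
    also have "\<dots> = (\<integral>\<^sup>+ s. ennreal (2 * s powr (2 - 1)) * indicator {0<..} s *
        (\<integral>\<^sup>+ a. 1 * indicator {a \<in> space X. ennreal s < ennreal (cmod (f2 a))} a \<partial>X) \<partial>lborel)"
      using f12 by (intro nn_integral_layer X.sigma_finite_measure_axioms) auto
    also have "\<dots> \<le> (\<integral>\<^sup>+ s. ennreal (2 * s powr (2 - 1)) * indicator {s. 0 < s \<and> ennreal s \<le> F (ennreal x) * z} s * ennreal x
       + (\<integral>\<^sup>+ t. ennreal (2 * s powr (2 - 1)) * indicator {s. 0 < s \<and> ennreal s \<le> ennreal t * \<Phi> t} s *
         (ennreal (1 / t\<^sup>2) * indicator {t. 0 < t \<and> ennreal t < z} t) \<partial>lborel) \<partial>lborel)"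
    proof (rule nn_integral_mono)
      fix s :: real
      let ?m = "\<integral>\<^sup>+ a. 1 * indicator {a \<in> space X. ennreal s < ennreal (cmod (f2 a))} a \<partial>X"
      let ?r = "\<integral>\<^sup>+ t. ennreal (2 * s powr (2 - 1)) * indicator {s. 0 < s \<and> ennreal s \<le> ennreal t * \<Phi> t} s *
         (ennreal (1 / t\<^sup>2) * indicator {t. 0 < t \<and> ennreal t < z} t) \<partial>lborel"
      show "ennreal (2 * s powr (2 - 1)) * indicator {0<..} s * ?m \<le>
        ennreal (2 * s powr (2 - 1)) * indicator {s. 0 < s \<and> ennreal s \<le> F (ennreal x) * z} s * ennreal x + ?r"
      proof (cases "0 < s \<and> s < c")
        case True
        then have s: "0 < s" "s < c" by auto
        have "?m = emeasure X {a \<in> space X. ennreal s < ennreal (cmod (f2 a))}"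
          using f12 by simp
        also have "\<dots> \<le> ?d s"
          using s by (intro emeasure_mono) (auto simp: f2_def ennreal_less_iff indicator_def split: if_splits)
        finally have m: "?m \<le> ?d s" .
        obtain d where d: "?d s = ennreal d" "0 \<le> d" using dfin[OF s(1)] by (cases "?d s") auto
        have xd: "x < d" using c(3)[of s] s d x by (simp add: ennreal_less_iff)
        have "ennreal s * ennreal x \<le> F (ennreal x)"
          unfolding F_def using s c(3)[of s] dfin[OF s(1)] by (intro level_le_Fsup) auto
        then have "ennreal s * (ennreal x * z) \<le> F (ennreal x) * z"
          using mult_right_mono[of "ennreal s * ennreal x" "F (ennreal x)" z] by (simp add: mult.assoc)
        then have "x \<noteq> 0 \<Longrightarrow> ennreal s \<le> F (ennreal x) * z"
          using zx by (simp add: mult.commute)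
        then have 1: "ennreal (2 * s powr (2 - 1)) * ennreal x \<le> ennreal (2 * s powr (2 - 1)) * indicator {s. 0 < s \<and> ennreal s \<le> F (ennreal x) * z} s * ennreal x"
          using s by (cases "x = 0") auto
        have 2: "ennreal (2 * s powr (2 - 1)) * ennreal (d - x) \<le> ?r"
        proof -
          have "ennreal (2 * s powr (2 - 1)) * ennreal (d - x) =
            (\<integral>\<^sup>+ t. ennreal (2 * s powr (2 - 1)) * (ennreal (1 / t\<^sup>2) * indicator {t. 1 / d \<le> t \<and> ennreal t < z} t) \<partial>lborel)"
            by (subst nn_integral_cmult) (auto simp: nn_integral_inverse_square[OF x(2) xd x(1)])
          also have "\<dots> \<le> ?r"
          proof (rule nn_integral_mono)
            fix t :: real
            show "ennreal (2 * s powr (2 - 1)) * (ennreal (1 / t\<^sup>2) * indicator {t. 1 / d \<le> t \<and> ennreal t < z} t) \<le>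
              ennreal (2 * s powr (2 - 1)) * indicator {s. 0 < s \<and> ennreal s \<le> ennreal t * \<Phi> t} s *
              (ennreal (1 / t\<^sup>2) * indicator {t. 0 < t \<and> ennreal t < z} t)"
            proof (cases "1 / d \<le> t \<and> ennreal t < z")
              case True
              have d0: "0 < d" using xd x by simp
              then have "0 < 1 / d" by simp
              then have t: "0 < t" using True by linarith
              have "1 / t \<le> d" using True t d0 by (simp add: field_simps)
              then have "ennreal s * ennreal (1 / t) \<le> \<Phi> t"
                unfolding \<Phi>[OF t] F_def using s d dfin[OF s(1)] by (intro level_le_Fsup) (auto intro: ennreal_leI)
              then have "ennreal t * (ennreal s * ennreal (1 / t)) \<le> ennreal t * \<Phi> t" by (rule mult_left_mono) simp
              also have "ennreal t * (ennreal s * ennreal (1 / t)) = ennreal s"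
                using t s by (simp add: ennreal_mult[symmetric])
              finally show ?thesis using True t s by simp
            qed simp
          qed
          finally show ?thesis .
        qed
        have "ennreal (2 * s powr (2 - 1)) * indicator {0<..} s * ?m \<le> ennreal (2 * s powr (2 - 1)) * ennreal d"
          using s m d by (auto intro!: mult_left_mono)
        also have "ennreal d = ennreal x + ennreal (d - x)" using xd x by (simp add: ennreal_plus[symmetric] del: ennreal_plus)
        also have "ennreal (2 * s powr (2 - 1)) * (ennreal x + ennreal (d - x)) =
            ennreal (2 * s powr (2 - 1)) * ennreal x + ennreal (2 * s powr (2 - 1)) * ennreal (d - x)"
          by (rule distrib_left)
        also note add_mono[OF 1 2]
        finally show ?thesis .
      next
        case False
        have "?m = 0" if "0 < s"
        proof -
          have "cmod (f2 a) \<le> s" if "a \<in> space X" for a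
            using False \<open>0 < s\<close> that by (auto simp: f2_def A_def indicator_def)
          then have "?m = (\<integral>\<^sup>+ a. 0 \<partial>X)"
            by (intro nn_integral_cong) (auto simp: indicator_def not_less intro!: ennreal_leI)
          then show ?thesis by simp
        qed
        then show ?thesis by (auto simp: indicator_def)
      qed
    qed
    also have "\<dots> = (\<integral>\<^sup>+ s. ennreal (2 * s powr (2 - 1)) * indicator {s. 0 < s \<and> ennreal s \<le> F (ennreal x) * z} s \<partial>lborel) * ennreal x
       + (\<integral>\<^sup>+ s. \<integral>\<^sup>+ t. ennreal (2 * s powr (2 - 1)) * indicator {s. 0 < s \<and> ennreal s \<le> ennreal t * \<Phi> t} s *
         (ennreal (1 / t\<^sup>2) * indicator {t. 0 < t \<and> ennreal t < z} t) \<partial>lborel \<partial>lborel)"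
      by (subst nn_integral_add) (auto simp: nn_integral_multc)
    also have "(\<integral>\<^sup>+ s. ennreal (2 * s powr (2 - 1)) * indicator {s. 0 < s \<and> ennreal s \<le> F (ennreal x) * z} s \<partial>lborel) = (F (ennreal x) * z)\<^sup>2"
      by (subst layer_le) (auto simp: epowr_2)
    also have "(\<integral>\<^sup>+ s. \<integral>\<^sup>+ t. ennreal (2 * s powr (2 - 1)) * indicator {s. 0 < s \<and> ennreal s \<le> ennreal t * \<Phi> t} s *
         (ennreal (1 / t\<^sup>2) * indicator {t. 0 < t \<and> ennreal t < z} t) \<partial>lborel \<partial>lborel) =
       (\<integral>\<^sup>+ t. \<integral>\<^sup>+ s. ennreal (2 * s powr (2 - 1)) * indicator {s. 0 < s \<and> ennreal s \<le> ennreal t * \<Phi> t} s *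
         (ennreal (1 / t\<^sup>2) * indicator {t. 0 < t \<and> ennreal t < z} t) \<partial>lborel \<partial>lborel)"
      by (rule lborel_pair.Fubini'[symmetric]) measurable
    also have "\<dots> = (\<integral>\<^sup>+ t. (ennreal t * \<Phi> t)\<^sup>2 * (ennreal (1 / t\<^sup>2) * indicator {t. 0 < t \<and> ennreal t < z} t) \<partial>lborel)"
      by (intro nn_integral_cong, subst nn_integral_multc, simp, subst layer_le) (auto simp: epowr_2)
    also have "\<dots> = J"
      unfolding J_def
    proof (intro nn_integral_cong)
      fix t :: real
      show "(ennreal t * \<Phi> t)\<^sup>2 * (ennreal (1 / t\<^sup>2) * indicator {t. 0 < t \<and> ennreal t < z} t) =
         (\<Phi> t)\<^sup>2 * indicator {t. 0 < t \<and> ennreal t < z} t"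
      proof (cases "0 < t \<and> ennreal t < z")
        case True
        then have "(ennreal t)\<^sup>2 * ennreal (1 / t\<^sup>2) = 1"
          by (simp add: ennreal_power ennreal_mult[symmetric])
        moreover have "(ennreal t * \<Phi> t)\<^sup>2 * ennreal (1 / t\<^sup>2) = ((ennreal t)\<^sup>2 * ennreal (1 / t\<^sup>2)) * (\<Phi> t)\<^sup>2"
          by (simp only: power_mult_distrib mult_ac)
        ultimately show ?thesis using True by simp
      qed simp
    qed
    also have "(F (ennreal x) * z)\<^sup>2 * ennreal x \<le> z * (F (ennreal x))\<^sup>2"
    proof (cases "x = 0")
      case False
      have "(F (ennreal x) * z)\<^sup>2 * ennreal x = z * (F (ennreal x))\<^sup>2 * (z * ennreal x)"
        by (simp only: power2_eq_square mult_ac)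
      then show ?thesis using zx False by simp
    qed simp
    finally have "(\<integral>\<^sup>+ a. (ennreal (cmod (f2 a)))\<^sup>2 \<partial>X) \<le> z * (F (ennreal x))\<^sup>2 + J" by (simp add: add_right_mono)
    then show ?thesis using add_right_mono[OF zF, of J] by (rule order_trans)
  qed
  have "(\<integral>\<^sup>+ y. (ennreal (cmod (T f y)))\<^sup>2 * indicator E y \<partial>Y) \<le>
     (\<integral>\<^sup>+ y. 2 * ((F (ennreal x))\<^sup>2 * indicator E y) + 2 * (ennreal (cmod (T f2 y)))\<^sup>2 \<partial>Y)"
  proof (rule nn_integral_mono)
    fix y assume y: "y \<in> space Y"
    have "(cmod (T f y))\<^sup>2 \<le> 2 * (cmod (T f1 y))\<^sup>2 + 2 * (cmod (T f2 y))\<^sup>2"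
    proof -
      have "(cmod (T f y))\<^sup>2 \<le> (cmod (T f1 y) + cmod (T f2 y))\<^sup>2"
        unfolding Tf[OF y] by (intro power_mono norm_triangle_ineq) auto
      also have "\<dots> \<le> 2 * (cmod (T f1 y))\<^sup>2 + 2 * (cmod (T f2 y))\<^sup>2"
        using sum_squares_bound[of "cmod (T f1 y)" "cmod (T f2 y)"] by (simp add: power2_sum)
      finally show ?thesis .
    qed
    then have "(ennreal (cmod (T f y)))\<^sup>2 \<le> ennreal (2 * (cmod (T f1 y))\<^sup>2 + 2 * (cmod (T f2 y))\<^sup>2)"
      by (simp add: ennreal_power ennreal_leI del: ennreal_plus)
    also have "\<dots> = 2 * (ennreal (cmod (T f1 y)))\<^sup>2 + 2 * (ennreal (cmod (T f2 y)))\<^sup>2"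
      by (simp add: ennreal_plus ennreal_mult ennreal_power)
    also have "\<dots> \<le> 2 * (F (ennreal x))\<^sup>2 + 2 * (ennreal (cmod (T f2 y)))\<^sup>2"
      by (intro add_right_mono mult_left_mono power_mono F1 y) auto
    finally show "(ennreal (cmod (T f y)))\<^sup>2 * indicator E y \<le> 2 * ((F (ennreal x))\<^sup>2 * indicator E y) + 2 * (ennreal (cmod (T f2 y)))\<^sup>2"
      by (auto simp: indicator_def)
  qed
  also have "\<dots> = 2 * (z * (F (ennreal x))\<^sup>2) + 2 * (\<integral>\<^sup>+ y. (ennreal (cmod (T f2 y)))\<^sup>2 \<partial>Y)"
    using f12 by (subst nn_integral_add) (auto simp: nn_integral_cmult nn_integral_cmult_indicator z_def mult.commute[of "emeasure Y E"])
  also have "\<dots> \<le> 2 * J + 2 * (ennreal K * (J + J))"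
  proof (intro add_mono mult_left_mono zF)
    have "(\<integral>\<^sup>+ y. (ennreal (cmod (T f2 y)))\<^sup>2 \<partial>Y) \<le> ennreal K * (\<integral>\<^sup>+ a. (ennreal (cmod (f2 a)))\<^sup>2 \<partial>X)"
      unfolding T_def by (rule L2[OF f12(2)])
    also have "\<dots> \<le> ennreal K * (J + J)" by (intro mult_left_mono f2) auto
    finally show "(\<integral>\<^sup>+ y. (ennreal (cmod (T f2 y)))\<^sup>2 \<partial>Y) \<le> ennreal K * (J + J)" .
  qed auto
  also have "\<dots> = ennreal (2 + 4 * K) * J"
  proof -
    have "ennreal (2 + 4 * K) = 2 + 4 * ennreal K"
      using K_pos by (simp add: ennreal_plus ennreal_mult')
    moreover have "2 * (ennreal K * (J + J)) = 4 * ennreal K * J"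
      by (simp add: mult_2[symmetric] mult.left_commute[of "ennreal K"] mult.assoc)
    ultimately show ?thesis by (simp add: distrib_right)
  qed
  finally show ?thesis unfolding J_def \<Phi>_def z_def .
qed

end

context kernel_op begin

lemma L2_fin:
  assumes f: "integrable X f" and b: "\<And>x. cmod (f x) \<le> b"
  shows "(\<integral>\<^sup>+ y. (ennreal (cmod (T f y)))\<^sup>2 \<partial>Y) < top"
proof -
  have "(\<integral>\<^sup>+ x. (ennreal (cmod (f x)))\<^sup>2 \<partial>X) \<le> (\<integral>\<^sup>+ x. ennreal b * ennreal (cmod (f x)) \<partial>X)"
    using b by (intro nn_integral_mono) (auto simp: power2_eq_square intro!: mult_right_mono ennreal_leI)
  also have "\<dots> = ennreal b * (\<integral>\<^sup>+ x. ennreal (cmod (f x)) \<partial>X)"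
    using f by (intro nn_integral_cmult) auto
  also have "\<dots> < top" using f by (auto simp: integrable_iff_bounded less_top ennreal_mult_less_top)
  finally have "ennreal K * (\<integral>\<^sup>+ x. (ennreal (cmod (f x)))\<^sup>2 \<partial>X) < top"
    by (simp add: ennreal_mult_less_top)
  with L2[OF f] show ?thesis unfolding T_def by (rule le_less_trans)
qed

text \<open>The inequality for the exponent 2 is applied to the sets \<open>E \<inter> {\<bar>T f\<bar> > s}\<close>. The levels
  \<open>s > m \<Phi>(t)\<close> contribute at most half of the left-hand side, which is absorbed since it is finite.\<close>

lemma Jurkat_Sampson:
  assumes f: "integrable X f" and b: "\<And>x. cmod (f x) \<le> b" and E [measurable]: "E \<in> sets Y" and q: "2 < q"
  defines "C \<equiv> 2 + 4 * K"
  shows "(\<integral>\<^sup>+ y. epowr (ennreal (cmod (T f y))) q * indicator E y \<partial>Y) \<le> ennreal (2 * C * (2 * C) powr ((q - 2) / 2)) *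
    (\<integral>\<^sup>+ t. epowr (PhiF X (\<lambda>x. ennreal (cmod (f x))) t) q * indicator {t. 0 < t \<and> ennreal t < emeasure Y E} t \<partial>lborel)"
proof -
  have C: "2 < C" using K_pos by (simp add: C_def)
  have [measurable]: "f \<in> borel_measurable X" using f by simp
  define \<Phi> where "\<Phi> = PhiF X (\<lambda>x. ennreal (cmod (f x)))"
  have [measurable]: "\<Phi> \<in> borel_measurable borel" by (simp add: \<Phi>_def)
  define z where "z = emeasure Y E"
  \<comment> \<open>Chosen so that C / m^2 = 1/2, which makes the coefficient of \<open>N\<close> on
    the right of \<open>main\<close> at most 1/2.\<close>
  define m where "m = (2 * C) powr (1 / 2)"
  have m: "0 < m" "m\<^sup>2 = 2 * C" using C by (simp_all add: m_def powr_half_sqrt)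
  let ?g = "\<lambda>y. ennreal (cmod (T f y))"
  let ?Z = "{t. 0 < t \<and> ennreal t < z} :: real set"
  define N where "N = (\<integral>\<^sup>+ y. epowr (?g y) q * indicator E y \<partial>Y)"
  define J where "J = (\<integral>\<^sup>+ t. epowr (\<Phi> t) q * indicator ?Z t \<partial>lborel)"
  define G where "G s = emeasure Y (E \<inter> {y \<in> space Y. ennreal s < ?g y})" for s
  have [measurable]: "G \<in> borel_measurable borel"
    unfolding G_def
    by (intro borel_measurable_ennreal_antimono antimonoI emeasure_mono) (auto dest: order.strict_trans1[OF ennreal_leI])
  have e2: "epowr x q = x\<^sup>2 * epowr x (q - 2)" if "x \<noteq> top" for x
    using q epowr_add[of x 2 "q - 2"] that by (cases "x = 0") (auto simp: epowr_2)
  have "N = (\<integral>\<^sup>+ y. ((?g y)\<^sup>2 * indicator E y) * epowr (?g y) (q - 2) \<partial>Y)"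
    unfolding N_def by (intro nn_integral_cong) (simp add: e2 mult_ac)
  also have "\<dots> = (\<integral>\<^sup>+ s. ennreal ((q - 2) * s powr (q - 2 - 1)) * indicator {0<..} s *
      (\<integral>\<^sup>+ y. ((?g y)\<^sup>2 * indicator E y) * indicator {y \<in> space Y. ennreal s < ?g y} y \<partial>Y) \<partial>lborel)"
    by (rule nn_integral_layer[OF Y.sigma_finite_measure_axioms]) (use q in auto)
  also have "\<dots> \<le> (\<integral>\<^sup>+ s. ennreal ((q - 2) * s powr (q - 2 - 1)) * indicator {0<..} s * (ennreal C *
      (\<integral>\<^sup>+ t. (\<Phi> t)\<^sup>2 * indicator {t. 0 < t \<and> ennreal t < G s} t \<partial>lborel)) \<partial>lborel)"
  proof (intro nn_integral_mono mult_left_mono)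
    fix s :: real
    have "(\<integral>\<^sup>+ y. ((?g y)\<^sup>2 * indicator E y) * indicator {y \<in> space Y. ennreal s < ?g y} y \<partial>Y) =
       (\<integral>\<^sup>+ y. (?g y)\<^sup>2 * indicator (E \<inter> {y \<in> space Y. ennreal s < ?g y}) y \<partial>Y)"
      by (intro nn_integral_cong) (simp add: indicator_inter_arith mult.assoc)
    also have "\<dots> \<le> ennreal C * (\<integral>\<^sup>+ t. (\<Phi> t)\<^sup>2 * indicator {t. 0 < t \<and> ennreal t < G s} t \<partial>lborel)"
      unfolding C_def \<Phi>_def G_def by (rule Jurkat_Sampson_2[OF f b]) measurable
    finally show "(\<integral>\<^sup>+ y. ((?g y)\<^sup>2 * indicator E y) * indicator {y \<in> space Y. ennreal s < ?g y} y \<partial>Y) \<le> \<dots>" .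
  qed auto
  \<comment> \<open>Where \<open>s \<le> m * \<Phi> t\<close> the square of \<open>\<Phi> t\<close>
    is kept; elsewhere it is less than (s / m)^2, and integrating this constant over
    \<open>t\<close> produces a multiple of the layer-cake integrand of \<open>N\<close>.\<close>
  also have "\<dots> \<le> (\<integral>\<^sup>+ s. ennreal C * (\<integral>\<^sup>+ t. (\<Phi> t)\<^sup>2 * indicator ?Z t * (ennreal ((q - 2) * s powr (q - 2 - 1)) * indicator {s. 0 < s \<and> ennreal s \<le> ennreal m * \<Phi> t} s) \<partial>lborel)
      + ennreal (C / m\<^sup>2 * ((q - 2) / q)) * (ennreal (q * s powr (q - 1)) * indicator {0<..} s * G s) \<partial>lborel)"
  proof (rule nn_integral_mono)
    fix s :: real
    show "ennreal ((q - 2) * s powr (q - 2 - 1)) * indicator {0<..} s * (ennreal C *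
      (\<integral>\<^sup>+ t. (\<Phi> t)\<^sup>2 * indicator {t. 0 < t \<and> ennreal t < G s} t \<partial>lborel)) \<le>
      ennreal C * (\<integral>\<^sup>+ t. (\<Phi> t)\<^sup>2 * indicator ?Z t * (ennreal ((q - 2) * s powr (q - 2 - 1)) * indicator {s. 0 < s \<and> ennreal s \<le> ennreal m * \<Phi> t} s) \<partial>lborel)
      + ennreal (C / m\<^sup>2 * ((q - 2) / q)) * (ennreal (q * s powr (q - 1)) * indicator {0<..} s * G s)"
    proof (cases "0 < s")
      case s: True
      let ?w = "ennreal ((q - 2) * s powr (q - 2 - 1))"
      have Gz: "G s \<le> z" unfolding G_def z_def by (intro emeasure_mono) auto
      have "(\<integral>\<^sup>+ t. (\<Phi> t)\<^sup>2 * indicator {t. 0 < t \<and> ennreal t < G s} t \<partial>lborel) \<le>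
        (\<integral>\<^sup>+ t. (\<Phi> t)\<^sup>2 * indicator ?Z t * indicator {s. 0 < s \<and> ennreal s \<le> ennreal m * \<Phi> t} s + ennreal ((s / m)\<^sup>2) * indicator {t. 0 < t \<and> ennreal t < G s} t \<partial>lborel)"
      proof (rule nn_integral_mono)
        fix t :: real
        show "(\<Phi> t)\<^sup>2 * indicator {t. 0 < t \<and> ennreal t < G s} t \<le> (\<Phi> t)\<^sup>2 * indicator ?Z t * indicator {s. 0 < s \<and> ennreal s \<le> ennreal m * \<Phi> t} s + ennreal ((s / m)\<^sup>2) * indicator {t. 0 < t \<and> ennreal t < G s} t"
        proof (cases "0 < t \<and> ennreal t < G s")
          case t: True
          then have tz: "ennreal t < z" using Gz by auto
          show ?thesis
          proof (cases "ennreal s \<le> ennreal m * \<Phi> t")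
            case True
            then show ?thesis using t s tz by simp
          next
            case False
            then have "\<Phi> t \<noteq> top" using m by (auto simp: ennreal_mult_top)
            then obtain r where r: "\<Phi> t = ennreal r" "0 \<le> r" by (cases "\<Phi> t") auto
            have "m * r < s" using False r m s by (simp add: ennreal_mult[symmetric] not_le ennreal_less_iff)
            then have "r\<^sup>2 \<le> (s / m)\<^sup>2" using m r by (intro power_mono) (auto simp: field_simps)
            then show ?thesis using t r by (auto simp: ennreal_power intro!: add_increasing ennreal_leI)
          qed
        qed auto
      qed
      also have "\<dots> = (\<integral>\<^sup>+ t. (\<Phi> t)\<^sup>2 * indicator ?Z t * indicator {s. 0 < s \<and> ennreal s \<le> ennreal m * \<Phi> t} s \<partial>lborel) + ennreal ((s / m)\<^sup>2) * G s"
        by (subst nn_integral_add) (auto simp: nn_integral_cmult emeasure_ennreal_interval)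
      finally have "?w * (ennreal C * (\<integral>\<^sup>+ t. (\<Phi> t)\<^sup>2 * indicator {t. 0 < t \<and> ennreal t < G s} t \<partial>lborel)) \<le>
        ?w * (ennreal C * ((\<integral>\<^sup>+ t. (\<Phi> t)\<^sup>2 * indicator ?Z t * indicator {s. 0 < s \<and> ennreal s \<le> ennreal m * \<Phi> t} s \<partial>lborel) + ennreal ((s / m)\<^sup>2) * G s))"
        by (intro mult_left_mono) auto
      also have "\<dots> = ennreal C * (?w * (\<integral>\<^sup>+ t. (\<Phi> t)\<^sup>2 * indicator ?Z t * indicator {s. 0 < s \<and> ennreal s \<le> ennreal m * \<Phi> t} s \<partial>lborel)) + ?w * (ennreal C * (G s * ennreal ((s / m)\<^sup>2)))"
        by (simp only: distrib_left mult_ac)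
      also have "?w * (\<integral>\<^sup>+ t. (\<Phi> t)\<^sup>2 * indicator ?Z t * indicator {s. 0 < s \<and> ennreal s \<le> ennreal m * \<Phi> t} s \<partial>lborel) =
        (\<integral>\<^sup>+ t. (\<Phi> t)\<^sup>2 * indicator ?Z t * (?w * indicator {s. 0 < s \<and> ennreal s \<le> ennreal m * \<Phi> t} s) \<partial>lborel)"
        by (subst nn_integral_cmult[symmetric]) (auto simp: mult_ac)
      also have "?w * (ennreal C * (G s * ennreal ((s / m)\<^sup>2))) = ennreal ((q - 2) * s powr (q - 2 - 1) * C * (s / m)\<^sup>2) * G s"
        by (rule ennreal_mult3) (use q C in auto)
      also have "(q - 2) * s powr (q - 2 - 1) * C * (s / m)\<^sup>2 = (C / m\<^sup>2 * ((q - 2) / q)) * (q * s powr (q - 1))"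
      proof -
        have "s powr (q - 1) = s powr (q - 2 - 1) * s\<^sup>2"
          using s powr_add[of s "q - 2 - 1" 2] by simp
        then show ?thesis using q m by (simp only:) (simp add: power_divide)
      qed
      also have "ennreal \<dots> = ennreal (C / m\<^sup>2 * ((q - 2) / q)) * ennreal (q * s powr (q - 1))"
        using q C by (intro ennreal_mult) auto
      finally show ?thesis using s by (simp add: mult.assoc)
    qed simp
  qed
  also have "\<dots> = ennreal C * (\<integral>\<^sup>+ s. \<integral>\<^sup>+ t. (\<Phi> t)\<^sup>2 * indicator ?Z t * (ennreal ((q - 2) * s powr (q - 2 - 1)) * indicator {s. 0 < s \<and> ennreal s \<le> ennreal m * \<Phi> t} s) \<partial>lborel \<partial>lborel)
      + ennreal (C / m\<^sup>2 * ((q - 2) / q)) * (\<integral>\<^sup>+ s. ennreal (q * s powr (q - 1)) * indicator {0<..} s * G s \<partial>lborel)"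
    by (subst nn_integral_add) (auto simp: nn_integral_cmult)
  also have "(\<integral>\<^sup>+ s. \<integral>\<^sup>+ t. (\<Phi> t)\<^sup>2 * indicator ?Z t * (ennreal ((q - 2) * s powr (q - 2 - 1)) * indicator {s. 0 < s \<and> ennreal s \<le> ennreal m * \<Phi> t} s) \<partial>lborel \<partial>lborel)
     = (\<integral>\<^sup>+ t. \<integral>\<^sup>+ s. (\<Phi> t)\<^sup>2 * indicator ?Z t * (ennreal ((q - 2) * s powr (q - 2 - 1)) * indicator {s. 0 < s \<and> ennreal s \<le> ennreal m * \<Phi> t} s) \<partial>lborel \<partial>lborel)"
    by (rule lborel_pair.Fubini'[symmetric]) measurable
  also have "\<dots> = (\<integral>\<^sup>+ t. (\<Phi> t)\<^sup>2 * indicator ?Z t * epowr (ennreal m * \<Phi> t) (q - 2) \<partial>lborel)"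
    using q by (intro nn_integral_cong, subst nn_integral_cmult, simp, subst layer_le) auto
  also have "\<dots> \<le> (\<integral>\<^sup>+ t. ennreal (m powr (q - 2)) * (epowr (\<Phi> t) q * indicator ?Z t) \<partial>lborel)"
  proof (rule nn_integral_mono)
    fix t :: real
    have "(\<Phi> t)\<^sup>2 * epowr (\<Phi> t) (q - 2) \<le> epowr (\<Phi> t) q"
      by (cases "\<Phi> t = top") (auto simp: e2)
    from mult_left_mono[OF this, of "ennreal (m powr (q - 2)) * indicator ?Z t"]
    show "(\<Phi> t)\<^sup>2 * indicator ?Z t * epowr (ennreal m * \<Phi> t) (q - 2) \<le> ennreal (m powr (q - 2)) * (epowr (\<Phi> t) q * indicator ?Z t)"
      using m by (simp add: epowr_mult epowr_ennreal mult_ac)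
  qed
  also have "\<dots> = ennreal (m powr (q - 2)) * J"
    unfolding J_def by (rule nn_integral_cmult) measurable
  also have "(\<integral>\<^sup>+ s. ennreal (q * s powr (q - 1)) * indicator {0<..} s * G s \<partial>lborel) = N"
  proof -
    have "N = (\<integral>\<^sup>+ y. indicator E y * epowr (?g y) q \<partial>Y)" by (simp add: N_def mult.commute)
    also have "\<dots> = (\<integral>\<^sup>+ s. ennreal (q * s powr (q - 1)) * indicator {0<..} s *
      (\<integral>\<^sup>+ y. indicator E y * indicator {y \<in> space Y. ennreal s < ?g y} y \<partial>Y) \<partial>lborel)"
      by (rule nn_integral_layer[OF Y.sigma_finite_measure_axioms]) (use q in auto)
    also have "\<dots> = (\<integral>\<^sup>+ s. ennreal (q * s powr (q - 1)) * indicator {0<..} s * G s \<partial>lborel)"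
      unfolding G_def by (intro nn_integral_cong) (simp add: indicator_inter_arith[symmetric])
    finally show ?thesis by simp
  qed
  finally have main: "N \<le> ennreal C * (ennreal (m powr (q - 2)) * J) + ennreal (C / m\<^sup>2 * ((q - 2) / q)) * N"
    by (simp add: mult_left_mono add_right_mono)
  \<comment> \<open>Absorption requires \<open>N\<close> to be finite: |T f|^q is at most a power of
    the L1 norm of \<open>f\<close> times |T f|^2, and the latter is integrable by
    \<open>L2_fin\<close>.\<close>
  have Nfin: "N < top"
  proof -
    define a where "a = (\<integral>\<^sup>+ x. ennreal (cmod (f x)) \<partial>X)"
    have a: "a < top" using f by (simp add: a_def integrable_iff_bounded)
    have "N \<le> (\<integral>\<^sup>+ y. epowr a (q - 2) * (?g y)\<^sup>2 \<partial>Y)"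
      unfolding N_def
    proof (rule nn_integral_mono)
      fix y assume y: "y \<in> space Y"
      have "epowr (?g y) (q - 2) \<le> epowr a (q - 2)" unfolding a_def using q by (intro epowr_mono T_bound[OF f y]) auto
      from mult_right_mono[OF this, of "(?g y)\<^sup>2"]
      show "epowr (?g y) q * indicator E y \<le> epowr a (q - 2) * (?g y)\<^sup>2"
        by (auto simp: indicator_def e2 mult.commute[of "(?g y)\<^sup>2"])
    qed
    also have "\<dots> = epowr a (q - 2) * (\<integral>\<^sup>+ y. (?g y)\<^sup>2 \<partial>Y)" by (rule nn_integral_cmult) measurable
    also have "\<dots> < top"
    proof -
      have "epowr a (q - 2) < top" using a by (metis epowr_eq_top_iff less_top)
      then show ?thesis using L2_fin[OF f b] by (simp add: ennreal_mult_less_top)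
    qed
    finally show ?thesis .
  qed
  have "N \<le> ennreal (2 * C * m powr (q - 2)) * J"
  proof (cases "J = top")
    case True
    then show ?thesis using C m by (simp add: ennreal_mult_top)
  next
    case False
    then obtain j where j: "J = ennreal j" "0 \<le> j" by (cases J) auto
    obtain n where n: "N = ennreal n" "0 \<le> n" using Nfin by (cases N) auto
    define e where "e = C / m\<^sup>2 * ((q - 2) / q)"
    have e: "0 \<le> e" "e \<le> 1 / 2" using m C q by (auto simp: e_def field_simps)
    have "n \<le> C * (m powr (q - 2) * j) + e * n"
      using main n j C e q m unfolding e_def[symmetric] by (simp add: ennreal_mult[symmetric] ennreal_plus[symmetric] del: ennreal_plus)
    moreover have "e * n \<le> 1 / 2 * n" using e n by (intro mult_right_mono) auto
    ultimately have "n \<le> 2 * (C * (m powr (q - 2) * j))" by linarith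
    then have "n \<le> 2 * C * m powr (q - 2) * j" by (simp only: mult.assoc)
    then show ?thesis using n j C by (simp add: ennreal_mult[symmetric] ennreal_leI)
  qed
  also have "m powr (q - 2) = (2 * C) powr ((q - 2) / 2)" by (simp add: m_def powr_powr)
  finally show ?thesis unfolding N_def J_def z_def \<Phi>_def .
qed

text \<open>Here \<open>\<sigma>\<close> stands for 1/v and \<open>\<phi>\<close> for |f| v. Asking
  only for domination of \<open>f\<close> avoids quotients of functions; in the transposed
  inequality \<open>u\<close> takes the place of \<open>\<sigma>\<close>.\<close>

definition weighted_bound :: "real \<Rightarrow> real \<Rightarrow> ('b \<Rightarrow> real) \<Rightarrow> ('a \<Rightarrow> real) \<Rightarrow> bool" where
  "weighted_bound p q u \<sigma> \<longleftrightarrow> (\<exists>C>0. \<forall>f \<phi> b. integrable X f \<and> (\<forall>x. cmod (f x) \<le> b) \<and> \<phi> \<in> borel_measurable X \<and> (\<forall>x. 0 \<le> \<phi> x) \<and>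
    (AE x in X. cmod (f x) \<le> \<phi> x * \<sigma> x) \<longrightarrow>
    (\<integral>\<^sup>+ y. epowr (ennreal (cmod (T f y)) * ennreal (u y)) q \<partial>Y) \<le> ennreal C * epowr (\<integral>\<^sup>+ x. epowr (ennreal (\<phi> x)) p \<partial>X) (q / p))"

text \<open>For \<open>q \<ge> 2\<close> the weighted inequality is the Jurkat-Sampson inequality, summed over the level
  sets of the weight, followed by the weighted Hardy inequality.\<close>

lemma weighted_ge_2:
  fixes u :: "'b \<Rightarrow> real" and \<sigma> :: "'a \<Rightarrow> real" and p q p' B :: real
  defines "WU \<equiv> \<lambda>x. \<integral>\<^sup>+ t. epowr (rearr Y (\<lambda>y. ennreal (u y)) t) q * indicator {0<..<x} t \<partial>lborel"
  defines "W \<equiv> \<lambda>x. \<integral>\<^sup>+ t. epowr (rearr X (\<lambda>x. ennreal (\<sigma> x)) t) p' * indicator {0<..<x} t \<partial>lborel"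
  assumes [measurable]: "u \<in> borel_measurable Y" "\<sigma> \<in> borel_measurable X"
    and u: "\<And>y. 0 \<le> u y" and \<sigma>: "\<And>x. 0 \<le> \<sigma> x"
    and p: "1 < p" "p \<le> q" and p': "1 < p'" and pp': "1 / p + 1 / p' = 1" and q: "2 \<le> q"
    and W: "\<And>x. 0 < x \<Longrightarrow> W x \<noteq> 0" "\<And>x. 0 < x \<Longrightarrow> W x \<noteq> top"
    and B: "0 < B" "\<And>t. 0 < t \<Longrightarrow> WU t * epowr (W (1 / t)) (q / p') \<le> ennreal B"
  shows "weighted_bound p q u \<sigma>"
proof -
  define C0 where "C0 = (if q = 2 then 2 + 4 * K else 2 * (2 + 4 * K) * (2 * (2 + 4 * K)) powr ((q - 2) / 2))"
  define C1 where "C1 = (q / p' + 1) * B * 2 * p / (p - 1) * 2 powr (p - 1)"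
  have C0: "0 < C0" using K_pos by (auto simp: C0_def intro!: mult_pos_pos)
  have C1: "0 < C1" unfolding C1_def using p p' B by (intro mult_pos_pos divide_pos_pos add_nonneg_pos) auto
  show ?thesis
    unfolding weighted_bound_def
  proof (intro exI[of _ "C0 * C1"] conjI allI impI)
    show "0 < C0 * C1" using C0 C1 by simp
    fix f \<phi> b assume "integrable X f \<and> (\<forall>x. cmod (f x) \<le> b) \<and> \<phi> \<in> borel_measurable X \<and> (\<forall>x. 0 \<le> \<phi> x) \<and>
      (AE x in X. cmod (f x) \<le> \<phi> x * \<sigma> x)"
    then have f: "integrable X f" and b: "\<And>x. cmod (f x) \<le> b" and \<phi>m [measurable]: "\<phi> \<in> borel_measurable X"
      and \<phi>: "\<And>x. 0 \<le> \<phi> x" and le: "AE x in X. cmod (f x) \<le> \<phi> x * \<sigma> x" by blast+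
    have [measurable]: "f \<in> borel_measurable X" using f by simp
    let ?N = "\<integral>\<^sup>+ x. epowr (ennreal (\<phi> x)) p \<partial>X"
    define \<Phi> where "\<Phi> = PhiF X (\<lambda>x. ennreal (cmod (f x)))"
    have [measurable]: "\<Phi> \<in> borel_measurable borel" by (simp add: \<Phi>_def)
    let ?U = "rearr Y (\<lambda>y. ennreal (u y))"
    have JS: "(\<integral>\<^sup>+ y. epowr (ennreal (cmod (T f y))) q * indicator E y \<partial>Y) \<le>
      (\<integral>\<^sup>+ t. (ennreal C0 * epowr (\<Phi> t) q) * indicator {t. 0 < t \<and> ennreal t < emeasure Y E} t \<partial>lborel)"
      if [measurable]: "E \<in> sets Y" for E
    proof -
      have "(\<integral>\<^sup>+ y. epowr (ennreal (cmod (T f y))) q * indicator E y \<partial>Y) \<le> ennreal C0 *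
        (\<integral>\<^sup>+ t. epowr (\<Phi> t) q * indicator {t. 0 < t \<and> ennreal t < emeasure Y E} t \<partial>lborel)"
        using Jurkat_Sampson_2[OF f b that] Jurkat_Sampson[OF f b that, of q] q
        by (cases "q = 2") (simp_all add: C0_def \<Phi>_def epowr_2)
      also have "\<dots> = (\<integral>\<^sup>+ t. (ennreal C0 * epowr (\<Phi> t) q) * indicator {t. 0 < t \<and> ennreal t < emeasure Y E} t \<partial>lborel)"
        by (subst nn_integral_cmult[symmetric]) (auto simp: mult_ac)
      finally show ?thesis .
    qed
    have "(\<integral>\<^sup>+ y. epowr (ennreal (cmod (T f y)) * ennreal (u y)) q \<partial>Y) = (\<integral>\<^sup>+ y. epowr (ennreal (cmod (T f y))) q * epowr (ennreal (u y)) q \<partial>Y)"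
      by (simp add: epowr_mult)
    \<comment> \<open>This step brings in the rearrangement of the weight. Its hypothesis is
      \<open>JS\<close> for arbitrary sets, which is why the Jurkat-Sampson inequalities carry a set
      \<open>E\<close>.\<close>
    also have "\<dots> \<le> (\<integral>\<^sup>+ t. (ennreal C0 * epowr (\<Phi> t) q) * indicator {0<..} t * epowr (?U t) q \<partial>lborel)"
      by (rule rearr_bound[OF Y.sigma_finite_measure_axioms]) (use q JS in auto)
    also have "\<dots> \<le> (\<integral>\<^sup>+ t. ennreal C0 * (epowr (PhiF X (\<lambda>x. ennreal (\<phi> x * \<sigma> x)) t) q * epowr (?U t) q * indicator {0<..} t) \<partial>lborel)"
    proof (rule nn_integral_mono)
      fix t :: real
      have "\<Phi> t \<le> PhiF X (\<lambda>x. ennreal (\<phi> x * \<sigma> x)) t"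
        unfolding \<Phi>_def PhiF_def Fsup_def
        using le by (auto intro!: SUP_mono' nn_integral_mono_AE elim!: eventually_mono intro: mult_right_mono ennreal_leI)
      then have "epowr (\<Phi> t) q \<le> epowr (PhiF X (\<lambda>x. ennreal (\<phi> x * \<sigma> x)) t) q" using q by (intro epowr_mono) auto
      from mult_left_mono[OF this, of "ennreal C0 * indicator {0<..} t * epowr (?U t) q"]
      show "(ennreal C0 * epowr (\<Phi> t) q) * indicator {0<..} t * epowr (?U t) q \<le>
        ennreal C0 * (epowr (PhiF X (\<lambda>x. ennreal (\<phi> x * \<sigma> x)) t) q * epowr (?U t) q * indicator {0<..} t)"
        by (simp add: mult_ac)
    qed
    also have "\<dots> = ennreal C0 * (\<integral>\<^sup>+ t. epowr (PhiF X (\<lambda>x. ennreal (\<phi> x * \<sigma> x)) t) q * epowr (?U t) q * indicator {0<..} t \<partial>lborel)"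
      by (rule nn_integral_cmult) measurable
    also have "\<dots> \<le> ennreal C0 * (ennreal C1 * epowr ?N (q / p))"
      unfolding C1_def
      by (intro mult_left_mono weighted_Hardy[OF X.sigma_finite_measure_axioms])
         (use \<phi> \<sigma> p p' pp' W B in \<open>auto simp: WU_def W_def\<close>)
    also have "\<dots> = ennreal (C0 * C1) * epowr ?N (q / p)"
      using C0 C1 by (simp add: ennreal_mult mult.assoc)
    finally show "(\<integral>\<^sup>+ y. epowr (ennreal (cmod (T f y)) * ennreal (u y)) q \<partial>Y) \<le> ennreal (C0 * C1) * epowr ?N (q / p)" .
  qed
qed

end

section \<open>The transposed kernel and duality\<close>

lemma borel_measurable_cnj [measurable (raw)]:
  assumes "f \<in> borel_measurable M"
  shows "(\<lambda>x. cnj (f x)) \<in> borel_measurable M"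
  using assms by (rule measurable_compose) (intro borel_measurable_continuous_onI continuous_intros)

context kernel_op begin

lemma duality:
  assumes f: "integrable X f" and h: "integrable Y h"
  shows "(LINT x|X. f x * (LINT y|Y. k x y * h y)) = (LINT y|Y. h y * T f y)"
proof -
  interpret P: pair_sigma_finite X Y ..
  have [measurable]: "f \<in> borel_measurable X" "h \<in> borel_measurable Y" using f h by simp_all
  have m: "(\<lambda>(x, y). f x * (k x y * h y)) \<in> borel_measurable (X \<Otimes>\<^sub>M Y)" by measurable
  have "(\<integral>\<^sup>+ z. ennreal (norm (case z of (x, y) \<Rightarrow> f x * (k x y * h y))) \<partial>(X \<Otimes>\<^sub>M Y)) \<le>
    (\<integral>\<^sup>+ (x, y). ennreal (norm (f x)) * ennreal (norm (h y)) \<partial>(X \<Otimes>\<^sub>M Y))"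
  proof (intro nn_integral_mono, clarify)
    fix x y
    have "norm (f x * (k x y * h y)) \<le> norm (f x) * norm (h y)"
      unfolding norm_mult using k_le[of x y] by (intro mult_left_mono mult_left_le_one_le) auto
    then show "ennreal (norm (f x * (k x y * h y))) \<le> ennreal (norm (f x)) * ennreal (norm (h y))"
      by (simp add: ennreal_mult[symmetric] ennreal_leI)
  qed
  also have "\<dots> = (\<integral>\<^sup>+ x. \<integral>\<^sup>+ y. ennreal (norm (f x)) * ennreal (norm (h y)) \<partial>Y \<partial>X)"
    by (subst Y.nn_integral_fst[symmetric]) auto
  also have "\<dots> = (\<integral>\<^sup>+ x. ennreal (norm (f x)) \<partial>X) * (\<integral>\<^sup>+ y. ennreal (norm (h y)) \<partial>Y)"
    by (simp add: nn_integral_cmult nn_integral_multc)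
  also have "\<dots> < \<infinity>"
    using f h by (auto simp: integrable_iff_bounded ennreal_mult_less_top)
  finally have int: "integrable (X \<Otimes>\<^sub>M Y) (\<lambda>(x, y). f x * (k x y * h y))"
    by (intro integrableI_bounded m)
  have "(LINT x|X. f x * (LINT y|Y. k x y * h y)) = (LINT x|X. LINT y|Y. f x * (k x y * h y))"
    by simp
  also have "\<dots> = (LINT y|Y. LINT x|X. f x * (k x y * h y))"
    by (rule P.Fubini_integral[OF int, symmetric])
  also have "\<dots> = (LINT y|Y. LINT x|X. h y * (k x y * f x))"
    by (simp add: mult_ac)
  also have "\<dots> = (LINT y|Y. h y * T f y)"
    by (simp add: T_def)
  finally show ?thesis .
qed

text \<open>On a set of finite measure the square norm \<open>I\<close> of \<open>g\<close> is the
  pairing of \<open>h\<close> with \<open>T f\<close>, where \<open>f\<close> is the conjugate of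
  \<open>g\<close> cut off to that set. Young's inequality with parameter \<open>K\<close> and the
  bound for \<open>T\<close> give \<open>I \<le> I / 2 + K / 2 * ?H\<close>. As \<open>g\<close> is
  bounded by the L1 norm of \<open>h\<close>, \<open>I\<close> is finite and can be absorbed, so
  that the constant remains \<open>K\<close>.\<close>

lemma dual: "kernel_op Y X (\<lambda>y x. k x y) K"
proof (unfold_locales)
  show "(\<lambda>(y, x). k x y) \<in> borel_measurable (Y \<Otimes>\<^sub>M X)" by measurable
  show "cmod (k x y) \<le> 1" for x y by (rule k_le)
  show "0 < K" by (rule K_pos)
  fix h :: "'b \<Rightarrow> complex" assume h: "integrable Y h"
  have [measurable]: "h \<in> borel_measurable Y" using h by simp
  define g where "g x = (LINT y|Y. k x y * h y)" for x
  have [measurable]: "g \<in> borel_measurable X"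
    unfolding g_def by (rule Y.borel_measurable_lebesgue_integral) measurable
  define b where "b = (LINT y|Y. cmod (h y))"
  have gb: "cmod (g x) \<le> b" if x: "x \<in> space X" for x
  proof -
    have "cmod (g x) \<le> (LINT y|Y. cmod (k x y * h y))" unfolding g_def by (rule integral_norm_bound)
    also have "\<dots> \<le> b" unfolding b_def
    proof (rule integral_mono_AE')
      show "integrable Y (\<lambda>y. cmod (h y))" using h by simp
    qed (use k_le in \<open>auto simp: norm_mult mult_left_le_one_le\<close>)
    finally show ?thesis .
  qed
  let ?H = "\<integral>\<^sup>+ y. (ennreal (cmod (h y)))\<^sup>2 \<partial>Y"
  obtain A where A: "range A \<subseteq> sets X" "(\<Union>i. A i) = space X" "\<And>i. emeasure X (A i) \<noteq> \<infinity>" "incseq A"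
    using X.sigma_finite_incseq by metis
  have An [measurable]: "A n \<in> sets X" for n using A(1) by auto
  have "(\<integral>\<^sup>+ x. (ennreal (cmod (g x)))\<^sup>2 * indicator (A n) x \<partial>X) \<le> ennreal K * ?H" for n
  proof (cases "?H = top")
    case True
    then show ?thesis using K_pos by (simp add: ennreal_mult_top)
  next
    case False
    define f where "f x = indicator (A n) x *\<^sub>R cnj (g x)" for x
    have [measurable]: "f \<in> borel_measurable X" unfolding f_def by measurable
    have fint: "integrable X f"
      by (rule integrableI_bounded_set[of "A n" _ _ b]) (use A(3) gb in \<open>auto simp: f_def less_top intro!: AE_I2\<close>)
    have g2int: "integrable X (\<lambda>x. f x * g x)"
      by (rule integrableI_bounded_set[of "A n" _ _ "b * b"])
         (use A(3) gb in \<open>auto simp: f_def less_top norm_mult intro!: AE_I2 mult_mono order_trans[OF norm_ge_zero gb]\<close>)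
    have fg: "f x * g x = of_real ((cmod (g x))\<^sup>2 * indicator (A n) x)" for x
    proof -
      have "cnj (g x) * g x = of_real ((cmod (g x))\<^sup>2)"
        by (simp only: complex_norm_square mult.commute)
      then show ?thesis by (simp add: f_def indicator_def)
    qed
    define I where "I = (\<integral>\<^sup>+ x. (ennreal (cmod (g x)))\<^sup>2 * indicator (A n) x \<partial>X)"
    have I: "I = ennreal (LINT x|X. (cmod (g x))\<^sup>2 * indicator (A n) x)" and Iint: "integrable X (\<lambda>x. (cmod (g x))\<^sup>2 * indicator (A n) x)"
    proof -
      show int: "integrable X (\<lambda>x. (cmod (g x))\<^sup>2 * indicator (A n) x)"
        by (rule Bochner_Integration.integrable_cong[THEN iffD1, OF refl _ integrable_norm[OF g2int]])
           (simp add: fg indicator_def norm_power)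
      have "I = (\<integral>\<^sup>+ x. ennreal ((cmod (g x))\<^sup>2 * indicator (A n) x) \<partial>X)"
        unfolding I_def by (intro nn_integral_cong) (auto simp: indicator_def ennreal_power)
      then show "I = ennreal (LINT x|X. (cmod (g x))\<^sup>2 * indicator (A n) x)"
        using int by (simp add: nn_integral_eq_integral)
    qed
    have "(LINT x|X. f x * g x) = of_real (LINT x|X. (cmod (g x))\<^sup>2 * indicator (A n) x)"
      unfolding fg by (rule integral_complex_of_real)
    then have "I = ennreal (cmod (LINT x|X. f x * g x))"
      unfolding I by (simp add: integral_nonneg_AE)
    also have "(LINT x|X. f x * g x) = (LINT y|Y. h y * T f y)"
      unfolding g_def by (rule duality[OF fint h])
    also have "ennreal (cmod \<dots>) \<le> (\<integral>\<^sup>+ y. ennreal (cmod (h y * T f y)) \<partial>Y)"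
    proof (cases "integrable Y (\<lambda>y. h y * T f y)")
      case True
      then show ?thesis using integral_norm_bound_ennreal[OF True] by simp
    qed (simp add: not_integrable_integral_eq)
    also have "\<dots> \<le> (\<integral>\<^sup>+ y. ennreal (1 / (2 * K)) * (ennreal (cmod (T f y)))\<^sup>2 + ennreal (K / 2) * (ennreal (cmod (h y)))\<^sup>2 \<partial>Y)"
    proof (intro nn_integral_mono)
      fix y
      have "0 \<le> (cmod (T f y) - K * cmod (h y))\<^sup>2" by simp
      then have "2 * K * (cmod (T f y) * cmod (h y)) \<le> (cmod (T f y))\<^sup>2 + K\<^sup>2 * (cmod (h y))\<^sup>2"
        by (simp add: power2_diff power_mult_distrib mult_ac)
      then have "cmod (h y * T f y) \<le> 1 / (2 * K) * (cmod (T f y))\<^sup>2 + K / 2 * (cmod (h y))\<^sup>2"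
        using K_pos by (simp add: norm_mult field_simps power2_eq_square)
      then have "ennreal (cmod (h y * T f y)) \<le> ennreal (1 / (2 * K) * (cmod (T f y))\<^sup>2 + K / 2 * (cmod (h y))\<^sup>2)"
        by (rule ennreal_leI)
      also have "\<dots> = ennreal (1 / (2 * K)) * (ennreal (cmod (T f y)))\<^sup>2 + ennreal (K / 2) * (ennreal (cmod (h y)))\<^sup>2"
        using K_pos by (subst ennreal_plus) (simp_all add: ennreal_power ennreal_mult[symmetric])
      finally show "ennreal (cmod (h y * T f y)) \<le> \<dots>" .
    qed
    also have "\<dots> = ennreal (1 / (2 * K)) * (\<integral>\<^sup>+ y. (ennreal (cmod (T f y)))\<^sup>2 \<partial>Y) + ennreal (K / 2) * ?H"
      by (simp add: nn_integral_add nn_integral_cmult)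
    also have "(\<integral>\<^sup>+ y. (ennreal (cmod (T f y)))\<^sup>2 \<partial>Y) \<le> ennreal K * (\<integral>\<^sup>+ x. (ennreal (cmod (f x)))\<^sup>2 \<partial>X)"
      unfolding T_def by (rule L2[OF fint])
    also have "(\<integral>\<^sup>+ x. (ennreal (cmod (f x)))\<^sup>2 \<partial>X) = I"
      unfolding I_def by (intro nn_integral_cong) (auto simp: f_def indicator_def)
    finally have main: "I \<le> ennreal (1 / (2 * K)) * (ennreal K * I) + ennreal (K / 2) * ?H"
      by (simp add: mult_left_mono add_right_mono)
    obtain r where r: "?H = ennreal r" "0 \<le> r" using False by (cases ?H) auto
    obtain i where i: "I = ennreal i" "0 \<le> i" unfolding I by (metis enn2real_nonneg ennreal_enn2real ennreal_less_top)
    have "i \<le> 1 / (2 * K) * (K * i) + K / 2 * r"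
      using main r i K_pos by (simp add: ennreal_mult[symmetric] ennreal_plus[symmetric] del: ennreal_plus)
    then have "i \<le> K * r" using K_pos by simp
    then show ?thesis using r i K_pos unfolding I_def by (simp add: ennreal_mult[symmetric] ennreal_leI)
  qed
  then have "(SUP n. \<integral>\<^sup>+ x. (ennreal (cmod (g x)))\<^sup>2 * indicator (A n) x \<partial>X) \<le> ennreal K * ?H"
    by (rule SUP_least)
  moreover have "(\<integral>\<^sup>+ x. (ennreal (cmod (g x)))\<^sup>2 \<partial>X) = (SUP n. \<integral>\<^sup>+ x. (ennreal (cmod (g x)))\<^sup>2 * indicator (A n) x \<partial>X)"
  proof (subst nn_integral_monotone_convergence_SUP[symmetric])
    show "incseq (\<lambda>n x. (ennreal (cmod (g x)))\<^sup>2 * indicator (A n) x)"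
      using A(4) by (auto simp: incseq_def le_fun_def indicator_def)
    show "(\<integral>\<^sup>+ x. (ennreal (cmod (g x)))\<^sup>2 \<partial>X) = (\<integral>\<^sup>+ x. (SUP n. (ennreal (cmod (g x)))\<^sup>2 * indicator (A n) x) \<partial>X)"
    proof (rule nn_integral_cong)
      fix x assume "x \<in> space X"
      then obtain n where n: "x \<in> A n" using A(2) by auto
      show "(ennreal (cmod (g x)))\<^sup>2 = (SUP n. (ennreal (cmod (g x)))\<^sup>2 * indicator (A n) x)"
        using n by (intro antisym SUP_least SUP_upper2[of n]) (auto simp: indicator_def)
    qed
  qed measurable
  ultimately show "(\<integral>\<^sup>+ x. (ennreal (cmod (LINT y|Y. k x y * h y)))\<^sup>2 \<partial>X) \<le> ennreal K * ?H"
    by (simp add: g_def)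
qed

text \<open>For \<open>q < 2\<close> the transposed operator is bounded for the dual exponents \<open>p' \<ge> q' > 2\<close>.\<close>

lemma weighted_less_2:
  fixes u :: "'b \<Rightarrow> real" and \<sigma> :: "'a \<Rightarrow> real" and p q p' B :: real
  defines "WU \<equiv> \<lambda>x. \<integral>\<^sup>+ t. epowr (rearr Y (\<lambda>y. ennreal (u y)) t) q * indicator {0<..<x} t \<partial>lborel"
  defines "W \<equiv> \<lambda>x. \<integral>\<^sup>+ t. epowr (rearr X (\<lambda>x. ennreal (\<sigma> x)) t) p' * indicator {0<..<x} t \<partial>lborel"
  assumes [measurable]: "u \<in> borel_measurable Y" "\<sigma> \<in> borel_measurable X"
    and u: "\<And>y. 0 \<le> u y" and \<sigma>: "\<And>x. 0 \<le> \<sigma> x"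
    and p: "1 < p" "p \<le> q" and p': "1 < p'" and pp': "1 / p + 1 / p' = 1" and q: "q < 2"
    and WU: "\<And>x. 0 < x \<Longrightarrow> WU x \<noteq> 0" "\<And>x. 0 < x \<Longrightarrow> WU x \<noteq> top"
    and B: "0 < B" "\<And>t. 0 < t \<Longrightarrow> WU t * epowr (W (1 / t)) (q / p') \<le> ennreal B"
  shows "weighted_bound p q u \<sigma>"
proof -
  interpret D: kernel_op Y X "\<lambda>y x. k x y" K by (rule dual)
  \<comment> \<open>For \<open>p \<le> q < 2\<close> the conjugate exponents satisfy
    \<open>2 < q'\<close> and \<open>q' \<le> p'\<close>. The transposed operator thus falls under
    the case already treated, with \<open>q'\<close> and \<open>p'\<close> in the places of
    \<open>p\<close> and \<open>q\<close>.\<close>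
  define q' where "q' = q / (q - 1)"
  have q1: "1 < q" using p by simp
  have q': "1 < q'" "1 / q' + 1 / q = 1" using q1 by (simp_all add: q'_def field_simps)
  have p'_eq: "p' = p / (p - 1)" using pp' p p' by (simp add: field_simps)
  have q'p': "q' \<le> p'" using p q1 by (simp add: q'_def p'_eq field_simps)
  have "2 < q'" using q q1 by (simp add: q'_def field_simps)
  then have p'2: "2 \<le> p'" using q'p' by simp
  \<comment> \<open>The weight condition is self-dual: it is raised to the power
    \<open>p' / q\<close> and read at \<open>1 / t\<close>.\<close>
  have B': "W t * epowr (WU (1 / t)) (p' / q) \<le> ennreal (B powr (p' / q))" if t: "0 < t" for t
  proof -
    have "epowr (WU (1 / t) * epowr (W t) (q / p')) (p' / q) \<le> epowr (ennreal B) (p' / q)"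
      using B(2)[of "1 / t"] t p' q1 by (intro epowr_mono) auto
    then show ?thesis using B(1) p' q1 by (simp add: epowr_mult epowr_epowr epowr_ennreal mult.commute)
  qed
  have "0 < B powr (p' / q)" using B by simp
  then have "D.weighted_bound q' p' \<sigma> u"
    using \<sigma> u q' q'p' q1 p'2 WU B' unfolding WU_def W_def
    by (intro D.weighted_ge_2[of \<sigma> u q' p' q "B powr (p' / q)"]) auto
  then obtain C' where C': "0 < C'" and bound': "\<forall>h \<psi> b. integrable Y h \<and> (\<forall>y. cmod (h y) \<le> b) \<and> \<psi> \<in> borel_measurable Y \<and>
    (\<forall>y. 0 \<le> \<psi> y) \<and> (AE y in Y. cmod (h y) \<le> \<psi> y * u y) \<longrightarrow>
    (\<integral>\<^sup>+ x. epowr (ennreal (cmod (D.T h x)) * ennreal (\<sigma> x)) p' \<partial>X) \<le> ennreal C' * epowr (\<integral>\<^sup>+ y. epowr (ennreal (\<psi> y)) q' \<partial>Y) (p' / q')"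
    unfolding D.weighted_bound_def by blast
  show ?thesis
    unfolding weighted_bound_def
  proof (intro exI[of _ "C' powr (q / p')"] conjI allI impI)
    show "0 < C' powr (q / p')" using C' by simp
    fix f \<phi> b assume "integrable X f \<and> (\<forall>x. cmod (f x) \<le> b) \<and> \<phi> \<in> borel_measurable X \<and> (\<forall>x. 0 \<le> \<phi> x) \<and>
      (AE x in X. cmod (f x) \<le> \<phi> x * \<sigma> x)"
    then have f: "integrable X f" and b: "\<And>x. cmod (f x) \<le> b" and \<phi>m [measurable]: "\<phi> \<in> borel_measurable X"
      and \<phi>: "\<And>x. 0 \<le> \<phi> x" and le: "AE x in X. cmod (f x) \<le> \<phi> x * \<sigma> x" by blast+
    have [measurable]: "f \<in> borel_measurable X" using f by simp
    define N where "N = (\<integral>\<^sup>+ x. epowr (ennreal (\<phi> x)) p \<partial>X)"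
    define c where "c = (LINT x|X. cmod (f x))"
    have Tc: "cmod (T f y) \<le> c" if "y \<in> space Y" for y
    proof -
      have "ennreal (cmod (T f y)) \<le> (\<integral>\<^sup>+ x. ennreal (cmod (f x)) \<partial>X)" by (rule T_bound[OF f that])
      also have "\<dots> = ennreal c" unfolding c_def using f by (intro nn_integral_eq_integral) auto
      finally show ?thesis by (simp add: c_def integral_nonneg_AE)
    qed
    obtain A where A: "range A \<subseteq> sets Y" "(\<Union>i. A i) = space Y" "\<And>i. emeasure Y (A i) \<noteq> \<infinity>" "incseq A"
      using Y.sigma_finite_incseq by metis
    have An [measurable]: "A n \<in> sets Y" for n using A(1) by auto
    \<comment> \<open>On \<open>S n\<close> the weight is bounded and the measure finite. The
      integral to be estimated is then finite and can be divided out at the end.\<close>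
    define S where "S n = A n \<inter> {y \<in> space Y. u y \<le> real n}" for n
    have [measurable]: "S n \<in> sets Y" for n unfolding S_def by measurable
    have Sfin: "emeasure Y (S n) < \<infinity>" for n
    proof -
      have "emeasure Y (S n) \<le> emeasure Y (A n)" by (intro emeasure_mono) (auto simp: S_def)
      then show ?thesis using A(3)[of n] by (auto simp: less_top top_unique)
    qed
    have fin: "(\<integral>\<^sup>+ y. epowr (ennreal (cmod (T f y)) * ennreal (u y)) q * indicator (S n) y \<partial>Y) \<le> ennreal (C' powr (q / p')) * epowr N (q / p)" for n
    proof (cases "N = top")
      case True
      then show ?thesis using C' by (simp add: ennreal_mult_top)
    next
      case False
      define g where "g y = cmod (T f y) powr q * u y powr q * indicator (S n) y" for y
      have [measurable]: "g \<in> borel_measurable Y" unfolding g_def by measurable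
      \<comment> \<open>The extremal function for the L^q norm: its product with \<open>T f\<close>
        is the nonnegative \<open>g\<close>. It is dominated by \<open>\<psi> * u\<close>, and the
        power \<open>q'\<close> of \<open>\<psi>\<close> is again \<open>g\<close> because
        \<open>(q - 1) * q' = q\<close>.\<close>
      define h where "h y = cnj (T f y / cmod (T f y)) * of_real (cmod (T f y) powr (q - 1) * u y powr q * indicator (S n) y)" for y
      have [measurable]: "h \<in> borel_measurable Y" unfolding h_def by measurable
      define \<psi> where "\<psi> y = cmod (T f y) powr (q - 1) * u y powr (q - 1) * indicator (S n) y" for y
      have [measurable]: "\<psi> \<in> borel_measurable Y" unfolding \<psi>_def by measurable
      have ucb: "u y \<le> real n" "cmod (T f y) \<le> c" if "y \<in> S n" for y
        using that Tc[of y] sets.sets_into_space[OF An[of n]] by (auto simp: S_def)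
      have hn: "cmod (h y) \<le> cmod (T f y) powr (q - 1) * u y powr q * indicator (S n) y" for y
        by (cases "T f y = 0") (auto simp: h_def norm_mult norm_divide indicator_def)
      have hb: "cmod (h y) \<le> c powr (q - 1) * real n powr q" for y
      proof (cases "y \<in> S n")
        case True
        have "cmod (T f y) powr (q - 1) * u y powr q \<le> c powr (q - 1) * real n powr q"
          using ucb[OF True] u q1 by (intro mult_mono powr_mono2) auto
        then show ?thesis using hn[of y] True by simp
      next
        case False
        then show ?thesis by (simp add: h_def)
      qed
      have hint: "integrable Y h"
      proof (rule integrableI_bounded_set[of "S n" _ _ "c powr (q - 1) * real n powr q"])
        show "AE y in Y. y \<in> S n \<longrightarrow> norm (h y) \<le> c powr (q - 1) * real n powr q"
          using hb by (intro AE_I2) simp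
      qed (use Sfin in \<open>auto simp: h_def\<close>)
      have gint: "integrable Y g"
      proof (rule integrableI_bounded_set[of "S n" _ _ "c powr q * real n powr q"])
        show "AE y in Y. y \<in> S n \<longrightarrow> norm (g y) \<le> c powr q * real n powr q"
          using ucb u q1 by (intro AE_I2) (auto simp: g_def abs_mult intro!: mult_mono powr_mono2)
      qed (use Sfin in \<open>auto simp: g_def\<close>)
      have hT: "h y * T f y = of_real (g y)" for y
      proof (cases "T f y = 0")
        case False
        then have "cnj (T f y) * T f y = of_real ((cmod (T f y))\<^sup>2)"
          by (simp only: complex_norm_square mult.commute)
        then have "cnj (T f y / cmod (T f y)) * T f y = of_real (cmod (T f y))"
          using False by (simp add: power2_eq_square)
        moreover have "cmod (T f y) powr q = cmod (T f y) * cmod (T f y) powr (q - 1)"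
          using False by (simp add: powr_diff)
        moreover have "h y * T f y = (cnj (T f y / cmod (T f y)) * T f y) * of_real (cmod (T f y) powr (q - 1) * u y powr q * indicator (S n) y)"
          unfolding h_def by (simp only: mult_ac)
        ultimately show ?thesis by (simp add: g_def mult_ac)
      qed (simp add: h_def g_def)
      define I where "I = (\<integral>\<^sup>+ y. ennreal (g y) \<partial>Y)"
      have g0: "0 \<le> g y" for y by (simp add: g_def)
      have I: "I = ennreal (LINT y|Y. g y)" unfolding I_def using gint g0 by (intro nn_integral_eq_integral) auto
      have Ieq: "(\<integral>\<^sup>+ y. epowr (ennreal (cmod (T f y)) * ennreal (u y)) q * indicator (S n) y \<partial>Y) = I"
        unfolding I_def by (intro nn_integral_cong) (auto simp: g_def epowr_mult epowr_ennreal u ennreal_mult indicator_def)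
      have "I = ennreal (cmod (LINT y|Y. h y * T f y))"
        unfolding hT I using g0 by (simp add: integral_nonneg_AE)
      also have "(LINT y|Y. h y * T f y) = (LINT x|X. f x * D.T h x)"
        unfolding D.T_def by (rule duality[OF f hint, symmetric])
      also have "ennreal (cmod \<dots>) \<le> (\<integral>\<^sup>+ x. ennreal (cmod (f x * D.T h x)) \<partial>X)"
      proof (cases "integrable X (\<lambda>x. f x * D.T h x)")
        case True
        then show ?thesis using integral_norm_bound_ennreal[OF True] by simp
      qed (simp add: not_integrable_integral_eq)
      also have "\<dots> \<le> (\<integral>\<^sup>+ x. ennreal (\<phi> x) * (ennreal (cmod (D.T h x)) * ennreal (\<sigma> x)) \<partial>X)"
      proof (intro nn_integral_mono_AE eventually_mono[OF le])
        fix x assume "cmod (f x) \<le> \<phi> x * \<sigma> x"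
        then have "cmod (f x * D.T h x) \<le> (\<phi> x * \<sigma> x) * cmod (D.T h x)"
          unfolding norm_mult by (rule mult_right_mono) simp
        then show "ennreal (cmod (f x * D.T h x)) \<le> ennreal (\<phi> x) * (ennreal (cmod (D.T h x)) * ennreal (\<sigma> x))"
          using \<phi> \<sigma> by (simp add: ennreal_mult[symmetric] ennreal_leI mult_ac)
      qed
      also have "\<dots> \<le> epowr N (1 / p) * epowr (\<integral>\<^sup>+ x. epowr (ennreal (cmod (D.T h x)) * ennreal (\<sigma> x)) p' \<partial>X) (1 / p')"
        unfolding N_def by (rule Hoelder_nn_integral) (use p p' pp' in auto)
      also have "\<dots> \<le> epowr N (1 / p) * epowr (ennreal C' * epowr I (p' / q')) (1 / p')"
      proof (intro mult_left_mono epowr_mono)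
        have "(\<integral>\<^sup>+ x. epowr (ennreal (cmod (D.T h x)) * ennreal (\<sigma> x)) p' \<partial>X) \<le> ennreal C' * epowr (\<integral>\<^sup>+ y. epowr (ennreal (\<psi> y)) q' \<partial>Y) (p' / q')"
        proof (rule bound'[rule_format, where b = "c powr (q - 1) * real n powr q"], intro conjI allI)
          show "integrable Y h" by (rule hint)
          show "cmod (h y) \<le> c powr (q - 1) * real n powr q" for y by (rule hb)
          show "AE y in Y. cmod (h y) \<le> \<psi> y * u y"
          proof (rule AE_I2)
            fix y
            have "u y powr q = u y powr (q - 1) * u y"
              using u[of y] q1 by (cases "u y = 0") (auto simp: powr_diff)
            then show "cmod (h y) \<le> \<psi> y * u y" using hn[of y] by (simp add: \<psi>_def mult_ac)
          qed
        qed (auto simp: \<psi>_def)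
        also have "(\<integral>\<^sup>+ y. epowr (ennreal (\<psi> y)) q' \<partial>Y) = I"
          unfolding I_def
        proof (intro nn_integral_cong)
          fix y
          have "(q - 1) * q' = q" using q1 by (simp add: q'_def)
          then show "epowr (ennreal (\<psi> y)) q' = ennreal (g y)"
            using u[of y] q' by (auto simp: \<psi>_def g_def epowr_ennreal powr_mult powr_powr indicator_def)
        qed
        finally show "(\<integral>\<^sup>+ x. epowr (ennreal (cmod (D.T h x)) * ennreal (\<sigma> x)) p' \<partial>X) \<le> ennreal C' * epowr I (p' / q')" .
      qed (use p' in auto)
      \<comment> \<open>The right-hand side contains \<open>I\<close> to the power
        \<open>1 / q'\<close>; dividing by it leaves the power \<open>1 / q\<close> on the
        left.\<close>
      finally have main: "I \<le> epowr N (1 / p) * epowr (ennreal C' * epowr I (p' / q')) (1 / p')" .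
      obtain i where i: "I = ennreal i" "0 \<le> i" using I g0 by (metis Bochner_Integration.integral_nonneg)
      obtain m where m: "N = ennreal m" "0 \<le> m" using False by (cases N) auto
      have "i \<le> C' powr (q / p') * m powr (q / p)"
      proof (cases "i = 0")
        case False
        then have i0: "0 < i" using i by simp
        have "i \<le> m powr (1 / p) * (C' * i powr (p' / q')) powr (1 / p')"
          using main i m C' by (simp add: epowr_ennreal ennreal_mult[symmetric])
        also have "(C' * i powr (p' / q')) powr (1 / p') = C' powr (1 / p') * i powr (1 / q')"
          using C' i0 p' by (simp add: powr_mult powr_powr)
        finally have "i powr (1 / q + 1 / q') \<le> m powr (1 / p) * C' powr (1 / p') * i powr (1 / q')"
          using q' i0 by (simp add: add.commute mult_ac)
        then have "i powr (1 / q) \<le> m powr (1 / p) * C' powr (1 / p')"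
          using i0 by (simp add: powr_add)
        then have "(i powr (1 / q)) powr q \<le> (m powr (1 / p) * C' powr (1 / p')) powr q"
          using q1 by (intro powr_mono2) auto
        then show ?thesis using i0 C' m q1 by (simp add: powr_powr powr_mult mult.commute)
      qed simp
      then show ?thesis unfolding Ieq using i m C' by (simp add: epowr_ennreal ennreal_mult[symmetric] ennreal_leI)
    qed
    have "(\<integral>\<^sup>+ y. epowr (ennreal (cmod (T f y)) * ennreal (u y)) q \<partial>Y) = (\<integral>\<^sup>+ y. (SUP n. epowr (ennreal (cmod (T f y)) * ennreal (u y)) q * indicator (S n) y) \<partial>Y)"
    proof (rule nn_integral_cong)
      fix y assume "y \<in> space Y"
      then obtain n where n: "y \<in> A n" using A(2) by auto
      obtain n' where n': "u y \<le> real n'" using real_arch_simple by auto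
      have "y \<in> S (max n n')" using n n' incseqD[OF A(4), of n "max n n'"] \<open>y \<in> space Y\<close> by (auto simp: S_def)
      then show "epowr (ennreal (cmod (T f y)) * ennreal (u y)) q = (SUP n. epowr (ennreal (cmod (T f y)) * ennreal (u y)) q * indicator (S n) y)"
        by (intro antisym SUP_least SUP_upper2[of "max n n'"]) (auto simp: indicator_def)
    qed
    also have "\<dots> = (SUP n. \<integral>\<^sup>+ y. epowr (ennreal (cmod (T f y)) * ennreal (u y)) q * indicator (S n) y \<partial>Y)"
    proof (rule nn_integral_monotone_convergence_SUP)
      have Sm: "S n \<subseteq> S (Suc n)" for n
        using incseqD[OF A(4) le_SucI[OF order_refl], of n] by (auto simp: S_def)
      then show "incseq (\<lambda>n y. epowr (ennreal (cmod (T f y)) * ennreal (u y)) q * indicator (S n) y)"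
        by (intro incseq_SucI le_funI mult_left_mono) (auto simp: indicator_def dest: subsetD[OF Sm])
    qed measurable
    also have "\<dots> \<le> ennreal (C' powr (q / p')) * epowr N (q / p)" by (rule SUP_least) (rule fin)
    finally show "(\<integral>\<^sup>+ y. epowr (ennreal (cmod (T f y)) * ennreal (u y)) q \<partial>Y) \<le> ennreal (C' powr (q / p')) * epowr (\<integral>\<^sup>+ x. epowr (ennreal (\<phi> x)) p \<partial>X) (q / p)"
      unfolding N_def .
  qed
qed

theorem weighted_inequality:
  fixes u :: "'b \<Rightarrow> real" and \<sigma> :: "'a \<Rightarrow> real" and p q p' B :: real
  defines "WU \<equiv> \<lambda>x. \<integral>\<^sup>+ t. epowr (rearr Y (\<lambda>y. ennreal (u y)) t) q * indicator {0<..<x} t \<partial>lborel"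
  defines "W \<equiv> \<lambda>x. \<integral>\<^sup>+ t. epowr (rearr X (\<lambda>x. ennreal (\<sigma> x)) t) p' * indicator {0<..<x} t \<partial>lborel"
  assumes "u \<in> borel_measurable Y" "\<sigma> \<in> borel_measurable X"
    and "\<And>y. 0 \<le> u y" and "\<And>x. 0 \<le> \<sigma> x"
    and "1 < p" "p \<le> q" and "1 < p'" and "1 / p + 1 / p' = 1"
    and "\<And>x. 0 < x \<Longrightarrow> WU x \<noteq> 0" "\<And>x. 0 < x \<Longrightarrow> WU x \<noteq> top"
    and "\<And>x. 0 < x \<Longrightarrow> W x \<noteq> 0" "\<And>x. 0 < x \<Longrightarrow> W x \<noteq> top"
    and "0 < B" "\<And>t. 0 < t \<Longrightarrow> WU t * epowr (W (1 / t)) (q / p') \<le> ennreal B"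
  shows "weighted_bound p q u \<sigma>"
proof (cases "q < 2")
  case True
  then show ?thesis using assms(3-) unfolding WU_def W_def by (intro weighted_less_2[of u \<sigma> p q p' B])
next
  case False
  then have "2 \<le> q" by simp
  then show ?thesis using assms(3-) unfolding WU_def W_def by (intro weighted_ge_2[of u \<sigma> p q p' B])
qed

end

section \<open>Norms of rearrangements\<close>

lemma Lnorm_real:
  assumes "0 < r"
  shows "Lnorm M (ennreal r) g = epowr (\<integral>\<^sup>+ x. epowr (g x) r \<partial>M) (1 / r)"
  using assms by (simp add: Lnorm_def)

lemma Lnorm_interval:
  assumes "0 < r"
  shows "Lnorm (restrict_space lborel {0<..<s::real}) (ennreal r) g =
    epowr (\<integral>\<^sup>+ t. epowr (g t) r * indicator {0<..<s} t \<partial>lborel) (1 / r)"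
  using assms by (simp add: Lnorm_real nn_integral_restrict_space)

lemma epowr_le_iff: "0 < r \<Longrightarrow> epowr x (1 / r) \<le> y \<longleftrightarrow> x \<le> epowr y r"
  using epowr_mono[of "epowr x (1 / r)" y r] epowr_mono[of x "epowr y r" "1 / r"] epowr_inverse[of r x] epowr_inverse[of r y]
  by auto

lemma nn_integral_Ioi_le:
  fixes h :: "real \<Rightarrow> ennreal"
  assumes [measurable]: "h \<in> borel_measurable borel"
    and le: "\<And>s. 0 < s \<Longrightarrow> (\<integral>\<^sup>+ t. h t * indicator {0<..<s} t \<partial>lborel) \<le> c"
  shows "(\<integral>\<^sup>+ t. h t * indicator {0<..} t \<partial>lborel) \<le> c"
proof -
  have "h t * indicator {0<..} t = (SUP n. h t * indicator {0<..<real (Suc n)} t)" for t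
  proof (cases "0 < t")
    case True
    obtain n where n: "t < real n" using reals_Archimedean2 by blast
    have "h t * indicator {0<..} t \<le> h t * indicator {0<..<real (Suc n)} t"
      using True n by (simp add: indicator_def)
    then have "h t * indicator {0<..} t \<le> (SUP n. h t * indicator {0<..<real (Suc n)} t)"
      by (rule SUP_upper2[OF UNIV_I])
    moreover have "(SUP n. h t * indicator {0<..<real (Suc n)} t) \<le> h t * indicator {0<..} t"
      by (rule SUP_least) (simp add: indicator_def)
    ultimately show ?thesis by (rule antisym)
  qed simp
  then have "(\<integral>\<^sup>+ t. h t * indicator {0<..} t \<partial>lborel) =
      (\<integral>\<^sup>+ t. (SUP n. h t * indicator {0<..<real (Suc n)} t) \<partial>lborel)" by (intro nn_integral_cong)
  also have "\<dots> = (SUP n. \<integral>\<^sup>+ t. h t * indicator {0<..<real (Suc n)} t \<partial>lborel)"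
  proof (rule nn_integral_monotone_convergence_SUP)
    show "incseq (\<lambda>n t. h t * indicator {0<..<real (Suc n)} t)"
      by (auto simp: incseq_def le_fun_def indicator_def)
  qed measurable
  also have "\<dots> \<le> c" by (rule SUP_least) (rule le, simp)
  finally show ?thesis .
qed

lemma ennreal_pos_interval:
  assumes "m \<noteq> 0" "0 < s"
  shows "\<exists>r>0. r \<le> s \<and> (\<forall>t<r. ennreal t < (m :: ennreal))"
proof (cases m)
  case (real a)
  then have "0 < a" using assms by (cases "a = 0") auto
  then show ?thesis using real assms by (intro exI[of _ "min a s"]) (auto intro: ennreal_lessI)
next
  case top
  then show ?thesis using assms by (intro exI[of _ s]) simp
qed

lemma AE_interval_ex:
  assumes "AE t in lborel. 0 < t \<and> t < s \<longrightarrow> P t" "0 < (s::real)"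
  shows "\<exists>t. 0 < t \<and> t < s \<and> P t"
proof (rule ccontr)
  assume "\<not> ?thesis"
  then have "AE t in lborel. t \<notin> {0<..<s}" using assms(1) by (auto elim!: eventually_mono)
  then have "emeasure lborel {0<..<s} = 0" by (subst (asm) AE_iff_measurable[of "{0<..<s}"]) auto
  then show False using assms(2) by simp
qed

text \<open>If \<open>w > c\<close> on a set of positive measure, then the rearrangement is at least
  \<open>c\<close> on a short interval next to 0. Its values there already control the essential
  supremum, whatever the length \<open>s\<close>.\<close>

lemma AE_le_of_rearr_le:
  fixes w :: "'a \<Rightarrow> ennreal"
  assumes w [measurable]: "w \<in> borel_measurable M" and s: "0 < s"
    and le: "AE t in lborel. 0 < t \<and> t < s \<longrightarrow> rearr M w t \<le> b"
  shows "AE x in M. w x \<le> b"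
proof -
  have *: "esssup M w \<le> c" if c: "b < c" for c
  proof -
    have "emeasure M {x \<in> space M. c < w x} = 0"
    proof (rule ccontr)
      assume "emeasure M {x \<in> space M. c < w x} \<noteq> 0"
      from ennreal_pos_interval[OF this s] obtain r
        where r: "0 < r" "r \<le> s" "\<And>t. t < r \<Longrightarrow> ennreal t < emeasure M {x \<in> space M. c < w x}" by blast
      have "AE t in lborel. 0 < t \<and> t < r \<longrightarrow> rearr M w t \<le> b"
        using le r(2) by (auto elim!: eventually_mono)
      from AE_interval_ex[OF this r(1)] obtain t where t: "0 < t" "t < r" "rearr M w t \<le> b" by blast
      have "c \<le> rearr M w t" by (rule le_rearr[OF w r(3)[OF t(2)]])
      with t(3) c show False by simp
    qed
    then have "AE x in M. w x \<le> c"
      by (subst AE_iff_measurable[of "{x \<in> space M. c < w x}"]) (auto simp: not_le)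
    then show ?thesis by (rule esssup_I[OF w])
  qed
  then have "esssup M w \<le> b" by (rule dense_ge)
  then show ?thesis using esssup_AE[of w M] by (auto elim!: eventually_mono)
qed

lemma AE_finite_of_rearr_finite:
  fixes w :: "'a \<Rightarrow> ennreal"
  assumes w [measurable]: "w \<in> borel_measurable M" and s: "0 < s"
    and fin: "AE t in lborel. 0 < t \<and> t < s \<longrightarrow> rearr M w t \<noteq> top"
  shows "AE x in M. w x \<noteq> top"
proof -
  have "emeasure M {x \<in> space M. w x = top} = 0"
  proof (rule ccontr)
    assume "emeasure M {x \<in> space M. w x = top} \<noteq> 0"
    from ennreal_pos_interval[OF this s] obtain r
      where r: "0 < r" "r \<le> s" "\<And>t. t < r \<Longrightarrow> ennreal t < emeasure M {x \<in> space M. w x = top}" by blast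
    have "AE t in lborel. 0 < t \<and> t < r \<longrightarrow> rearr M w t \<noteq> top"
      using fin r(2) by (auto elim!: eventually_mono)
    from AE_interval_ex[OF this r(1)] obtain t where t: "0 < t" "t < r" "rearr M w t \<noteq> top" by blast
    have "c \<le> rearr M w t" if "c < top" for c
    proof (rule le_rearr[OF w])
      have "ennreal t < emeasure M {x \<in> space M. w x = top}" by (rule r(3)[OF t(2)])
      also have "\<dots> \<le> emeasure M {x \<in> space M. c < w x}" using that by (intro emeasure_mono) auto
      finally show "ennreal t < emeasure M {x \<in> space M. c < w x}" .
    qed
    then have "top \<le> rearr M w t" by (rule dense_le)
    with t(3) show False by (simp add: top_unique)
  qed
  then show ?thesis by (subst AE_iff_measurable[of "{x \<in> space M. w x = top}"]) auto
qed

lemma AE_restrict_interval: "(AE t in restrict_space lborel {0<..<s::real}. P t) \<longleftrightarrow> (AE t in lborel. 0 < t \<and> t < s \<longrightarrow> P t)"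
  by (subst AE_restrict_space_iff) auto

lemma Lnorm_top_le_rearr:
  fixes w :: "'a \<Rightarrow> ennreal"
  assumes w: "w \<in> borel_measurable M" and s: "0 < s"
  shows "Lnorm M top w \<le> Lnorm (restrict_space lborel {0<..<s}) top (rearr M w)"
proof -
  have "AE t in restrict_space lborel {0<..<s}. rearr M w t \<le> esssup (restrict_space lborel {0<..<s}) (rearr M w)"
    by (rule esssup_AE)
  then have "AE x in M. w x \<le> esssup (restrict_space lborel {0<..<s}) (rearr M w)"
    unfolding AE_restrict_interval by (rule AE_le_of_rearr_le[OF w s])
  then show ?thesis unfolding Lnorm_def by (simp add: esssup_I[OF w])
qed

text \<open>For a finite exponent this is \<open>rearr_bound\<close> with both densities equal to 1,
  followed by monotone convergence in \<open>s\<close>; for the infinite exponent a single interval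
  suffices.\<close>

lemma Lnorm_le_of_rearr:
  fixes w :: "'a \<Rightarrow> ennreal"
  assumes sf: "sigma_finite_measure M" and w [measurable]: "w \<in> borel_measurable M" and r: "r \<noteq> 0"
    and le: "\<And>s. 0 < s \<Longrightarrow> Lnorm (restrict_space lborel {0<..<s}) r (rearr M w) \<le> b"
  shows "Lnorm M r w \<le> b"
proof (cases r)
  case top
  have "Lnorm M r w \<le> Lnorm (restrict_space lborel {0<..<1}) r (rearr M w)"
    unfolding top by (rule Lnorm_top_le_rearr[OF w zero_less_one])
  also have "\<dots> \<le> b" by (rule le) simp
  finally show ?thesis .
next
  case (real a)
  then have a: "0 < a" using r by (cases "a = 0") auto
  have "(\<integral>\<^sup>+ x. 1 * epowr (w x) a \<partial>M) \<le> (\<integral>\<^sup>+ t. 1 * indicator {0<..} t * epowr (rearr M w t) a \<partial>lborel)"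
    by (rule rearr_bound[OF sf _ w _ a]) (simp_all add: emeasure_ennreal_interval)
  also have "\<dots> = (\<integral>\<^sup>+ t. epowr (rearr M w t) a * indicator {0<..} t \<partial>lborel)" by (simp add: mult.commute)
  also have "\<dots> \<le> epowr b a"
  proof (rule nn_integral_Ioi_le)
    fix s :: real assume "0 < s"
    from le[OF this] show "(\<integral>\<^sup>+ t. epowr (rearr M w t) a * indicator {0<..<s} t \<partial>lborel) \<le> epowr b a"
      by (simp add: real Lnorm_interval a epowr_le_iff)
  qed measurable
  finally show ?thesis by (simp add: real Lnorm_real a epowr_le_iff)
qed

lemma Lnorm_eq_0_AE:
  assumes [measurable]: "g \<in> borel_measurable M" and "Lnorm M r g = 0" "r \<noteq> 0"
  shows "AE x in M. g x = 0"
proof (cases r)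
  case top
  then show ?thesis using assms esssup_AE[of g M] by (auto simp: Lnorm_def elim!: eventually_mono)
next
  case (real a)
  then have a: "0 < a" using assms(3) by (cases "a = 0") auto
  then show ?thesis using assms by (simp add: real Lnorm_real nn_integral_0_iff_AE)
qed

lemma Lnorm_finite_AE:
  assumes [measurable]: "g \<in> borel_measurable M" and "Lnorm M r g \<noteq> top" "r \<noteq> 0"
  shows "AE x in M. g x \<noteq> top"
proof (cases r)
  case top
  have "AE x in M. g x \<le> Lnorm M r g" using esssup_AE[of g M] by (simp add: Lnorm_def top)
  then show ?thesis using assms(2) by (auto elim!: eventually_mono simp: top_unique)
next
  case (real a)
  then have a: "0 < a" using assms(3) by (cases "a = 0") auto
  then have "(\<integral>\<^sup>+ x. epowr (g x) a \<partial>M) \<noteq> \<infinity>" using assms by (simp add: real Lnorm_real)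
  then have "AE x in M. epowr (g x) a \<noteq> \<infinity>" by (intro nn_integral_PInf_AE) auto
  then show ?thesis by simp
qed

lemma Lnorm_AE_0:
  assumes "AE x in M. g x = 0" "g \<in> borel_measurable M" "r \<noteq> 0"
  shows "Lnorm M r g = 0"
proof (cases r)
  case top
  have "esssup M g \<le> 0" using assms by (intro esssup_I) auto
  then show ?thesis by (simp add: Lnorm_def top)
next
  case (real a)
  then have a: "0 < a" using assms(3) by (cases "a = 0") auto
  have "(\<integral>\<^sup>+ x. epowr (g x) a \<partial>M) = (\<integral>\<^sup>+ x. 0 \<partial>M)" using assms(1) by (intro nn_integral_cong_AE) auto
  then show ?thesis by (simp add: real Lnorm_real a)
qed

lemma Lnorm_mult_le:
  assumes g [measurable]: "g \<in> borel_measurable M" and h: "h \<in> borel_measurable M" and r: "r \<noteq> 0"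
    and le: "AE x in M. h x \<le> c * g x"
  shows "Lnorm M r h \<le> c * Lnorm M r g"
proof (cases r)
  case top
  have "AE x in M. h x \<le> c * esssup M g"
    using le esssup_AE[of g M] by eventually_elim (meson mult_left_mono order_trans zero_le)
  then show ?thesis by (simp add: Lnorm_def top esssup_I[OF h])
next
  case (real a)
  then have a: "0 < a" using assms(3) by (cases "a = 0") auto
  have "(\<integral>\<^sup>+ x. epowr (h x) a \<partial>M) \<le> (\<integral>\<^sup>+ x. epowr c a * epowr (g x) a \<partial>M)"
  proof (rule nn_integral_mono_AE)
    show "AE x in M. epowr (h x) a \<le> epowr c a * epowr (g x) a"
      using le by eventually_elim (use a in \<open>simp add: epowr_mult[symmetric] epowr_mono\<close>)
  qed
  also have "\<dots> = epowr (c * Lnorm M r g) a"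
    by (simp add: nn_integral_cmult epowr_mult real Lnorm_real a epowr_inverse)
  finally show ?thesis unfolding real(2) Lnorm_real[OF a] epowr_le_iff[OF a] by (simp add: real Lnorm_real a)
qed

lemma Lnorm_Hoelder:
  assumes f [measurable]: "f \<in> borel_measurable M" and g [measurable]: "g \<in> borel_measurable M"
    and pq: "p = 1 \<and> q = top \<or> (\<exists>a b. p = ennreal a \<and> q = ennreal b \<and> 1 < a \<and> 1 < b \<and> 1 / a + 1 / b = 1)"
  shows "(\<integral>\<^sup>+ x. f x * g x \<partial>M) \<le> Lnorm M p f * Lnorm M q g"
  using pq
proof (elim disjE exE conjE)
  assume [simp]: "p = 1" "q = top"
  have "(\<integral>\<^sup>+ x. f x * g x \<partial>M) \<le> (\<integral>\<^sup>+ x. f x * esssup M g \<partial>M)"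
  proof (rule nn_integral_mono_AE)
    show "AE x in M. f x * g x \<le> f x * esssup M g"
      using esssup_AE[of g M] by eventually_elim (simp add: mult_left_mono)
  qed
  also have "\<dots> = Lnorm M p f * Lnorm M q g"
    by (simp add: nn_integral_multc Lnorm_def)
  finally show ?thesis .
next
  fix a b assume "p = ennreal a" "q = ennreal b" "1 < a" "1 < b" "1 / a + 1 / b = 1"
  then show ?thesis using Hoelder_nn_integral[OF f g] by (simp add: Lnorm_real)
qed

lemma conjugate_exponents:
  assumes "1 \<le> p" "p < top" "inverse p + inverse p' = (1 :: ennreal)"
  obtains "p = 1" "p' = top" | a b where "p = ennreal a" "p' = ennreal b" "1 < a" "1 < b" "1 / a + 1 / b = 1"
proof -
  obtain a where a: "p = ennreal a" "1 \<le> a" using assms(1,2)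
    by (cases p) (auto simp: ennreal_le_iff2 simp flip: ennreal_1)
  have ip: "inverse p = ennreal (1 / a)" using a by (simp add: inverse_ennreal inverse_eq_divide)
  have "ennreal (1 / a) + ennreal (1 - 1 / a) = 1"
    using a by (subst ennreal_plus[symmetric]) auto
  then have "ennreal (1 / a) + inverse p' = ennreal (1 / a) + ennreal (1 - 1 / a)"
    using assms(3) unfolding ip by simp
  then have ip': "inverse p' = ennreal (1 - 1 / a)"
    by (simp add: ennreal_add_left_cancel)
  show ?thesis
  proof (cases "a = 1")
    case True
    then show ?thesis using that(1) a ip' by simp
  next
    case False
    then have a1: "1 < a" using a by simp
    then have pos: "0 < 1 - 1 / a" by simp
    have "inverse (inverse p') = p'"
    proof (cases p')
      case (real r)
      then show ?thesis by (cases "r = 0") (auto simp: inverse_ennreal)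
    qed simp
    then have "p' = inverse (inverse p')" by simp
    also have "\<dots> = ennreal (1 / (1 - 1 / a))" unfolding ip' using pos by (simp add: inverse_ennreal inverse_eq_divide)
    finally show ?thesis using that(2)[of a "1 / (1 - 1 / a)"] a a1 pos by (simp add: field_simps)
  qed
qed

section \<open>Norms and rearrangements for completed measures\<close>

text \<open>Every subset of a null set is measurable in the completion. Together with the next two
  lemmas this lets weights be replaced by representatives that are measurable before completion,
  where the product structure needed for Fubini's theorem is at hand.\<close>

lemma AE_eq_completion_measurable:
  assumes g: "g \<in> borel_measurable M" and eq: "AE x in M. h x = g x"
  shows "h \<in> borel_measurable (completion M)"
proof (rule measurableI)
  fix A :: "'b set" assume A: "A \<in> sets borel"
  have gA: "g -` A \<inter> space M \<in> sets (completion M)" using g A by (auto intro: measurable_sets)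
  obtain N where N: "N \<in> null_sets M" "{x \<in> space M. h x \<noteq> g x} \<subseteq> N"
    using eq by (auto simp: eventually_ae_filter)
  have sub: "B \<in> sets (completion M)" if "B \<subseteq> N" for B
    using completion.complete[OF that] N(1) null_sets_completionI by blast
  have "h -` A \<inter> space (completion M) = (g -` A \<inter> space M - N) \<union> (h -` A \<inter> space M \<inter> N)"
    using N(2) by auto
  moreover have "N \<in> sets (completion M)" by (rule sub) simp
  moreover have "h -` A \<inter> space M \<inter> N \<in> sets (completion M)" by (rule sub) simp
  ultimately show "h -` A \<inter> space (completion M) \<in> sets (completion M)"
    using gA by (metis sets.Un sets.Diff)
qed simp

lemma Lnorm_completion:
  assumes g: "g \<in> borel_measurable M" and eq: "AE x in M. h x = g x"
  shows "Lnorm (completion M) p h = Lnorm M p g"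
proof (cases "p = top")
  case True
  have h: "h \<in> borel_measurable (completion M)" by (rule AE_eq_completion_measurable[OF g eq])
  have g': "g \<in> borel_measurable (completion M)" by (rule measurable_completion[OF g])
  have "esssup (completion M) h = Inf {z. AE x in M. h x \<le> z}"
    unfolding esssup_eq_AE[OF h] AE_completion_iff ..
  also have "{z. AE x in M. h x \<le> z} = {z. AE x in M. g x \<le> z}"
  proof (intro Collect_cong iffI)
    fix z
    show "AE x in M. g x \<le> z" if "AE x in M. h x \<le> z" using that eq by eventually_elim simp
    show "AE x in M. h x \<le> z" if "AE x in M. g x \<le> z" using that eq by eventually_elim simp
  qed
  also have "Inf \<dots> = esssup M g" by (rule esssup_eq_AE[OF g, symmetric])
  finally show ?thesis by (simp add: Lnorm_def True)
next
  case False
  have "(\<integral>\<^sup>+ x. epowr (h x) (enn2real p) \<partial>M) = (\<integral>\<^sup>+ x. epowr (g x) (enn2real p) \<partial>M)"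
    using eq by (intro nn_integral_cong_AE) auto
  then show ?thesis using False by (simp add: Lnorm_def nn_integral_completion)
qed

lemma rearr_completion:
  assumes g: "g \<in> borel_measurable M" and eq: "AE x in M. h x = g x"
  shows "rearr (completion M) h = rearr M g"
proof
  fix t
  have "emeasure (completion M) {x \<in> space M. s < h x} = emeasure M {x \<in> space M. s < g x}" for s
  proof -
    have [measurable]: "h \<in> borel_measurable (completion M)" by (rule AE_eq_completion_measurable[OF g eq])
    have [measurable]: "g \<in> borel_measurable (completion M)" by (rule measurable_completion[OF g])
    have 1: "{x \<in> space (completion M). s < h x} \<in> sets (completion M)" by measurable
    have 2: "{x \<in> space (completion M). s < g x} \<in> sets (completion M)" by measurable
    have "emeasure (completion M) {x \<in> space M. s < h x} = emeasure (completion M) {x \<in> space M. s < g x}"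
    proof (rule emeasure_eq_AE)
      show "AE x in completion M. x \<in> {x \<in> space M. s < h x} \<longleftrightarrow> x \<in> {x \<in> space M. s < g x}"
        using AE_completion[OF eq] by eventually_elim simp
    qed (use 1 2 in simp_all)
    also have "\<dots> = emeasure M {x \<in> space M. s < g x}"
      using g by (subst emeasure_completion) (simp_all add: main_part_sets)
    finally show ?thesis .
  qed
  then show "rearr (completion M) h t = rearr M g t" by (simp add: rearr_def distr_fun_def)
qed

lemma rearr_AE_cong:
  assumes "g \<in> borel_measurable M" "h \<in> borel_measurable M" "AE x in M. h x = g x"
  shows "rearr M h = rearr M g"
  using rearr_completion[OF assms(1,3)] rearr_completion[OF assms(2), of h] by simp

section \<open>The weighted inequality for \<open>[0, \<infinity>]\<close>-valued weights\<close>

context kernel_op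
begin

lemma Lnorm_T_le:
  assumes u [measurable]: "u \<in> borel_measurable Y" and f: "integrable X f" and q: "q \<noteq> 0"
  shows "Lnorm Y q (\<lambda>y. ennreal (cmod (T f y)) * u y) \<le> (\<integral>\<^sup>+ x. ennreal (cmod (f x)) \<partial>X) * Lnorm Y q u"
proof (rule Lnorm_mult_le[OF u _ q])
  have [measurable]: "f \<in> borel_measurable X" using f by simp
  show "(\<lambda>y. ennreal (cmod (T f y)) * u y) \<in> borel_measurable Y" by measurable
  show "AE y in Y. ennreal (cmod (T f y)) * u y \<le> (\<integral>\<^sup>+ x. ennreal (cmod (f x)) \<partial>X) * u y"
    using T_bound[OF f] by (intro AE_I2 mult_right_mono) auto
qed

text \<open>With the product of the global norms of \<open>u\<close> and \<open>\<sigma>\<close>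
  bounded, Hoelder's inequality and the bound of type (1, infinity) suffice. The alternatives in
  \<open>le\<close> come from \<open>\<phi>\<close> = |f| v and \<open>\<sigma>\<close> = 1/v: where
  \<open>v\<close> is 0 or infinite, the product of the two is 0 by convention and need not dominate
  \<open>f\<close>.\<close>

lemma weighted_Lnorm_endpoint:
  fixes u :: "'b \<Rightarrow> ennreal" and \<sigma> :: "'a \<Rightarrow> ennreal"
  assumes u [measurable]: "u \<in> borel_measurable Y" and \<sigma> [measurable]: "\<sigma> \<in> borel_measurable X"
    and q: "q \<noteq> 0" and p: "p \<noteq> 0"
    and pp': "p = 1 \<and> p' = top \<or> (\<exists>a b. p = ennreal a \<and> p' = ennreal b \<and> 1 < a \<and> 1 < b \<and> 1 / a + 1 / b = 1)"
    and B: "Lnorm Y q u * Lnorm X p' \<sigma> \<le> ennreal B" and fin: "AE x in X. \<sigma> x \<noteq> top"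
    and f: "integrable X f" and \<phi> [measurable]: "\<phi> \<in> borel_measurable X"
    and le: "AE x in X. \<phi> x = top \<or> \<sigma> x = top \<or> ennreal (cmod (f x)) \<le> \<phi> x * \<sigma> x"
    and N: "Lnorm X p \<phi> \<noteq> top"
  shows "Lnorm Y q (\<lambda>y. ennreal (cmod (T f y)) * u y) \<le> ennreal B * Lnorm X p \<phi>"
proof -
  have "(\<integral>\<^sup>+ x. ennreal (cmod (f x)) \<partial>X) \<le> (\<integral>\<^sup>+ x. \<phi> x * \<sigma> x \<partial>X)"
  proof (rule nn_integral_mono_AE)
    show "AE x in X. ennreal (cmod (f x)) \<le> \<phi> x * \<sigma> x"
      using le fin Lnorm_finite_AE[OF \<phi> N p] by eventually_elim simp
  qed
  also have "\<dots> \<le> Lnorm X p \<phi> * Lnorm X p' \<sigma>" by (rule Lnorm_Hoelder[OF \<phi> \<sigma> pp'])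
  finally have 1: "(\<integral>\<^sup>+ x. ennreal (cmod (f x)) \<partial>X) \<le> Lnorm X p \<phi> * Lnorm X p' \<sigma>" .
  have "Lnorm Y q (\<lambda>y. ennreal (cmod (T f y)) * u y) \<le> (\<integral>\<^sup>+ x. ennreal (cmod (f x)) \<partial>X) * Lnorm Y q u"
    by (rule Lnorm_T_le[OF u f q])
  also have "\<dots> \<le> Lnorm X p \<phi> * Lnorm X p' \<sigma> * Lnorm Y q u" by (intro mult_right_mono 1) simp
  also have "\<dots> = Lnorm Y q u * Lnorm X p' \<sigma> * Lnorm X p \<phi>" by (simp only: mult_ac)
  also have "\<dots> \<le> ennreal B * Lnorm X p \<phi>" by (intro mult_right_mono B) simp
  finally show ?thesis .
qed

text \<open>A reduction to real-valued weights: the infinite values occupy null sets, so replacing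
  them by 0 changes neither the rearrangements nor the norms.\<close>

lemma weighted_Lnorm_interior:
  fixes u :: "'b \<Rightarrow> ennreal" and \<sigma> :: "'a \<Rightarrow> ennreal" and p q p' B :: real
  defines "A \<equiv> \<lambda>s. Lnorm (restrict_space lborel {0<..<s}) (ennreal q) (rearr Y u)"
  defines "S \<equiv> \<lambda>s. Lnorm (restrict_space lborel {0<..<s}) (ennreal p') (rearr X \<sigma>)"
  assumes u [measurable]: "u \<in> borel_measurable Y" and \<sigma> [measurable]: "\<sigma> \<in> borel_measurable X"
    and p: "1 < p" "p \<le> q" and p': "1 < p'" and pp': "1 / p + 1 / p' = 1"
    and A: "\<And>s. 0 < s \<Longrightarrow> A s \<noteq> 0" "\<And>s. 0 < s \<Longrightarrow> A s \<noteq> top"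
    and S: "\<And>s. 0 < s \<Longrightarrow> S s \<noteq> 0" "\<And>s. 0 < s \<Longrightarrow> S s \<noteq> top"
    and B: "\<And>s. 0 < s \<Longrightarrow> A (1 / s) * S s \<le> ennreal B"
    and finu: "AE y in Y. u y \<noteq> top" and fin: "AE x in X. \<sigma> x \<noteq> top"
  shows "\<exists>C>0. \<forall>f \<phi> b. integrable X f \<and> (\<forall>x. cmod (f x) \<le> b) \<and> \<phi> \<in> borel_measurable X \<and>
    (AE x in X. \<phi> x = top \<or> \<sigma> x = top \<or> ennreal (cmod (f x)) \<le> \<phi> x * \<sigma> x) \<and> Lnorm X (ennreal p) \<phi> \<noteq> top \<longrightarrow>
    Lnorm Y (ennreal q) (\<lambda>y. ennreal (cmod (T f y)) * u y) \<le> ennreal C * Lnorm X (ennreal p) \<phi>"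
proof -
  have q: "1 < q" using p by simp
  let ?u = "\<lambda>y. enn2real (u y)" and ?\<sigma> = "\<lambda>x. enn2real (\<sigma> x)"
  have RU: "rearr Y (\<lambda>y. ennreal (?u y)) = rearr Y u"
    by (rule rearr_AE_cong) (use finu in \<open>auto elim!: eventually_mono simp: less_top\<close>)
  have RS: "rearr X (\<lambda>x. ennreal (?\<sigma> x)) = rearr X \<sigma>"
    by (rule rearr_AE_cong) (use fin in \<open>auto elim!: eventually_mono simp: less_top\<close>)
  let ?WU = "\<lambda>x. \<integral>\<^sup>+ t. epowr (rearr Y u t) q * indicator {0<..<x} t \<partial>lborel"
  let ?W = "\<lambda>x. \<integral>\<^sup>+ t. epowr (rearr X \<sigma> t) p' * indicator {0<..<x} t \<partial>lborel"
  have A': "A s = epowr (?WU s) (1 / q)" for s using q unfolding A_def by (subst Lnorm_interval) auto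
  have S': "S s = epowr (?W s) (1 / p')" for s using p' unfolding S_def by (subst Lnorm_interval) auto
  have "weighted_bound p q ?u ?\<sigma>"
  \<comment> \<open>The added 1 makes the constant positive, as \<open>weighted_inequality\<close>
    demands.\<close>
  proof (rule weighted_inequality[where p' = p' and B = "enn2real (epowr (ennreal B) q) + 1"], unfold RU RS)
    fix x :: real assume x: "0 < x"
    show "?WU x \<noteq> 0" "?WU x \<noteq> top" using A[OF x] by (auto simp: A')
    show "?W x \<noteq> 0" "?W x \<noteq> top" using S[OF x] by (auto simp: S')
    have "?WU x * epowr (?W (1 / x)) (q / p') = epowr (A (1 / (1 / x)) * S (1 / x)) q"
      using q by (simp add: A' S' epowr_mult epowr_inverse epowr_epowr)
    also have "\<dots> \<le> epowr (ennreal B) q" using B[of "1 / x"] x q by (intro epowr_mono) auto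
    also have "\<dots> \<le> ennreal (enn2real (epowr (ennreal B) q) + 1)"
      by (simp add: ennreal_plus less_top[symmetric] epowr_def)
    finally show "?WU x * epowr (?W (1 / x)) (q / p') \<le> ennreal (enn2real (epowr (ennreal B) q) + 1)" .
  qed (use p p' pp' in \<open>simp_all add: add_nonneg_pos\<close>)
  then obtain C where C: "0 < C" and bd: "\<forall>f \<phi> b. integrable X f \<and> (\<forall>x. cmod (f x) \<le> b) \<and> \<phi> \<in> borel_measurable X \<and> (\<forall>x. 0 \<le> \<phi> x) \<and>
      (AE x in X. cmod (f x) \<le> \<phi> x * ?\<sigma> x) \<longrightarrow>
      (\<integral>\<^sup>+ y. epowr (ennreal (cmod (T f y)) * ennreal (?u y)) q \<partial>Y) \<le> ennreal C * epowr (\<integral>\<^sup>+ x. epowr (ennreal (\<phi> x)) p \<partial>X) (q / p)"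
    unfolding weighted_bound_def by blast
  show ?thesis
  proof (intro exI[of _ "C powr (1 / q)"] conjI allI impI)
    show "0 < C powr (1 / q)" using C by simp
    fix f \<phi> b assume "integrable X f \<and> (\<forall>x. cmod (f x) \<le> b) \<and> \<phi> \<in> borel_measurable X \<and>
      (AE x in X. \<phi> x = top \<or> \<sigma> x = top \<or> ennreal (cmod (f x)) \<le> \<phi> x * \<sigma> x) \<and> Lnorm X (ennreal p) \<phi> \<noteq> top"
    then have f: "integrable X f" and b: "\<And>x. cmod (f x) \<le> b" and \<phi> [measurable]: "\<phi> \<in> borel_measurable X"
      and le: "AE x in X. \<phi> x = top \<or> \<sigma> x = top \<or> ennreal (cmod (f x)) \<le> \<phi> x * \<sigma> x"
      and N: "Lnorm X (ennreal p) \<phi> \<noteq> top" by blast+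
    have fin\<phi>: "AE x in X. \<phi> x \<noteq> top" using p by (intro Lnorm_finite_AE[OF \<phi> N]) simp
    have le': "AE x in X. cmod (f x) \<le> enn2real (\<phi> x) * ?\<sigma> x"
      using le fin\<phi> fin
    proof eventually_elim
      case (elim x)
      then have "ennreal (cmod (f x)) \<le> ennreal (enn2real (\<phi> x) * ?\<sigma> x)"
        by (simp add: ennreal_mult less_top)
      then show ?case by (simp add: ennreal_le_iff)
    qed
    have "(\<integral>\<^sup>+ y. epowr (ennreal (cmod (T f y)) * u y) q \<partial>Y) = (\<integral>\<^sup>+ y. epowr (ennreal (cmod (T f y)) * ennreal (?u y)) q \<partial>Y)"
      using finu by (intro nn_integral_cong_AE) (auto elim!: eventually_mono simp: less_top)
    also have "\<dots> \<le> ennreal C * epowr (\<integral>\<^sup>+ x. epowr (ennreal (enn2real (\<phi> x))) p \<partial>X) (q / p)"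
      by (rule bd[rule_format, of f b]) (use f b le' in simp)
    also have "(\<integral>\<^sup>+ x. epowr (ennreal (enn2real (\<phi> x))) p \<partial>X) = (\<integral>\<^sup>+ x. epowr (\<phi> x) p \<partial>X)"
      using fin\<phi> by (intro nn_integral_cong_AE) (auto elim!: eventually_mono simp: less_top)
    also have "ennreal C * epowr (\<integral>\<^sup>+ x. epowr (\<phi> x) p \<partial>X) (q / p) = epowr (ennreal (C powr (1 / q)) * Lnorm X (ennreal p) \<phi>) q"
      using p q C by (simp add: Lnorm_real epowr_mult epowr_epowr epowr_ennreal powr_powr)
    finally show "Lnorm Y (ennreal q) (\<lambda>y. ennreal (cmod (T f y)) * u y) \<le> ennreal (C powr (1 / q)) * Lnorm X (ennreal p) \<phi>"
      using q by (simp add: Lnorm_real epowr_le_iff)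
  qed
qed

text \<open>With an infinite exponent the norm of the first rearrangement over (0, 1/s) is at least
  the full norm of \<open>w\<close>, for every \<open>s\<close>. Dividing by that norm bounds the
  second factor uniformly in \<open>s\<close>, hence also the full norm of
  \<open>w'\<close>.\<close>

lemma Lnorm_product_bound:
  fixes w :: "'c \<Rightarrow> ennreal" and w' :: "'d \<Rightarrow> ennreal"
  assumes "sigma_finite_measure N" and w: "w \<in> borel_measurable M" and w': "w' \<in> borel_measurable N" and r: "r \<noteq> 0"
    and B: "\<And>s. 0 < s \<Longrightarrow> Lnorm (restrict_space lborel {0<..<1 / s}) top (rearr M w) *
      Lnorm (restrict_space lborel {0<..<s}) r (rearr N w') \<le> B"
    and ne: "Lnorm M top w \<noteq> 0" "Lnorm M top w \<noteq> top"
  shows "Lnorm M top w * Lnorm N r w' \<le> B"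
proof -
  have "Lnorm N r w' \<le> B / Lnorm M top w"
  proof (rule Lnorm_le_of_rearr[OF assms(1) w' r])
    fix s :: real assume s: "0 < s"
    let ?L = "Lnorm (restrict_space lborel {0<..<s}) r (rearr N w')"
    have "?L = Lnorm M top w * ?L / Lnorm M top w"
      using ne by (metis mult.commute mult_divide_eq_ennreal)
    also have "\<dots> \<le> B / Lnorm M top w"
    proof (rule divide_right_mono_ennreal)
      have "Lnorm M top w * ?L \<le> Lnorm (restrict_space lborel {0<..<1 / s}) top (rearr M w) * ?L"
        using s by (intro mult_right_mono Lnorm_top_le_rearr[OF w]) auto
      also have "\<dots> \<le> B" by (rule B[OF s])
      finally show "Lnorm M top w * ?L \<le> B" .
    qed
    finally show "?L \<le> B / Lnorm M top w" .
  qed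
  then have "Lnorm M top w * Lnorm N r w' \<le> Lnorm M top w * (B / Lnorm M top w)" by (rule mult_left_mono) simp
  also have "\<dots> = B" using ne by (metis ennreal_times_divide mult.commute mult_divide_eq_ennreal)
  finally show ?thesis .
qed

theorem weighted_Lnorm:
  fixes u :: "'b \<Rightarrow> ennreal" and \<sigma> :: "'a \<Rightarrow> ennreal" and p q p' :: ennreal
  assumes u [measurable]: "u \<in> borel_measurable Y" and \<sigma> [measurable]: "\<sigma> \<in> borel_measurable X"
    and p: "1 \<le> p" "p \<le> q" "p < top" and pp': "inverse p + inverse p' = 1"
    and SUP: "(SUP s\<in>{0::real<..}. Lnorm (restrict_space lborel {0<..<1 / s}) q (rearr Y u) *
      Lnorm (restrict_space lborel {0<..<s}) p' (rearr X \<sigma>)) < top"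
  shows "\<exists>C>0. \<forall>f \<phi> b. integrable X f \<and> (\<forall>x. cmod (f x) \<le> b) \<and> \<phi> \<in> borel_measurable X \<and>
    (AE x in X. \<phi> x = top \<or> \<sigma> x = top \<or> ennreal (cmod (f x)) \<le> \<phi> x * \<sigma> x) \<longrightarrow>
    Lnorm Y q (\<lambda>y. ennreal (cmod (T f y)) * u y) \<le> ennreal C * Lnorm X p \<phi>"
proof -
  define A where "A s = Lnorm (restrict_space lborel {0<..<s}) q (rearr Y u)" for s
  define S where "S s = Lnorm (restrict_space lborel {0<..<s}) p' (rearr X \<sigma>)" for s
  have cj: "p = 1 \<and> p' = top \<or> (\<exists>a b. p = ennreal a \<and> p' = ennreal b \<and> 1 < a \<and> 1 < b \<and> 1 / a + 1 / b = 1)"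
    by (rule conjugate_exponents[OF p(1,3) pp']) auto
  then have p'0: "p' \<noteq> 0" by auto
  have p0: "p \<noteq> 0" and q0: "q \<noteq> 0" using p by auto
  define B where "B = enn2real (SUP s\<in>{0::real<..}. A (1 / s) * S s)"
  have B: "A (1 / s) * S s \<le> ennreal B" if "0 < s" for s
  proof -
    have "A (1 / s) * S s \<le> (SUP s\<in>{0::real<..}. A (1 / s) * S s)" using that by (intro SUP_upper) simp
    also have "\<dots> = ennreal B" unfolding B_def using SUP by (subst ennreal_enn2real) (simp_all add: A_def S_def)
    finally show ?thesis .
  qed
  have S0: "AE x in X. \<sigma> x = 0" if "S s = 0" "0 < s" for s
  proof -
    have "AE t in restrict_space lborel {0<..<s}. rearr X \<sigma> t = 0"
      using that by (intro Lnorm_eq_0_AE[OF _ _ p'0]) (auto simp: S_def intro: measurable_restrict_space1)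
    then have "AE t in lborel. 0 < t \<and> t < s \<longrightarrow> rearr X \<sigma> t \<le> 0"
      unfolding AE_restrict_interval by (auto elim!: eventually_mono)
    from AE_le_of_rearr_le[OF \<sigma> that(2) this] show ?thesis by simp
  qed
  have A0: "AE y in Y. u y = 0" if "A s = 0" "0 < s" for s
  proof -
    have "AE t in restrict_space lborel {0<..<s}. rearr Y u t = 0"
      using that by (intro Lnorm_eq_0_AE[OF _ _ q0]) (auto simp: A_def intro: measurable_restrict_space1)
    then have "AE t in lborel. 0 < t \<and> t < s \<longrightarrow> rearr Y u t \<le> 0"
      unfolding AE_restrict_interval by (auto elim!: eventually_mono)
    from AE_le_of_rearr_le[OF u that(2) this] show ?thesis by simp
  qed
  have "\<exists>C>0. \<forall>f \<phi> b. integrable X f \<and> (\<forall>x. cmod (f x) \<le> b) \<and> \<phi> \<in> borel_measurable X \<and>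
    (AE x in X. \<phi> x = top \<or> \<sigma> x = top \<or> ennreal (cmod (f x)) \<le> \<phi> x * \<sigma> x) \<and> Lnorm X p \<phi> \<noteq> top \<longrightarrow>
    Lnorm Y q (\<lambda>y. ennreal (cmod (T f y)) * u y) \<le> ennreal C * Lnorm X p \<phi>" (is "\<exists>C>0. ?P C")
  proof -
    \<comment> \<open>If one weight vanishes almost everywhere, every product in the supremum may be
      0 while the other factor is infinite; these cases are settled directly. Otherwise no factor is
      0, so all of them are finite.\<close>
    consider (u) "AE y in Y. u y = 0" | (\<sigma>) "AE x in X. \<sigma> x = 0"
      | (main) "\<not> (AE y in Y. u y = 0)" "\<not> (AE x in X. \<sigma> x = 0)" by blast
    then show ?thesis
    proof cases
      case u
      have "Lnorm Y q (\<lambda>y. ennreal (cmod (T f y)) * u y) = 0" if "integrable X f" for f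
      proof (rule Lnorm_AE_0[OF _ _ q0])
        have [measurable]: "f \<in> borel_measurable X" using that by simp
        show "(\<lambda>y. ennreal (cmod (T f y)) * u y) \<in> borel_measurable Y" by measurable
      qed (use u in auto)
      then show ?thesis by (intro exI[of _ 1]) simp
    next
      case \<sigma>
      have zero: "Lnorm Y q (\<lambda>y. ennreal (cmod (T f y)) * u y) = 0"
        if f: "integrable X f" and \<phi>: "\<phi> \<in> borel_measurable X" and N: "Lnorm X p \<phi> \<noteq> top"
          and le: "AE x in X. \<phi> x = top \<or> \<sigma> x = top \<or> ennreal (cmod (f x)) \<le> \<phi> x * \<sigma> x" for f \<phi>
      proof (rule Lnorm_AE_0[OF _ _ q0])
        have [measurable]: "f \<in> borel_measurable X" using f by simp
        show "(\<lambda>y. ennreal (cmod (T f y)) * u y) \<in> borel_measurable Y" by measurable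
        have "AE x in X. f x = 0" using \<sigma> le Lnorm_finite_AE[OF \<phi> N p0] by eventually_elim auto
        then have "T f y = 0" for y unfolding T_def by (intro integral_eq_zero_AE) auto
        then show "AE y in Y. ennreal (cmod (T f y)) * u y = 0" by simp
      qed
      have "?P 1"
      proof (intro allI impI)
        fix f \<phi> b assume "integrable X f \<and> (\<forall>x. cmod (f x) \<le> b) \<and> \<phi> \<in> borel_measurable X \<and>
          (AE x in X. \<phi> x = top \<or> \<sigma> x = top \<or> ennreal (cmod (f x)) \<le> \<phi> x * \<sigma> x) \<and> Lnorm X p \<phi> \<noteq> top"
        then have "Lnorm Y q (\<lambda>y. ennreal (cmod (T f y)) * u y) = 0" by (intro zero) blast+
        then show "Lnorm Y q (\<lambda>y. ennreal (cmod (T f y)) * u y) \<le> ennreal 1 * Lnorm X p \<phi>" by simp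
      qed
      then show ?thesis by (intro exI[of _ 1]) simp
    next
      case main
      have An0: "A s \<noteq> 0" if "0 < s" for s using A0[OF _ that] main by blast
      have Sn0: "S s \<noteq> 0" if "0 < s" for s using S0[OF _ that] main by blast
      have An: "A s \<noteq> top" if "0 < s" for s
        using B[of "1 / s"] Sn0[of "1 / s"] that by (auto simp: ennreal_top_mult top_unique)
      have Sn: "S s \<noteq> top" if "0 < s" for s
        using B[of s] An0[of "1 / s"] that by (auto simp: ennreal_mult_top top_unique)
      have finu: "AE y in Y. u y \<noteq> top"
      proof (rule AE_finite_of_rearr_finite[OF u zero_less_one])
        have "AE t in restrict_space lborel {0<..<1}. rearr Y u t \<noteq> top"
          using An[of 1] by (intro Lnorm_finite_AE[OF _ _ q0]) (auto simp: A_def intro: measurable_restrict_space1)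
        then show "AE t in lborel. 0 < t \<and> t < 1 \<longrightarrow> rearr Y u t \<noteq> top" unfolding AE_restrict_interval .
      qed
      have fin: "AE x in X. \<sigma> x \<noteq> top"
      proof (rule AE_finite_of_rearr_finite[OF \<sigma> zero_less_one])
        have "AE t in restrict_space lborel {0<..<1}. rearr X \<sigma> t \<noteq> top"
          using Sn[of 1] by (intro Lnorm_finite_AE[OF _ _ p'0]) (auto simp: S_def intro: measurable_restrict_space1)
        then show "AE t in lborel. 0 < t \<and> t < 1 \<longrightarrow> rearr X \<sigma> t \<noteq> top" unfolding AE_restrict_interval .
      qed
      show ?thesis
      proof (cases "p' = top \<or> q = top")
        case True
        have "Lnorm Y q u * Lnorm X p' \<sigma> \<le> ennreal B"
        proof (cases "q = top")
          case q: True
          have "Lnorm Y top u \<noteq> 0" using Lnorm_eq_0_AE[OF u, of top] main by auto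
          moreover have "Lnorm Y top u \<noteq> top"
            using Lnorm_top_le_rearr[OF u zero_less_one] An[of 1] by (auto simp: A_def q top_unique)
          ultimately show ?thesis unfolding q
            using B[unfolded A_def S_def q] by (intro Lnorm_product_bound[OF X.sigma_finite_measure_axioms u \<sigma> p'0])
        next
          case False
          with True have p': "p' = top" by simp
          have "Lnorm X top \<sigma> \<noteq> 0" using Lnorm_eq_0_AE[OF \<sigma>, of top] main by auto
          moreover have "Lnorm X top \<sigma> \<noteq> top"
            using Lnorm_top_le_rearr[OF \<sigma> zero_less_one] Sn[of 1] by (auto simp: S_def p' top_unique)
          moreover have "Lnorm (restrict_space lborel {0<..<1 / s}) top (rearr X \<sigma>) *
              Lnorm (restrict_space lborel {0<..<s}) q (rearr Y u) \<le> ennreal B" if "0 < s" for s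
            using B[of "1 / s"] that by (simp add: A_def S_def p' mult.commute)
          ultimately have "Lnorm X top \<sigma> * Lnorm Y q u \<le> ennreal B"
            by (intro Lnorm_product_bound[OF Y.sigma_finite_measure_axioms \<sigma> u q0])
          then show ?thesis by (simp add: p' mult.commute)
        qed
        also have "\<dots> \<le> ennreal (\<bar>B\<bar> + 1)" by (rule ennreal_leI) simp
        finally have "?P (\<bar>B\<bar> + 1)"
          by (intro allI impI weighted_Lnorm_endpoint[OF u \<sigma> q0 p0 cj _ fin]) blast+
        then show ?thesis by (intro exI[of _ "\<bar>B\<bar> + 1"]) simp
      next
        case False
        with cj obtain a b where ab: "p = ennreal a" "p' = ennreal b" "1 < a" "1 < b" "1 / a + 1 / b = 1" by auto
        obtain c where c: "q = ennreal c" "0 \<le> c" using False by (cases q) auto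
        have ac: "a \<le> c" using p(2) c(2) by (simp add: ab(1) c(1))
        show ?thesis
          unfolding ab(1) c(1)
          by (rule weighted_Lnorm_interior[OF u \<sigma> ab(3) ac ab(4,5) _ _ _ _ _ finu fin, of B])
            (use An0 An Sn0 Sn B in \<open>simp_all add: A_def S_def ab(2) c(1)\<close>)
      qed
    qed
  qed
  then obtain C where C: "0 < C" "?P C" by blast
  show ?thesis
  proof (intro exI[of _ C] conjI allI impI C(1))
    fix f \<phi> b assume asm: "integrable X f \<and> (\<forall>x. cmod (f x) \<le> b) \<and> \<phi> \<in> borel_measurable X \<and>
      (AE x in X. \<phi> x = top \<or> \<sigma> x = top \<or> ennreal (cmod (f x)) \<le> \<phi> x * \<sigma> x)"
    show "Lnorm Y q (\<lambda>y. ennreal (cmod (T f y)) * u y) \<le> ennreal C * Lnorm X p \<phi>"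
    proof (cases "Lnorm X p \<phi> = top")
      case True
      then show ?thesis using C(1) by (simp add: ennreal_mult_top)
    next
      case False
      with asm C(2) show ?thesis by blast
    qed
  qed
qed

end

section \<open>Laguerre polynomials\<close>

definition lag_poly :: "nat \<Rightarrow> nat \<Rightarrow> real poly" where
  "lag_poly d k = (\<Sum>i\<le>k. monom ((- 1) ^ i * real ((k + d) choose (k - i)) / fact i) i)"

lemma coeff_lag_poly:
  "coeff (lag_poly d k) i = (if i \<le> k then (- 1) ^ i * real ((k + d) choose (k - i)) / fact i else 0)"
  by (simp add: lag_poly_def coeff_sum coeff_monom)

lemma poly_lag_poly: "poly (lag_poly d k) x = (\<Sum>i\<le>k. (- 1) ^ i * real ((k + d) choose (k - i)) / fact i * x ^ i)"
  by (simp add: lag_poly_def poly_sum poly_monom)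

lemma binomial_Suc_mult: "Suc k * (N choose Suc k) = (N - k) * (N choose k)"
proof (cases "k \<le> N")
  case True
  then show ?thesis
    by (metis binomial_absorb_comp binomial_absorption)
qed simp

text \<open>The Leibniz step \<open>d/dt (e\<^sup>-\<^sup>t t\<^bsup>d + 1\<^esup> L\<^sub>m\<^bsup>d + 1\<^esup>) = (m + 1) e\<^sup>-\<^sup>t t\<^sup>d L\<^bsub>m + 1\<^esub>\<^bsup>d\<^esup>\<close>.\<close>

lemma lag_poly_Rodrigues_step:
  "smult (real d + 1) (lag_poly (Suc d) m) + pCons 0 (pderiv (lag_poly (Suc d) m)) - pCons 0 (lag_poly (Suc d) m)
    = smult (real m + 1) (lag_poly d (Suc m))"
proof (rule poly_eqI)
  fix i
  let ?N = "m + d + 1"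
  have c: "coeff (pCons 0 (pderiv p)) i = real i * coeff p i" for p :: "real poly"
    by (cases i) (simp_all add: coeff_pderiv)
  consider "i = 0" | j where "i = Suc j" "i \<le> m" | "i = Suc m" | "i > Suc m" by (cases i; force)
  then show "coeff (smult (real d + 1) (lag_poly (Suc d) m) + pCons 0 (pderiv (lag_poly (Suc d) m)) - pCons 0 (lag_poly (Suc d) m)) i
    = coeff (smult (real m + 1) (lag_poly d (Suc m))) i"
  proof cases
    case 1
    have "Suc m * (?N choose Suc m) = (?N - m) * (?N choose m)" by (rule binomial_Suc_mult)
    moreover have "?N - m = d + 1" by simp
    ultimately have "real (Suc m) * real (?N choose Suc m) = real (d + 1) * real (?N choose m)"
      by (metis of_nat_mult)
    then show ?thesis using 1 by (simp add: coeff_lag_poly c add_ac del: binomial_Suc_Suc)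
  next
    case (2 j)
    have "Suc (m - i) * (?N choose Suc (m - i)) = (?N - (m - i)) * (?N choose (m - i))" by (rule binomial_Suc_mult)
    then have "real (Suc (m - i)) * real (?N choose Suc (m - i)) = real (?N - (m - i)) * real (?N choose (m - i))"
      by (simp only: flip: of_nat_mult)
    moreover have e1: "Suc (m - i) = m - j" "real (Suc (m - i)) = real m + 1 - real i" "real (?N - (m - i)) = real d + 1 + real i"
      using 2 by (auto simp: of_nat_diff)
    ultimately have *: "(real m + 1 - real i) * real (?N choose (m - j)) = (real d + 1 + real i) * real (?N choose (m - i))"
      unfolding e1(2,3) unfolding e1(1) by simp
    have f: "fact i = real i * fact j" using 2 by simp
    have cj: "coeff (pCons 0 p) i = coeff p j" for p :: "real poly" using 2 by simp
    have sj: "(- 1 :: real) ^ j = - ((- 1) ^ i)" and jm: "j \<le> m" and e2: "Suc m - i = m - j" using 2 by simp_all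
    have L: "coeff (smult (real d + 1) (lag_poly (Suc d) m) + pCons 0 (pderiv (lag_poly (Suc d) m)) - pCons 0 (lag_poly (Suc d) m)) i
      = (- 1) ^ i * ((real d + 1 + real i) * real (?N choose (m - i)) / fact i + real (?N choose (m - j)) / fact j)"
      unfolding coeff_add coeff_diff coeff_smult c unfolding cj coeff_lag_poly sj
      using 2(2) jm by (simp add: algebra_simps add_divide_distrib del: binomial_Suc_Suc fact_Suc)
    have R: "coeff (smult (real m + 1) (lag_poly d (Suc m))) i = (- 1) ^ i * ((real m + 1) * real (?N choose (m - j)) / fact i)"
      unfolding coeff_smult coeff_lag_poly e2
      using 2(2) by (simp add: mult_ac del: binomial_Suc_Suc fact_Suc)
    have "(real d + 1 + real i) * real (?N choose (m - i)) / fact i + real (?N choose (m - j)) / fact j = (real m + 1) * real (?N choose (m - j)) / fact i"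
    proof -
      have "real i \<noteq> 0" using 2 by simp
      then show ?thesis unfolding *[symmetric] f by (simp add: field_simps del: binomial_Suc_Suc)
    qed
    then show ?thesis unfolding L R by simp
  next
    case 3
    have "coeff (smult (real d + 1) (lag_poly (Suc d) m) + pCons 0 (pderiv (lag_poly (Suc d) m)) - pCons 0 (lag_poly (Suc d) m)) i = - ((- 1) ^ m / fact m)"
      using 3 by (simp add: coeff_lag_poly c coeff_pderiv)
    also have "\<dots> = (real m + 1) * (- ((- 1) ^ m) / fact (Suc m))"
    proof -
      have n: "real m + 1 \<noteq> 0" by linarith
      have f: "fact (Suc m) = (real m + 1) * fact m" by (simp add: add.commute)
      show ?thesis unfolding f using n by (simp add: divide_simps)
    qed
    also have "\<dots> = coeff (smult (real m + 1) (lag_poly d (Suc m))) i"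
      using 3 by (simp add: coeff_lag_poly del: fact_Suc)
    finally show ?thesis .
  next
    case 4
    then show ?thesis by (auto simp: coeff_lag_poly c coeff_pCons coeff_pderiv split: nat.splits)
  qed
qed

text \<open>The exponent \<open>Suc m + d\<close> is read as \<open>m + Suc d\<close>: the inner
  derivatives are given by the induction hypothesis at \<open>Suc d\<close>, and the outermost one
  is the Leibniz step.\<close>

lemma iterated_deriv_lag_poly:
  assumes "0 < t"
  shows "(deriv ^^ m) (\<lambda>s. exp (- s) * s powr (real m + real d)) t = fact m * exp (- t) * t ^ d * poly (lag_poly d m) t"
  using assms
proof (induction m arbitrary: d t)
  case 0
  then show ?case by (simp add: poly_lag_poly powr_realpow)
next
  case (Suc m)
  let ?P = "lag_poly (Suc d) m"
  have e: "real (Suc m) + real d = real m + real (Suc d)" by simp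
  have "eventually (\<lambda>s. (deriv ^^ m) (\<lambda>s. exp (- s) * s powr (real (Suc m) + real d)) s
      = fact m * exp (- s) * s ^ Suc d * poly ?P s) (nhds t)"
    using eventually_nhds_in_open[of "{0<..}" t] Suc.prems unfolding e
    by (auto elim!: eventually_mono simp: Suc.IH simp del: of_nat_Suc power_Suc)
  moreover have "((\<lambda>s. fact m * exp (- s) * s ^ Suc d * poly ?P s) has_real_derivative
      fact (Suc m) * exp (- t) * t ^ d * poly (lag_poly d (Suc m)) t) (at t)"
  proof -
    have "((\<lambda>s. fact m * exp (- s) * s ^ Suc d * poly ?P s) has_real_derivative
      fact m * exp (- t) * t ^ d * ((real d + 1) * poly ?P t + t * poly (pderiv ?P) t - t * poly ?P t)) (at t)"
    proof -
      have D: "((\<lambda>s::real. s ^ Suc d) has_real_derivative (real d + 1) * t ^ d) (at t)"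
        using DERIV_pow[of "Suc d" t UNIV] by (simp add: add.commute del: power_Suc)
      show ?thesis
        by (rule D derivative_eq_intros refl)+ (simp add: algebra_simps)
    qed
    also have "(real d + 1) * poly ?P t + t * poly (pderiv ?P) t - t * poly ?P t = (real m + 1) * poly (lag_poly d (Suc m)) t"
      using arg_cong[OF lag_poly_Rodrigues_step[of d m], of "\<lambda>p. poly p t"] by (simp add: algebra_simps)
    finally show ?thesis by (simp add: algebra_simps)
  qed
  ultimately have "((deriv ^^ m) (\<lambda>s. exp (- s) * s powr (real (Suc m) + real d)) has_real_derivative
      fact (Suc m) * exp (- t) * t ^ d * poly (lag_poly d (Suc m)) t) (at t)"
    by (subst DERIV_cong_ev[OF refl _ refl])
  then show ?case by (simp add: DERIV_imp_deriv)
qed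

lemma laguerre_eq: "laguerre k (real d) = lag_poly d k"
proof (rule ccontr)
  assume "laguerre k (real d) \<noteq> lag_poly d k"
  then have "finite {x. poly (laguerre k (real d) - lag_poly d k) x = 0}" by (intro poly_roots_finite) simp
  moreover have "{0<..} \<subseteq> {x. poly (laguerre k (real d) - lag_poly d k) x = 0}"
  proof clarify
    fix t :: real assume t: "0 < t"
    have "rodrigues k (real d) t = (t powr (- real d) * t ^ d) * (exp t * exp (- t)) * poly (lag_poly d k) t"
      unfolding rodrigues_def iterated_deriv_lag_poly[OF t] by simp
    also have "t powr (- real d) * t ^ d = 1" using t by (simp add: powr_minus powr_realpow)
    also have "exp t * exp (- t) = 1" by (simp add: exp_minus)
    finally show "poly (laguerre k (real d) - lag_poly d k) t = 0" using poly_laguerre[OF t, of k "real d"] by simp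
  qed
  ultimately have "finite {0::real<..}" using finite_subset by blast
  then show False using infinite_Ioi by blast
qed

text \<open>Pascal's rule in the coefficients. Its summed form carries both the bound and the
  generating function from \<open>d\<close> to \<open>d + 1\<close>, so that each of them needs a
  separate argument only for \<open>d = 0\<close>.\<close>

lemma lag_poly_Suc_diff: "lag_poly (Suc d) (Suc k) = lag_poly (Suc d) k + lag_poly d (Suc k)"
proof (rule poly_eqI)
  fix i
  consider "i \<le> k" | "i = Suc k" | "i > Suc k" by linarith
  then show "coeff (lag_poly (Suc d) (Suc k)) i = coeff (lag_poly (Suc d) k + lag_poly d (Suc k)) i"
  proof cases
    case 1
    then have "Suc k + Suc d choose (Suc k - i) = (k + Suc d choose (k - i)) + (Suc k + d choose (Suc k - i))"
      by (simp add: Suc_diff_le)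
    then show ?thesis using 1 by (simp add: coeff_lag_poly add_divide_distrib distrib_left del: binomial_Suc_Suc)
  qed (simp_all add: coeff_lag_poly)
qed

lemma lag_poly_Suc_sum: "lag_poly (Suc d) k = (\<Sum>i\<le>k. lag_poly d i)"
proof (induction k)
  case 0
  show ?case by (simp add: lag_poly_def)
qed (simp add: lag_poly_Suc_diff)

section \<open>Bounds and generating function of the Laguerre functions\<close>

text \<open>Charlier polynomials in \<open>j\<close> for the Poisson weights \<open>x\<^sup>j / j!\<close>, with \<open>y = - 1 / x\<close>. The value at
  \<open>j = k\<close> is \<open>L\<^sub>k(x)\<close> up to a factor, so a single term of the norm of the \<open>k\<close>-th polynomial bounds it.\<close>

fun charlier :: "real \<Rightarrow> nat \<Rightarrow> nat \<Rightarrow> real" where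
  "charlier y 0 j = 1"
| "charlier y (Suc k) j = charlier y k j + y * real j * charlier y k (j - 1)"

text \<open>The difference in \<open>j\<close> lowers the degree \<open>k\<close>, as a derivative
  would. The truncated \<open>j - 1\<close> does no harm at \<open>j = 0\<close>, since it always
  comes with the factor \<open>j\<close>.\<close>

lemma charlier_diff: "charlier y (Suc k) (Suc j) - charlier y (Suc k) j = y * real (Suc k) * charlier y k j"
proof (induction k arbitrary: j)
  case (Suc k)
  have 1: "charlier y (Suc k) (Suc j) - charlier y (Suc k) j = y * real (Suc k) * charlier y k j" by (rule Suc.IH)
  have 2: "real j * (charlier y (Suc k) j - charlier y (Suc k) (j - 1)) = real j * (y * real (Suc k) * charlier y k (j - 1))"
    using Suc.IH[of "j - 1"] by (cases j) simp_all
  have "charlier y (Suc (Suc k)) (Suc j) - charlier y (Suc (Suc k)) j =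
     (charlier y (Suc k) (Suc j) - charlier y (Suc k) j) + y * charlier y (Suc k) j + y * (real j * (charlier y (Suc k) j - charlier y (Suc k) (j - 1)))"
    by (subst (1 2) charlier.simps(2)) (simp add: algebra_simps del: charlier.simps)
  also have "\<dots> = y * real (Suc k) * (charlier y k j + y * real j * charlier y k (j - 1)) + y * charlier y (Suc k) j"
    unfolding 1 2 by (simp add: algebra_simps del: charlier.simps)
  also have "charlier y k j + y * real j * charlier y k (j - 1) = charlier y (Suc k) j" by simp
  finally show ?case by (simp add: algebra_simps del: charlier.simps)
qed (simp add: algebra_simps)

lemma charlier_eq: "charlier y k j = (\<Sum>i\<le>k. real (k choose i) * real (j choose i) * fact i * y ^ i)"
proof (induction k arbitrary: j)
  case (Suc k)
  let ?s = "\<lambda>k i. real (k choose i) * real (j choose i) * fact i * y ^ i"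
  have abs: "real (Suc i) * real (j choose Suc i) = real j * real (j - 1 choose i)" for i
    using binomial_absorption[of i j] by (metis of_nat_mult)
  have "(\<Sum>i\<le>Suc k. ?s (Suc k) i) = ?s (Suc k) 0 + (\<Sum>i\<le>k. ?s (Suc k) (Suc i))"
    by (rule sum.atMost_Suc_shift)
  also have "(\<Sum>i\<le>k. ?s (Suc k) (Suc i)) = (\<Sum>i\<le>k. ?s k (Suc i)) + (\<Sum>i\<le>k. y * real j * (real (k choose i) * real (j - 1 choose i) * fact i * y ^ i))"
  proof (subst sum.distrib[symmetric], rule sum.cong)
    fix i
    have "?s (Suc k) (Suc i) = ?s k (Suc i) + real (k choose i) * (real (Suc i) * real (j choose Suc i)) * fact i * y ^ Suc i"
      by (simp add: algebra_simps)
    then show "?s (Suc k) (Suc i) = ?s k (Suc i) + y * real j * (real (k choose i) * real (j - 1 choose i) * fact i * y ^ i)"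
      unfolding abs by (simp add: mult_ac)
  qed simp
  also have "?s (Suc k) 0 + ((\<Sum>i\<le>k. ?s k (Suc i)) + (\<Sum>i\<le>k. y * real j * (real (k choose i) * real (j - 1 choose i) * fact i * y ^ i)))
     = (\<Sum>i\<le>Suc k. ?s k i) + y * real j * charlier y k (j - 1)"
  proof -
    have "(\<Sum>i\<le>Suc k. ?s k i) = ?s k 0 + (\<Sum>i\<le>k. ?s k (Suc i))" by (rule sum.atMost_Suc_shift)
    then show ?thesis unfolding Suc.IH sum_distrib_left by (simp del: sum.atMost_Suc)
  qed
  also have "(\<Sum>i\<le>Suc k. ?s k i) = charlier y k j" unfolding Suc.IH by simp
  finally show ?case by simp
qed simp

lemma charlier_bound: "\<bar>charlier y k j\<bar> \<le> (1 + \<bar>y\<bar> * real j) ^ k"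
proof (induction k arbitrary: j)
  case (Suc k)
  have "\<bar>charlier y (Suc k) j\<bar> \<le> \<bar>charlier y k j\<bar> + \<bar>y\<bar> * real j * \<bar>charlier y k (j - 1)\<bar>"
    by (simp add: order_trans[OF abs_triangle_ineq] abs_mult)
  also have "\<dots> \<le> (1 + \<bar>y\<bar> * real j) ^ k + \<bar>y\<bar> * real j * (1 + \<bar>y\<bar> * real j) ^ k"
  proof (intro add_mono mult_left_mono Suc.IH order_trans[OF Suc.IH])
    show "(1 + \<bar>y\<bar> * real (j - 1)) ^ k \<le> (1 + \<bar>y\<bar> * real j) ^ k"
      by (intro power_mono add_left_mono mult_left_mono) auto
  qed auto
  finally show ?case by (simp add: algebra_simps)
qed simp

text \<open>A geometric bound in \<open>j\<close> is all that convergence against the weights x^j /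
  j! asks for.\<close>

lemma charlier_le_exp: "\<bar>charlier y k j\<bar> \<le> exp (real k * \<bar>y\<bar>) ^ j"
proof -
  have "\<bar>charlier y k j\<bar> \<le> (1 + \<bar>y\<bar> * real j) ^ k" by (rule charlier_bound)
  also have "\<dots> \<le> exp (\<bar>y\<bar> * real j) ^ k" by (intro power_mono exp_ge_add_one_self) auto
  also have "\<dots> = exp (real k * \<bar>y\<bar>) ^ j" by (simp add: exp_of_nat_mult[symmetric] mult_ac)
  finally show ?thesis .
qed

lemma summable_exp_weight:
  fixes x c :: real
  assumes "\<And>j. \<bar>f j\<bar> \<le> C * c ^ j"
  shows "summable (\<lambda>j. x ^ j / fact j * f j)"
proof (rule summable_comparison_test')
  show "summable (\<lambda>j. C * ((\<bar>x\<bar> * c) ^ j / fact j))"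
    using summable_exp[of "\<bar>x\<bar> * c"] by (intro summable_mult) (simp add: divide_inverse mult.commute)
  fix j
  show "norm (x ^ j / fact j * f j) \<le> C * ((\<bar>x\<bar> * c) ^ j / fact j)"
    using mult_left_mono[OF assms, of "\<bar>x\<bar> ^ j / fact j" j]
    by (simp add: abs_mult power_abs power_mult_distrib mult_ac)
qed

text \<open>Summation by parts. The recursion is inserted in one of the two factors; as
  \<open>y = - 1 / x\<close>, the factor \<open>y * j\<close> turns the weight at \<open>j\<close>
  into minus the weight at \<open>j - 1\<close>. After a shift the two sums combine to a difference
  in \<open>j\<close>, and \<open>charlier_diff\<close> leaves \<open>Suc k / x\<close> times the
  norm for \<open>k\<close>.\<close>

lemma charlier_norm:
  assumes x: "0 < x"
  shows "(\<lambda>j. x ^ j / fact j * (charlier (- 1 / x) k j)\<^sup>2) sums (fact k / x ^ k * exp x)"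
proof (induction k)
  case 0
  show ?case using exp_converges[of x] by (simp add: divide_inverse mult.commute)
next
  case (Suc k)
  let ?y = "- 1 / x"
  let ?C = "charlier ?y"
  let ?w = "\<lambda>j. x ^ j / fact j"
  let ?e = "exp (real k * \<bar>?y\<bar>)" and ?e' = "exp (real (Suc k) * \<bar>?y\<bar>)"
  have s1: "summable (\<lambda>j. ?w j * (?C k j * ?C (Suc k) j))"
  proof (rule summable_exp_weight[where C = 1 and c = "?e * ?e'"])
    show "\<bar>?C k j * ?C (Suc k) j\<bar> \<le> 1 * (?e * ?e') ^ j" for j
      unfolding abs_mult power_mult_distrib mult_1 by (intro mult_mono charlier_le_exp) auto
  qed
  have s2: "summable (\<lambda>j. ?w j * (?C k j * ?C (Suc k) (Suc j)))"
  proof (rule summable_exp_weight[where C = ?e' and c = "?e * ?e'"])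
    show "\<bar>?C k j * ?C (Suc k) (Suc j)\<bar> \<le> ?e' * (?e * ?e') ^ j" for j
    proof -
      have "\<bar>?C k j * ?C (Suc k) (Suc j)\<bar> \<le> ?e ^ j * ?e' ^ Suc j"
        unfolding abs_mult by (intro mult_mono charlier_le_exp) auto
      then show ?thesis by (simp add: power_mult_distrib mult_ac del: charlier.simps)
    qed
  qed
  define t where "t j = ?w j * (?y * real j * ?C k (j - 1) * ?C (Suc k) j)" for j
  have "(\<lambda>j. - (?w j * (?C k j * ?C (Suc k) (Suc j)))) sums (- (\<Sum>j. ?w j * (?C k j * ?C (Suc k) (Suc j))))"
    using summable_sums[OF s2] by (rule sums_minus)
  moreover have "- (?w j * (?C k j * ?C (Suc k) (Suc j))) = t (Suc j)" for j
    using x by (simp add: t_def field_simps del: charlier.simps of_nat_Suc)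
  ultimately have "(\<lambda>j. t (Suc j)) sums (- (\<Sum>j. ?w j * (?C k j * ?C (Suc k) (Suc j))))" by simp
  then have "t sums (- (\<Sum>j. ?w j * (?C k j * ?C (Suc k) (Suc j))) + t 0)" by (rule sums_Suc)
  then have "t sums (- (\<Sum>j. ?w j * (?C k j * ?C (Suc k) (Suc j))))" by (simp add: t_def)
  with summable_sums[OF s1] have "(\<lambda>j. ?w j * (?C k j * ?C (Suc k) j) + t j) sums
     ((\<Sum>j. ?w j * (?C k j * ?C (Suc k) j)) + - (\<Sum>j. ?w j * (?C k j * ?C (Suc k) (Suc j))))"
    by (rule sums_add)
  moreover have "?w j * (?C k j * ?C (Suc k) j) + t j = ?w j * (?C (Suc k) j)\<^sup>2" for j
    unfolding t_def power2_eq_square by (subst (4) charlier.simps(2)) (simp add: algebra_simps del: charlier.simps)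
  moreover have "(\<Sum>j. ?w j * (?C k j * ?C (Suc k) j)) + - (\<Sum>j. ?w j * (?C k j * ?C (Suc k) (Suc j)))
     = fact (Suc k) / x ^ Suc k * exp x"
  proof -
    have "(\<Sum>j. ?w j * (?C k j * ?C (Suc k) (Suc j))) - (\<Sum>j. ?w j * (?C k j * ?C (Suc k) j))
      = (\<Sum>j. ?w j * (?C k j * ?C (Suc k) (Suc j)) - ?w j * (?C k j * ?C (Suc k) j))"
      by (rule suminf_diff[OF s2 s1])
    also have "\<dots> = (\<Sum>j. ?y * real (Suc k) * (?w j * (?C k j)\<^sup>2))"
    proof (rule suminf_cong)
      fix j
      have "?w j * (?C k j * ?C (Suc k) (Suc j)) - ?w j * (?C k j * ?C (Suc k) j) = ?w j * ?C k j * (?C (Suc k) (Suc j) - ?C (Suc k) j)"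
        by (simp add: algebra_simps del: charlier.simps)
      then show "?w j * (?C k j * ?C (Suc k) (Suc j)) - ?w j * (?C k j * ?C (Suc k) j) = ?y * real (Suc k) * (?w j * (?C k j)\<^sup>2)"
        unfolding charlier_diff by (simp add: power2_eq_square mult_ac del: charlier.simps)
    qed
    also have "\<dots> = ?y * real (Suc k) * (fact k / x ^ k * exp x)"
      using sums_mult[OF Suc.IH, of "?y * real (Suc k)"] by (simp only: sums_unique[symmetric])
    finally show ?thesis using x by (simp add: field_simps)
  qed
  ultimately show ?case by simp
qed

lemma lag_poly_0_bound:
  assumes x: "0 \<le> x"
  shows "\<bar>poly (lag_poly 0 k) x\<bar> * exp (- (x / 2)) \<le> 1"
proof (cases "x = 0")
  case True
  have "poly (lag_poly 0 k) 0 = 1" by (simp add: poly_0_coeff_0 coeff_lag_poly)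
  then show ?thesis using True by simp
next
  case False
  then have x: "0 < x" using x by simp
  define y where y: "y = - 1 / x"
  have "charlier y k k = (\<Sum>i\<le>k. real (k choose i) * real (k choose i) * fact i * y ^ i)" by (rule charlier_eq)
  \<comment> \<open>Reversing the sum exchanges the powers of \<open>y = - 1 / x\<close> for powers
    of \<open>x\<close>, up to the common factor \<open>y ^ k\<close>.\<close>
  also have "\<dots> = (\<Sum>i\<le>k. real (k choose (k - i)) * real (k choose (k - i)) * fact (k - i) * y ^ (k - i))"
    by (rule sum.reindex_bij_witness[of _ "\<lambda>i. k - i" "\<lambda>i. k - i"]) auto
  also have "\<dots> = (\<Sum>i\<le>k. fact k * y ^ k * ((- 1) ^ i * real (k choose (k - i)) / fact i * x ^ i))"
  proof (rule sum.cong)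
    fix i assume "i \<in> {..k}"
    then have i: "i \<le> k" by simp
    have "real (k choose (k - i)) * fact (k - i) = fact k / fact i"
      using i by (simp add: binomial_symmetric[symmetric] binomial_fact)
    moreover have "y ^ (k - i) = y ^ k * ((- 1) ^ i * x ^ i)"
    proof -
      have "y ^ k = y ^ (k - i) * y ^ i" using i by (simp flip: power_add)
      moreover have "y ^ i * ((- 1) ^ i * x ^ i) = 1"
        using x by (simp add: y flip: power_mult_distrib)
      ultimately show ?thesis by (simp add: mult.assoc)
    qed
    ultimately show "real (k choose (k - i)) * real (k choose (k - i)) * fact (k - i) * y ^ (k - i) =
        fact k * y ^ k * ((- 1) ^ i * real (k choose (k - i)) / fact i * x ^ i)"
      by (simp add: mult.assoc)
  qed simp
  also have "\<dots> = fact k * y ^ k * poly (lag_poly 0 k) x"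
    unfolding poly_lag_poly sum_distrib_left by simp
  finally have C: "charlier y k k = fact k * y ^ k * poly (lag_poly 0 k) x" .
  note norm = charlier_norm[OF x, of k, folded y]
  have "(\<Sum>j\<in>{k}. x ^ j / fact j * (charlier y k j)\<^sup>2) \<le> fact k / x ^ k * exp x"
    unfolding sums_unique[OF norm]
    by (rule sum_le_suminf[OF sums_summable[OF norm]]) (use x in auto)
  then have "x ^ k / fact k * (charlier y k k)\<^sup>2 \<le> fact k / x ^ k * exp x"
    by simp
  moreover have "x ^ k / fact k * (charlier y k k)\<^sup>2 = fact k / x ^ k * (poly (lag_poly 0 k) x)\<^sup>2"
  proof -
    have "y * x = - 1" using x by (simp add: y)
    then have "y ^ k * x ^ k = (- 1) ^ k" by (metis power_mult_distrib)
    then have "(y ^ k * x ^ k) * (y ^ k * x ^ k) = 1" by simp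
    then have "(y ^ k)\<^sup>2 * (x ^ k)\<^sup>2 = 1" by (simp only: power2_eq_square mult_ac)
    then have z: "x ^ k * (y ^ k)\<^sup>2 = 1 / x ^ k" using x by (simp add: field_simps power2_eq_square)
    have "x ^ k / fact k * (charlier y k k)\<^sup>2 = fact k * (poly (lag_poly 0 k) x)\<^sup>2 * (x ^ k * (y ^ k)\<^sup>2)"
      unfolding C by (simp add: power_mult_distrib power2_eq_square)
    then show ?thesis unfolding z by simp
  qed
  moreover have "0 < fact k / x ^ k" using x by simp
  ultimately have "(poly (lag_poly 0 k) x)\<^sup>2 \<le> exp x"
    by (metis mult_le_cancel_left_pos)
  also have "exp x = (exp (x / 2))\<^sup>2" by (simp flip: exp_double)
  finally have "\<bar>poly (lag_poly 0 k) x\<bar> \<le> exp (x / 2)" by (simp add: abs_le_square_iff[symmetric])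
  then show ?thesis by (simp add: exp_minus field_simps)
qed

text \<open>The bounds for \<open>d\<close> add up by the hockey-stick identity, so the right-hand
  side remains the value of the polynomial at 0. That value is the ray weight, which is why the
  normalized kernel is bounded by 1.\<close>

lemma lag_poly_bound:
  assumes x: "0 \<le> x"
  shows "\<bar>poly (lag_poly d k) x\<bar> * exp (- (x / 2)) \<le> real ((k + d) choose d)"
proof (induction d arbitrary: k)
  case 0
  show ?case using lag_poly_0_bound[OF x] by simp
next
  case (Suc d)
  have "\<bar>poly (lag_poly (Suc d) k) x\<bar> \<le> (\<Sum>i\<le>k. \<bar>poly (lag_poly d i) x\<bar>)"
    unfolding lag_poly_Suc_sum poly_sum by (rule sum_abs)
  then have "\<bar>poly (lag_poly (Suc d) k) x\<bar> * exp (- (x / 2)) \<le> (\<Sum>i\<le>k. \<bar>poly (lag_poly d i) x\<bar>) * exp (- (x / 2))"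
    by (rule mult_right_mono) simp
  also have "\<dots> \<le> (\<Sum>i\<le>k. real ((i + d) choose d))"
    unfolding sum_distrib_right by (intro sum_mono Suc.IH)
  also have "\<dots> = real (\<Sum>i\<le>k. ((d + i) choose d))" by (simp add: add.commute)
  also have "(\<Sum>i\<le>k. ((d + i) choose d)) = Suc (d + k) choose Suc d"
    by (induction k) (simp_all)
  finally show ?case by (simp add: add.commute del: binomial_Suc_Suc)
qed

section \<open>Generating functions\<close>

lemma sums_partial_sums:
  fixes a :: "nat \<Rightarrow> complex"
  assumes a: "\<And>w. norm w < 1 \<Longrightarrow> (\<lambda>k. a k * w ^ k) sums F w" and w: "norm w < 1"
  shows "(\<lambda>k. (\<Sum>j\<le>k. a j) * w ^ k) sums (F w / (1 - w))"
proof -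
  \<comment> \<open>Convergence at a larger radius gives absolute convergence at \<open>w\<close>,
    which the Cauchy product requires.\<close>
  obtain r where r: "norm w < r" "r < 1" using dense[OF w] by auto
  have "0 < r" using r norm_ge_zero[of w] by linarith
  then have "norm (of_real r :: complex) = r" by simp
  then have 1: "summable (\<lambda>k. norm (a k * w ^ k))"
    using powser_insidea[of a "of_real r" w] a[of "of_real r"] r by (auto simp: sums_iff)
  have 2: "summable (\<lambda>k. norm (w ^ k))" using w by (simp add: norm_power summable_geometric)
  have "(\<lambda>k. \<Sum>i\<le>k. (a i * w ^ i) * w ^ (k - i)) sums ((\<Sum>k. a k * w ^ k) * (\<Sum>k. w ^ k))"
    by (rule Cauchy_product_sums[OF 1 2])
  moreover have "(\<Sum>i\<le>k. (a i * w ^ i) * w ^ (k - i)) = (\<Sum>j\<le>k. a j) * w ^ k" for k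
    unfolding sum_distrib_right by (intro sum.cong) (auto simp: mult.assoc simp flip: power_add)
  moreover have "(\<Sum>k. a k * w ^ k) = F w" using a[OF w] by (simp add: sums_iff)
  moreover have "(\<Sum>k. w ^ k) = 1 / (1 - w)" using suminf_geometric[OF w] .
  ultimately show ?thesis by simp
qed

lemma sums_binomial_lower:
  fixes w :: complex
  assumes "norm w < 1"
  shows "(\<lambda>m. of_nat (m + i choose i) * w ^ m) sums (1 / (1 - w) ^ Suc i)"
  using assms
proof (induction i arbitrary: w)
  case 0
  then show ?case using geometric_sums[of w] by simp
next
  case (Suc i)
  have "(\<lambda>k. (\<Sum>j\<le>k. of_nat (j + i choose i)) * w ^ k) sums (1 / (1 - w) ^ Suc i / (1 - w))"
    by (rule sums_partial_sums) (use Suc in auto)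
  moreover have "(\<Sum>j\<le>k. of_nat (j + i choose i)) = (of_nat (k + Suc i choose Suc i) :: complex)" for k
    by (induction k) (simp_all add: add_ac)
  ultimately show ?case by (simp add: divide_divide_eq_left mult.commute)
qed

lemma sums_binomial:
  fixes w :: complex
  assumes "norm w < 1"
  shows "(\<lambda>k. of_nat (k choose i) * w ^ k) sums (w ^ i / (1 - w) ^ Suc i)"
proof -
  have "(\<lambda>m. w ^ i * (of_nat (m + i choose i) * w ^ m)) sums (w ^ i * (1 / (1 - w) ^ Suc i))"
    by (intro sums_mult sums_binomial_lower assms)
  then have "(\<lambda>m. of_nat (m + i choose i) * w ^ (m + i)) sums (w ^ i / (1 - w) ^ Suc i)"
    by (simp add: power_add mult_ac)
  moreover have "(\<Sum>k<i. of_nat (k choose i) * w ^ k) = (0 :: complex)" by (intro sum.neutral) auto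
  ultimately show ?thesis using sums_iff_shift[of "\<lambda>k. of_nat (k choose i) * w ^ k" i "w ^ i / (1 - w) ^ Suc i"] by simp
qed

text \<open>After inserting the coefficients the sum over \<open>k\<close> is taken first: x^i
  collects the factor w^i / (1 - w)^(i + 1), and an exponential series in \<open>i\<close> remains.
  The exchange is justified by the same computation with absolute values, where
  \<open>norm w\<close> replaces \<open>w\<close>.\<close>

lemma lag_poly_0_generating:
  fixes w :: complex and x :: real
  assumes w: "norm w < 1"
  shows "(\<lambda>k. of_real (poly (lag_poly 0 k) x) * w ^ k) sums (exp (- of_real x * w / (1 - w)) / (1 - w))"
proof -
  define f where "f i k = (- of_real x) ^ i / fact i * (of_nat (k choose i) * w ^ k)" for i k :: nat
  define z where "z = - of_real x * w / (1 - w)"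
  have w1: "1 - w \<noteq> 0" using w by auto
  have norm_f: "norm (f i k) = \<bar>x\<bar> ^ i / fact i * (real (k choose i) * norm w ^ k)" for i k
    by (simp add: f_def norm_mult norm_divide norm_power)
  have rown: "((\<lambda>k. norm (f i k)) has_sum (\<bar>x\<bar> ^ i / fact i * (norm w ^ i / (1 - norm w) ^ Suc i))) UNIV" for i
  proof -
    have "(\<lambda>k. of_real (real (k choose i) * norm w ^ k) :: complex) sums of_real (norm w ^ i / (1 - norm w) ^ Suc i)"
      using sums_binomial[of "of_real (norm w)" i] w by simp
    then have "(\<lambda>k. real (k choose i) * norm w ^ k) sums (norm w ^ i / (1 - norm w) ^ Suc i)"
      by (simp only: sums_of_real_iff)
    then have "(\<lambda>k. norm (f i k)) sums (\<bar>x\<bar> ^ i / fact i * (norm w ^ i / (1 - norm w) ^ Suc i))"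
      unfolding norm_f by (rule sums_mult)
    then show ?thesis by (intro norm_summable_imp_has_sum) (auto simp: sums_iff)
  qed
  have row: "((\<lambda>k. f i k) has_sum (z ^ i / fact i / (1 - w))) UNIV" for i
  proof (rule norm_summable_imp_has_sum)
    show "summable (\<lambda>k. norm (f i k))" using rown[of i] has_sum_imp_sums sums_summable by blast
    have "(\<lambda>k. f i k) sums ((- of_real x) ^ i / fact i * (w ^ i / (1 - w) ^ Suc i))"
      unfolding f_def by (intro sums_mult sums_binomial w)
    then show "(\<lambda>k. f i k) sums (z ^ i / fact i / (1 - w))"
    proof -
      have "z = - of_real x * (w / (1 - w))" by (simp add: z_def)
      then have "z ^ i = (- of_real x) ^ i * (w ^ i / (1 - w) ^ i)" by (simp only: power_mult_distrib power_divide)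
      then show ?thesis using \<open>f i sums _\<close> by (simp add: mult_ac)
    qed
  qed
  have "(\<lambda>x. norm (case x of (i, k) \<Rightarrow> f i k)) summable_on (UNIV \<times> UNIV)"
  proof (subst Infinite_Sum.abs_summable_on_Sigma_iff, intro conjI ballI)
    fix i show "(\<lambda>k. norm (case (i, k) of (i, k) \<Rightarrow> f i k)) summable_on UNIV"
      using rown[of i] by (auto simp: summable_on_def)
  next
    have eq: "(\<Sum>\<^sub>\<infinity>k. norm (case (i, k) of (i, k) \<Rightarrow> f i k)) = (\<bar>x\<bar> * norm w / (1 - norm w)) ^ i / fact i / (1 - norm w)" for i
      using infsumI[OF rown[of i]] by (simp add: power_divide power_mult_distrib mult_ac)
    have "summable (\<lambda>i. norm (norm ((\<bar>x\<bar> * norm w / (1 - norm w)) ^ i / fact i / (1 - norm w))))"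
      using summable_exp[of "\<bar>x\<bar> * norm w / (1 - norm w)"] w
      by (simp add: divide_inverse mult.commute summable_mult2 abs_mult)
    then show "(\<lambda>i. norm (\<Sum>\<^sub>\<infinity>k. norm (case (i, k) of (i, k) \<Rightarrow> f i k))) summable_on UNIV"
      unfolding eq by (intro norm_summable_imp_summable_on) simp
  qed
  then have sm: "(\<lambda>(i, k). f i k) summable_on (UNIV \<times> UNIV)"
    by (rule abs_summable_summable)
  have "((\<lambda>i. z ^ i / fact i / (1 - w)) has_sum (exp z / (1 - w))) UNIV"
  proof (rule norm_summable_imp_has_sum)
    have "summable (\<lambda>i. norm (z ^ i / fact i) * norm (inverse (1 - w)))"
      using summable_norm_exp[of z] by (intro summable_mult2) (simp add: divide_inverse mult.commute scaleR_conv_of_real norm_mult)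
    then show "summable (\<lambda>i. norm (z ^ i / fact i / (1 - w)))" by (simp add: norm_divide divide_inverse norm_mult norm_inverse)
    show "(\<lambda>i. z ^ i / fact i / (1 - w)) sums (exp z / (1 - w))"
      using exp_converges[of z] by (intro sums_divide) (simp add: scaleR_conv_of_real divide_inverse mult.commute)
  qed
  then have tot: "(\<Sum>\<^sub>\<infinity>i. \<Sum>\<^sub>\<infinity>k. f i k) = exp z / (1 - w)"
    using infsumI[OF row] by (simp add: infsumI)
  have col: "(\<Sum>\<^sub>\<infinity>i. f i k) = of_real (poly (lag_poly 0 k) x) * w ^ k" for k
  proof -
    have "(\<Sum>\<^sub>\<infinity>i. f i k) = (\<Sum>\<^sub>\<infinity>i\<in>{..k}. f i k)"
      by (rule infsum_cong_neutral) (auto simp: f_def)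
    also have "\<dots> = (\<Sum>i\<le>k. f i k)" by simp
    also have "\<dots> = (\<Sum>i\<le>k. of_real ((- 1) ^ i * real (k choose (k - i)) / fact i * x ^ i) * w ^ k)"
      by (intro sum.cong) (auto simp: f_def binomial_symmetric[symmetric] power_minus[of "of_real x"])
    finally show ?thesis by (simp add: poly_lag_poly sum_distrib_right)
  qed
  have "(\<lambda>k. \<Sum>\<^sub>\<infinity>i. f i k) summable_on UNIV"
  proof (rule summable_on_Sigma_banach)
    have "(\<lambda>(k, i). f i k) = (\<lambda>(i, k). f i k) \<circ> prod.swap" by auto
    moreover have "((\<lambda>(i, k). f i k) \<circ> prod.swap) summable_on UNIV"
      using sm summable_on_reindex_bij_betw[OF bij_swap, of "\<lambda>(i, k). f i k"] by (simp add: comp_def)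
    ultimately show "(\<lambda>(k, i). f i k) summable_on (SIGMA k:UNIV. UNIV)" by simp
  qed
  then have "((\<lambda>k. of_real (poly (lag_poly 0 k) x) * w ^ k) has_sum (\<Sum>\<^sub>\<infinity>k. \<Sum>\<^sub>\<infinity>i. f i k)) UNIV"
    unfolding col[symmetric] by (rule has_sum_infsum)
  moreover have "(\<Sum>\<^sub>\<infinity>k. \<Sum>\<^sub>\<infinity>i. f i k) = exp z / (1 - w)"
    using infsum_swap_banach[OF sm] tot by simp
  ultimately show ?thesis unfolding z_def by (simp add: has_sum_imp_sums)
qed

lemma lag_poly_generating:
  fixes w :: complex and x :: real
  assumes "norm w < 1"
  shows "(\<lambda>k. of_real (poly (lag_poly d k) x) * w ^ k) sums (exp (- of_real x * w / (1 - w)) / (1 - w) ^ Suc d)"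
  using assms
proof (induction d arbitrary: w)
  case 0
  then show ?case using lag_poly_0_generating by simp
next
  case (Suc d)
  have "(\<lambda>k. (\<Sum>j\<le>k. of_real (poly (lag_poly d j) x)) * w ^ k) sums (exp (- of_real x * w / (1 - w)) / (1 - w) ^ Suc d / (1 - w))"
    by (rule sums_partial_sums) (use Suc in auto)
  then show ?case by (simp add: lag_poly_Suc_sum poly_sum divide_divide_eq_left mult.commute)
qed

section \<open>Gaussian integrals\<close>

text \<open>The characteristic function of the standard normal distribution, rescaled by the
  standard deviation \<open>c\<close> of this Gaussian.\<close>

lemma gauss_cis_real:
  fixes a d :: real
  assumes a: "0 < a"
  shows "integrable lborel (\<lambda>x. of_real (exp (- a * x\<^sup>2)) * cis (d * x))" (is "integrable _ ?f")
    and "(LINT x|lborel. of_real (exp (- a * x\<^sup>2)) * cis (d * x)) = of_real (sqrt (pi / a) * exp (- (d\<^sup>2 / (4 * a))))"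
proof -
  define c where "c = 1 / sqrt (2 * a)"
  have c: "0 < c" "c\<^sup>2 = 1 / (2 * a)" using a by (simp_all add: c_def power_divide)
  have char: "(LINT x|lborel. std_normal_density x *\<^sub>R cis (t * x)) = of_real (exp (- (t\<^sup>2) / 2))" for t
    using fun_cong[OF char_std_normal_distribution, of t]
    by (simp add: char_def integral_density cis_conv_exp mult.commute)
  have int: "integrable lborel (\<lambda>x. std_normal_density x *\<^sub>R cis (t * x))" for t
  proof (rule Bochner_Integration.integrable_bound[of _ std_normal_density])
    show "integrable lborel std_normal_density" by simp
    show "(\<lambda>x. std_normal_density x *\<^sub>R cis (t * x)) \<in> borel_measurable lborel"
      unfolding cis_conv_exp by measurable
  qed simp
  let ?t = "d * c"
  have scale: "(std_normal_density (x / c)) *\<^sub>R cis (?t * (x / c)) = (1 / sqrt (2 * pi)) *\<^sub>R ?f x" for x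
    using c a by (simp add: std_normal_density_def power_divide scaleR_conv_of_real field_simps)
  have i1: "integrable lborel (\<lambda>x. (1 / sqrt (2 * pi)) *\<^sub>R ?f x)"
    using lborel_integrable_real_affine[OF int[of ?t], of "1 / c" 0] c(1) unfolding scale[symmetric] by simp
  have "integrable lborel (\<lambda>x. sqrt (2 * pi) *\<^sub>R ((1 / sqrt (2 * pi)) *\<^sub>R ?f x))"
    by (intro integrable_scaleR_right i1)
  then show "integrable lborel ?f" by simp
  have "of_real (exp (- (?t\<^sup>2) / 2)) = \<bar>1 / c\<bar> *\<^sub>R (LINT x|lborel. std_normal_density (0 + (1 / c) * x) *\<^sub>R cis (?t * (0 + (1 / c) * x)))"
    unfolding char[symmetric] using c(1) by (intro lborel_integral_real_affine) simp
  also have "\<dots> = (1 / c) *\<^sub>R ((1 / sqrt (2 * pi)) *\<^sub>R (LINT x|lborel. ?f x))"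
  proof -
    have "(LINT x|lborel. std_normal_density (0 + (1 / c) * x) *\<^sub>R cis (?t * (0 + (1 / c) * x))) = (LINT x|lborel. (1 / sqrt (2 * pi)) *\<^sub>R ?f x)"
      by (intro Bochner_Integration.integral_cong refl) (simp only: add_0 times_divide_eq_left mult_1 scale)
    moreover have "\<bar>1 / c\<bar> = 1 / c" using c(1) by simp
    ultimately show ?thesis by (simp only: integral_scaleR_right)
  qed
  finally have "(LINT x|lborel. ?f x) = of_real (c * sqrt (2 * pi) * exp (- (?t\<^sup>2) / 2))"
    using c(1) by (simp add: scaleR_conv_of_real field_simps)
  also have "c * sqrt (2 * pi) = sqrt (pi / a)"
    using a by (simp add: c_def real_sqrt_divide real_sqrt_mult)
  also have "- (?t\<^sup>2) / 2 = - (d\<^sup>2 / (4 * a))"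
    using c(2) by (simp add: power_mult_distrib)
  finally show "(LINT x|lborel. ?f x) = of_real (sqrt (pi / a) * exp (- (d\<^sup>2 / (4 * a))))" .
qed

lemma norm_square_Basis: "(norm (x :: 'a::euclidean_space))\<^sup>2 = (\<Sum>b\<in>Basis. (x \<bullet> b)\<^sup>2)"
  unfolding power2_norm_eq_inner by (subst euclidean_inner) (simp only: power2_eq_square)

lemma gauss_cis:
  fixes d :: "'a::euclidean_space" and a :: real
  assumes a: "0 < a"
  shows "integrable lborel (\<lambda>x. of_real (exp (- a * (norm x)\<^sup>2)) * cis (d \<bullet> x))"
    and "(LINT x|lborel. of_real (exp (- a * (norm x)\<^sup>2)) * cis (d \<bullet> x)) =
      of_real (sqrt (pi / a) ^ DIM('a) * exp (- ((norm d)\<^sup>2 / (4 * a))))"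
proof -
  let ?g = "\<lambda>b x. of_real (exp (- a * x\<^sup>2)) * cis ((d \<bullet> b) * x)"
  interpret product_sigma_finite "\<lambda>_::'a. lborel :: real measure" ..
  have split: "of_real (exp (- a * (norm x)\<^sup>2)) * cis (d \<bullet> x) = (\<Prod>b\<in>Basis. ?g b (x \<bullet> b))" for x :: 'a
  proof -
    have e: "exp (- a * (norm x)\<^sup>2) = (\<Prod>b\<in>Basis. exp (- a * (x \<bullet> b)\<^sup>2))"
      by (simp only: norm_square_Basis sum_distrib_left exp_sum[OF finite_Basis])
    have c: "cis (sum f A) = (\<Prod>b\<in>A. cis (f b))" if "finite A" for f :: "'a \<Rightarrow> real" and A
      using that by induction (simp_all add: cis_mult[symmetric])
    have "cis (d \<bullet> x) = (\<Prod>b\<in>Basis. cis ((d \<bullet> b) * (x \<bullet> b)))"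
      by (subst euclidean_inner) (rule c[OF finite_Basis])
    then show ?thesis unfolding e by (simp only: of_real_prod prod.distrib)
  qed
  have m [measurable]: "(\<lambda>x::'a. of_real (exp (- a * (norm x)\<^sup>2)) * cis (d \<bullet> x)) \<in> borel_measurable borel"
    unfolding cis_conv_exp by measurable
  have ev: "(\<Sum>b'\<in>Basis. f b' *\<^sub>R b') \<bullet> b = f b" if "b \<in> Basis" for f and b :: 'a
    using that by (simp add: inner_sum_left inner_Basis if_distrib sum.delta cong: if_cong)
  have e: "(\<Prod>b\<in>Basis. ?g b ((\<Sum>b'\<in>Basis. f b' *\<^sub>R b') \<bullet> b)) = (\<Prod>b\<in>Basis. ?g b (f b))" for f :: "'a \<Rightarrow> real"
    by (intro prod.cong) (auto simp: ev)
  have mm: "(\<lambda>f. \<Sum>b\<in>Basis. f b *\<^sub>R b :: 'a) \<in> measurable (\<Pi>\<^sub>M b\<in>Basis. lborel) borel" by measurable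
  have "integrable (\<Pi>\<^sub>M b\<in>(Basis::'a set). lborel) (\<lambda>f. \<Prod>b\<in>Basis. ?g b (f b))"
    by (intro product_integrable_prod gauss_cis_real a finite_Basis)
  then show "integrable lborel (\<lambda>x::'a. of_real (exp (- a * (norm x)\<^sup>2)) * cis (d \<bullet> x))"
    by (subst lborel_eq, subst integrable_distr_eq[OF mm m]) (simp only: split e)
  have "(LINT x|lborel. of_real (exp (- a * (norm x)\<^sup>2)) * cis (d \<bullet> x)) = (LINT f|(\<Pi>\<^sub>M b\<in>(Basis::'a set). lborel). (\<Prod>b\<in>Basis. ?g b (f b)))"
    by (subst lborel_eq, subst integral_distr[OF mm m]) (simp only: split e)
  also have "\<dots> = (\<Prod>b\<in>Basis. of_real (sqrt (pi / a) * exp (- ((d \<bullet> b)\<^sup>2 / (4 * a)))))"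
  proof -
    have "(LINT f|(\<Pi>\<^sub>M b\<in>(Basis::'a set). lborel). (\<Prod>b\<in>Basis. ?g b (f b))) = (\<Prod>b\<in>(Basis::'a set). LINT x|lborel. ?g b x)"
      by (rule product_integral_prod[OF finite_Basis]) (rule gauss_cis_real(1)[OF a])
    then show ?thesis by (simp only: gauss_cis_real(2)[OF a])
  qed
  also have "\<dots> = of_real (sqrt (pi / a) ^ DIM('a) * (\<Prod>b\<in>(Basis::'a set). exp (- ((d \<bullet> b)\<^sup>2 / (4 * a)))))"
    by (simp add: prod.distrib)
  also have "(\<Prod>b\<in>(Basis::'a set). exp (- ((d \<bullet> b)\<^sup>2 / (4 * a)))) = exp (- ((norm d)\<^sup>2 / (4 * a)))"
    by (simp only: exp_sum[OF finite_Basis, symmetric] sum_negf sum_divide_distrib[symmetric] norm_square_Basis)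
  finally show "(LINT x|lborel. of_real (exp (- a * (norm x)\<^sup>2)) * cis (d \<bullet> x)) =
      of_real (sqrt (pi / a) ^ DIM('a) * exp (- ((norm d)\<^sup>2 / (4 * a))))" .
qed

lemma nn_integral_gauss:
  assumes a: "0 < a"
  shows "(\<integral>\<^sup>+ x. ennreal (exp (- a * (norm (x :: 'a::euclidean_space))\<^sup>2)) \<partial>lborel) = ennreal (sqrt (pi / a) ^ DIM('a))"
proof -
  have i: "complex_integrable lborel (\<lambda>x::'a. of_real (exp (- a * (norm x)\<^sup>2)))"
    using gauss_cis(1)[OF a, of "0::'a"] by simp
  then have ir: "integrable lborel (\<lambda>x::'a. exp (- a * (norm x)\<^sup>2))"
    using integrable_norm[OF i] by simp
  have "of_real (LINT x|lborel. exp (- a * (norm (x::'a))\<^sup>2)) = (of_real (sqrt (pi / a) ^ DIM('a)) :: complex)"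
  proof -
    have "of_real (LINT x|lborel. exp (- a * (norm (x::'a))\<^sup>2)) = (LINT x|lborel. complex_of_real (exp (- a * (norm (x::'a))\<^sup>2)))"
      by (rule integral_complex_of_real[symmetric])
    also have "\<dots> = (LINT x|lborel. complex_of_real (exp (- a * (norm (x::'a))\<^sup>2)) * cis (0 \<bullet> x))"
      by (simp only: inner_zero_left cis_zero mult_1_right)
    also have "\<dots> = of_real (sqrt (pi / a) ^ DIM('a))"
      unfolding gauss_cis(2)[OF a] by simp
    finally show ?thesis .
  qed
  then have "(LINT x|lborel. exp (- a * (norm (x::'a))\<^sup>2)) = sqrt (pi / a) ^ DIM('a)"
    using of_real_eq_iff by blast
  then show ?thesis using nn_integral_eq_integral[OF ir] by simp
qed

lemma lborel_integral_shift:
  fixes f :: "'a::euclidean_space \<Rightarrow> 'b::{banach, second_countable_topology}"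
  assumes "f \<in> borel_measurable borel"
  shows "(LINT x|lborel. f (c + x)) = (LINT x|lborel. f x)"
proof -
  have "(LINT x|lborel. f x) = (LINT x|distr lborel borel ((+) c). f x)" by (simp add: lborel_distr_plus)
  also have "\<dots> = (LINT x|lborel. f (c + x))" using assms by (subst integral_distr) auto
  finally show ?thesis by simp
qed

lemma lborel_nn_integral_shift:
  fixes f :: "'a::euclidean_space \<Rightarrow> ennreal"
  assumes "f \<in> borel_measurable borel"
  shows "(\<integral>\<^sup>+ x. f (c + x) \<partial>lborel) = (\<integral>\<^sup>+ x. f x \<partial>lborel)"
proof -
  have "(\<integral>\<^sup>+ x. f x \<partial>lborel) = (\<integral>\<^sup>+ x. f x \<partial>distr lborel borel ((+) c))" by (simp add: lborel_distr_plus)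
  also have "\<dots> = (\<integral>\<^sup>+ x. f (c + x) \<partial>lborel)" using assms by (subst nn_integral_distr) auto
  finally show ?thesis by simp
qed

text \<open>Completing the square by the shift \<open>c\<close> splits off a constant phase, which
  disappears in the modulus.\<close>

lemma gauss_exp_cis:
  fixes b d :: "'a::euclidean_space" and a :: real
  assumes a: "0 < a"
  shows "cmod (LINT x|lborel. of_real (exp (- a * (norm x)\<^sup>2 + b \<bullet> x)) * cis (d \<bullet> x)) =
      sqrt (pi / a) ^ DIM('a) * exp (((norm b)\<^sup>2 - (norm d)\<^sup>2) / (4 * a))"
proof -
  define c where "c = (1 / (2 * a)) *\<^sub>R b"
  have sq: "- a * (norm (c + x))\<^sup>2 + b \<bullet> (c + x) = (norm b)\<^sup>2 / (4 * a) + (- a * (norm x)\<^sup>2)" for x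
    using a by (simp add: c_def power2_norm_eq_inner inner_add_left inner_add_right inner_commute field_simps)
  have "(LINT x|lborel. of_real (exp (- a * (norm x)\<^sup>2 + b \<bullet> x)) * cis (d \<bullet> x)) =
    (LINT x|lborel. of_real (exp (- a * (norm (c + x))\<^sup>2 + b \<bullet> (c + x))) * cis (d \<bullet> (c + x)))"
    by (rule lborel_integral_shift[symmetric]) (unfold cis_conv_exp, measurable)
  also have "\<dots> = (LINT x|lborel. (of_real (exp ((norm b)\<^sup>2 / (4 * a))) * cis (d \<bullet> c)) * (of_real (exp (- a * (norm x)\<^sup>2)) * cis (d \<bullet> x)))"
    unfolding sq by (simp only: inner_add_right exp_add of_real_mult cis_mult[symmetric] mult_ac)
  also have "\<dots> = (of_real (exp ((norm b)\<^sup>2 / (4 * a))) * cis (d \<bullet> c)) * of_real (sqrt (pi / a) ^ DIM('a) * exp (- ((norm d)\<^sup>2 / (4 * a))))"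
    by (simp only: integral_mult_right_zero gauss_cis(2)[OF a])
  finally have "cmod (LINT x|lborel. of_real (exp (- a * (norm x)\<^sup>2 + b \<bullet> x)) * cis (d \<bullet> x)) =
      exp ((norm b)\<^sup>2 / (4 * a)) * (sqrt (pi / a) ^ DIM('a) * exp (- ((norm d)\<^sup>2 / (4 * a))))"
    using a by (simp only: norm_mult norm_of_real norm_cis mult_1_right abs_mult power_abs abs_exp_cancel) simp
  also have "\<dots> = sqrt (pi / a) ^ DIM('a) * (exp ((norm b)\<^sup>2 / (4 * a)) * exp (- ((norm d)\<^sup>2 / (4 * a))))"
    by (simp only: mult_ac)
  also have "exp ((norm b)\<^sup>2 / (4 * a)) * exp (- ((norm d)\<^sup>2 / (4 * a))) = exp (((norm b)\<^sup>2 - (norm d)\<^sup>2) / (4 * a))"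
    by (simp add: exp_add[symmetric] diff_divide_distrib)
  finally show ?thesis .
qed

section \<open>Schur's test for \<open>S\<^sup>* S\<close>\<close>

lemma integrable_mult_pair:
  fixes f :: "'a \<Rightarrow> complex" and h :: "'b \<Rightarrow> complex"
  assumes "sigma_finite_measure M" "sigma_finite_measure N" "integrable M f" "integrable N h"
  shows "integrable (M \<Otimes>\<^sub>M N) (\<lambda>(x, y). f x * h y)"
proof (rule integrableI_bounded)
  interpret M: sigma_finite_measure M by fact
  interpret N: sigma_finite_measure N by fact
  have [measurable]: "f \<in> borel_measurable M" "h \<in> borel_measurable N" using assms by simp_all
  show "(\<lambda>(x, y). f x * h y) \<in> borel_measurable (M \<Otimes>\<^sub>M N)" by measurable
  have "(\<integral>\<^sup>+ z. ennreal (norm (case z of (x, y) \<Rightarrow> f x * h y)) \<partial>(M \<Otimes>\<^sub>M N)) =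
      (\<integral>\<^sup>+ x. \<integral>\<^sup>+ y. ennreal (norm (f x)) * ennreal (norm (h y)) \<partial>N \<partial>M)"
    by (subst N.nn_integral_fst[symmetric]) (auto simp: norm_mult ennreal_mult)
  also have "\<dots> = (\<integral>\<^sup>+ x. ennreal (norm (f x)) \<partial>M) * (\<integral>\<^sup>+ y. ennreal (norm (h y)) \<partial>N)"
    by (simp add: nn_integral_cmult nn_integral_multc)
  also have "\<dots> < \<infinity>" using assms by (auto simp: integrable_iff_bounded ennreal_mult_less_top)
  finally show "(\<integral>\<^sup>+ z. ennreal (norm (case z of (x, y) \<Rightarrow> f x * h y)) \<partial>(M \<Otimes>\<^sub>M N)) < \<infinity>" .
qed

text \<open>The left-hand side is a quadratic form in \<open>g\<close> whose kernel is bounded by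
  the symmetric \<open>q\<close>, and |g x| |g y| is at most half the sum of the squares.
  \<open>D\<close> and \<open>D'\<close> justify Fubini's theorem; the constant is \<open>A\<close>
  alone, so they may degenerate with a parameter while the estimate stays uniform.\<close>

lemma Schur_test_square:
  fixes k :: "'a \<Rightarrow> 'b \<Rightarrow> complex" and q :: "'a \<Rightarrow> 'a \<Rightarrow> real" and A D D' :: real
  assumes "sigma_finite_measure M" "sigma_finite_measure N"
    and km [measurable]: "(\<lambda>(x, w). k x w) \<in> borel_measurable (M \<Otimes>\<^sub>M N)"
    and qm [measurable]: "(\<lambda>(x, y). q x y) \<in> borel_measurable (M \<Otimes>\<^sub>M M)"
    and kD: "\<And>x w. cmod (k x w) \<le> D" and kD': "\<And>x. x \<in> space M \<Longrightarrow> (\<integral>\<^sup>+ w. ennreal (cmod (k x w)) \<partial>N) \<le> ennreal D'"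
    and q: "\<And>x y. x \<in> space M \<Longrightarrow> y \<in> space M \<Longrightarrow> cmod (LINT w|N. k x w * cnj (k y w)) \<le> q x y"
    and qsym: "\<And>x y. q x y = q y x"
    and qA: "\<And>x. x \<in> space M \<Longrightarrow> (\<integral>\<^sup>+ y. ennreal (q x y) \<partial>M) \<le> ennreal A"
    and g: "integrable M g"
  shows "(\<integral>\<^sup>+ w. (ennreal (cmod (LINT x|M. k x w * g x)))\<^sup>2 \<partial>N) \<le> ennreal A * (\<integral>\<^sup>+ x. (ennreal (cmod (g x)))\<^sup>2 \<partial>M)"
proof -
  interpret M: sigma_finite_measure M by fact
  interpret N: sigma_finite_measure N by fact
  interpret MM: pair_sigma_finite M M ..
  interpret P: pair_sigma_finite "M \<Otimes>\<^sub>M M" N ..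
  have [measurable]: "g \<in> borel_measurable M" using g by simp
  have cnj_m: "(\<lambda>x. cnj (h x)) \<in> borel_measurable L" if "h \<in> borel_measurable L" for h and L :: "'c measure"
    using that by (rule measurable_compose) (intro borel_measurable_continuous_onI continuous_intros)
  have kp: "(\<lambda>z. k (f z) (h z)) \<in> borel_measurable L" if "f \<in> measurable L M" "h \<in> measurable L N" for f h and L :: "'c measure"
    using measurable_compose[OF measurable_Pair[OF that] km] by simp
  define S where "S w = (LINT x|M. k x w * g x)" for w
  define F where "F = (\<lambda>((x, y), w). (k x w * g x) * cnj (k y w * g y))"
  have Fm: "F \<in> borel_measurable ((M \<Otimes>\<^sub>M M) \<Otimes>\<^sub>M N)"
    unfolding F_def split_beta' by (intro borel_measurable_times cnj_m kp) measurable
  have D0: "0 \<le> D" using order_trans[OF norm_ge_zero kD[of undefined undefined]] .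
  have gfin: "(\<integral>\<^sup>+ x. ennreal (cmod (g x)) \<partial>M) < top" using g by (simp add: integrable_iff_bounded less_top)
  have Fint: "integrable ((M \<Otimes>\<^sub>M M) \<Otimes>\<^sub>M N) F"
  proof (rule integrableI_bounded[OF Fm])
    have "(\<integral>\<^sup>+ z. ennreal (norm (F z)) \<partial>((M \<Otimes>\<^sub>M M) \<Otimes>\<^sub>M N)) = (\<integral>\<^sup>+ z. \<integral>\<^sup>+ w. ennreal (norm (F (z, w))) \<partial>N \<partial>(M \<Otimes>\<^sub>M M))"
      by (rule N.nn_integral_fst[symmetric]) (use Fm in measurable)
    also have "\<dots> \<le> (\<integral>\<^sup>+ z. ennreal (D * D') * (ennreal (cmod (g (fst z))) * ennreal (cmod (g (snd z)))) \<partial>(M \<Otimes>\<^sub>M M))"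
    proof (rule nn_integral_mono, clarsimp simp: space_pair_measure)
      fix x y assume x: "x \<in> space M" "y \<in> space M"
      have "(\<integral>\<^sup>+ w. ennreal (cmod (F ((x, y), w))) \<partial>N) \<le> (\<integral>\<^sup>+ w. (ennreal D * (ennreal (cmod (g x)) * ennreal (cmod (g y)))) * ennreal (cmod (k x w)) \<partial>N)"
      proof (rule nn_integral_mono)
        fix w
        have "cmod (F ((x, y), w)) = (cmod (g x) * cmod (g y) * cmod (k x w)) * cmod (k y w)"
          by (simp add: F_def norm_mult mult_ac)
        also have "\<dots> \<le> (cmod (g x) * cmod (g y) * cmod (k x w)) * D" by (intro mult_left_mono kD) simp
        finally have "cmod (F ((x, y), w)) \<le> D * (cmod (g x) * cmod (g y)) * cmod (k x w)" by (simp only: mult_ac)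
        then have "ennreal (cmod (F ((x, y), w))) \<le> ennreal (D * (cmod (g x) * cmod (g y)) * cmod (k x w))" by (rule ennreal_leI)
        also have "\<dots> = (ennreal D * (ennreal (cmod (g x)) * ennreal (cmod (g y)))) * ennreal (cmod (k x w))"
          using D0 by (simp add: ennreal_mult)
        finally show "ennreal (cmod (F ((x, y), w))) \<le> (ennreal D * (ennreal (cmod (g x)) * ennreal (cmod (g y)))) * ennreal (cmod (k x w))" .
      qed
      also have "\<dots> = (ennreal D * (ennreal (cmod (g x)) * ennreal (cmod (g y)))) * (\<integral>\<^sup>+ w. ennreal (cmod (k x w)) \<partial>N)"
      proof (rule nn_integral_cmult)
        have [measurable]: "(\<lambda>w. k x w) \<in> borel_measurable N" using x by (intro kp) auto
        show "(\<lambda>w. ennreal (cmod (k x w))) \<in> borel_measurable N" by measurable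
      qed
      also have "\<dots> \<le> (ennreal D * (ennreal (cmod (g x)) * ennreal (cmod (g y)))) * ennreal D'"
        by (intro mult_left_mono kD' x) simp
      finally show "(\<integral>\<^sup>+ w. ennreal (cmod (F ((x, y), w))) \<partial>N) \<le> ennreal (D * D') * (ennreal (cmod (g x)) * ennreal (cmod (g y)))"
        using D0 by (simp add: ennreal_mult' mult_ac)
    qed
    also have "\<dots> = ennreal (D * D') * (\<integral>\<^sup>+ z. ennreal (cmod (g (fst z))) * ennreal (cmod (g (snd z))) \<partial>(M \<Otimes>\<^sub>M M))"
      by (rule nn_integral_cmult) measurable
    also have "(\<integral>\<^sup>+ z. ennreal (cmod (g (fst z))) * ennreal (cmod (g (snd z))) \<partial>(M \<Otimes>\<^sub>M M)) = (\<integral>\<^sup>+ x. \<integral>\<^sup>+ y. ennreal (cmod (g x)) * ennreal (cmod (g y)) \<partial>M \<partial>M)"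
      by (subst M.nn_integral_fst[symmetric]) auto
    also have "\<dots> = (\<integral>\<^sup>+ x. ennreal (cmod (g x)) \<partial>M) * (\<integral>\<^sup>+ x. ennreal (cmod (g x)) \<partial>M)"
      by (simp add: nn_integral_cmult nn_integral_multc)
    also have "ennreal (D * D') * \<dots> < \<infinity>" using gfin by (simp add: ennreal_mult_less_top)
    finally show "(\<integral>\<^sup>+ z. ennreal (norm (F z)) \<partial>((M \<Otimes>\<^sub>M M) \<Otimes>\<^sub>M N)) < \<infinity>" .
  qed
  have kint: "integrable M (\<lambda>x. k x w * g x)" if "w \<in> space N" for w
  proof (rule Bochner_Integration.integrable_bound[of _ "\<lambda>x. of_real D * g x"])
    show "integrable M (\<lambda>x. of_real D * g x)" using g by simp
    show "(\<lambda>x. k x w * g x) \<in> borel_measurable M" using that by (intro borel_measurable_times kp) auto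
    show "AE x in M. norm (k x w * g x) \<le> norm (of_real D * g x)"
      using kD D0 by (intro AE_I2) (simp add: norm_mult mult_right_mono)
  qed
  have inner: "(LINT z|(M \<Otimes>\<^sub>M M). F (z, w)) = of_real ((cmod (S w))\<^sup>2)" if w: "w \<in> space N" for w
  proof -
    have "integrable (M \<Otimes>\<^sub>M M) (\<lambda>(x, y). (k x w * g x) * cnj (k y w * g y))"
      using integrable_mult_pair[OF assms(1) assms(1) kint[OF w] integrable_bounded_linear[OF bounded_linear_cnj kint[OF w]]] by simp
    then have "(LINT z|(M \<Otimes>\<^sub>M M). F (z, w)) = (LINT x|M. LINT y|M. (k x w * g x) * cnj (k y w * g y))"
      unfolding F_def by (subst MM.integral_fst'[symmetric]) (auto simp: split_beta')
    also have "\<dots> = S w * cnj (S w)"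
    proof -
      have "(LINT y|M. cnj (k y w * g y)) = cnj (S w)"
        unfolding S_def by (rule integral_bounded_linear[OF bounded_linear_cnj kint[OF w]])
      then show ?thesis by (simp only: integral_mult_right_zero integral_mult_left_zero S_def[symmetric])
    qed
    also have "\<dots> = of_real ((cmod (S w))\<^sup>2)" by (simp only: complex_norm_square)
    finally show ?thesis .
  qed
  have Sint: "integrable N (\<lambda>w. (cmod (S w))\<^sup>2)"
  proof -
    have "integrable N (\<lambda>w. LINT z|(M \<Otimes>\<^sub>M M). F (z, w))"
      by (rule P.integrable_snd) (use Fint in \<open>simp add: split_beta'\<close>)
    then have "integrable N (\<lambda>w. complex_of_real ((cmod (S w))\<^sup>2))"
      by (rule Bochner_Integration.integrable_cong[THEN iffD1, rotated 2]) (simp_all add: inner)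
    then have "integrable N (\<lambda>w. norm (complex_of_real ((cmod (S w))\<^sup>2)))" by (rule integrable_norm)
    then show ?thesis by (simp add: norm_power)
  qed
  have "(\<integral>\<^sup>+ w. (ennreal (cmod (S w)))\<^sup>2 \<partial>N) = ennreal (LINT w|N. (cmod (S w))\<^sup>2)"
    using nn_integral_eq_integral[OF Sint] by (simp add: ennreal_power)
  also have "\<dots> = ennreal (cmod (LINT w|N. of_real ((cmod (S w))\<^sup>2)))"
    by (simp only: integral_complex_of_real) (simp add: integral_nonneg_AE)
  also have "(LINT w|N. of_real ((cmod (S w))\<^sup>2)) = (LINT w|N. LINT z|(M \<Otimes>\<^sub>M M). F (z, w))"
    by (intro Bochner_Integration.integral_cong) (simp_all add: inner)
  also have "\<dots> = (LINT z|(M \<Otimes>\<^sub>M M). LINT w|N. F (z, w))"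
    by (rule P.Fubini_integral) (use Fint in \<open>simp add: split_beta'\<close>)
  also have "ennreal (cmod \<dots>) \<le> (\<integral>\<^sup>+ z. ennreal (cmod (LINT w|N. F (z, w))) \<partial>(M \<Otimes>\<^sub>M M))"
    by (rule integral_norm_bound_ennreal) (rule P.integrable_fst, use Fint in \<open>simp add: split_beta'\<close>)
  also have "\<dots> \<le> (\<integral>\<^sup>+ z. ennreal (1 / 2) * ((ennreal (cmod (g (fst z))))\<^sup>2 * ennreal (q (fst z) (snd z))) +
      ennreal (1 / 2) * ((ennreal (cmod (g (snd z))))\<^sup>2 * ennreal (q (fst z) (snd z))) \<partial>(M \<Otimes>\<^sub>M M))"
  proof (rule nn_integral_mono)
    fix z assume "z \<in> space (M \<Otimes>\<^sub>M M)"
    then obtain x y where z: "z = (x, y)" and x: "x \<in> space M" "y \<in> space M"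
      by (auto simp: space_pair_measure)
    have q0: "0 \<le> q x y" using order_trans[OF norm_ge_zero q[OF x]] .
    have half: "ennreal (1 / 2 * (c\<^sup>2 * q x y)) = ennreal (1 / 2) * ((ennreal c)\<^sup>2 * ennreal (q x y))" if "0 \<le> c" for c
    proof -
      have "ennreal (1 / 2 * (c\<^sup>2 * q x y)) = ennreal (1 / 2) * ennreal (c\<^sup>2 * q x y)" using q0 by (intro ennreal_mult) auto
      also have "ennreal (c\<^sup>2 * q x y) = ennreal (c\<^sup>2) * ennreal (q x y)" using q0 by (intro ennreal_mult) auto
      also have "ennreal (c\<^sup>2) = (ennreal c)\<^sup>2" using that by (simp add: ennreal_power)
      finally show ?thesis .
    qed
    have "(LINT w|N. F ((x, y), w)) = (LINT w|N. (g x * cnj (g y)) * (k x w * cnj (k y w)))"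
      unfolding F_def by (intro Bochner_Integration.integral_cong) (auto simp: mult_ac)
    then have "cmod (LINT w|N. F ((x, y), w)) = (cmod (g x) * cmod (g y)) * cmod (LINT w|N. k x w * cnj (k y w))"
      by (simp add: norm_mult)
    also have "\<dots> \<le> (cmod (g x) * cmod (g y)) * q x y" by (intro mult_left_mono q x) simp
    also have "\<dots> \<le> (1 / 2 * (cmod (g x))\<^sup>2 + 1 / 2 * (cmod (g y))\<^sup>2) * q x y"
    proof (rule mult_right_mono)
      show "cmod (g x) * cmod (g y) \<le> 1 / 2 * (cmod (g x))\<^sup>2 + 1 / 2 * (cmod (g y))\<^sup>2"
        using sum_squares_bound[of "cmod (g x)" "cmod (g y)"] by simp
      show "0 \<le> q x y" by (rule q0)
    qed
    finally have "ennreal (cmod (LINT w|N. F ((x, y), w))) \<le> ennreal ((1 / 2 * (cmod (g x))\<^sup>2 + 1 / 2 * (cmod (g y))\<^sup>2) * q x y)"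
      by (rule ennreal_leI)
    also have "(1 / 2 * (cmod (g x))\<^sup>2 + 1 / 2 * (cmod (g y))\<^sup>2) * q x y = 1 / 2 * ((cmod (g x))\<^sup>2 * q x y) + 1 / 2 * ((cmod (g y))\<^sup>2 * q x y)"
      by (simp only: distrib_right mult.assoc)
    also have "ennreal \<dots> = ennreal (1 / 2 * ((cmod (g x))\<^sup>2 * q x y)) + ennreal (1 / 2 * ((cmod (g y))\<^sup>2 * q x y))"
      using q0 by (intro ennreal_plus) auto
    finally show "ennreal (cmod (LINT w|N. F (z, w))) \<le> ennreal (1 / 2) * ((ennreal (cmod (g (fst z))))\<^sup>2 * ennreal (q (fst z) (snd z))) +
      ennreal (1 / 2) * ((ennreal (cmod (g (snd z))))\<^sup>2 * ennreal (q (fst z) (snd z)))"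
      unfolding z fst_conv snd_conv by (simp only: half norm_ge_zero)
  qed
  also have "\<dots> = ennreal (1 / 2) * (\<integral>\<^sup>+ z. (ennreal (cmod (g (fst z))))\<^sup>2 * ennreal (q (fst z) (snd z)) \<partial>(M \<Otimes>\<^sub>M M)) +
      ennreal (1 / 2) * (\<integral>\<^sup>+ z. (ennreal (cmod (g (snd z))))\<^sup>2 * ennreal (q (fst z) (snd z)) \<partial>(M \<Otimes>\<^sub>M M))"
    by (subst nn_integral_add) (auto simp: nn_integral_cmult)
  also have "(\<integral>\<^sup>+ z. (ennreal (cmod (g (fst z))))\<^sup>2 * ennreal (q (fst z) (snd z)) \<partial>(M \<Otimes>\<^sub>M M)) \<le> ennreal A * (\<integral>\<^sup>+ x. (ennreal (cmod (g x)))\<^sup>2 \<partial>M)"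
  proof -
    have "(\<integral>\<^sup>+ z. (ennreal (cmod (g (fst z))))\<^sup>2 * ennreal (q (fst z) (snd z)) \<partial>(M \<Otimes>\<^sub>M M)) = (\<integral>\<^sup>+ x. \<integral>\<^sup>+ y. (ennreal (cmod (g x)))\<^sup>2 * ennreal (q x y) \<partial>M \<partial>M)"
      by (subst M.nn_integral_fst[symmetric]) auto
    also have "\<dots> = (\<integral>\<^sup>+ x. (ennreal (cmod (g x)))\<^sup>2 * (\<integral>\<^sup>+ y. ennreal (q x y) \<partial>M) \<partial>M)"
      by (intro nn_integral_cong nn_integral_cmult) measurable
    also have "\<dots> \<le> (\<integral>\<^sup>+ x. (ennreal (cmod (g x)))\<^sup>2 * ennreal A \<partial>M)"
      by (intro nn_integral_mono mult_left_mono qA) auto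
    finally show ?thesis by (simp add: nn_integral_multc mult.commute[of "ennreal A"])
  qed
  also have "(\<integral>\<^sup>+ z. (ennreal (cmod (g (snd z))))\<^sup>2 * ennreal (q (fst z) (snd z)) \<partial>(M \<Otimes>\<^sub>M M)) \<le> ennreal A * (\<integral>\<^sup>+ x. (ennreal (cmod (g x)))\<^sup>2 \<partial>M)"
  proof -
    have "(\<integral>\<^sup>+ z. (ennreal (cmod (g (snd z))))\<^sup>2 * ennreal (q (fst z) (snd z)) \<partial>(M \<Otimes>\<^sub>M M)) = (\<integral>\<^sup>+ y. \<integral>\<^sup>+ x. (ennreal (cmod (g y)))\<^sup>2 * ennreal (q x y) \<partial>M \<partial>M)"
      by (subst MM.nn_integral_snd[symmetric]) auto
    also have "\<dots> = (\<integral>\<^sup>+ y. (ennreal (cmod (g y)))\<^sup>2 * (\<integral>\<^sup>+ x. ennreal (q x y) \<partial>M) \<partial>M)"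
      by (intro nn_integral_cong nn_integral_cmult) measurable
    also have "\<dots> \<le> (\<integral>\<^sup>+ x. (ennreal (cmod (g x)))\<^sup>2 * ennreal A \<partial>M)"
    proof (intro nn_integral_mono mult_left_mono)
      fix y assume y: "y \<in> space M"
      have "(\<integral>\<^sup>+ x. ennreal (q x y) \<partial>M) = (\<integral>\<^sup>+ x. ennreal (q y x) \<partial>M)"
        by (intro nn_integral_cong arg_cong[where f = ennreal] qsym)
      then show "(\<integral>\<^sup>+ x. ennreal (q x y) \<partial>M) \<le> ennreal A" using qA[OF y] by simp
    qed auto
    finally show ?thesis by (simp add: nn_integral_multc mult.commute[of "ennreal A"])
  qed
  finally have "(\<integral>\<^sup>+ w. (ennreal (cmod (S w)))\<^sup>2 \<partial>N) \<le> ennreal (1 / 2) * (ennreal A * (\<integral>\<^sup>+ x. (ennreal (cmod (g x)))\<^sup>2 \<partial>M)) + ennreal (1 / 2) * (ennreal A * (\<integral>\<^sup>+ x. (ennreal (cmod (g x)))\<^sup>2 \<partial>M))"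
    by (simp add: mult_left_mono add_mono)
  also have "\<dots> = ennreal A * (\<integral>\<^sup>+ x. (ennreal (cmod (g x)))\<^sup>2 \<partial>M)"
  proof -
    have "ennreal (1 / 2) + ennreal (1 / 2) = 1" by (subst ennreal_plus[symmetric]) simp_all
    then show ?thesis unfolding distrib_right[symmetric] by simp
  qed
  finally show ?thesis by (simp add: S_def)
qed

section \<open>Twisted convolution with Laguerre functions\<close>

lemma cis_2pi_int: "cis (2 * pi * real_of_int m) = 1"
  using cis_multiple_2pi[of "real_of_int m"] by simp

lemma integral_cis_period:
  fixes m :: int
  shows "integrable lborel (\<lambda>t. indicator {0..2 * pi} t *\<^sub>R cis (real_of_int m * t))"
    and "(LINT t|lborel. indicator {0..2 * pi} t *\<^sub>R cis (real_of_int m * t)) = (if m = 0 then of_real (2 * pi) else 0)"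
proof -
  have cont: "continuous_on S (\<lambda>t. cis (real_of_int m * t))" for S
    unfolding cis_conv_exp by (intro continuous_intros)
  show "integrable lborel (\<lambda>t. indicator {0..2 * pi} t *\<^sub>R cis (real_of_int m * t))"
    using borel_integrable_atLeastAtMost'[OF cont] by (simp add: set_integrable_def)
  show "(LINT t|lborel. indicator {0..2 * pi} t *\<^sub>R cis (real_of_int m * t)) = (if m = 0 then of_real (2 * pi) else 0)"
  proof (cases "m = 0")
    case True
    then show ?thesis by (simp add: scaleR_conv_of_real)
  next
    case False
    have "(LINT t|lborel. indicator {0..2 * pi} t *\<^sub>R cis (real_of_int m * t)) =
      cis (real_of_int m * (2 * pi)) / (\<i> * of_int m) - cis (real_of_int m * 0) / (\<i> * of_int m)"
    proof (rule integral_FTC_atLeastAtMost)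
      fix t :: real
      show "((\<lambda>t. cis (real_of_int m * t) / (\<i> * of_int m)) has_vector_derivative cis (real_of_int m * t)) (at t within {0..2 * pi})"
        using False unfolding cis_conv_exp
        by (auto intro!: derivative_eq_intros has_vector_derivative_real_field simp: field_simps)
    qed (use cont in auto)
    then show ?thesis using False cis_2pi_int[of m] by (simp add: mult_ac)
  qed
qed

text \<open>Parseval's identity for the partial sums, followed by dominated convergence: absolute
  summability bounds all of them by the constant \<open>C\<close>. The terms from \<open>N\<close>
  on are dropped.\<close>

lemma circle_Bessel:
  fixes c :: "nat \<Rightarrow> complex"
  assumes c: "summable (\<lambda>k. cmod (c k))"
  shows "ennreal (\<Sum>k<N. (cmod (c k))\<^sup>2) \<le>
    ennreal (1 / (2 * pi)) * (\<integral>\<^sup>+ t. (ennreal (cmod (\<Sum>k. c k * cis (real k * t))))\<^sup>2 * indicator {0..2 * pi} t \<partial>lborel)"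
proof -
  let ?I = "\<lambda>t. indicator {0..2 * pi} t :: real"
  define S where "S M t = (\<Sum>k<M. c k * cis (real k * t))" for M and t :: real
  define F where "F t = (\<Sum>k. c k * cis (real k * t))" for t :: real
  define C where "C = (\<Sum>k. cmod (c k))"
  have sm: "summable (\<lambda>k. c k * cis (real k * t))" for t
    by (rule summable_norm_cancel) (simp add: norm_mult c)
  have SF: "(\<lambda>M. S M t) \<longlonglongrightarrow> F t" for t
    unfolding S_def F_def by (rule summable_LIMSEQ[OF sm])
  have SC: "cmod (S M t) \<le> C" for M t
  proof -
    have "cmod (S M t) \<le> (\<Sum>k<M. cmod (c k))"
      unfolding S_def by (rule order_trans[OF norm_sum]) (simp add: norm_mult)
    also have "\<dots> \<le> C" unfolding C_def by (intro sum_le_suminf c) auto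
    finally show ?thesis .
  qed
  have Sm [measurable]: "S M \<in> borel_measurable borel" for M
    unfolding S_def cis_conv_exp by measurable
  have Fm [measurable]: "F \<in> borel_measurable borel"
    by (rule borel_measurable_LIMSEQ_metric[of S, OF Sm SF])
  have "(LINT t|lborel. ?I t *\<^sub>R (S M t * cnj (S M t))) = of_real (2 * pi * (\<Sum>k<M. (cmod (c k))\<^sup>2))" for M
  proof -
    have e: "?I t *\<^sub>R (S M t * cnj (S M t)) = (\<Sum>j<M. \<Sum>k<M. (c j * cnj (c k)) * (?I t *\<^sub>R cis (real_of_int (int j - int k) * t)))" for t
    proof -
      have "S M t * cnj (S M t) = (\<Sum>j<M. \<Sum>k<M. (c j * cis (real j * t)) * cnj (c k * cis (real k * t)))"
        by (simp only: S_def cnj_sum sum_product)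
      also have "\<dots> = (\<Sum>j<M. \<Sum>k<M. (c j * cnj (c k)) * cis (real_of_int (int j - int k) * t))"
      proof (intro sum.cong refl)
        fix j k
        have "cis (real j * t) * cnj (cis (real k * t)) = cis (real_of_int (int j - int k) * t)"
          by (simp add: cis_cnj cis_mult left_diff_distrib)
        moreover have "(c j * cis (real j * t)) * cnj (c k * cis (real k * t)) = (c j * cnj (c k)) * (cis (real j * t) * cnj (cis (real k * t)))"
          by (simp only: complex_cnj_mult mult_ac)
        ultimately show "(c j * cis (real j * t)) * cnj (c k * cis (real k * t)) = (c j * cnj (c k)) * cis (real_of_int (int j - int k) * t)"
          by simp
      qed
      finally show ?thesis by (simp only: scaleR_sum_right mult_scaleR_right)
    qed
    have "(LINT t|lborel. ?I t *\<^sub>R (S M t * cnj (S M t))) = (\<Sum>j<M. \<Sum>k<M. (c j * cnj (c k)) * (LINT t|lborel. ?I t *\<^sub>R cis (real_of_int (int j - int k) * t)))"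
      unfolding e
      by (simp only: Bochner_Integration.integral_sum integral_mult_right_zero integral_cis_period(1) integrable_mult_right Bochner_Integration.integrable_sum)
    also have "\<dots> = (\<Sum>j<M. \<Sum>k<M. if k = j then (c j * cnj (c j)) * of_real (2 * pi) else 0)"
      unfolding integral_cis_period(2) by (intro sum.cong refl) auto
    also have "\<dots> = (\<Sum>j<M. (c j * cnj (c j)) * of_real (2 * pi))"
      by (intro sum.cong refl) (simp add: sum.delta)
    also have "\<dots> = (\<Sum>j<M. of_real (2 * pi * (cmod (c j))\<^sup>2))"
      by (simp only: complex_norm_square[symmetric] of_real_mult[symmetric] mult.commute)
    finally show ?thesis by (simp only: of_real_sum sum_distrib_left)
  qed
  moreover have "?I t *\<^sub>R (S M t * cnj (S M t)) = of_real (?I t * (cmod (S M t))\<^sup>2)" for M t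
    by (simp only: complex_norm_square[symmetric] scaleR_conv_of_real of_real_mult)
  ultimately have "of_real (LINT t|lborel. ?I t * (cmod (S M t))\<^sup>2) = complex_of_real (2 * pi * (\<Sum>k<M. (cmod (c k))\<^sup>2))" for M
    by (simp only: integral_complex_of_real)
  then have SI: "(LINT t|lborel. ?I t * (cmod (S M t))\<^sup>2) = 2 * pi * (\<Sum>k<M. (cmod (c k))\<^sup>2)" for M
    by (simp only: of_real_eq_iff)
  have dom: "integrable lborel (\<lambda>t. ?I t * C\<^sup>2)" by simp
  have bnd: "AE t in lborel. norm (?I t * (cmod (S M t))\<^sup>2) \<le> ?I t * C\<^sup>2" for M
    using SC by (intro AE_I2) (auto simp: indicator_def intro!: power_mono)
  have lim: "AE t in lborel. (\<lambda>M. ?I t * (cmod (S M t))\<^sup>2) \<longlonglongrightarrow> ?I t * (cmod (F t))\<^sup>2"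
    by (intro AE_I2 tendsto_intros SF)
  have L: "(\<lambda>M. LINT t|lborel. ?I t * (cmod (S M t))\<^sup>2) \<longlonglongrightarrow> (LINT t|lborel. ?I t * (cmod (F t))\<^sup>2)"
    by (rule integral_dominated_convergence[OF _ _ dom lim bnd]) measurable
  have Fi: "integrable lborel (\<lambda>t. ?I t * (cmod (F t))\<^sup>2)"
    by (rule integrable_dominated_convergence[OF _ _ dom lim bnd]) measurable
  have "2 * pi * (\<Sum>k<N. (cmod (c k))\<^sup>2) \<le> (LINT t|lborel. ?I t * (cmod (F t))\<^sup>2)"
  proof (rule LIMSEQ_le_const[OF L], intro exI[of _ N] allI impI)
    fix M assume "N \<le> M"
    then show "2 * pi * (\<Sum>k<N. (cmod (c k))\<^sup>2) \<le> (LINT t|lborel. ?I t * (cmod (S M t))\<^sup>2)"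
      unfolding SI by (intro mult_left_mono sum_mono2) auto
  qed
  then have "(\<Sum>k<N. (cmod (c k))\<^sup>2) \<le> 1 / (2 * pi) * (LINT t|lborel. ?I t * (cmod (F t))\<^sup>2)"
    by (simp add: field_simps)
  then have "ennreal (\<Sum>k<N. (cmod (c k))\<^sup>2) \<le> ennreal (1 / (2 * pi)) * ennreal (LINT t|lborel. ?I t * (cmod (F t))\<^sup>2)"
    by (subst ennreal_mult[symmetric]) (auto intro!: ennreal_leI integral_nonneg_AE)
  also have "ennreal (LINT t|lborel. ?I t * (cmod (F t))\<^sup>2) = (\<integral>\<^sup>+ t. ennreal (?I t * (cmod (F t))\<^sup>2) \<partial>lborel)"
    by (rule nn_integral_eq_integral[OF Fi, symmetric]) auto
  also have "\<dots> = (\<integral>\<^sup>+ t. (ennreal (cmod (F t)))\<^sup>2 * indicator {0..2 * pi} t \<partial>lborel)"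
    by (intro nn_integral_cong) (auto simp: indicator_def ennreal_power)
  finally show ?thesis unfolding F_def .
qed

section \<open>Laguerre functions and their Gaussian generating function\<close>

lemma phi_fun_eq:
  fixes z :: "complex ^ 'n::finite"
  shows "phi_fun k l z = poly (lag_poly (CARD('n) - 1) k) (\<bar>l\<bar> * (norm z)\<^sup>2 / 2) * exp (- (\<bar>l\<bar> * (norm z)\<^sup>2 / 4))"
  by (simp only: phi_fun_def laguerre_eq)

lemma phi_fun_bound: "\<bar>phi_fun k l (z :: complex ^ 'n::finite)\<bar> \<le> ray_weight CARD('n) k"
proof -
  define n where "n = CARD('n)"
  have n: "0 < n" by (simp add: n_def)
  let ?x = "\<bar>l\<bar> * (norm z)\<^sup>2 / 2"
  have "\<bar>phi_fun k l z\<bar> = \<bar>poly (lag_poly (n - 1) k) ?x\<bar> * exp (- (?x / 2))"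
    by (simp add: phi_fun_eq abs_mult n_def)
  also have "\<dots> \<le> real ((k + (n - 1)) choose (n - 1))" by (rule lag_poly_bound) simp
  also have "\<dots> = ray_weight n k"
    using n by (simp add: ray_weight_def binomial_fact)
  finally show ?thesis by (simp add: n_def)
qed

text \<open>The generating function of the Laguerre functions at \<open>w\<close>. The quotient
  \<open>(1 + w) / (1 - w)\<close> arises by adding the exponents -x/2 and -x w / (1 - w) for x =
  |l| |z|^2 / 2.\<close>

definition gauss_kernel :: "real \<Rightarrow> complex \<Rightarrow> complex ^ 'n::finite \<Rightarrow> complex" where
  "gauss_kernel l w z = exp (- of_real (\<bar>l\<bar> / 4 * (norm z)\<^sup>2) * ((1 + w) / (1 - w))) / (1 - w) ^ CARD('n)"

lemma phi_fun_generating: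
  fixes z :: "complex ^ 'n::finite"
  assumes w: "norm w < 1"
  shows "(\<lambda>k. of_real (phi_fun k l z) * w ^ k) sums gauss_kernel l w z"
proof -
  define n where "n = CARD('n)"
  have n: "Suc (n - 1) = n" by (simp add: n_def)
  let ?x = "\<bar>l\<bar> * (norm z)\<^sup>2 / 2"
  have w1: "1 - w \<noteq> 0" using w by auto
  have "(\<lambda>k. of_real (exp (- (?x / 2))) * (of_real (poly (lag_poly (n - 1) k) ?x) * w ^ k)) sums
    (of_real (exp (- (?x / 2))) * (exp (- of_real ?x * w / (1 - w)) / (1 - w) ^ n))"
    using lag_poly_generating[OF w, of "n - 1" ?x] unfolding n by (rule sums_mult)
  moreover have "of_real (exp (- (?x / 2))) * (of_real (poly (lag_poly (n - 1) k) ?x) * w ^ k) = of_real (phi_fun k l z) * w ^ k" for k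
    by (simp add: phi_fun_eq n_def mult_ac)
  moreover have "of_real (exp (- (?x / 2))) * (exp (- of_real ?x * w / (1 - w)) / (1 - w) ^ n) = gauss_kernel l w z"
  proof -
    have "of_real (- (?x / 2)) + (- of_real ?x * w / (1 - w)) = - of_real (\<bar>l\<bar> / 4 * (norm z)\<^sup>2) * ((1 + w) / (1 - w))"
      using w1 by (simp add: field_simps)
    then have "exp (of_real (- (?x / 2))) * exp (- of_real ?x * w / (1 - w)) = exp (- of_real (\<bar>l\<bar> / 4 * (norm z)\<^sup>2) * ((1 + w) / (1 - w)))"
      by (simp only: exp_add[symmetric])
    then show ?thesis by (simp only: gauss_kernel_def n_def exp_of_real times_divide_eq_right)
  qed
  ultimately show ?thesis by (simp only:)
qed

text \<open>The Cayley transform maps the disc to the right half-plane, so the kernel decays. The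
  second bound comes from |1 + w|^2 + |1 - w|^2 = 2 + 2 |w|^2; unlike the first it does not
  degenerate at the circle, and it makes the operator bound uniform.\<close>

lemma Re_Cayley:
  fixes w :: complex
  assumes w: "norm w < 1"
  shows "0 < Re ((1 + w) / (1 - w))" and "2 \<le> (cmod (1 - w))\<^sup>2 * ((cmod ((1 + w) / (1 - w)))\<^sup>2 + 1)"
proof -
  have w1: "1 - w \<noteq> 0" using w by auto
  have "(1 + w) / (1 - w) = (1 + w) * cnj (1 - w) / of_real ((cmod (1 - w))\<^sup>2)"
    by (subst complex_div_cnj) simp
  then have "Re ((1 + w) / (1 - w)) = Re ((1 + w) * cnj (1 - w)) / (cmod (1 - w))\<^sup>2"
    by (simp only: Re_divide_of_real)
  also have "Re ((1 + w) * cnj (1 - w)) = 1 - (cmod w)\<^sup>2"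
    unfolding cmod_power2 by (simp add: power2_eq_square algebra_simps)
  finally have R: "Re ((1 + w) / (1 - w)) = (1 - (cmod w)\<^sup>2) / (cmod (1 - w))\<^sup>2" .
  have "(cmod w)\<^sup>2 < 1" using w by (simp add: power_less_one_iff)
  then show "0 < Re ((1 + w) / (1 - w))" unfolding R using w1 by simp
  have "(cmod (1 - w))\<^sup>2 * ((cmod ((1 + w) / (1 - w)))\<^sup>2 + 1) = (cmod (1 + w))\<^sup>2 + (cmod (1 - w))\<^sup>2"
    using w1 by (simp add: norm_divide power_divide field_simps)
  also have "\<dots> = 2 + 2 * (cmod w)\<^sup>2"
    unfolding cmod_power2 by (simp add: power2_eq_square algebra_simps)
  finally show "2 \<le> (cmod (1 - w))\<^sup>2 * ((cmod ((1 + w) / (1 - w)))\<^sup>2 + 1)" by simp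
qed

lemma sqrt_power_DIM: "0 \<le> x \<Longrightarrow> sqrt x ^ DIM(complex ^ 'n::finite) = x ^ CARD('n)"
  by (simp add: power_mult power2_eq_square flip: power_mult_distrib)

lemma herm_add: "herm (x + y) z = herm x z + herm y z" "herm x (y + z) = herm x y + herm x z"
  and herm_diff: "herm (x - y) z = herm x z - herm y z"
  by (simp_all add: herm_def sum.distrib sum_subtractf algebra_simps)

text \<open>Multiplication by \<open>- \<i>\<close> turns the symplectic form into a real inner
  product, so that the twist becomes an ordinary character in its second argument.\<close>

definition rot :: "complex ^ 'n::finite \<Rightarrow> complex ^ 'n" where
  "rot z = (\<chi> j. - \<i> * z $ j)"

lemma Im_herm: "Im (herm z w) = rot z \<bullet> w"
  by (simp add: herm_def rot_def inner_vec_def inner_complex_def Im_sum algebra_simps)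

lemma rot_inner: "rot z \<bullet> z = 0"
  by (metis Im_herm herm_self)

lemma norm_rot: "norm (rot z) = norm z"
  by (simp add: rot_def norm_vec_def norm_mult)

lemma gauss_kernel_measurable [measurable]: "gauss_kernel l w \<in> borel_measurable borel"
  unfolding gauss_kernel_def by measurable

lemma cmod_gauss_kernel:
  fixes z :: "complex ^ 'n::finite"
  shows "cmod (gauss_kernel l w z) = exp (- (\<bar>l\<bar> / 4 * Re ((1 + w) / (1 - w))) * (norm z)\<^sup>2) / cmod (1 - w) ^ CARD('n)"
proof -
  have "Re (- of_real (\<bar>l\<bar> / 4 * (norm z)\<^sup>2) * ((1 + w) / (1 - w))) = - (\<bar>l\<bar> / 4 * Re ((1 + w) / (1 - w))) * (norm z)\<^sup>2"
  proof -
    have "Re (- of_real x * y) = - x * Re y" for x y by simp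
    moreover have "- (x * y) * t = - (x * t) * y" for x y t :: real by simp
    ultimately show ?thesis by (rule trans)
  qed
  then show ?thesis by (simp only: gauss_kernel_def norm_divide norm_exp_eq_Re norm_power)
qed

definition twist :: "real \<Rightarrow> complex ^ 'n::finite \<Rightarrow> complex ^ 'n \<Rightarrow> complex" where
  "twist l z w = cis (- (l / 2) * Im (herm z w))"

lemma cmod_twist [simp]: "cmod (twist l z w) = 1" by (simp add: twist_def)

lemma twist_measurable [measurable]: "(\<lambda>(z, w). twist l z w) \<in> borel_measurable (borel \<Otimes>\<^sub>M borel)"
proof -
  have "continuous_on UNIV (\<lambda>p :: (complex ^ 'n) \<times> (complex ^ 'n). twist l (fst p) (snd p))"
    unfolding twist_def herm_def cis_conv_exp by (intro continuous_intros)
  from borel_measurable_continuous_onI[OF this] show ?thesis by (simp add: borel_prod split_beta')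
qed

text \<open>The kernel of \<open>S\<^sup>* S\<close> is, up to a phase, the Fourier transform of a real Gaussian: the quadratic
  form is \<open>a \<bar>w - \<zeta>\<bar>\<^sup>2 + cnj a \<bar>w\<bar>\<^sup>2\<close>.\<close>

lemma twisted_gauss_bracket:
  fixes z z' :: "complex ^ 'n::finite" and w :: complex and l :: real
  defines "a \<equiv> (1 + w) / (1 - w)" and "\<kappa> \<equiv> \<bar>l\<bar> / 4"
  assumes w: "norm w < 1" and l: "l \<noteq> 0"
  shows "cmod (LINT v|lborel. (twist l z v * gauss_kernel l w (v - z)) * cnj (twist l z' v * gauss_kernel l w (v - z'))) =
    (pi / (2 * \<kappa> * Re a)) ^ CARD('n) / (cmod (1 - w))\<^sup>2 ^ CARD('n) * exp (- (\<kappa> * ((cmod a)\<^sup>2 + 1) / (2 * Re a)) * (norm (z - z'))\<^sup>2)"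
proof -
  define \<zeta> where "\<zeta> = z - z'"
  have R: "0 < Re a" unfolding a_def by (rule Re_Cayley[OF w])
  have \<kappa>: "0 < \<kappa>" using l by (simp add: \<kappa>_def)
  define \<alpha> where "\<alpha> = 2 * \<kappa> * Re a"
  have \<alpha>: "0 < \<alpha>" using R \<kappa> by (simp add: \<alpha>_def)
  \<comment> \<open>After the shift by \<open>z'\<close>, \<open>b\<close> is the real linear part
    of the exponent and \<open>d\<close> the frequency. The frequency has one term from the
    imaginary part of \<open>a\<close> and one from the twist.\<close>
  define b where "b = (2 * \<kappa> * Re a) *\<^sub>R \<zeta>"
  define d where "d = (2 * \<kappa> * Im a) *\<^sub>R \<zeta> - (l / 2) *\<^sub>R rot \<zeta>"
  define c where "c = twist l \<zeta> z' * (exp (- of_real (\<kappa> * (norm \<zeta>)\<^sup>2) * a) / of_real ((cmod (1 - w))\<^sup>2 ^ CARD('n)))"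
  let ?f = "\<lambda>v. (twist l z v * gauss_kernel l w (v - z)) * cnj (twist l z' v * gauss_kernel l w (v - z'))"
  have tw: "(\<lambda>v. twist l y v) \<in> borel_measurable borel" for y :: "complex ^ 'n"
    using measurable_compose[OF measurable_Pair1' twist_measurable] by simp
  have fm: "?f \<in> borel_measurable borel"
    using tw[of z] tw[of z'] by measurable
  have eq: "?f (z' + v) = c * (of_real (exp (- \<alpha> * (norm v)\<^sup>2 + b \<bullet> v)) * cis (d \<bullet> v))" for v
  proof -
    have "twist l z (z' + v) * cnj (twist l z' (z' + v)) = twist l \<zeta> (z' + v)"
      by (simp add: twist_def cis_cnj cis_mult \<zeta>_def herm_diff algebra_simps)
    also have "\<dots> = twist l \<zeta> z' * cis (- (l / 2) * (rot \<zeta> \<bullet> v))"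
      by (simp add: twist_def Im_herm[symmetric] herm_add cis_mult algebra_simps)
    finally have 1: "twist l z (z' + v) * cnj (twist l z' (z' + v)) = twist l \<zeta> z' * cis (- (l / 2) * (rot \<zeta> \<bullet> v))" .
    have n2: "(norm (v - \<zeta>))\<^sup>2 = (norm v)\<^sup>2 - 2 * (\<zeta> \<bullet> v) + (norm \<zeta>)\<^sup>2"
      by (simp add: power2_norm_eq_inner inner_diff inner_commute)
    have "gauss_kernel l w (z' + v - z) * cnj (gauss_kernel l w (z' + v - z')) =
      exp (- of_real (\<kappa> * (norm (v - \<zeta>))\<^sup>2) * a) * exp (- of_real (\<kappa> * (norm v)\<^sup>2) * cnj a) / ((1 - w) ^ CARD('n) * cnj ((1 - w) ^ CARD('n)))"
      by (simp add: gauss_kernel_def a_def \<kappa>_def \<zeta>_def exp_cnj algebra_simps)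
    also have "(1 - w) ^ CARD('n) * cnj ((1 - w) ^ CARD('n)) = of_real ((cmod (1 - w))\<^sup>2 ^ CARD('n))"
      by (simp only: complex_norm_square[symmetric] norm_power power_mult[symmetric] mult.commute)
    also have "exp (- of_real (\<kappa> * (norm (v - \<zeta>))\<^sup>2) * a) * exp (- of_real (\<kappa> * (norm v)\<^sup>2) * cnj a)
      = exp (- of_real (\<kappa> * (norm \<zeta>)\<^sup>2) * a) * (of_real (exp (- \<alpha> * (norm v)\<^sup>2 + b \<bullet> v)) * cis (2 * \<kappa> * Im a * (\<zeta> \<bullet> v)))"
    proof -
      have "- of_real (\<kappa> * (norm (v - \<zeta>))\<^sup>2) * a + - of_real (\<kappa> * (norm v)\<^sup>2) * cnj a =
         - of_real (\<kappa> * (norm \<zeta>)\<^sup>2) * a + (of_real (- \<alpha> * (norm v)\<^sup>2 + b \<bullet> v) + \<i> * of_real (2 * \<kappa> * Im a * (\<zeta> \<bullet> v)))"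
        by (simp add: n2 complex_eq_iff \<alpha>_def b_def algebra_simps)
      then show ?thesis by (simp only: exp_add[symmetric] cis_conv_exp exp_of_real[symmetric])
    qed
    finally have 2: "gauss_kernel l w (z' + v - z) * cnj (gauss_kernel l w (z' + v - z')) =
      exp (- of_real (\<kappa> * (norm \<zeta>)\<^sup>2) * a) * (of_real (exp (- \<alpha> * (norm v)\<^sup>2 + b \<bullet> v)) * cis (2 * \<kappa> * Im a * (\<zeta> \<bullet> v))) / of_real ((cmod (1 - w))\<^sup>2 ^ CARD('n))" .
    have 3: "cis (- (l / 2) * (rot \<zeta> \<bullet> v)) * cis (2 * \<kappa> * Im a * (\<zeta> \<bullet> v)) = cis (d \<bullet> v)"
      by (simp add: cis_mult d_def inner_diff_left)
    have "?f (z' + v) = (twist l z (z' + v) * cnj (twist l z' (z' + v))) * (gauss_kernel l w (z' + v - z) * cnj (gauss_kernel l w (z' + v - z')))"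
      by (simp only: complex_cnj_mult mult_ac)
    also have "\<dots> = c * (of_real (exp (- \<alpha> * (norm v)\<^sup>2 + b \<bullet> v)) * (cis (- (l / 2) * (rot \<zeta> \<bullet> v)) * cis (2 * \<kappa> * Im a * (\<zeta> \<bullet> v))))"
      unfolding 1 2 c_def by (simp add: mult_ac)
    finally show ?thesis unfolding 3 .
  qed
  have "(LINT v|lborel. ?f v) = (LINT v|lborel. ?f (z' + v))"
    by (rule lborel_integral_shift[OF fm, symmetric])
  also have "\<dots> = c * (LINT v|lborel. of_real (exp (- \<alpha> * (norm v)\<^sup>2 + b \<bullet> v)) * cis (d \<bullet> v))"
    unfolding eq by (rule integral_mult_right_zero)
  finally have "cmod (LINT v|lborel. ?f v) = cmod c * (sqrt (pi / \<alpha>) ^ DIM(complex ^ 'n) * exp (((norm b)\<^sup>2 - (norm d)\<^sup>2) / (4 * \<alpha>)))"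
    by (simp only: norm_mult gauss_exp_cis[OF \<alpha>])
  also have "sqrt (pi / \<alpha>) ^ DIM(complex ^ 'n) = (pi / (2 * \<kappa> * Re a)) ^ CARD('n)"
    using \<alpha> by (subst sqrt_power_DIM) (simp_all add: \<alpha>_def)
  also have "cmod c = exp (- (\<kappa> * Re a) * (norm \<zeta>)\<^sup>2) / (cmod (1 - w))\<^sup>2 ^ CARD('n)"
    by (simp add: c_def norm_mult norm_divide norm_power mult_ac)
  also have "exp (- (\<kappa> * Re a) * (norm \<zeta>)\<^sup>2) / (cmod (1 - w))\<^sup>2 ^ CARD('n) * ((pi / (2 * \<kappa> * Re a)) ^ CARD('n) * exp (((norm b)\<^sup>2 - (norm d)\<^sup>2) / (4 * \<alpha>))) =
     (pi / (2 * \<kappa> * Re a)) ^ CARD('n) / (cmod (1 - w))\<^sup>2 ^ CARD('n) * (exp (- (\<kappa> * Re a) * (norm \<zeta>)\<^sup>2) * exp (((norm b)\<^sup>2 - (norm d)\<^sup>2) / (4 * \<alpha>)))"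
    by simp
  also have "exp (- (\<kappa> * Re a) * (norm \<zeta>)\<^sup>2) * exp (((norm b)\<^sup>2 - (norm d)\<^sup>2) / (4 * \<alpha>)) = exp (- (\<kappa> * ((cmod a)\<^sup>2 + 1) / (2 * Re a)) * (norm \<zeta>)\<^sup>2)"
  proof -
    have "(norm b)\<^sup>2 = 4 * \<kappa>\<^sup>2 * (Re a)\<^sup>2 * (norm \<zeta>)\<^sup>2" by (simp add: b_def power_mult_distrib)
    \<comment> \<open>The two parts of \<open>d\<close> are orthogonal, so their squares add. Since
      (l / 2)^2 = 4 kappa^2, the twist contributes exactly the 1 in |a|^2 + 1; without this
      additional decay the estimate would degenerate at \<open>w = - 1\<close>.\<close>
    moreover have "(norm d)\<^sup>2 = 4 * \<kappa>\<^sup>2 * ((Im a)\<^sup>2 + 1) * (norm \<zeta>)\<^sup>2"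
    proof -
      have "(norm d)\<^sup>2 = (2 * \<kappa> * Im a)\<^sup>2 * (norm \<zeta>)\<^sup>2 + (l / 2)\<^sup>2 * (norm (rot \<zeta>))\<^sup>2"
        unfolding d_def power2_norm_eq_inner
        by (simp add: inner_diff_left inner_diff_right rot_inner inner_commute[of \<zeta> "rot \<zeta>"] power2_eq_square)
      moreover have "(l / 2)\<^sup>2 = 4 * \<kappa>\<^sup>2" by (simp add: \<kappa>_def power2_eq_square)
      ultimately show ?thesis by (simp add: norm_rot power_mult_distrib algebra_simps)
    qed
    moreover have "- (\<kappa> * Re a) * N + (4 * \<kappa>\<^sup>2 * (Re a)\<^sup>2 * N - 4 * \<kappa>\<^sup>2 * ((Im a)\<^sup>2 + 1) * N) / (4 * \<alpha>) = - (\<kappa> * ((cmod a)\<^sup>2 + 1) / (2 * Re a)) * N" for N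
      using R \<kappa> unfolding cmod_power2 by (simp add: \<alpha>_def field_simps power2_eq_square)
    ultimately show ?thesis by (simp only: exp_add[symmetric])
  qed
  finally show ?thesis unfolding \<zeta>_def .
qed

lemma twisted_gauss_L2:
  fixes g :: "complex ^ 'n::finite \<Rightarrow> complex" and w :: complex and l :: real
  assumes w: "norm w < 1" and l: "l \<noteq> 0" and g: "integrable lborel g"
  shows "(\<integral>\<^sup>+ v. (ennreal (cmod (LINT z|lborel. twist l z v * gauss_kernel l w (v - z) * g z)))\<^sup>2 \<partial>lborel)
    \<le> ennreal ((8 * pi\<^sup>2 / l\<^sup>2) ^ CARD('n)) * (\<integral>\<^sup>+ z. (ennreal (cmod (g z)))\<^sup>2 \<partial>lborel)"
proof -
  define a where "a = (1 + w) / (1 - w)"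
  define \<kappa> where "\<kappa> = \<bar>l\<bar> / 4"
  have R: "0 < Re a" unfolding a_def by (rule Re_Cayley[OF w])
  have \<kappa>: "0 < \<kappa>" using l by (simp add: \<kappa>_def)
  have w1: "0 < cmod (1 - w)" using w by auto
  define \<beta> where "\<beta> = \<kappa> * ((cmod a)\<^sup>2 + 1) / (2 * Re a)"
  have \<beta>: "0 < \<beta>" using R \<kappa> by (auto simp: \<beta>_def intro!: divide_pos_pos mult_pos_pos add_nonneg_pos)
  define q where "q z z' = (pi / (2 * \<kappa> * Re a)) ^ CARD('n) / (cmod (1 - w))\<^sup>2 ^ CARD('n) * exp (- \<beta> * (norm (z - z'))\<^sup>2)" for z z' :: "complex ^ 'n"
  show ?thesis
  proof (rule Schur_test_square[where q = q and D = "1 / cmod (1 - w) ^ CARD('n)" and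
      D' = "1 / cmod (1 - w) ^ CARD('n) * (pi / (\<kappa> * Re a)) ^ CARD('n)"])
    show "sigma_finite_measure (lborel :: (complex ^ 'n) measure)" "sigma_finite_measure (lborel :: (complex ^ 'n) measure)"
      by (rule sigma_finite_lborel)+
    show "(\<lambda>(z, v). twist l z v * gauss_kernel l w (v - z)) \<in> borel_measurable (lborel \<Otimes>\<^sub>M (lborel :: (complex ^ 'n) measure))"
      using twist_measurable[of l] by (simp add: split_beta') measurable
    show "(\<lambda>(x, y). q x y) \<in> borel_measurable (lborel \<Otimes>\<^sub>M lborel)"
      unfolding q_def by measurable
    show "cmod (twist l z v * gauss_kernel l w (v - z)) \<le> 1 / cmod (1 - w) ^ CARD('n)" for z v :: "complex ^ 'n"
      using R \<kappa> w1 by (simp add: norm_mult cmod_gauss_kernel a_def[symmetric] \<kappa>_def[symmetric] divide_right_mono)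
    show "(\<integral>\<^sup>+ v. ennreal (cmod (twist l z v * gauss_kernel l w (v - z))) \<partial>lborel) \<le> ennreal (1 / cmod (1 - w) ^ CARD('n) * (pi / (\<kappa> * Re a)) ^ CARD('n))"
      for z :: "complex ^ 'n"
    proof -
      have "(\<integral>\<^sup>+ v. ennreal (cmod (twist l z v * gauss_kernel l w (v - z))) \<partial>lborel) =
        (\<integral>\<^sup>+ v. ennreal (exp (- (\<kappa> * Re a) * (norm (- z + v))\<^sup>2) / cmod (1 - w) ^ CARD('n)) \<partial>lborel)"
        by (simp add: norm_mult cmod_gauss_kernel a_def[symmetric] \<kappa>_def[symmetric])
      also have "\<dots> = (\<integral>\<^sup>+ v. ennreal (exp (- (\<kappa> * Re a) * (norm (v :: complex ^ 'n))\<^sup>2) / cmod (1 - w) ^ CARD('n)) \<partial>lborel)"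
        by (rule lborel_nn_integral_shift[of "\<lambda>v. ennreal (exp (- (\<kappa> * Re a) * (norm v)\<^sup>2) / cmod (1 - w) ^ CARD('n))"]) measurable
      also have "\<dots> = (\<integral>\<^sup>+ v. ennreal (1 / cmod (1 - w) ^ CARD('n)) * ennreal (exp (- (\<kappa> * Re a) * (norm (v :: complex ^ 'n))\<^sup>2)) \<partial>lborel)"
        by (intro nn_integral_cong) (simp add: ennreal_mult[symmetric])
      also have "\<dots> = ennreal (1 / cmod (1 - w) ^ CARD('n)) * ennreal (sqrt (pi / (\<kappa> * Re a)) ^ DIM(complex ^ 'n))"
      proof -
        have "0 < \<kappa> * Re a" using R \<kappa> by simp
        note G = nn_integral_gauss[OF this, where 'a = "complex ^ 'n"]
        show ?thesis unfolding G[symmetric] by (rule nn_integral_cmult) measurable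
      qed
      also have "sqrt (pi / (\<kappa> * Re a)) ^ DIM(complex ^ 'n) = (pi / (\<kappa> * Re a)) ^ CARD('n)"
        using R \<kappa> by (intro sqrt_power_DIM) simp
      also have "ennreal (1 / cmod (1 - w) ^ CARD('n)) * ennreal ((pi / (\<kappa> * Re a)) ^ CARD('n)) = ennreal (1 / cmod (1 - w) ^ CARD('n) * (pi / (\<kappa> * Re a)) ^ CARD('n))"
        using R \<kappa> by (intro ennreal_mult[symmetric]) auto
      finally show ?thesis by simp
    qed
    show "cmod (LINT v|lborel. (twist l z v * gauss_kernel l w (v - z)) * cnj (twist l z' v * gauss_kernel l w (v - z'))) \<le> q z z'" for z z' :: "complex ^ 'n"
      using twisted_gauss_bracket[OF w l, of z z'] unfolding q_def \<beta>_def a_def \<kappa>_def by simp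
    show "q z z' = q z' z" for z z' by (simp add: q_def norm_minus_commute)
    show "(\<integral>\<^sup>+ z'. ennreal (q z z') \<partial>lborel) \<le> ennreal ((8 * pi\<^sup>2 / l\<^sup>2) ^ CARD('n))" for z
    proof -
      let ?c = "(pi / (2 * \<kappa> * Re a)) ^ CARD('n) / (cmod (1 - w))\<^sup>2 ^ CARD('n)"
      have c0: "0 \<le> ?c" using R \<kappa> by simp
      have "(\<integral>\<^sup>+ z'. ennreal (q z z') \<partial>lborel) = (\<integral>\<^sup>+ z'. ennreal ?c * ennreal (exp (- \<beta> * (norm (- z + z'))\<^sup>2)) \<partial>lborel)"
      proof (intro nn_integral_cong)
        fix z'
        have "norm (z - z') = norm (- z + z')" by (metis norm_minus_commute uminus_add_conv_diff)
        then show "ennreal (q z z') = ennreal ?c * ennreal (exp (- \<beta> * (norm (- z + z'))\<^sup>2))"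
          unfolding q_def by (simp only: ennreal_mult[OF c0 exp_ge_zero])
      qed
      also have "\<dots> = (\<integral>\<^sup>+ z'. ennreal ?c * ennreal (exp (- \<beta> * (norm (z' :: complex ^ 'n))\<^sup>2)) \<partial>lborel)"
        by (rule lborel_nn_integral_shift[of "\<lambda>z'. ennreal ?c * ennreal (exp (- \<beta> * (norm z')\<^sup>2))"]) measurable
      also have "\<dots> = ennreal ?c * ennreal (sqrt (pi / \<beta>) ^ DIM(complex ^ 'n))"
        unfolding nn_integral_gauss[OF \<beta>, where 'a = "complex ^ 'n", symmetric]
        by (rule nn_integral_cmult) measurable
      also have "sqrt (pi / \<beta>) ^ DIM(complex ^ 'n) = (pi / \<beta>) ^ CARD('n)"
        using \<beta> by (intro sqrt_power_DIM) simp
      also have "ennreal ?c * ennreal ((pi / \<beta>) ^ CARD('n)) = ennreal (?c * (pi / \<beta>) ^ CARD('n))"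
        using \<beta> c0 by (intro ennreal_mult[symmetric]) auto
      also have "?c * (pi / \<beta>) ^ CARD('n) = (pi / (2 * \<kappa> * Re a) / (cmod (1 - w))\<^sup>2 * (pi / \<beta>)) ^ CARD('n)"
        by (simp only: power_mult_distrib power_divide)
      also have "ennreal \<dots> \<le> ennreal ((8 * pi\<^sup>2 / l\<^sup>2) ^ CARD('n))"
      proof (intro ennreal_leI power_mono)
        \<comment> \<open>\<open>Re a\<close> cancels between the height and the width of the
          Gaussian, and \<open>Re_Cayley\<close> disposes of the remaining dependence on
          \<open>w\<close>. With kappa = |l| / 4 this is the origin of the constant 8 pi^2 /
          l^2.\<close>
        have "pi / (2 * \<kappa> * Re a) / (cmod (1 - w))\<^sup>2 * (pi / \<beta>) = pi\<^sup>2 / (\<kappa>\<^sup>2 * ((cmod (1 - w))\<^sup>2 * ((cmod a)\<^sup>2 + 1)))"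
          using R \<kappa> by (simp add: \<beta>_def power2_eq_square)
        also have "\<dots> \<le> pi\<^sup>2 / (\<kappa>\<^sup>2 * 2)"
        proof (rule divide_left_mono)
          show "\<kappa>\<^sup>2 * 2 \<le> \<kappa>\<^sup>2 * ((cmod (1 - w))\<^sup>2 * ((cmod a)\<^sup>2 + 1))"
            unfolding a_def by (intro mult_left_mono Re_Cayley(2)[OF w]) simp
          then show "0 < \<kappa>\<^sup>2 * ((cmod (1 - w))\<^sup>2 * ((cmod a)\<^sup>2 + 1)) * (\<kappa>\<^sup>2 * 2)"
            using \<kappa> w1 by (intro mult_pos_pos add_nonneg_pos) auto
        qed simp
        also have "pi\<^sup>2 / (\<kappa>\<^sup>2 * 2) = 8 * pi\<^sup>2 / l\<^sup>2" using l by (simp add: \<kappa>_def power2_eq_square)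
        finally show "pi / (2 * \<kappa> * Re a) / (cmod (1 - w))\<^sup>2 * (pi / \<beta>) \<le> 8 * pi\<^sup>2 / l\<^sup>2" .
      next
        show "0 \<le> pi / (2 * \<kappa> * Re a) / (cmod (1 - w))\<^sup>2 * (pi / \<beta>)" using R \<kappa> \<beta> by simp
      qed
      finally show ?thesis .
    qed
  qed (rule g)
qed

section \<open>Summation over all rays at a fixed parameter, and Plancherel's inequality\<close>

lemma ray_weight_eq: "ray_weight CARD('n::finite) k = real ((k + (CARD('n) - 1)) choose (CARD('n) - 1))"
proof -
  have "0 < CARD('n)" by simp
  then show ?thesis by (simp add: ray_weight_def binomial_fact)
qed

lemma ray_weight_pos: "0 < ray_weight n k"
  by (simp add: ray_weight_def)

lemma summable_ray_weight:
  assumes r: "0 \<le> r" "r < 1"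
  shows "summable (\<lambda>k. ray_weight CARD('n::finite) k * r ^ k)"
proof -
  let ?i = "CARD('n) - 1"
  have "(\<lambda>k. complex_of_real (real (k + ?i choose ?i) * r ^ k)) sums (1 / (1 - of_real r) ^ Suc ?i)"
    using sums_binomial_lower[of "of_real r" ?i] r by simp
  then have "summable (\<lambda>k. complex_of_real (real (k + ?i choose ?i) * r ^ k))" by (rule sums_summable)
  then show ?thesis by (simp only: summable_complex_of_real ray_weight_eq)
qed

lemma phi_fun_measurable [measurable]: "phi_fun k l \<in> borel_measurable (borel :: (complex ^ 'n::finite) measure)"
  unfolding phi_fun_eq[abs_def] by (intro borel_measurable_continuous_onI continuous_intros) simp_all

text \<open>At the radius N / (N + 1) all powers up to \<open>N\<close> stay above 1/e, which
  replaces a limit of the radius to 1.\<close>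

lemma exp_le_power_quotient:
  assumes "k \<le> N"
  shows "exp (- 1) \<le> (real N / real (Suc N)) ^ k"
proof (cases "N = 0")
  case True
  then show ?thesis using assms by simp
next
  case False
  let ?r = "real N / real (Suc N)"
  have "1 / ?r = 1 + 1 / real N" using False by (simp add: field_simps)
  also have "\<dots> \<le> exp (1 / real N)" by (rule exp_ge_add_one_self)
  finally have "exp (- (1 / real N)) \<le> ?r" using False by (simp add: exp_minus field_simps)
  then have "exp (- (1 / real N)) ^ N \<le> ?r ^ N" by (rule power_mono) simp
  moreover have "exp (- (1 / real N)) ^ N = exp (- 1)" using False by (simp add: exp_of_nat_mult[symmetric])
  moreover have "?r ^ N \<le> ?r ^ k" using assms by (intro power_decreasing) auto
  ultimately show ?thesis by simp
qed

text \<open>For fixed \<open>v\<close> the numbers r^k S_k(v) are Fourier coefficients of a function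
  of the angle, namely the twisted convolution of \<open>g\<close> with the Gaussian at
  \<open>w = r * cis t\<close>. Bessel's inequality, Fubini's theorem and
  \<open>twisted_gauss_L2\<close> bound their square sum, uniformly in \<open>r\<close>. For r = N /
  (N + 1) the first \<open>N\<close> factors r^(2k) are at least e^(-2), which accounts for
  \<open>exp 2\<close> in \<open>A\<close>.\<close>

lemma twisted_laguerre_L2:
  fixes g :: "complex ^ 'n::finite \<Rightarrow> complex" and l :: real
  assumes l: "l \<noteq> 0" and g: "integrable lborel g"
  defines "A \<equiv> exp 2 * (8 * pi\<^sup>2 / l\<^sup>2) ^ CARD('n)"
  shows "(\<Sum>k. \<integral>\<^sup>+ v. (ennreal (cmod (LINT z|lborel. twist l z v * of_real (phi_fun k l (v - z)) * g z)))\<^sup>2 \<partial>lborel)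
    \<le> ennreal A * (\<integral>\<^sup>+ z. (ennreal (cmod (g z)))\<^sup>2 \<partial>lborel)"
proof -
  have [measurable]: "g \<in> borel_measurable borel" using g by simp
  define S where "S k v = (LINT z|lborel. twist l z v * of_real (phi_fun k l (v - z)) * g z)" for k v
  let ?w = "ray_weight CARD('n)"
  define G where "G = (LINT z|lborel. cmod (g z))"
  have kint: "integrable lborel (\<lambda>z. twist l z v * of_real (phi_fun k l (v - z)) * g z)"
    and kbound: "(LINT z|lborel. cmod (twist l z v * of_real (phi_fun k l (v - z)) * g z)) \<le> ?w k * G" for k v
  proof -
    have b: "cmod (twist l z v * of_real (phi_fun k l (v - z)) * g z) \<le> ?w k * cmod (g z)" for z
      using mult_right_mono[OF phi_fun_bound[of k l "v - z"], of "cmod (g z)"] by (simp add: norm_mult)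
    show int: "integrable lborel (\<lambda>z. twist l z v * of_real (phi_fun k l (v - z)) * g z)"
    proof (rule Bochner_Integration.integrable_bound)
      show "integrable lborel (\<lambda>z. ?w k * cmod (g z))" using g by simp
      show "(\<lambda>z. twist l z v * of_real (phi_fun k l (v - z)) * g z) \<in> borel_measurable lborel" by measurable
      show "AE z in lborel. norm (twist l z v * of_real (phi_fun k l (v - z)) * g z) \<le> norm (?w k * cmod (g z))"
        using b by (intro AE_I2 order_trans[OF b]) simp
    qed
    have "(LINT z|lborel. cmod (twist l z v * of_real (phi_fun k l (v - z)) * g z)) \<le> (LINT z|lborel. ?w k * cmod (g z))"
      by (rule integral_mono) (use int g b in auto)
    then show "(LINT z|lborel. cmod (twist l z v * of_real (phi_fun k l (v - z)) * g z)) \<le> ?w k * G"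
      by (simp add: G_def)
  qed
  have Sbound: "cmod (S k v) \<le> ?w k * G" for k v
    unfolding S_def by (rule order_trans[OF integral_norm_bound kbound])
  have Sm [measurable]: "S k \<in> borel_measurable borel" for k
  proof -
    have "S k \<in> borel_measurable lborel"
      unfolding S_def by (rule lborel.borel_measurable_lebesgue_integral) measurable
    then show ?thesis by simp
  qed
  have fin: "(\<Sum>k<N. \<integral>\<^sup>+ v. (ennreal (cmod (S k v)))\<^sup>2 \<partial>lborel) \<le> ennreal A * (\<integral>\<^sup>+ z. (ennreal (cmod (g z)))\<^sup>2 \<partial>lborel)" for N
  proof -
    define r where "r = real N / real (Suc N)"
    have r: "0 \<le> r" "r < 1" by (simp_all add: r_def)
    define c where "c v k = of_real (r ^ k) * S k v" for v k
    have csum: "summable (\<lambda>k. cmod (c v k))" for v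
    proof (rule summable_comparison_test')
      show "summable (\<lambda>k. G * (?w k * r ^ k))" by (intro summable_mult summable_ray_weight r)
      show "norm (cmod (c v k)) \<le> G * (?w k * r ^ k)" for k
        using mult_left_mono[OF Sbound[of k v], of "r ^ k"] r by (simp add: c_def norm_mult norm_power mult_ac)
    qed
    define F where "F v t = (\<Sum>k. c v k * cis (real k * t))" for v t
    have Fm [measurable]: "(\<lambda>(v, t). F v t) \<in> borel_measurable (lborel \<Otimes>\<^sub>M lborel)"
      unfolding F_def c_def cis_conv_exp by measurable
    \<comment> \<open>By \<open>phi_fun_bound\<close> the terms are dominated by
      \<open>?w k * r ^ k\<close>, which is summable; so the series may be summed under the
      integral, where it is the Gaussian kernel.\<close>
    have F_eq: "F v t = (LINT z|lborel. twist l z v * gauss_kernel l (of_real r * cis t) (v - z) * g z)" for v t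
    proof -
      define w where "w = of_real r * cis t"
      have w: "norm w < 1" using r by (simp add: w_def norm_mult)
      have wk: "w ^ k = of_real (r ^ k) * cis (real k * t)" for k
        by (simp only: w_def power_mult_distrib Complex.DeMoivre of_real_power)
      have nwk: "cmod (w ^ k) = r ^ k" for k using r by (simp add: wk norm_mult norm_power)
      let ?f = "\<lambda>k z. w ^ k * (twist l z v * of_real (phi_fun k l (v - z)) * g z)"
      have ptw: "(\<lambda>k. ?f k z) sums (twist l z v * gauss_kernel l w (v - z) * g z)" for z
      proof -
        have "(\<lambda>k. (twist l z v * g z) * (of_real (phi_fun k l (v - z)) * w ^ k)) sums ((twist l z v * g z) * gauss_kernel l w (v - z))"
          by (intro sums_mult phi_fun_generating w)
        then show ?thesis by (simp add: mult_ac)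
      qed
      have "(LINT z|lborel. (\<Sum>k. ?f k z)) = (\<Sum>k. LINT z|lborel. ?f k z)"
      proof (rule integral_suminf)
        show "integrable lborel (?f k)" for k using kint by simp
        show "AE z in lborel. summable (\<lambda>k. norm (?f k z))"
        proof (rule AE_I2, rule summable_comparison_test')
          fix z
          show "summable (\<lambda>k. cmod (g z) * (?w k * r ^ k))" by (intro summable_mult summable_ray_weight r)
          show "norm (norm (?f k z)) \<le> cmod (g z) * (?w k * r ^ k)" for k
          proof -
            have "norm (?f k z) = (r ^ k * cmod (g z)) * \<bar>phi_fun k l (v - z)\<bar>" by (simp add: norm_mult nwk[simplified norm_power] norm_power mult_ac)
            also have "\<dots> \<le> (r ^ k * cmod (g z)) * ?w k" using r by (intro mult_left_mono phi_fun_bound) simp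
            finally show ?thesis by (simp add: mult_ac)
          qed
        qed
        show "summable (\<lambda>k. LINT z|lborel. norm (?f k z))"
        proof (rule summable_comparison_test')
          show "summable (\<lambda>k. G * (?w k * r ^ k))" by (intro summable_mult summable_ray_weight r)
          fix k
          have "(LINT z|lborel. norm (?f k z)) = r ^ k * (LINT z|lborel. cmod (twist l z v * of_real (phi_fun k l (v - z)) * g z))"
            by (simp only: norm_mult[of "w ^ k"] nwk integral_mult_right_zero)
          also have "\<dots> \<le> r ^ k * (?w k * G)" using r by (intro mult_left_mono kbound) simp
          finally show "norm (LINT z|lborel. norm (?f k z)) \<le> G * (?w k * r ^ k)" by (simp add: mult_ac)
        qed
      qed
      moreover have "(\<Sum>k. ?f k z) = twist l z v * gauss_kernel l w (v - z) * g z" for z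
        using ptw by (rule sums_unique[symmetric])
      moreover have "(LINT z|lborel. ?f k z) = c v k * cis (real k * t)" for k
      proof -
        have "(LINT z|lborel. ?f k z) = w ^ k * S k v" by (simp only: integral_mult_right_zero S_def)
        then show ?thesis by (simp add: wk c_def mult_ac)
      qed
      ultimately show ?thesis by (simp only: F_def w_def)
    qed
    have "(\<Sum>k<N. \<integral>\<^sup>+ v. (ennreal (cmod (S k v)))\<^sup>2 \<partial>lborel) = (\<integral>\<^sup>+ v. (\<Sum>k<N. (ennreal (cmod (S k v)))\<^sup>2) \<partial>lborel)"
      by (rule nn_integral_sum[symmetric]) measurable
    also have "\<dots> \<le> (\<integral>\<^sup>+ v. ennreal (exp 2 / (2 * pi)) * (\<integral>\<^sup>+ t. (ennreal (cmod (F v t)))\<^sup>2 * indicator {0..2 * pi} t \<partial>lborel) \<partial>lborel)"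
    proof (rule nn_integral_mono)
      fix v
      have "(\<Sum>k<N. (cmod (S k v))\<^sup>2) \<le> exp 2 * (\<Sum>k<N. (cmod (c v k))\<^sup>2)"
        unfolding sum_distrib_left
      proof (rule sum_mono)
        fix k assume "k \<in> {..<N}"
        then have "exp (- 1) \<le> r ^ k" unfolding r_def by (intro exp_le_power_quotient) simp
        then have "exp (- 1) * exp (- 1) \<le> r ^ k * r ^ k" by (intro mult_mono) (use r in auto)
        then have "exp 2 * (exp (- 1) * exp (- 1)) \<le> exp 2 * (r ^ k * r ^ k)" by (rule mult_left_mono) simp
        then have "1 \<le> exp 2 * (r ^ k)\<^sup>2" by (simp add: mult_exp_exp power2_eq_square)
        from mult_right_mono[OF this, of "(cmod (S k v))\<^sup>2"]
        show "(cmod (S k v))\<^sup>2 \<le> exp 2 * (cmod (c v k))\<^sup>2"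
          using r by (simp add: c_def norm_mult norm_power power_mult_distrib mult_ac)
      qed
      then have "ennreal (\<Sum>k<N. (cmod (S k v))\<^sup>2) \<le> ennreal (exp 2) * ennreal (\<Sum>k<N. (cmod (c v k))\<^sup>2)"
        by (subst ennreal_mult[symmetric]) (auto intro!: ennreal_leI sum_nonneg)
      also have "\<dots> \<le> ennreal (exp 2) * (ennreal (1 / (2 * pi)) * (\<integral>\<^sup>+ t. (ennreal (cmod (F v t)))\<^sup>2 * indicator {0..2 * pi} t \<partial>lborel))"
        unfolding F_def by (intro mult_left_mono circle_Bessel csum) simp
      also have "\<dots> = ennreal (exp 2 / (2 * pi)) * (\<integral>\<^sup>+ t. (ennreal (cmod (F v t)))\<^sup>2 * indicator {0..2 * pi} t \<partial>lborel)"
        by (simp add: mult.assoc[symmetric] ennreal_mult[symmetric])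
      finally show "(\<Sum>k<N. (ennreal (cmod (S k v)))\<^sup>2) \<le> \<dots>"
        by (simp add: ennreal_power sum_ennreal)
    qed
    also have "\<dots> = ennreal (exp 2 / (2 * pi)) * (\<integral>\<^sup>+ v. \<integral>\<^sup>+ t. (ennreal (cmod (F v t)))\<^sup>2 * indicator {0..2 * pi} t \<partial>lborel \<partial>lborel)"
      by (rule nn_integral_cmult) measurable
    also have "(\<integral>\<^sup>+ v. \<integral>\<^sup>+ t. (ennreal (cmod (F v t)))\<^sup>2 * indicator {0..2 * pi} t \<partial>lborel \<partial>lborel) =
       (\<integral>\<^sup>+ t. \<integral>\<^sup>+ v. (ennreal (cmod (F v t)))\<^sup>2 * indicator {0..2 * pi} t \<partial>lborel \<partial>lborel)"
      by (rule lborel_pair.Fubini'[symmetric]) measurable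
    also have "\<dots> = (\<integral>\<^sup>+ t. (\<integral>\<^sup>+ v. (ennreal (cmod (F v t)))\<^sup>2 \<partial>lborel) * indicator {0..2 * pi} t \<partial>lborel)"
      by (intro nn_integral_cong nn_integral_multc) measurable
    also have "\<dots> \<le> (\<integral>\<^sup>+ t. (ennreal ((8 * pi\<^sup>2 / l\<^sup>2) ^ CARD('n)) * (\<integral>\<^sup>+ z. (ennreal (cmod (g z)))\<^sup>2 \<partial>lborel)) * indicator {0..2 * pi} t \<partial>lborel)"
    proof (intro nn_integral_mono mult_right_mono)
      fix t :: real
      have "norm (of_real r * cis t) < 1" using r by (simp add: norm_mult)
      from twisted_gauss_L2[OF this l g]
      show "(\<integral>\<^sup>+ v. (ennreal (cmod (F v t)))\<^sup>2 \<partial>lborel) \<le> ennreal ((8 * pi\<^sup>2 / l\<^sup>2) ^ CARD('n)) * (\<integral>\<^sup>+ z. (ennreal (cmod (g z)))\<^sup>2 \<partial>lborel)"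
        unfolding F_eq .
    qed simp
    also have "\<dots> = (ennreal ((8 * pi\<^sup>2 / l\<^sup>2) ^ CARD('n)) * (\<integral>\<^sup>+ z. (ennreal (cmod (g z)))\<^sup>2 \<partial>lborel)) * ennreal (2 * pi)"
      by (simp add: nn_integral_cmult_indicator)
    finally have "(\<Sum>k<N. \<integral>\<^sup>+ v. (ennreal (cmod (S k v)))\<^sup>2 \<partial>lborel) \<le>
      ennreal (exp 2 / (2 * pi)) * (ennreal ((8 * pi\<^sup>2 / l\<^sup>2) ^ CARD('n)) * ((\<integral>\<^sup>+ z. (ennreal (cmod (g z)))\<^sup>2 \<partial>lborel) * ennreal (2 * pi)))"
      by (simp add: mult_left_mono mult.assoc)
    also have "\<dots> = ennreal (exp 2 / (2 * pi) * (8 * pi\<^sup>2 / l\<^sup>2) ^ CARD('n) * (2 * pi)) * (\<integral>\<^sup>+ z. (ennreal (cmod (g z)))\<^sup>2 \<partial>lborel)"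
      by (rule ennreal_mult3) auto
    also have "exp 2 / (2 * pi) * (8 * pi\<^sup>2 / l\<^sup>2) ^ CARD('n) * (2 * pi) = A"
      by (simp add: A_def)
    finally show ?thesis .
  qed
  then show ?thesis unfolding S_def[symmetric] suminf_eq_SUP by (rule SUP_least)
qed

text \<open>Schur's test for the transform damped by a Gaussian in \<open>l\<close>. The kernel of
  S* S is then a Gaussian in \<open>t - s\<close> whose integral is \<open>2 * pi\<close> whatever
  the damping \<open>e\<close>, so the damping is removed by monotone convergence.\<close>

lemma Plancherel_le:
  fixes h :: "real \<Rightarrow> complex"
  assumes h: "integrable lborel h"
  shows "(\<integral>\<^sup>+ l. (ennreal (cmod (LINT t|lborel. h t * cis (- l * t))))\<^sup>2 \<partial>lborel) \<le> ennreal (2 * pi) * (\<integral>\<^sup>+ t. (ennreal (cmod (h t)))\<^sup>2 \<partial>lborel)"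
proof -
  have [measurable]: "h \<in> borel_measurable borel" using h by simp
  define H where "H l = (LINT t|lborel. h t * cis (- l * t))" for l
  have Hm [measurable]: "H \<in> borel_measurable borel"
  proof -
    have "H \<in> borel_measurable lborel"
      unfolding H_def cis_conv_exp by (rule lborel.borel_measurable_lebesgue_integral) measurable
    then show ?thesis by simp
  qed
  let ?e = "\<lambda>e l. exp (- (e / 2) * l\<^sup>2)"
  have reg: "(\<integral>\<^sup>+ l. (ennreal (cmod (H l)))\<^sup>2 * ennreal (exp (- e * l\<^sup>2)) \<partial>lborel) \<le> ennreal (2 * pi) * (\<integral>\<^sup>+ t. (ennreal (cmod (h t)))\<^sup>2 \<partial>lborel)"
    if e: "0 < e" for e :: real
  proof -
    define q where "q t s = sqrt (pi / e) * exp (- (1 / (4 * e)) * (norm (t - s))\<^sup>2)" for t s :: real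
    have g2: "(\<integral>\<^sup>+ l. ennreal (?e e l) \<partial>lborel) = ennreal (sqrt (2 * pi / e))"
      using nn_integral_gauss[where 'a = real, of "e / 2"] e by (simp add: mult.commute)
    have "(\<integral>\<^sup>+ l. (ennreal (cmod (LINT t|lborel. (of_real (?e e l) * cis (- l * t)) * h t)))\<^sup>2 \<partial>lborel) \<le> ennreal (2 * pi) * (\<integral>\<^sup>+ t. (ennreal (cmod (h t)))\<^sup>2 \<partial>lborel)"
    proof (rule Schur_test_square[where q = q and D = 1 and D' = "sqrt (2 * pi / e)"])
      show "sigma_finite_measure (lborel :: real measure)" "sigma_finite_measure (lborel :: real measure)"
        by (rule sigma_finite_lborel)+
      show "(\<lambda>(t, l). of_real (?e e l) * cis (- l * t)) \<in> borel_measurable (lborel \<Otimes>\<^sub>M lborel)"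
        unfolding cis_conv_exp by measurable
      show "(\<lambda>(x, y). q x y) \<in> borel_measurable (lborel \<Otimes>\<^sub>M lborel)"
        unfolding q_def by measurable
      show "cmod (of_real (?e e l) * cis (- l * t)) \<le> 1" for t l using e by (simp add: norm_mult)
      show "(\<integral>\<^sup>+ l. ennreal (cmod (of_real (?e e l) * cis (- l * t))) \<partial>lborel) \<le> ennreal (sqrt (2 * pi / e))" for t
        using g2 by (simp add: norm_mult)
      show "q t s = q s t" for t s by (simp add: q_def abs_minus_commute)
      show "cmod (LINT l|lborel. of_real (?e e l) * cis (- l * t) * cnj (of_real (?e e l) * cis (- l * s))) \<le> q t s" for t s
      proof -
        have eq: "of_real (?e e l) * cis (- l * t) * cnj (of_real (?e e l) * cis (- l * s)) = of_real (exp (- e * (norm l)\<^sup>2)) * cis ((s - t) \<bullet> l)" for l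
        proof -
          have "of_real (?e e l) * of_real (?e e l) = (of_real (exp (- e * (norm l)\<^sup>2)) :: complex)"
            by (simp add: mult_exp_exp field_simps flip: of_real_mult)
          moreover have "cis (- l * t) * cnj (cis (- l * s)) = cis ((s - t) \<bullet> l)"
            by (simp add: cis_cnj cis_mult algebra_simps)
          moreover have "of_real (?e e l) * cis (- l * t) * cnj (of_real (?e e l) * cis (- l * s)) =
            (of_real (?e e l) * of_real (?e e l)) * (cis (- l * t) * cnj (cis (- l * s)))"
            by (simp only: complex_cnj_mult complex_cnj_complex_of_real mult_ac)
          ultimately show ?thesis by simp
        qed
        have "cmod (LINT l|lborel. of_real (?e e l) * cis (- l * t) * cnj (of_real (?e e l) * cis (- l * s))) = sqrt (pi / e) * exp (- ((norm (s - t))\<^sup>2 / (4 * e)))"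
          unfolding eq gauss_cis(2)[OF e] using e by (simp add: norm_mult)
        then show ?thesis by (simp add: q_def power2_commute)
      qed
      show "(\<integral>\<^sup>+ s. ennreal (q t s) \<partial>lborel) \<le> ennreal (2 * pi)" for t
      proof -
        have d: "0 < 1 / (4 * e)" using e by simp
        have "(\<integral>\<^sup>+ s. ennreal (q t s) \<partial>lborel) = (\<integral>\<^sup>+ s. ennreal (sqrt (pi / e)) * ennreal (exp (- (1 / (4 * e)) * (norm (- t + s))\<^sup>2)) \<partial>lborel)"
        proof (intro nn_integral_cong)
          fix s
          have "norm (t - s) = norm (- t + s)" by simp
          then show "ennreal (q t s) = ennreal (sqrt (pi / e)) * ennreal (exp (- (1 / (4 * e)) * (norm (- t + s))\<^sup>2))"
            unfolding q_def using e by (subst ennreal_mult[symmetric]) auto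
        qed
        also have "\<dots> = (\<integral>\<^sup>+ s. ennreal (sqrt (pi / e)) * ennreal (exp (- (1 / (4 * e)) * (norm (s :: real))\<^sup>2)) \<partial>lborel)"
          by (rule lborel_nn_integral_shift[of "\<lambda>s. ennreal (sqrt (pi / e)) * ennreal (exp (- (1 / (4 * e)) * (norm s)\<^sup>2))"]) measurable
        also have "\<dots> = ennreal (sqrt (pi / e)) * ennreal (sqrt (pi / (1 / (4 * e))) ^ DIM(real))"
          unfolding nn_integral_gauss[OF d, where 'a = real, symmetric] by (rule nn_integral_cmult) measurable
        also have "\<dots> = ennreal (sqrt (pi / e) * sqrt (pi / (1 / (4 * e))))"
          using e by (simp add: ennreal_mult)
        also have "sqrt (pi / e) * sqrt (pi / (1 / (4 * e))) = 2 * pi"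
        proof -
          have "sqrt (pi / e) * sqrt (pi / (1 / (4 * e))) = sqrt ((2 * pi)\<^sup>2)"
            using e by (subst real_sqrt_mult[symmetric]) (simp add: power2_eq_square)
          also have "\<dots> = \<bar>2 * pi\<bar>" by (rule real_sqrt_abs)
          finally show ?thesis by simp
        qed
        finally show ?thesis by simp
      qed
    qed (rule h)
    moreover have "(ennreal (cmod (LINT t|lborel. (of_real (?e e l) * cis (- l * t)) * h t)))\<^sup>2 = (ennreal (cmod (H l)))\<^sup>2 * ennreal (exp (- e * l\<^sup>2))" for l
    proof -
      have "(LINT t|lborel. (of_real (?e e l) * cis (- l * t)) * h t) = (LINT t|lborel. of_real (?e e l) * (h t * cis (- l * t)))"
        by (simp only: mult_ac)
      also have "\<dots> = of_real (?e e l) * H l" by (simp only: integral_mult_right_zero H_def)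
      finally have X: "cmod (LINT t|lborel. (of_real (?e e l) * cis (- l * t)) * h t) = ?e e l * cmod (H l)" by (simp add: norm_mult)
      have "(?e e l * cmod (H l))\<^sup>2 = (cmod (H l))\<^sup>2 * exp (- e * l\<^sup>2)"
        by (simp add: power_mult_distrib exp_double[symmetric] mult.commute)
      then have "(ennreal (?e e l * cmod (H l)))\<^sup>2 = ennreal ((cmod (H l))\<^sup>2 * exp (- e * l\<^sup>2))"
        by (simp only: ennreal_power mult_nonneg_nonneg exp_ge_zero norm_ge_zero)
      also have "\<dots> = ennreal ((cmod (H l))\<^sup>2) * ennreal (exp (- e * l\<^sup>2))" by (intro ennreal_mult) auto
      also have "ennreal ((cmod (H l))\<^sup>2) = (ennreal (cmod (H l)))\<^sup>2" by (simp only: ennreal_power norm_ge_zero)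
      finally show ?thesis unfolding X .
    qed
    ultimately show ?thesis by (simp only:)
  qed
  have "(\<integral>\<^sup>+ l. (ennreal (cmod (H l)))\<^sup>2 \<partial>lborel) = (\<integral>\<^sup>+ l. (SUP n. (ennreal (cmod (H l)))\<^sup>2 * ennreal (exp (- (1 / real (Suc n)) * l\<^sup>2))) \<partial>lborel)"
  proof (rule nn_integral_cong)
    fix l :: real
    have inc: "incseq (\<lambda>n. (ennreal (cmod (H l)))\<^sup>2 * ennreal (exp (- (1 / real (Suc n)) * l\<^sup>2)))"
    proof (intro incseq_SucI mult_left_mono ennreal_leI)
      fix n
      have "1 / real (Suc (Suc n)) \<le> 1 / real (Suc n)" by (intro divide_left_mono) auto
      from mult_right_mono[OF this, of "l\<^sup>2"]
      show "exp (- (1 / real (Suc n)) * l\<^sup>2) \<le> exp (- (1 / real (Suc (Suc n))) * l\<^sup>2)" by simp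
    qed simp
    have "(\<lambda>n. exp (- (1 / real (Suc n)) * l\<^sup>2)) \<longlonglongrightarrow> exp (- 0 * l\<^sup>2)"
      using LIMSEQ_inverse_real_of_nat by (intro tendsto_intros) (simp add: inverse_eq_divide)
    then have "(\<lambda>n. (ennreal (cmod (H l)))\<^sup>2 * ennreal (exp (- (1 / real (Suc n)) * l\<^sup>2))) \<longlonglongrightarrow> (ennreal (cmod (H l)))\<^sup>2 * ennreal (exp (- 0 * l\<^sup>2))"
      by (intro ennreal_tendsto_cmult tendsto_ennrealI) (simp_all add: ennreal_power)
    with LIMSEQ_unique[OF this LIMSEQ_SUP[OF inc]]
    show "(ennreal (cmod (H l)))\<^sup>2 = (SUP n. (ennreal (cmod (H l)))\<^sup>2 * ennreal (exp (- (1 / real (Suc n)) * l\<^sup>2)))" by simp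
  qed
  also have "\<dots> = (SUP n. \<integral>\<^sup>+ l. (ennreal (cmod (H l)))\<^sup>2 * ennreal (exp (- (1 / real (Suc n)) * l\<^sup>2)) \<partial>lborel)"
  proof (rule nn_integral_monotone_convergence_SUP)
    show "incseq (\<lambda>n l. (ennreal (cmod (H l)))\<^sup>2 * ennreal (exp (- (1 / real (Suc n)) * l\<^sup>2)))"
    proof (intro incseq_SucI le_funI mult_left_mono ennreal_leI)
      fix n and l :: real
      have "1 / real (Suc (Suc n)) \<le> 1 / real (Suc n)" by (intro divide_left_mono) auto
      from mult_right_mono[OF this, of "l\<^sup>2"]
      show "exp (- (1 / real (Suc n)) * l\<^sup>2) \<le> exp (- (1 / real (Suc (Suc n))) * l\<^sup>2)" by simp
    qed simp
  qed measurable
  also have "\<dots> \<le> ennreal (2 * pi) * (\<integral>\<^sup>+ t. (ennreal (cmod (h t)))\<^sup>2 \<partial>lborel)"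
    by (intro SUP_least reg) simp
  finally show ?thesis unfolding H_def .
qed

section \<open>The normalized Strichartz transform as an integral operator\<close>

lemma sets_nu2: "sets (nu2 n) = sets (restrict_space borel (fan n))"
  by (simp add: nu2_def)

lemma measurable_nu2_borel [measurable]: "(\<lambda>a. a) \<in> measurable (nu2 n) borel"
proof -
  have "(\<lambda>a. a) \<in> measurable (restrict_space borel (fan n)) borel"
    by (rule measurable_restrict_space1) measurable
  then show ?thesis by (simp cong: measurable_cong_sets add: measurable_cong_sets[OF sets_nu2 refl])
qed

lemma borel_measurable_fst_real: "(fst :: real \<times> real \<Rightarrow> real) \<in> borel_measurable borel"
  and borel_measurable_snd_real: "(snd :: real \<times> real \<Rightarrow> real) \<in> borel_measurable borel"
  by (intro borel_measurable_continuous_onI continuous_intros)+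

lemma sets_nu2_Collect: "{a \<in> space borel. P a} \<in> sets borel \<Longrightarrow> {a \<in> fan n. P a} \<in> sets (nu2 n)"
  by (auto simp: sets_nu2 sets_restrict_space)

text \<open>The parametrisation meets this set only at \<open>l = 0\<close>, where the density
  |l|^(2n) vanishes because \<open>n\<close> is positive.\<close>

lemma null_ray_inf:
  assumes n: "0 < n"
  shows "{a \<in> fan n. fst a = 0} \<in> null_sets (nu2 n)"
proof (rule null_setsI)
  let ?Z = "{a \<in> fan n. fst a = 0}"
  have "{a \<in> fan n. fst a \<le> 0 \<and> 0 \<le> fst a} \<in> sets (nu2 n)"
    by (rule sets_nu2_Collect, unfold borel_prod[symmetric]) measurable
  moreover have "{a \<in> fan n. fst a \<le> 0 \<and> 0 \<le> fst a} = ?Z" by auto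
  ultimately show Z: "?Z \<in> sets (nu2 n)" by simp
  have "emeasure (nu2 n) ?Z = (\<integral>\<^sup>+ a. indicator ?Z a \<partial>nu2 n)" using Z by simp
  also have "\<dots> = ennreal (1 / (2 * pi) ^ (2 * n + 1)) *
    (\<integral>\<^sup>+ l. (\<Sum>k. ennreal ((ray_weight n k)\<^sup>2) * indicator ?Z (l, (2 * real k + real n) * \<bar>l\<bar>)) * ennreal (\<bar>l\<bar> ^ (2 * n)) \<partial>lborel)"
    using Z by (intro nn_integral_nu2) (simp add: sets_nu2)
  also have "(\<integral>\<^sup>+ l. (\<Sum>k. ennreal ((ray_weight n k)\<^sup>2) * indicator ?Z (l, (2 * real k + real n) * \<bar>l\<bar>)) * ennreal (\<bar>l\<bar> ^ (2 * n)) \<partial>lborel) = (\<integral>\<^sup>+ l. 0 \<partial>(lborel :: real measure))"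
  proof (rule nn_integral_cong)
    fix l :: real
    show "(\<Sum>k. ennreal ((ray_weight n k)\<^sup>2) * indicator ?Z (l, (2 * real k + real n) * \<bar>l\<bar>)) * ennreal (\<bar>l\<bar> ^ (2 * n)) = 0"
      using n by (cases "l = 0") (simp_all add: indicator_def)
  qed
  finally show "emeasure (nu2 n) ?Z = 0" by simp
qed

text \<open>The sets \<open>Bs (k, m)\<close> are bounded pieces of single rays, so only one term of
  the series over the rays survives on each of them. With the null set at
  \<open>\<lambda> = 0\<close> they cover the fan.\<close>

lemma sigma_finite_nu2:
  assumes n: "0 < n"
  shows "sigma_finite_measure (nu2 n)"
proof
  define Bs where "Bs q = {a \<in> fan n. fst a \<noteq> 0 \<and> snd a = (2 * real (fst q) + real n) * \<bar>fst a\<bar> \<and> \<bar>fst a\<bar> \<le> real (snd q)}" for q :: "nat \<times> nat"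
  let ?Z = "{a \<in> fan n. fst a = 0}"
  let ?A = "insert ?Z (range Bs)"
  have B: "Bs (k, m) \<in> sets (nu2 n)" for k m :: nat
  proof -
    let ?c = "2 * real k + real n"
    have "closed {a :: real \<times> real. snd a = ?c * \<bar>fst a\<bar>}" "closed {a :: real \<times> real. \<bar>fst a\<bar> \<le> real m}"
      "closed {a :: real \<times> real. fst a = 0}"
      by (intro closed_Collect_eq closed_Collect_le continuous_intros)+
    then have "{a. snd a = ?c * \<bar>fst a\<bar>} \<inter> {a. \<bar>fst a\<bar> \<le> real m} - {a. fst a = 0} \<in> sets borel"
      by (intro sets.Diff sets.Int borel_closed)
    moreover have "{a. snd a = ?c * \<bar>fst a\<bar>} \<inter> {a. \<bar>fst a\<bar> \<le> real m} - {a. fst a = 0} =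
      {a \<in> space borel. fst a \<noteq> 0 \<and> snd a = ?c * \<bar>fst a\<bar> \<and> \<bar>fst a\<bar> \<le> real m}" by auto
    ultimately have "{a \<in> fan n. fst a \<noteq> 0 \<and> snd a = ?c * \<bar>fst a\<bar> \<and> \<bar>fst a\<bar> \<le> real m} \<in> sets (nu2 n)"
      by (intro sets_nu2_Collect) (simp only:)
    then show ?thesis by (simp add: Bs_def)
  qed
  have fin: "emeasure (nu2 n) (Bs (k, m)) \<noteq> \<infinity>" for k m :: nat
  proof -
    have "emeasure (nu2 n) (Bs (k, m)) = (\<integral>\<^sup>+ a. indicator (Bs (k, m)) a \<partial>nu2 n)" using B by simp
    also have "\<dots> = ennreal (1 / (2 * pi) ^ (2 * n + 1)) *
      (\<integral>\<^sup>+ l. (\<Sum>j. ennreal ((ray_weight n j)\<^sup>2) * indicator (Bs (k, m)) (l, (2 * real j + real n) * \<bar>l\<bar>)) * ennreal (\<bar>l\<bar> ^ (2 * n)) \<partial>lborel)"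
      using B[of k m] by (intro nn_integral_nu2) (simp add: sets_nu2)
    also have "\<dots> \<le> ennreal (1 / (2 * pi) ^ (2 * n + 1)) *
      (\<integral>\<^sup>+ l. ennreal ((ray_weight n k)\<^sup>2 * real m ^ (2 * n)) * indicator {- real m..real m} l \<partial>lborel)"
    proof (intro mult_left_mono nn_integral_mono)
      fix l :: real
      let ?T = "\<lambda>j. ennreal ((ray_weight n j)\<^sup>2) * indicator (Bs (k, m)) (l, (2 * real j + real n) * \<bar>l\<bar>)"
      have "suminf ?T = sum ?T {k}"
        by (rule suminf_finite) (auto simp: indicator_def Bs_def)
      then have e: "suminf ?T = ?T k"
        by (simp only: sum.insert finite.emptyI empty_iff not_False_eq_True sum.empty add_0_right)
      show "(\<Sum>j. ennreal ((ray_weight n j)\<^sup>2) * indicator (Bs (k, m)) (l, (2 * real j + real n) * \<bar>l\<bar>)) * ennreal (\<bar>l\<bar> ^ (2 * n))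
        \<le> ennreal ((ray_weight n k)\<^sup>2 * real m ^ (2 * n)) * indicator {- real m..real m} l"
      proof (cases "\<bar>l\<bar> \<le> real m")
        case True
        then have "(ray_weight n k)\<^sup>2 * \<bar>l\<bar> ^ (2 * n) \<le> (ray_weight n k)\<^sup>2 * real m ^ (2 * n)"
          by (intro mult_left_mono power_mono) auto
        then have "ennreal ((ray_weight n k)\<^sup>2) * ennreal (\<bar>l\<bar> ^ (2 * n)) \<le> ennreal ((ray_weight n k)\<^sup>2 * real m ^ (2 * n))"
          by (subst ennreal_mult[symmetric]) (auto intro!: ennreal_leI)
        then show ?thesis unfolding e using True by (auto simp: indicator_def Bs_def)
      next
        case False
        then show ?thesis unfolding e by (simp add: indicator_def Bs_def)
      qed
    qed simp
    also have "\<dots> < \<infinity>"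
      by (simp add: nn_integral_cmult_indicator ennreal_mult_less_top)
    finally show ?thesis by simp
  qed
  show "\<exists>A. countable A \<and> A \<subseteq> sets (nu2 n) \<and> \<Union> A = space (nu2 n) \<and> (\<forall>a\<in>A. emeasure (nu2 n) a \<noteq> \<infinity>)"
  proof (intro exI[of _ ?A] conjI)
    show "countable ?A" by simp
    show "?A \<subseteq> sets (nu2 n)" using B null_ray_inf[OF n] by auto
    show "\<forall>a\<in>?A. emeasure (nu2 n) a \<noteq> \<infinity>" using fin null_ray_inf[OF n] by (auto simp: null_sets_def)
    show "\<Union> ?A = space (nu2 n)"
    proof (intro set_eqI iffI)
      fix a assume a: "a \<in> space (nu2 n)"
      show "a \<in> \<Union> ?A"
      proof (cases "fst a = 0")
        case True
        then show ?thesis using a by (auto simp: space_nu2)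
      next
        case False
        then obtain k where "snd a = (2 * real k + real n) * \<bar>fst a\<bar>"
          using a by (auto simp: space_nu2 fan_def ray_def ray_inf_def)
        moreover obtain m :: nat where "\<bar>fst a\<bar> \<le> real m" using real_arch_simple by auto
        ultimately have "a \<in> Bs (k, m)" using a False by (simp add: space_nu2 Bs_def)
        then show ?thesis by blast
      qed
    qed (auto simp: space_nu2 Bs_def)
  qed
qed

lemma fan_index_measurable: "fan_index n \<in> measurable (nu2 n) (count_space UNIV)"
proof -
  define f where "f a = (if fst a \<le> 0 \<and> 0 \<le> fst a then fan_index n (0, 0) else nat \<lfloor>(snd a / \<bar>fst a\<bar> - real n) / 2\<rfloor>)" for a :: "real \<times> real"
  have "f \<in> measurable borel (count_space UNIV)"
    unfolding f_def borel_prod[symmetric] by measurable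
  from measurable_compose[OF measurable_nu2_borel this]
  have "f \<in> measurable (nu2 n) (count_space UNIV)" .
  moreover have "fan_index n a = f a" if a: "a \<in> space (nu2 n)" for a
  proof (cases "fst a = 0")
    case True
    \<comment> \<open>Such points lie on no ray. The description that defines
      \<open>fan_index\<close> is then the same empty one for all of them, and its value, though
      unspecified, is constant.\<close>
    then have "\<not> a \<in> ray n k" "\<not> (0, 0) \<in> ray n k" for k by (auto simp: ray_def)
    then show ?thesis using True by (simp add: f_def fan_index_def)
  next
    case False
    then obtain k where k: "snd a = (2 * real k + real n) * \<bar>fst a\<bar>"
      using a by (auto simp: space_nu2 fan_def ray_def ray_inf_def)
    then have "fan_index n a = k" using fan_index_eq[OF False, of n k] by (metis prod.collapse)
    then show ?thesis using False k by (simp add: f_def)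
  qed
  ultimately show ?thesis by (subst measurable_cong) auto
qed

text \<open>On \<open>ray_inf\<close> the index is an unspecified constant and the formula is not
  that of the transform, but this set is null. Normalizing by the weight of the same index keeps the
  bound by 1 valid at every point, as \<open>kernel_op\<close> demands.\<close>

definition strichartz_kernel :: "'n::finite heis \<Rightarrow> (real \<times> real) \<times> (complex ^ 'n) \<Rightarrow> complex" where
  "strichartz_kernel g y = of_real (inverse (ray_weight CARD('n) (fan_index CARD('n) (fst y)))) *
     e_fun (fan_index CARD('n) (fst y)) (fst (fst y)) (hmult (hinv g) (snd y, 0))"

lemma e_fun_hmult:
  "e_fun k l (hmult (hinv (z, t)) (w, 0)) = twist l z w * of_real (phi_fun k l (w - z)) * cis (- l * t)"
  by (simp add: e_fun_def hmult_def hinv_def herm_minus twist_def cis_mult algebra_simps)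

lemma strichartz_kernel_bound: "cmod (strichartz_kernel g (y :: (real \<times> real) \<times> (complex ^ 'n::finite))) \<le> 1"
proof (cases g)
  case (Pair z t)
  let ?w = "ray_weight CARD('n) (fan_index CARD('n) (fst y))"
  have "cmod (strichartz_kernel g y) = inverse ?w * \<bar>phi_fun (fan_index CARD('n) (fst y)) (fst (fst y)) (snd y - z)\<bar>"
    using ray_weight_pos[of "CARD('n)" "fan_index CARD('n) (fst y)"]
    by (simp add: strichartz_kernel_def Pair e_fun_hmult norm_mult norm_inverse)
  also have "\<dots> \<le> inverse ?w * ?w"
    using ray_weight_pos by (intro mult_left_mono phi_fun_bound) (simp add: less_imp_le)
  also have "\<dots> = 1" using ray_weight_pos[of "CARD('n)" "fan_index CARD('n) (fst y)"] by simp
  finally show ?thesis .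
qed

text \<open>For a fixed index the expression is continuous in all variables, and the index is a
  measurable function with countably many values.\<close>

lemma strichartz_kernel_measurable:
  "(\<lambda>(g, y). strichartz_kernel g (y :: (real \<times> real) \<times> (complex ^ 'n::finite))) \<in> borel_measurable (lborel \<Otimes>\<^sub>M (nu2 CARD('n) \<Otimes>\<^sub>M lborel))"
    (is "_ \<in> borel_measurable ?M")
proof -
  define E where "E k p = (case p of (l, (z, t), w) \<Rightarrow> of_real (inverse (ray_weight CARD('n) k)) * (twist l z w * of_real (phi_fun k l (w - z)) * cis (- l * t)))"
    for k and p :: "real \<times> 'n heis \<times> (complex ^ 'n)"
  have Em: "E k \<in> borel_measurable borel" for k
    unfolding E_def split_beta twist_def herm_def phi_fun_eq cis_conv_exp
    by (intro borel_measurable_continuous_onI continuous_intros) simp_all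
  have a: "(\<lambda>x. fst (fst (snd x))) \<in> borel_measurable ?M"
  proof -
    have "(\<lambda>x. fst (snd x)) \<in> measurable ?M (nu2 CARD('n))" by measurable
    from measurable_compose[OF this measurable_nu2_borel] have "(\<lambda>x. fst (snd x)) \<in> borel_measurable ?M" .
    from measurable_compose[OF this borel_measurable_fst_real] show ?thesis .
  qed
  have "fst \<in> measurable ?M lborel" "(\<lambda>x. snd (snd x)) \<in> measurable ?M lborel" by measurable
  then have "(\<lambda>x. (fst (fst (snd x)), fst x, snd (snd x))) \<in> borel_measurable ?M"
    by (intro borel_measurable_Pair a) simp_all
  from measurable_compose[OF this Em]
  have "(\<lambda>x. E k (fst (fst (snd x)), fst x, snd (snd x))) \<in> borel_measurable ?M" for k .
  moreover have "(\<lambda>x. fan_index CARD('n) (fst (snd x))) \<in> measurable ?M (count_space UNIV)"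
    by (rule measurable_compose[OF _ fan_index_measurable]) measurable
  ultimately have "(\<lambda>x. E (fan_index CARD('n) (fst (snd x))) (fst (fst (snd x)), fst x, snd (snd x))) \<in> borel_measurable ?M"
    by (rule measurable_compose_countable)
  moreover have "(\<lambda>x. E (fan_index CARD('n) (fst (snd x))) (fst (fst (snd x)), fst x, snd (snd x))) =
     (\<lambda>(g, y). strichartz_kernel g y)"
    by (auto simp: fun_eq_iff E_def strichartz_kernel_def e_fun_hmult)
  ultimately show ?thesis by simp
qed

text \<open>After the partial Fourier transform \<open>H\<close> in \<open>t\<close>, the operator
  on the ray of index \<open>k\<close> is a twisted convolution with a Laguerre function, divided by
  the ray weight. The squared weight in \<open>nu2\<close> undoes the division, the density |l|^(2n)
  cancels the l^(-2n) from \<open>twisted_laguerre_L2\<close>, and \<open>Plancherel_le\<close>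
  handles the integral over \<open>l\<close>.\<close>

lemma strichartz_kernel_L2:
  fixes f :: "'n::finite heis \<Rightarrow> complex"
  assumes f: "integrable lborel f"
  defines "n \<equiv> CARD('n)"
  shows "(\<integral>\<^sup>+ y. (ennreal (cmod (LINT x|lborel. strichartz_kernel x y * f x)))\<^sup>2 \<partial>(nu2 n \<Otimes>\<^sub>M lborel)) \<le>
    ennreal (1 / (2 * pi) ^ (2 * n + 1) * (exp 2 * (8 * pi\<^sup>2) ^ n) * (2 * pi)) * (\<integral>\<^sup>+ x. (ennreal (cmod (f x)))\<^sup>2 \<partial>lborel)"
proof -
  have n: "0 < n" by (simp add: n_def)
  interpret nu: sigma_finite_measure "nu2 n" by (rule sigma_finite_nu2[OF n])
  have fb: "f \<in> borel_measurable borel" using f by simp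
  then have f2 [measurable]: "f \<in> borel_measurable (lborel \<Otimes>\<^sub>M lborel)" by (simp add: lborel_prod)
  have fint: "integrable (lborel \<Otimes>\<^sub>M lborel) f" using f by (simp add: lborel_prod)
  define T where "T y = (LINT x|lborel. strichartz_kernel x y * f x)" for y
  have Tm [measurable]: "T \<in> borel_measurable (nu2 n \<Otimes>\<^sub>M lborel)"
  proof -
    have "(\<lambda>(y, x). strichartz_kernel x y * f x) \<in> borel_measurable ((nu2 n \<Otimes>\<^sub>M lborel) \<Otimes>\<^sub>M lborel)"
    proof -
      have "(\<lambda>p. (snd p, fst p)) \<in> measurable ((nu2 n \<Otimes>\<^sub>M lborel) \<Otimes>\<^sub>M lborel) (lborel \<Otimes>\<^sub>M (nu2 n \<Otimes>\<^sub>M lborel))" by measurable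
      from measurable_compose[OF this strichartz_kernel_measurable[where 'n = 'n, folded n_def]]
      have k: "(\<lambda>p. strichartz_kernel (snd p :: 'n heis) (fst p)) \<in> borel_measurable ((nu2 n \<Otimes>\<^sub>M lborel) \<Otimes>\<^sub>M lborel)" by simp
      have "(\<lambda>p. f (snd p)) \<in> borel_measurable ((nu2 n \<Otimes>\<^sub>M (lborel :: (complex ^ 'n) measure)) \<Otimes>\<^sub>M lborel)"
        by (rule measurable_compose[OF measurable_snd]) (simp add: fb)
      with k show ?thesis unfolding split_beta by (rule borel_measurable_times)
    qed
    then show ?thesis unfolding T_def by (rule lborel.borel_measurable_lebesgue_integral)
  qed
  define H where "H l z = (LINT t|lborel. f (z, t) * cis (- l * t))" for l z
  have Hm [measurable]: "(\<lambda>(l, z). H l z) \<in> borel_measurable (lborel \<Otimes>\<^sub>M lborel)"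
  proof -
    have m: "(\<lambda>(p, t). f (snd p, t) * cis (- fst p * t)) \<in> borel_measurable ((lborel \<Otimes>\<^sub>M lborel) \<Otimes>\<^sub>M lborel)"
    proof -
      have "(\<lambda>p. (snd (fst p), snd p)) \<in> measurable ((lborel \<Otimes>\<^sub>M lborel) \<Otimes>\<^sub>M lborel) (lborel \<Otimes>\<^sub>M lborel)" by measurable
      from measurable_compose[OF this f2] show ?thesis unfolding split_beta cis_conv_exp by measurable
    qed
    from lborel.borel_measurable_lebesgue_integral[OF m]
    show ?thesis unfolding H_def split_beta' .
  qed
  have Hint: "integrable lborel (H l)" for l
  proof -
    have "integrable (lborel \<Otimes>\<^sub>M lborel) (\<lambda>p. f p * cis (- l * snd p))"
    proof (rule Bochner_Integration.integrable_bound[OF fint])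
      show "(\<lambda>p. f p * cis (- l * snd p)) \<in> borel_measurable (lborel \<Otimes>\<^sub>M lborel)" unfolding cis_conv_exp by measurable
    qed (simp add: norm_mult)
    from lborel_pair.integrable_fst'[OF this] show ?thesis unfolding H_def by simp
  qed
  have TH: "T ((l, (2 * real k + real n) * \<bar>l\<bar>), w) =
      of_real (inverse (ray_weight n k)) * (LINT z|lborel. twist l z w * of_real (phi_fun k l (w - z)) * H l z)"
    if l: "l \<noteq> 0" for l k w
  proof -
    have k: "fan_index n (l, (2 * real k + real n) * \<bar>l\<bar>) = k" by (rule fan_index_eq[OF l])
    let ?g = "\<lambda>p. (twist l (fst p) w * of_real (phi_fun k l (w - fst p)) * cis (- l * snd p)) * f p"
    have gint: "integrable (lborel \<Otimes>\<^sub>M lborel) ?g"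
    proof (rule Bochner_Integration.integrable_bound)
      show "integrable (lborel \<Otimes>\<^sub>M lborel) (\<lambda>p. of_real (ray_weight n k) * f p)" using fint by simp
      show "?g \<in> borel_measurable (lborel \<Otimes>\<^sub>M lborel)" unfolding cis_conv_exp by measurable
      show "AE p in lborel \<Otimes>\<^sub>M lborel. norm (?g p) \<le> norm (of_real (ray_weight n k) * f p)"
        using phi_fun_bound[where 'n = 'n, of k l, folded n_def] ray_weight_pos[of n k]
        by (intro AE_I2) (auto simp: norm_mult intro!: mult_right_mono)
    qed
    have "T ((l, (2 * real k + real n) * \<bar>l\<bar>), w) = (LINT p|lborel. of_real (inverse (ray_weight n k)) * ?g p)"
      unfolding T_def
    proof (intro Bochner_Integration.integral_cong refl)
      fix p :: "'n heis"
      show "strichartz_kernel p ((l, (2 * real k + real n) * \<bar>l\<bar>), w) * f p = of_real (inverse (ray_weight n k)) * ?g p"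
        unfolding strichartz_kernel_def fst_conv snd_conv n_def[symmetric] k
        by (cases p) (simp add: e_fun_hmult)
    qed
    also have "\<dots> = of_real (inverse (ray_weight n k)) * (LINT p|(lborel \<Otimes>\<^sub>M lborel). ?g p)"
      by (simp add: lborel_prod)
    also have "(LINT p|(lborel \<Otimes>\<^sub>M lborel). ?g p) = (LINT z|lborel. LINT t|lborel. ?g (z, t))"
      by (rule lborel_pair.integral_fst'[OF gint, symmetric])
    also have "\<dots> = (LINT z|lborel. twist l z w * of_real (phi_fun k l (w - z)) * H l z)"
    proof (intro Bochner_Integration.integral_cong refl)
      fix z
      have "(LINT t|lborel. ?g (z, t)) = (LINT t|lborel. (twist l z w * of_real (phi_fun k l (w - z))) * (f (z, t) * cis (- l * t)))"
        by (simp only: fst_conv snd_conv mult_ac)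
      then show "(LINT t|lborel. ?g (z, t)) = twist l z w * of_real (phi_fun k l (w - z)) * H l z"
        by (simp only: integral_mult_right_zero H_def)
    qed
    finally show ?thesis .
  qed
  define \<phi> where "\<phi> a = (\<integral>\<^sup>+ w. (ennreal (cmod (T (a, w))))\<^sup>2 \<partial>lborel)" for a
  have \<phi>m: "\<phi> \<in> borel_measurable (nu2 n)"
    unfolding \<phi>_def by measurable
  have \<phi>m': "\<phi> \<in> borel_measurable (restrict_space borel (fan n))"
    using \<phi>m by (simp cong: measurable_cong_sets add: measurable_cong_sets[OF sets_nu2 refl])
  let ?E = "ennreal (exp 2 * (8 * pi\<^sup>2) ^ n)"
  have slice: "(\<Sum>k. ennreal ((ray_weight n k)\<^sup>2) * \<phi> (l, (2 * real k + real n) * \<bar>l\<bar>)) * ennreal (\<bar>l\<bar> ^ (2 * n)) \<le>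
      ?E * (\<integral>\<^sup>+ z. (ennreal (cmod (H l z)))\<^sup>2 \<partial>lborel)" for l
  proof (cases "l = 0")
    case True
    then show ?thesis using n by (simp add: zero_power)
  next
    case l: False
    let ?S = "\<lambda>k w. LINT z|lborel. twist l z w * of_real (phi_fun k l (w - z)) * H l z"
    have Sm: "?S k \<in> borel_measurable lborel" for k
    proof -
      have [measurable]: "H l \<in> borel_measurable borel" using Hint[of l] by simp
      show ?thesis by (rule lborel.borel_measurable_lebesgue_integral) measurable
    qed
    have "ennreal ((ray_weight n k)\<^sup>2) * \<phi> (l, (2 * real k + real n) * \<bar>l\<bar>) = (\<integral>\<^sup>+ w. (ennreal (cmod (?S k w)))\<^sup>2 \<partial>lborel)" for k
    proof -
      have "ennreal ((ray_weight n k)\<^sup>2) * \<phi> (l, (2 * real k + real n) * \<bar>l\<bar>) =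
        (\<integral>\<^sup>+ w. ennreal ((ray_weight n k)\<^sup>2) * (ennreal (inverse (ray_weight n k) * cmod (?S k w)))\<^sup>2 \<partial>lborel)"
        unfolding \<phi>_def TH[OF l] norm_mult using ray_weight_pos[of n k] Sm[of k]
        by (subst nn_integral_cmult) (simp_all add: less_imp_le norm_inverse)
      also have "\<dots> = (\<integral>\<^sup>+ w. (ennreal (cmod (?S k w)))\<^sup>2 \<partial>lborel)"
      proof (rule nn_integral_cong)
        fix w
        have "(ray_weight n k)\<^sup>2 * (inverse (ray_weight n k) * cmod (?S k w))\<^sup>2 = (cmod (?S k w))\<^sup>2"
          using ray_weight_pos[of n k] by (simp add: power_mult_distrib field_simps)
        moreover have "0 \<le> inverse (ray_weight n k) * cmod (?S k w)" using ray_weight_pos[of n k] by simp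
        ultimately show "ennreal ((ray_weight n k)\<^sup>2) * (ennreal (inverse (ray_weight n k) * cmod (?S k w)))\<^sup>2 = (ennreal (cmod (?S k w)))\<^sup>2"
          by (simp only: ennreal_power ennreal_mult[symmetric] zero_le_power2 norm_ge_zero)
      qed
      finally show ?thesis .
    qed
    then have "(\<Sum>k. ennreal ((ray_weight n k)\<^sup>2) * \<phi> (l, (2 * real k + real n) * \<bar>l\<bar>)) \<le>
      ennreal (exp 2 * (8 * pi\<^sup>2 / l\<^sup>2) ^ n) * (\<integral>\<^sup>+ z. (ennreal (cmod (H l z)))\<^sup>2 \<partial>lborel)"
      using twisted_laguerre_L2[OF l Hint[of l]] by (simp only: n_def)
    then have "(\<Sum>k. ennreal ((ray_weight n k)\<^sup>2) * \<phi> (l, (2 * real k + real n) * \<bar>l\<bar>)) * ennreal (\<bar>l\<bar> ^ (2 * n)) \<le>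
      ennreal (exp 2 * (8 * pi\<^sup>2 / l\<^sup>2) ^ n) * (\<integral>\<^sup>+ z. (ennreal (cmod (H l z)))\<^sup>2 \<partial>lborel) * ennreal (\<bar>l\<bar> ^ (2 * n))"
      by (rule mult_right_mono) simp
    also have "\<dots> = ennreal (exp 2 * (8 * pi\<^sup>2 / l\<^sup>2) ^ n * \<bar>l\<bar> ^ (2 * n)) * (\<integral>\<^sup>+ z. (ennreal (cmod (H l z)))\<^sup>2 \<partial>lborel)"
    proof -
      have "ennreal (exp 2 * (8 * pi\<^sup>2 / l\<^sup>2) ^ n * \<bar>l\<bar> ^ (2 * n)) = ennreal (exp 2 * (8 * pi\<^sup>2 / l\<^sup>2) ^ n) * ennreal (\<bar>l\<bar> ^ (2 * n))"
        by (rule ennreal_mult) auto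
      then show ?thesis by (simp only: mult_ac)
    qed
    also have "exp 2 * (8 * pi\<^sup>2 / l\<^sup>2) ^ n * \<bar>l\<bar> ^ (2 * n) = exp 2 * (8 * pi\<^sup>2) ^ n"
    proof -
      have "\<bar>l\<bar> ^ (2 * n) = (l\<^sup>2) ^ n" by (simp add: power_mult)
      then show ?thesis using l by (simp add: power_divide)
    qed
    finally show ?thesis .
  qed
  have "(\<integral>\<^sup>+ y. (ennreal (cmod (T y)))\<^sup>2 \<partial>(nu2 n \<Otimes>\<^sub>M lborel)) = (\<integral>\<^sup>+ a. \<phi> a \<partial>nu2 n)"
    unfolding \<phi>_def by (rule lborel.nn_integral_fst[symmetric]) measurable
  also have "\<dots> = ennreal (1 / (2 * pi) ^ (2 * n + 1)) *
    (\<integral>\<^sup>+ l. (\<Sum>k. ennreal ((ray_weight n k)\<^sup>2) * \<phi> (l, (2 * real k + real n) * \<bar>l\<bar>)) * ennreal (\<bar>l\<bar> ^ (2 * n)) \<partial>lborel)"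
    by (rule nn_integral_nu2[OF \<phi>m'])
  also have "\<dots> \<le> ennreal (1 / (2 * pi) ^ (2 * n + 1)) * (\<integral>\<^sup>+ l. ?E * (\<integral>\<^sup>+ z. (ennreal (cmod (H l z)))\<^sup>2 \<partial>lborel) \<partial>lborel)"
    by (intro mult_left_mono nn_integral_mono slice) simp
  also have "(\<integral>\<^sup>+ l. ?E * (\<integral>\<^sup>+ z. (ennreal (cmod (H l z)))\<^sup>2 \<partial>lborel) \<partial>lborel) = ?E * (\<integral>\<^sup>+ l. \<integral>\<^sup>+ z. (ennreal (cmod (H l z)))\<^sup>2 \<partial>lborel \<partial>lborel)"
    by (rule nn_integral_cmult) measurable
  also have "(\<integral>\<^sup>+ l. \<integral>\<^sup>+ z. (ennreal (cmod (H l z)))\<^sup>2 \<partial>lborel \<partial>lborel) = (\<integral>\<^sup>+ z. \<integral>\<^sup>+ l. (ennreal (cmod (H l z)))\<^sup>2 \<partial>lborel \<partial>lborel)"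
    by (rule lborel_pair.Fubini'[symmetric]) measurable
  also have "ennreal (1 / (2 * pi) ^ (2 * n + 1)) * (?E * (\<integral>\<^sup>+ z. \<integral>\<^sup>+ l. (ennreal (cmod (H l z)))\<^sup>2 \<partial>lborel \<partial>lborel)) \<le>
    ennreal (1 / (2 * pi) ^ (2 * n + 1)) * (?E * (\<integral>\<^sup>+ z. ennreal (2 * pi) * (\<integral>\<^sup>+ t. (ennreal (cmod (f (z, t))))\<^sup>2 \<partial>lborel) \<partial>lborel))"
  proof (intro mult_left_mono nn_integral_mono_AE)
    \<comment> \<open>Almost every \<open>z\<close> only: the slices of an integrable function are
      integrable outside a null set.\<close>
    show "AE z in lborel. (\<integral>\<^sup>+ l. (ennreal (cmod (H l z)))\<^sup>2 \<partial>lborel) \<le> ennreal (2 * pi) * (\<integral>\<^sup>+ t. (ennreal (cmod (f (z, t))))\<^sup>2 \<partial>lborel)"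
      using lborel_pair.AE_integrable_fst'[OF fint] unfolding H_def
      by (rule eventually_mono) (rule Plancherel_le)
  qed auto
  also have "(\<integral>\<^sup>+ z. ennreal (2 * pi) * (\<integral>\<^sup>+ t. (ennreal (cmod (f (z, t))))\<^sup>2 \<partial>lborel) \<partial>lborel) =
      (\<integral>\<^sup>+ z. \<integral>\<^sup>+ t. (ennreal (cmod (f (z, t))))\<^sup>2 \<partial>lborel \<partial>lborel) * ennreal (2 * pi)"
    by (subst nn_integral_cmult) (auto simp: mult.commute)
  also have "(\<integral>\<^sup>+ z. \<integral>\<^sup>+ t. (ennreal (cmod (f (z, t))))\<^sup>2 \<partial>lborel \<partial>lborel) = (\<integral>\<^sup>+ x. (ennreal (cmod (f x)))\<^sup>2 \<partial>lborel)"
  proof -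
    have "(\<integral>\<^sup>+ z. \<integral>\<^sup>+ t. (ennreal (cmod (f (z, t))))\<^sup>2 \<partial>lborel \<partial>lborel) = (\<integral>\<^sup>+ x. (ennreal (cmod (f x)))\<^sup>2 \<partial>(lborel \<Otimes>\<^sub>M lborel))"
      by (rule lborel.nn_integral_fst) measurable
    then show ?thesis by (simp add: lborel_prod)
  qed
  also have "ennreal (1 / (2 * pi) ^ (2 * n + 1)) * (?E * ((\<integral>\<^sup>+ x. (ennreal (cmod (f x)))\<^sup>2 \<partial>lborel) * ennreal (2 * pi))) =
      ennreal (1 / (2 * pi) ^ (2 * n + 1) * (exp 2 * (8 * pi\<^sup>2) ^ n) * (2 * pi)) * (\<integral>\<^sup>+ x. (ennreal (cmod (f x)))\<^sup>2 \<partial>lborel)"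
    by (rule ennreal_mult3) auto
  finally show ?thesis unfolding T_def .
qed

lemma kernel_op_strichartz:
  "kernel_op (lborel :: ('n::finite heis) measure) (nu2 CARD('n) \<Otimes>\<^sub>M lborel) strichartz_kernel
    (1 / (2 * pi) ^ (2 * CARD('n) + 1) * (exp 2 * (8 * pi\<^sup>2) ^ CARD('n)) * (2 * pi))"
proof -
  interpret nu: sigma_finite_measure "nu2 CARD('n)" by (rule sigma_finite_nu2) simp
  interpret P: pair_sigma_finite "nu2 CARD('n)" "lborel :: (complex ^ 'n) measure" ..
  show ?thesis
  proof (intro kernel_op.intro kernel_op_axioms.intro)
    show "sigma_finite_measure (lborel :: ('n heis) measure)" by (rule sigma_finite_lborel)
    show "sigma_finite_measure (nu2 CARD('n) \<Otimes>\<^sub>M (lborel :: (complex ^ 'n) measure))"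
      by (rule P.sigma_finite_measure_axioms)
    show "(\<lambda>(x, y). strichartz_kernel x y) \<in> borel_measurable (lborel \<Otimes>\<^sub>M (nu2 CARD('n) \<Otimes>\<^sub>M (lborel :: (complex ^ 'n) measure)))"
      by (rule strichartz_kernel_measurable)
    show "cmod (strichartz_kernel x y) \<le> 1" for x :: "'n heis" and y by (rule strichartz_kernel_bound)
  qed (simp, rule strichartz_kernel_L2)
qed

lemma norm_strichartz_eq:
  assumes "fst (fst y) \<noteq> 0"
  shows "norm_strichartz f y = (LINT x|lborel. strichartz_kernel x y * f x)"
proof -
  obtain a w where y: "y = (a, w)" by (cases y)
  have "(LINT x|lborel. strichartz_kernel x y * f x) =
    (LINT x|lborel. of_real (inverse (ray_weight CARD('a) (fan_index CARD('a) a))) * (f x * e_fun (fan_index CARD('a) a) (fst a) (hmult (hinv x) (w, 0))))"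
    by (simp add: strichartz_kernel_def y mult_ac)
  then show ?thesis using assms
    by (simp only: integral_mult_right_zero) (simp add: norm_strichartz_def strichartz_def y)
qed

section \<open>Schwartz functions\<close>

lemma schwartz_continuous: "f \<in> schwartz \<Longrightarrow> continuous_on UNIV f"
  unfolding schwartz_def
  by (auto simp: continuous_at_imp_continuous_on differentiable_imp_continuous_within dest!: bspec[of _ _ "[]"])

lemma schwartz_decay:
  assumes "f \<in> schwartz"
  obtains b where "\<And>x. norm x ^ N * cmod (f x) \<le> b"
proof -
  have "bounded (range (\<lambda>x. norm x ^ N *\<^sub>R f x))"
    using assms unfolding schwartz_def by (auto dest!: bspec[of _ _ "[]"])
  then obtain b where "\<forall>x. norm (norm x ^ N *\<^sub>R f x) \<le> b" by (auto simp: bounded_iff)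
  then have "norm x ^ N * cmod (f x) \<le> b" for x by simp
  then show ?thesis by (rule that)
qed

lemma nn_integral_inverse_1_plus_square: "(\<integral>\<^sup>+ x. ennreal (inverse (1 + x\<^sup>2)) \<partial>lborel) < (top :: ennreal)"
proof -
  have "integrable lborel (\<lambda>x::real. inverse (1 + x\<^sup>2))"
    using integrable_inverse_1_plus_square by (simp add: set_integrable_def)
  then show ?thesis by (simp add: integrable_iff_bounded)
qed

lemma integrable_prod_inverse:
  "integrable lborel (\<lambda>x::'a::euclidean_space. \<Prod>b\<in>Basis. inverse (1 + (x \<bullet> b)\<^sup>2))"
proof (rule integrableI_nonneg)
  have "(\<integral>\<^sup>+ (x::'a). ennreal (\<Prod>b\<in>Basis. inverse (1 + (x \<bullet> b)\<^sup>2)) \<partial>lborel) =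
      (\<integral>\<^sup>+ (x::'a). (\<Prod>b\<in>Basis. ennreal (inverse (1 + (x \<bullet> b)\<^sup>2))) \<partial>lborel)"
    by (subst prod_ennreal) auto
  also have "\<dots> = (\<Prod>b\<in>(Basis :: 'a set). (\<integral>\<^sup>+ x. ennreal (inverse (1 + x\<^sup>2)) \<partial>lborel))"
    by (rule nn_integral_lborel_prod) auto
  also have "\<dots> < \<infinity>"
    using nn_integral_inverse_1_plus_square by (simp add: power_less_top_ennreal)
  finally show "(\<integral>\<^sup>+ (x::'a). ennreal (\<Prod>b\<in>Basis. inverse (1 + (x \<bullet> b)\<^sup>2)) \<partial>lborel) < \<infinity>" .
qed (auto intro!: AE_I2 prod_nonneg)

text \<open>Decay of order \<open>2 * ?D\<close> outweighs the product of the factors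
  \<open>1 + (x \<bullet> b)^2\<close> over all coordinates, and the reciprocal of this product is
  integrable as a product of one-dimensional functions.\<close>

lemma schwartz_integrable:
  fixes f :: "'a::euclidean_space \<Rightarrow> complex"
  assumes f: "f \<in> schwartz"
  shows "integrable lborel f"
proof -
  let ?D = "DIM('a)"
  obtain b0 where b0: "\<And>x. cmod (f x) \<le> b0" using schwartz_decay[OF f, of 0] by auto
  obtain b1 where b1: "\<And>x. norm x ^ (2 * ?D) * cmod (f x) \<le> b1" using schwartz_decay[OF f] by blast
  have le: "cmod (f x) \<le> 2 ^ ?D * (b0 + b1) * (\<Prod>b\<in>Basis. inverse (1 + (x \<bullet> b)\<^sup>2))" for x
  proof -
    let ?P = "\<Prod>b\<in>(Basis :: 'a set). 1 + (x \<bullet> b)\<^sup>2" and ?r = "(norm x)\<^sup>2"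
    have pos: "0 < ?P" by (intro prod_pos) (auto intro: add_pos_nonneg)
    have "?P \<le> (\<Prod>b\<in>(Basis :: 'a set). 1 + ?r)"
    proof (intro prod_mono conjI)
      fix b :: 'a assume "b \<in> Basis"
      then have "\<bar>x \<bullet> b\<bar>\<^sup>2 \<le> ?r" by (intro power_mono Basis_le_norm) auto
      then show "1 + (x \<bullet> b)\<^sup>2 \<le> 1 + ?r" by simp
    qed simp
    also have "\<dots> = (1 + ?r) ^ ?D" by simp
    also have "\<dots> \<le> (2 * max 1 ?r) ^ ?D" by (intro power_mono) auto
    also have "\<dots> = 2 ^ ?D * max 1 ?r ^ ?D" by (rule power_mult_distrib)
    also have "max 1 ?r ^ ?D \<le> 1 + norm x ^ (2 * ?D)" by (auto simp: max_def power_mult)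
    finally have P: "?P \<le> 2 ^ ?D * (1 + norm x ^ (2 * ?D))" by simp
    have "cmod (f x) * ?P \<le> cmod (f x) * (2 ^ ?D * (1 + norm x ^ (2 * ?D)))"
      by (rule mult_left_mono[OF P]) simp
    also have "\<dots> = 2 ^ ?D * (cmod (f x) + norm x ^ (2 * ?D) * cmod (f x))" by (simp add: algebra_simps)
    also have "\<dots> \<le> 2 ^ ?D * (b0 + b1)" using b0[of x] b1[of x] by (intro mult_left_mono add_mono) auto
    finally have "cmod (f x) \<le> 2 ^ ?D * (b0 + b1) / ?P" using pos by (simp add: pos_le_divide_eq)
    then show ?thesis by (simp add: divide_inverse prod_inversef[symmetric] o_def)
  qed
  show ?thesis
  proof (rule Bochner_Integration.integrable_bound[OF integrable_mult_right[OF integrable_prod_inverse]])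
    show "f \<in> borel_measurable lborel"
      using borel_measurable_continuous_onI[OF schwartz_continuous[OF f]] by simp
    show "AE x in lborel. norm (f x) \<le> norm (2 ^ ?D * (b0 + b1) * (\<Prod>b\<in>Basis. inverse (1 + (x \<bullet> b)\<^sup>2)))"
      using le by (intro AE_I2) (simp add: order_trans[OF _ abs_ge_self])
  qed
qed

lemma AE_ray_param_nonzero:
  "AE y in nu2 CARD('n) \<Otimes>\<^sub>M (lborel :: (complex ^ 'n::finite) measure). fst (fst y) \<noteq> 0"
proof (rule AE_I')
  interpret nu: sigma_finite_measure "nu2 CARD('n)" by (rule sigma_finite_nu2) simp
  let ?Z = "{a \<in> fan CARD('n). fst a = 0}"
  have Z: "?Z \<in> null_sets (nu2 CARD('n))" by (rule null_ray_inf) simp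
  then show "?Z \<times> (UNIV :: (complex ^ 'n) set) \<in> null_sets (nu2 CARD('n) \<Otimes>\<^sub>M lborel)"
    by (intro null_setsI) (auto simp: lborel.emeasure_pair_measure_Times null_sets_def)
  show "{y \<in> space (nu2 CARD('n) \<Otimes>\<^sub>M (lborel :: (complex ^ 'n) measure)). \<not> fst (fst y) \<noteq> 0} \<subseteq> ?Z \<times> UNIV"
    by (auto simp: space_pair_measure space_nu2)
qed

theorem theorem3p1:
  fixes u :: "(real \<times> real) \<times> (complex ^ 'n::finite) \<Rightarrow> ennreal"
    and v :: "'n heis \<Rightarrow> ennreal"
    and U V :: "real \<Rightarrow> ennreal"
    and p q p' :: ennreal
  assumes "u \<in> borel_measurable fan_measure"
    and "v \<in> borel_measurable lebesgue"
    and "U = rearr fan_measure u"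
    and "\<And>t. inverse (V t) = rearr lebesgue (\<lambda>g. inverse (v g)) t"
    and "1 \<le> p" and "p \<le> q" and "p < \<infinity>"
    and "inverse p + inverse p' = 1"
    and "(SUP s\<in>{0::real<..}.
            Lnorm (restrict_space lborel {0<..<1 / s}) q U *
            Lnorm (restrict_space lborel {0<..<s}) p' (\<lambda>t. inverse (V t))) < \<infinity>"
  shows "\<exists>C::real. \<forall>f\<in>schwartz.
    Lnorm fan_measure q (\<lambda>x. ennreal (cmod (norm_strichartz f x)) * u x)
      \<le> ennreal C * Lnorm lebesgue p (\<lambda>g. ennreal (cmod (f g)) * v g)"
proof -
  let ?Y = "nu2 CARD('n) \<Otimes>\<^sub>M (lborel :: (complex ^ 'n) measure)"
  interpret K: kernel_op "lborel :: 'n heis measure" ?Y strichartz_kernel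
    "1 / (2 * pi) ^ (2 * CARD('n) + 1) * (exp 2 * (8 * pi\<^sup>2) ^ CARD('n)) * (2 * pi)"
    by (rule kernel_op_strichartz)
  \<comment> \<open>The operator estimates live on the uncompleted measures, so both weights are
    replaced by measurable representatives; rearrangements and norms are unaffected.\<close>
  obtain u' where u' [measurable]: "u' \<in> borel_measurable ?Y" and uu': "AE x in ?Y. u x = u' x"
    using completion_ex_borel_measurable[OF assms(1)[unfolded fan_measure_def]] by blast
  obtain v' where v' [measurable]: "v' \<in> borel_measurable lborel" and vv': "AE x in lborel. v x = v' x"
    using completion_ex_borel_measurable[OF assms(2)] by blast
  define \<sigma> where "\<sigma> g = inverse (v' g)" for g
  have \<sigma> [measurable]: "\<sigma> \<in> borel_measurable lborel" unfolding \<sigma>_def by measurable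
  have U: "U = rearr ?Y u'" unfolding assms(3) fan_measure_def by (rule rearr_completion[OF u' uu'])
  have "AE g in lborel. inverse (v g) = \<sigma> g" using vv' by eventually_elim (simp add: \<sigma>_def)
  from rearr_completion[OF \<sigma> this] have V: "(\<lambda>t. inverse (V t)) = rearr lborel \<sigma>"
    using assms(4) by (simp add: fun_eq_iff)
  obtain C where C: "\<forall>f \<phi> b. integrable lborel f \<and> (\<forall>x. cmod (f x) \<le> b) \<and> \<phi> \<in> borel_measurable lborel \<and>
      (AE x in lborel. \<phi> x = top \<or> \<sigma> x = top \<or> ennreal (cmod (f x)) \<le> \<phi> x * \<sigma> x) \<longrightarrow>
      Lnorm ?Y q (\<lambda>y. ennreal (cmod (K.T f y)) * u' y) \<le> ennreal C * Lnorm lborel p \<phi>"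
    using K.weighted_Lnorm[OF u' \<sigma> assms(5,6) assms(7)[unfolded infinity_ennreal_def] assms(8) assms(9)[unfolded U V infinity_ennreal_def]]
    by blast
  show ?thesis
  proof (intro exI[of _ C] ballI)
    fix f :: "'n heis \<Rightarrow> complex" assume f: "f \<in> schwartz"
    have fi: "integrable lborel f" by (rule schwartz_integrable[OF f])
    then have fm [measurable]: "f \<in> borel_measurable lborel" by simp
    obtain b where b: "\<And>x. cmod (f x) \<le> b" using schwartz_decay[OF f, of 0] by auto
    let ?\<phi> = "\<lambda>g. ennreal (cmod (f g)) * v' g"
    have \<phi>: "?\<phi> \<in> borel_measurable lborel" by measurable
    \<comment> \<open>Where \<open>v'\<close> is 0, \<open>\<sigma>\<close> is infinite; where
      \<open>v'\<close> is infinite, \<open>?\<phi>\<close> is infinite unless \<open>f\<close>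
      vanishes. At all other points the two factors cancel.\<close>
    have le: "?\<phi> x = top \<or> \<sigma> x = top \<or> ennreal (cmod (f x)) \<le> ?\<phi> x * \<sigma> x" for x
    proof (cases "v' x = 0 \<or> v' x = top")
      case True
      then show ?thesis by (cases "f x = 0") (auto simp: \<sigma>_def ennreal_mult_top)
    next
      case False
      then have "v' x * inverse (v' x) = 1"
        by (metis divide_ennreal_def ennreal_divide_self less_top)
      then show ?thesis by (simp add: \<sigma>_def mult.assoc)
    qed
    have "Lnorm fan_measure q (\<lambda>x. ennreal (cmod (norm_strichartz f x)) * u x) =
        Lnorm ?Y q (\<lambda>y. ennreal (cmod (K.T f y)) * u' y)"
      unfolding fan_measure_def
    proof (rule Lnorm_completion)
      show "(\<lambda>y. ennreal (cmod (K.T f y)) * u' y) \<in> borel_measurable ?Y"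
        using K.T_measurable[OF fm] by measurable
      \<comment> \<open>The transform is given by the kernel off the null set where the first
        coordinate of the fan is 0.\<close>
      show "AE y in ?Y. ennreal (cmod (norm_strichartz f y)) * u y = ennreal (cmod (K.T f y)) * u' y"
        using uu' AE_ray_param_nonzero by eventually_elim (simp add: norm_strichartz_eq K.T_def)
    qed
    also have "\<dots> \<le> ennreal C * Lnorm lborel p ?\<phi>"
      using C[rule_format, of f b ?\<phi>] fi b \<phi> le by blast
    also have "Lnorm lborel p ?\<phi> = Lnorm lebesgue p (\<lambda>g. ennreal (cmod (f g)) * v g)"
    proof (rule Lnorm_completion[symmetric, OF \<phi>])
      show "AE g in lborel. ennreal (cmod (f g)) * v g = ?\<phi> g" using vv' by eventually_elim simp
    qed
    finally show "Lnorm fan_measure q (\<lambda>x. ennreal (cmod (norm_strichartz f x)) * u x)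
      \<le> ennreal C * Lnorm lebesgue p (\<lambda>g. ennreal (cmod (f g)) * v g)" .
  qed
qed

end
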